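(* Let $A$ be an associative unital ring and let $S\subset A[t]$ be a multiplicative subset of monic centric polynomials that contains $t$. Then the composition $$K(\mathrm{End}_A^S)\xrightarrow{\ \zeta(t^{-1})\ast\tau(t)\ } L K(A[t]_S)$$ is homotopic to the map $t\colon K(\mathrm{End}_A^S)\to LK(A[t]_S)$, as maps over $K(A)\to K(A[t]_S)$ (i.e. the homotopy is fiberwise over $K(A[t]_S)$, where all the maps cover the map $K(\mathrm{End}_A^S)\to K(A)\to K(A[t]_S)$ induced by $(P,f)\mapsto P\mapsto P\otimes_A A[t]_S$).
   Context: Modules are right modules; in $A[t]$ the indeterminate commutes with $A$. A polynomial is centric if it lies in the center $Z(A[t])=Z(A)[t]$. $A[t]_S:=S^{-1}A[t]$. For $p\in S$ of degree $d$ put $\tilde p(t)=t^d p(1/t)$, let $T=\{\tilde p\mid p\in S\}$ (a multiplicative set of centric polynomials) and $A[t]_T:=T^{-1}A[t]$. For an $A$-module $P$ write $P[t]=P\otimes_A A[t]$, $P[t]_S=P\otimes_A A[t]_S$, $P[t]_T=P\otimes_A A[t]_T$. For a Waldhausen category $\mathcal C$ with weak equivalences $w\mathcal C$, $K(\mathcal C)=\Omega|wS_\bullet\mathcal C|$ (Waldhausen's $S_\bullet$-construction). $P(A)$ is the category of finitely generated projective $A$-modules; cofibrations are monomorphisms with projective cokernel and weak equivalences are isomorphisms (written $iP(A)$); $K(A)=K(P(A))$. $\mathrm{End}_A$ has objects $(P,f)$ with $P\in P(A)$ and $f\colon P\to P$ $A$-linear; a morphism $(P,f)\to(Q,g)$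 is $h\colon P\to Q$ with $gh=hf$; cofibrations and weak equivalences are those maps which become such in $P(A)$. $\mathrm{End}_A^S\subset\mathrm{End}_A$ is the full subcategory of $(P,f)$ with $p(f)=0$ for some $p\in S$. $\mathrm{Aut}_A\subset \mathrm{End}_A$ is the full subcategory of $(P,f)$ with $f$ an automorphism. $LX$ is the free loop space and $\ast\colon LX\times_X LX\to LX$ composes loops with the same basepoint. Coassembly map $c\colon K(\mathrm{Aut}_R)\to LK(R)$: for a category $C$ let $\mathrm{End}(C)$ be the category of self-maps in $C$. A $k$-simplex of the nerve of $\mathrm{End}(C)$ is a functor $[1]\times[k]\to C$ whose restrictions to $\{0\}\times[k]$ and $\{1\}\times[k]$ agree; realizing gives $(\Delta^1/\partial\Delta^1)\times\Delta^k\to|C|$, with adjoint $\Delta^k\to L|C|$; these assemble to $|\mathrm{End}(C)|\to L|C|$. Apply this to $iS_k\mathrm{Aut}_R=\mathrm{End}(iS_kP(R))$ for every $k$, realize the adjoints to get $S^1\times|iS_\bullet\mathrm{Aut}_R|\to|iS_\bullet P(R)|$, loop once to get $S^1\times K(\mathrm{Aut}_R)\to K(R)$, and take the adjoint. The maps in the claim: (1) $\tau(t)\colon K(\mathrm{End}_A^S)\to K(\mathrm{Aut}_{A[t]_S})\xrightarrow{c}LK(A[t]_S)$, the first map being induced by the exact functor $(P,f)\mapsto(P[t]_S,\,t-f)$, where $t-f=1\otimes t-f\otimes 1$ is an automorphism of $P[t]_S$. (2) $\zeta(t)\colon K(\mathrm{End}_A^S)\to K(\mathrm{Aut}_{A[t]_T})\xrightarrow{c}LK(A[t]_T)$,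 the first map being induced by $(P,f)\mapsto(P[t]_T,(1-ft)^{-1})$. $\zeta(t^{-1})$ is $\zeta(t)$ followed by the map $LK(A[t]_T)\cong LK(A[t^{-1}]_T)$ induced by $t\mapsto t^{-1}$ and the map $LK(A[t^{-1}]_T)\to LK(A[t]_S)$ induced by the canonical ring homomorphism $A[t^{-1}]_T\to A[t]_S$, $t^{-1}\mapsto 1/t$ (which exists since $t\in S$). (3) $t\colon K(\mathrm{End}_A^S)\to K(A)\to K(\mathrm{Aut}_{A[t]_S})\xrightarrow{c}LK(A[t]_S)$, induced by $(P,f)\mapsto P\mapsto(P[t]_S,\ \text{multiplication by }t)$. Models for extension of scalars are fixed so that, up to canonical homotopy, all three maps to $LK(A[t]_S)$ cover the same map $K(\mathrm{End}_A^S)\to K(A[t]_S)$, $(P,f)\mapsto P[t]_S$; the fiberwise product $\zeta(t^{-1})\ast\tau(t)$ is formed accordingly. *)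

theory Defs
  imports "HOL-Analysis.Analysis" "HOL-Homology.Simplices" "HOL-Algebra.UnivPoly"
    "HOL-Algebra.AbelCoset" "HOL-Library.Product_Order"
begin

section \<open>Localisation at central multiplicative sets\<close>

definition ring_center :: "('a, 'r) ring_scheme \<Rightarrow> 'a set" where
  "ring_center R = {z \<in> carrier R. \<forall>x\<in>carrier R. z \<otimes>\<^bsub>R\<^esub> x = x \<otimes>\<^bsub>R\<^esub> z}"

definition loc_rel :: "('a, 'r) ring_scheme \<Rightarrow> 'a set \<Rightarrow> (('a \<times> 'a) \<times> ('a \<times> 'a)) set" where
  "loc_rel R S = {((a, s), (b, r)). a \<in> carrier R \<and> b \<in> carrier R \<and> s \<in> S \<and> r \<in> S \<and>
     (\<exists>u\<in>S. u \<otimes>\<^bsub>R\<^esub> (r \<otimes>\<^bsub>R\<^esub> a) = u \<otimes>\<^bsub>R\<^esub> (s \<otimes>\<^bsub>R\<^esub> b))}"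

definition frac :: "('a, 'r) ring_scheme \<Rightarrow> 'a set \<Rightarrow> 'a \<Rightarrow> 'a \<Rightarrow> ('a \<times> 'a) set" where
  "frac R S a s = loc_rel R S `` {(a, s)}"

definition loc :: "('a, 'r) ring_scheme \<Rightarrow> 'a set \<Rightarrow> ('a \<times> 'a) set ring" where
  "loc R S = \<lparr>
     carrier = (carrier R \<times> S) // loc_rel R S,
     mult = (\<lambda>X Y. the_elem ((\<lambda>((a, s), (b, r)). frac R S (a \<otimes>\<^bsub>R\<^esub> b) (s \<otimes>\<^bsub>R\<^esub> r)) ` (X \<times> Y))),
     one = frac R S \<one>\<^bsub>R\<^esub> \<one>\<^bsub>R\<^esub>,
     zero = frac R S \<zero>\<^bsub>R\<^esub> \<one>\<^bsub>R\<^esub>,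
     add = (\<lambda>X Y. the_elem ((\<lambda>((a, s), (b, r)).
        frac R S (r \<otimes>\<^bsub>R\<^esub> a \<oplus>\<^bsub>R\<^esub> s \<otimes>\<^bsub>R\<^esub> b) (s \<otimes>\<^bsub>R\<^esub> r)) ` (X \<times> Y)))\<rparr>"

section \<open>Polynomials and the rings \<open>A[t]\<^sub>S\<close>, \<open>A[t]\<^sub>T\<close>\<close>

definition monic :: "('a, 'r) ring_scheme \<Rightarrow> (nat \<Rightarrow> 'a) \<Rightarrow> bool" where
  "monic A p \<longleftrightarrow> p \<in> carrier (UP A) \<and> coeff (UP A) p (deg A p) = \<one>\<^bsub>A\<^esub>"

abbreviation indet :: "('a, 'r) ring_scheme \<Rightarrow> nat \<Rightarrow> 'a" where
  "indet A \<equiv> monom (UP A) \<one>\<^bsub>A\<^esub> 1"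

definition reversed :: "('a, 'r) ring_scheme \<Rightarrow> (nat \<Rightarrow> 'a) \<Rightarrow> nat \<Rightarrow> 'a" where
  "reversed A p = (\<lambda>i. if i \<le> deg A p then coeff (UP A) p (deg A p - i) else \<zero>\<^bsub>A\<^esub>)"

definition polys_at :: "('a, 'r) ring_scheme \<Rightarrow> (nat \<Rightarrow> 'a) set \<Rightarrow> ((nat \<Rightarrow> 'a) \<times> (nat \<Rightarrow> 'a)) set ring"
  where "polys_at A S = loc (UP A) S"

definition const_at :: "('a, 'r) ring_scheme \<Rightarrow> (nat \<Rightarrow> 'a) set \<Rightarrow> 'a \<Rightarrow> ((nat \<Rightarrow> 'a) \<times> (nat \<Rightarrow> 'a)) set"
  where "const_at A S a = frac (UP A) S (monom (UP A) a 0) \<one>\<^bsub>UP A\<^esub>"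

definition indet_at :: "('a, 'r) ring_scheme \<Rightarrow> (nat \<Rightarrow> 'a) set \<Rightarrow> ((nat \<Rightarrow> 'a) \<times> (nat \<Rightarrow> 'a)) set"
  where "indet_at A S = frac (UP A) S (indet A) \<one>\<^bsub>UP A\<^esub>"

definition inv_indet_at :: "('a, 'r) ring_scheme \<Rightarrow> (nat \<Rightarrow> 'a) set \<Rightarrow> ((nat \<Rightarrow> 'a) \<times> (nat \<Rightarrow> 'a)) set"
  where "inv_indet_at A S = frac (UP A) S \<one>\<^bsub>UP A\<^esub> (indet A)"

text \<open>The ring homomorphism from \<open>A[t]\<^sub>T\<close> to \<open>A[t]\<^sub>S\<close> that is the identity on \<open>A\<close> and sends the
  indeterminate to \<open>1/t\<close>.  Renaming the indeterminate of the source to \<open>t\<^sup>-\<^sup>1\<close> identifies the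
  source with \<open>A[t\<^sup>-\<^sup>1]\<^sub>T\<close>, so this is the composite of
  that renaming isomorphism with the canonical map from \<open>A[t\<^sup>-\<^sup>1]\<^sub>T\<close> to \<open>A[t]\<^sub>S\<close>.\<close>

definition invert_indet ::
  "('a, 'r) ring_scheme \<Rightarrow> (nat \<Rightarrow> 'a) set \<Rightarrow> ((nat \<Rightarrow> 'a) \<times> (nat \<Rightarrow> 'a)) set \<Rightarrow> ((nat \<Rightarrow> 'a) \<times> (nat \<Rightarrow> 'a)) set"
  where "invert_indet A S x =
    (let B = polys_at A S; ev = eval A B (const_at A S) (inv_indet_at A S)
     in the_elem ((\<lambda>(p, q). ev p \<otimes>\<^bsub>B\<^esub> inv\<^bsub>B\<^esub> (ev q)) ` x))"

section \<open>Waldhausen categories\<close>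

text \<open>Composition \<open>cat_comp C X g f\<close> of \<open>f : X \<rightarrow> Y\<close> and \<open>g : Y \<rightarrow> Z\<close> takes the source object as
  an argument, since arrows are bare (extensional) functions that do not remember it.\<close>

record ('o, 'm) cat =
  cat_ob :: "'o set"
  cat_hom :: "'o \<Rightarrow> 'o \<Rightarrow> 'm set"
  cat_id :: "'o \<Rightarrow> 'm"
  cat_comp :: "'o \<Rightarrow> 'm \<Rightarrow> 'm \<Rightarrow> 'm"

record ('o, 'm) wcat = "('o, 'm) cat" +
  wzero :: 'o
  wcof :: "'o \<Rightarrow> 'o \<Rightarrow> 'm set"
  weq :: "'o \<Rightarrow> 'o \<Rightarrow> 'm set"

definition isos :: "('o, 'm, 'z) cat_scheme \<Rightarrow> 'o \<Rightarrow> 'o \<Rightarrow> 'm set" where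
  "isos C X Y = {f \<in> cat_hom C X Y. \<exists>g\<in>cat_hom C Y X.
     cat_comp C X g f = cat_id C X \<and> cat_comp C Y f g = cat_id C Y}"

definition full_sub :: "('o, 'm, 'z) cat_scheme \<Rightarrow> 'o set \<Rightarrow> ('o, 'm, 'z) cat_scheme" where
  "full_sub C U = C\<lparr>cat_ob := cat_ob C \<inter> U\<rparr>"

definition end_cat :: "('o, 'm) wcat \<Rightarrow> ('o \<times> 'm, 'm) wcat" where
  "end_cat C =
    (let H = (\<lambda>X Y. {h \<in> cat_hom C (fst X) (fst Y).
                cat_comp C (fst X) (snd Y) h = cat_comp C (fst X) h (snd X)})
     in \<lparr>cat_ob = {(X, f). X \<in> cat_ob C \<and> f \<in> cat_hom C X X},
         cat_hom = H,
         cat_id = (\<lambda>X. cat_id C (fst X)),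
         cat_comp = (\<lambda>X. cat_comp C (fst X)),
         wzero = (wzero C, cat_id C (wzero C)),
         wcof = (\<lambda>X Y. H X Y \<inter> wcof C (fst X) (fst Y)),
         weq = (\<lambda>X Y. H X Y \<inter> weq C (fst X) (fst Y))\<rparr>)"

definition aut_cat :: "('o, 'm) wcat \<Rightarrow> ('o \<times> 'm, 'm) wcat" where
  "aut_cat C = full_sub (end_cat C) {(X, f). f \<in> isos C X X}"

text \<open>A functor is a pair of an object map and an arrow map; the latter also takes source and
  target.\<close>

type_synonym ('o, 'm, 'p, 'n) fctr = "('o \<Rightarrow> 'p) \<times> ('o \<Rightarrow> 'o \<Rightarrow> 'm \<Rightarrow> 'n)"

definition forget_end :: "('o \<times> 'm, 'm, 'o, 'm) fctr" where
  "forget_end = (fst, \<lambda>_ _ h. h)"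

subsection \<open>Diagrams indexed by posets\<close>

definition le_pairs :: "'j::order set \<Rightarrow> ('j \<times> 'j) set" where
  "le_pairs J = {(i, j). i \<in> J \<and> j \<in> J \<and> i \<le> j}"

type_synonym ('j, 'o, 'm) diagram = "('j \<Rightarrow> 'o) \<times> ('j \<times> 'j \<Rightarrow> 'm)"

definition diagrams :: "'j::order set \<Rightarrow> ('o, 'm, 'z) cat_scheme \<Rightarrow> ('j, 'o, 'm) diagram set" where
  "diagrams J C = {(X, x). X \<in> J \<rightarrow>\<^sub>E cat_ob C \<and> x \<in> extensional (le_pairs J) \<and>
     (\<forall>i\<in>J. \<forall>j\<in>J. i \<le> j \<longrightarrow> x (i, j) \<in> cat_hom C (X i) (X j)) \<and>
     (\<forall>i\<in>J. x (i, i) = cat_id C (X i)) \<and>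
     (\<forall>i\<in>J. \<forall>j\<in>J. \<forall>k\<in>J. i \<le> j \<longrightarrow> j \<le> k \<longrightarrow>
        x (i, k) = cat_comp C (X i) (x (j, k)) (x (i, j)))}"

definition const_diagram :: "'j::order set \<Rightarrow> ('o, 'm, 'z) cat_scheme \<Rightarrow> 'o \<Rightarrow> ('j, 'o, 'm) diagram" where
  "const_diagram J C X = ((\<lambda>i\<in>J. X), (\<lambda>ij\<in>le_pairs J. cat_id C X))"

definition pull :: "'i::order set \<Rightarrow> ('i \<Rightarrow> 'j::order) \<Rightarrow> ('j, 'o, 'm) diagram \<Rightarrow> ('i, 'o, 'm) diagram" where
  "pull J \<theta> F = ((\<lambda>i\<in>J. fst F (\<theta> i)), (\<lambda>(i, j)\<in>le_pairs J. snd F (\<theta> i, \<theta> j)))"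

definition push :: "'j::order set \<Rightarrow> ('o, 'm, 'p, 'n) fctr \<Rightarrow> ('j, 'o, 'm) diagram \<Rightarrow> ('j, 'p, 'n) diagram" where
  "push J \<Phi> F = ((\<lambda>i\<in>J. fst \<Phi> (fst F i)),
     (\<lambda>(i, j)\<in>le_pairs J. snd \<Phi> (fst F i) (fst F j) (snd F (i, j))))"

subsection \<open>The categories \<open>wS\<^sub>n C\<close>\<close>

definition pushout_square ::
  "('o, 'm, 'z) cat_scheme \<Rightarrow> 'o \<Rightarrow> 'o \<Rightarrow> 'o \<Rightarrow> 'o \<Rightarrow> 'm \<Rightarrow> 'm \<Rightarrow> 'm \<Rightarrow> 'm \<Rightarrow> bool" where
  "pushout_square C X Y Z P f g y z \<longleftrightarrow>
     cat_comp C X y f = cat_comp C X z g \<and>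
     (\<forall>W\<in>cat_ob C. \<forall>u\<in>cat_hom C Y W. \<forall>v\<in>cat_hom C Z W.
        cat_comp C X u f = cat_comp C X v g \<longrightarrow>
        (\<exists>!w. w \<in> cat_hom C P W \<and> cat_comp C Y w y = u \<and> cat_comp C Z w z = v))"

text \<open>The arrow category of \<open>[n]\<close>, with the componentwise order on pairs.\<close>

definition Ar :: "nat \<Rightarrow> (nat \<times> nat) set" where
  "Ar n = {(i, j). i \<le> j \<and> j \<le> n}"

definition S_obs :: "('o, 'm) wcat \<Rightarrow> nat \<Rightarrow> (nat \<times> nat, 'o, 'm) diagram set" where
  "S_obs C n = {(X, x) \<in> diagrams (Ar n) C.
     (\<forall>j\<le>n. X (j, j) = wzero C) \<and>
     (\<forall>i j k. i \<le> j \<and> j \<le> k \<and> k \<le> n \<longrightarrow>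
        x ((i, j), (i, k)) \<in> wcof C (X (i, j)) (X (i, k)) \<and>
        pushout_square C (X (i, j)) (X (i, k)) (X (j, j)) (X (j, k))
          (x ((i, j), (i, k))) (x ((i, j), (j, j))) (x ((i, k), (j, k))) (x ((j, j), (j, k))))}"

definition wS :: "('o, 'm) wcat \<Rightarrow> nat \<Rightarrow> ((nat \<times> nat, 'o, 'm) diagram, nat \<times> nat \<Rightarrow> 'm) cat" where
  "wS C n = \<lparr>
     cat_ob = S_obs C n,
     cat_hom = (\<lambda>F G. {\<eta> \<in> extensional (Ar n).
        (\<forall>a\<in>Ar n. \<eta> a \<in> weq C (fst F a) (fst G a)) \<and>
        (\<forall>a\<in>Ar n. \<forall>b\<in>Ar n. a \<le> b \<longrightarrow>
           cat_comp C (fst F a) (\<eta> b) (snd F (a, b)) = cat_comp C (fst F a) (snd G (a, b)) (\<eta> a))}),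
     cat_id = (\<lambda>F. \<lambda>a\<in>Ar n. cat_id C (fst F a)),
     cat_comp = (\<lambda>F \<eta>' \<eta>. \<lambda>a\<in>Ar n. cat_comp C (fst F a) (\<eta>' a) (\<eta> a))\<rparr>"

definition wS_act ::
  "nat \<Rightarrow> (nat \<Rightarrow> nat) \<Rightarrow>
   ((nat \<times> nat, 'o, 'm) diagram, nat \<times> nat \<Rightarrow> 'm, (nat \<times> nat, 'o, 'm) diagram, nat \<times> nat \<Rightarrow> 'm) fctr"
  where "wS_act m \<theta> = (pull (Ar m) (map_prod \<theta> \<theta>), \<lambda>_ _ \<eta>. \<lambda>a\<in>Ar m. \<eta> (map_prod \<theta> \<theta> a))"

definition wS_fctr ::
  "nat \<Rightarrow> ('o, 'm, 'p, 'n) fctr \<Rightarrow>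
   ((nat \<times> nat, 'o, 'm) diagram, nat \<times> nat \<Rightarrow> 'm, (nat \<times> nat, 'p, 'n) diagram, nat \<times> nat \<Rightarrow> 'n) fctr"
  where "wS_fctr n \<Phi> = (push (Ar n) \<Phi>, \<lambda>F G \<eta>. \<lambda>a\<in>Ar n. snd \<Phi> (fst F a) (fst G a) (\<eta> a))"

section \<open>Geometric realisation of simplicial spaces\<close>

text \<open>\<open>sact X m \<theta>\<close> is the structure map from level \<open>n\<close> to level \<open>m\<close> of a monotone map \<open>\<theta>\<close> from
  \<open>[m]\<close> to \<open>[n]\<close>.\<close>

record 'x sspace =
  slevel :: "nat \<Rightarrow> 'x topology"
  sact :: "nat \<Rightarrow> (nat \<Rightarrow> nat) \<Rightarrow> 'x \<Rightarrow> 'x"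

definition simplex_push :: "nat \<Rightarrow> (nat \<Rightarrow> nat) \<Rightarrow> (nat \<Rightarrow> real) \<Rightarrow> nat \<Rightarrow> real" where
  "simplex_push m \<theta> u = (\<lambda>i. \<Sum>j | j \<le> m \<and> \<theta> j = i. u j)"

definition cells :: "'x sspace \<Rightarrow> (nat \<times> 'x \<times> (nat \<Rightarrow> real)) topology" where
  "cells X = sum_topology
     (\<lambda>n. prod_topology (slevel X n) (subtopology (powertop_real UNIV) (standard_simplex n))) UNIV"

definition glue :: "'x sspace \<Rightarrow> nat \<times> 'x \<times> (nat \<Rightarrow> real) \<Rightarrow> nat \<times> 'x \<times> (nat \<Rightarrow> real) \<Rightarrow> bool" where
  "glue X p q \<longleftrightarrow> (\<exists>m n \<theta> x u. mono_on {..m} \<theta> \<and> \<theta> ` {..m} \<subseteq> {..n} \<and>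
     x \<in> topspace (slevel X n) \<and> u \<in> standard_simplex m \<and>
     p = (m, sact X m \<theta> x, u) \<and> q = (n, x, simplex_push m \<theta> u))"

definition pt :: "'x sspace \<Rightarrow> nat \<times> 'x \<times> (nat \<Rightarrow> real) \<Rightarrow> (nat \<times> 'x \<times> (nat \<Rightarrow> real)) set" where
  "pt X p = {q. equivclp (glue X) p q}"

definition realise :: "'x sspace \<Rightarrow> (nat \<times> 'x \<times> (nat \<Rightarrow> real)) set topology" where
  "realise X = topology (\<lambda>U. U \<subseteq> pt X ` topspace (cells X) \<and>
     openin (cells X) {p \<in> topspace (cells X). pt X p \<in> U})"

text \<open>The map out of a realisation given by a function on representatives that is constant on
  classes.\<close>

definition descend :: "('p \<Rightarrow> 'y) \<Rightarrow> 'p set \<Rightarrow> 'y" where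
  "descend f c = the_elem (f ` c)"

definition realise_map ::
  "'y sspace \<Rightarrow> (nat \<Rightarrow> 'x \<Rightarrow> 'y) \<Rightarrow> (nat \<times> 'x \<times> (nat \<Rightarrow> real)) set \<Rightarrow> (nat \<times> 'y \<times> (nat \<Rightarrow> real)) set"
  where "realise_map Y g = descend (\<lambda>(n, x, u). pt Y (n, g n x, u))"

definition nerve :: "('o, 'm, 'z) cat_scheme \<Rightarrow> (nat, 'o, 'm) diagram sspace" where
  "nerve C = \<lparr>slevel = (\<lambda>q. discrete_topology (diagrams {..q} C)), sact = (\<lambda>m \<theta>. pull {..m} \<theta>)\<rparr>"

section \<open>Loop spaces and algebraic K-theory\<close>

text \<open>The space of continuous maps with the compact-open topology.\<close>

definition mapping_space :: "'x topology \<Rightarrow> 'y topology \<Rightarrow> ('x \<Rightarrow> 'y) topology" where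
  "mapping_space X Y = topology_generated_by
     {{f \<in> extensional (topspace X). continuous_map X Y f \<and> f ` K \<subseteq> U} | K U.
        compactin X K \<and> openin Y U}"

text \<open>The circle is \<open>[0,1]\<close> with its endpoints identified.\<close>

definition free_loops :: "'x topology \<Rightarrow> (real \<Rightarrow> 'x) topology" where
  "free_loops X = subtopology (mapping_space (top_of_set {0..1}) X) {\<gamma>. \<gamma> 0 = \<gamma> 1}"

definition based_loops :: "'x topology \<Rightarrow> 'x \<Rightarrow> (real \<Rightarrow> 'x) topology" where
  "based_loops X b = subtopology (mapping_space (top_of_set {0..1}) X) {\<gamma>. \<gamma> 0 = b \<and> \<gamma> 1 = b}"

definition loop_concat :: "(real \<Rightarrow> 'x) \<Rightarrow> (real \<Rightarrow> 'x) \<Rightarrow> real \<Rightarrow> 'x" where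
  "loop_concat \<gamma> \<delta> = (\<lambda>s\<in>{0..1}. if s \<le> 1/2 then \<gamma> (2 * s) else \<delta> (2 * s - 1))"

type_synonym ('o, 'm) S_simplex = "(nat, (nat \<times> nat, 'o, 'm) diagram, nat \<times> nat \<Rightarrow> 'm) diagram"

type_synonym ('o, 'm) S_level = "(nat \<times> ('o, 'm) S_simplex \<times> (nat \<Rightarrow> real)) set"

type_synonym ('o, 'm) S_point = "(nat \<times> ('o, 'm) S_level \<times> (nat \<Rightarrow> real)) set"

definition wS_space :: "('o, 'm) wcat \<Rightarrow> ('o, 'm) S_level sspace" where
  "wS_space C = \<lparr>
     slevel = (\<lambda>n. realise (nerve (wS C n))),
     sact = (\<lambda>m \<theta>. realise_map (nerve (wS C m)) (\<lambda>q. push {..q} (wS_act m \<theta>)))\<rparr>"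

definition S_base :: "('o, 'm) wcat \<Rightarrow> ('o, 'm) S_point" where
  "S_base C =
    (let \<delta> = (\<lambda>i. if i = 0 then 1 else 0);
         \<sigma> = const_diagram {..0} (wS C 0) (const_diagram (Ar 0) C (wzero C))
     in pt (wS_space C) (0, pt (nerve (wS C 0)) (0, \<sigma>, \<delta>), \<delta>))"

definition K_space :: "('o, 'm) wcat \<Rightarrow> (real \<Rightarrow> ('o, 'm) S_point) topology" where
  "K_space C = based_loops (realise (wS_space C)) (S_base C)"

text \<open>The map on \<open>K\<close> induced by an exact functor into \<open>D\<close>, and its free loop.\<close>

definition K_map ::
  "('p, 'n) wcat \<Rightarrow> ('o, 'm, 'p, 'n) fctr \<Rightarrow> (real \<Rightarrow> ('o, 'm) S_point) \<Rightarrow> real \<Rightarrow> ('p, 'n) S_point"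
  where "K_map D \<Phi> \<omega> = (\<lambda>r\<in>{0..1}.
    realise_map (wS_space D)
      (\<lambda>k. realise_map (nerve (wS D k)) (\<lambda>q. push {..q} (wS_fctr k \<Phi>))) (\<omega> r))"

definition LK_map ::
  "('p, 'n) wcat \<Rightarrow> ('o, 'm, 'p, 'n) fctr \<Rightarrow>
   (real \<Rightarrow> real \<Rightarrow> ('o, 'm) S_point) \<Rightarrow> real \<Rightarrow> real \<Rightarrow> ('p, 'n) S_point"
  where "LK_map D \<Phi> \<gamma> = (\<lambda>s\<in>{0..1}. K_map D \<Phi> (\<gamma> s))"

section \<open>Coassembly\<close>

text \<open>A \<open>q\<close>-simplex of the nerve of the category of self-maps in \<open>D\<close>, viewed as a functor from
  \<open>[1] \<times> [q]\<close> to \<open>D\<close>.\<close>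

definition prism ::
  "('o, 'm, 'z) cat_scheme \<Rightarrow> nat \<Rightarrow> (nat, 'o \<times> 'm, 'm) diagram \<Rightarrow> (nat \<times> nat, 'o, 'm) diagram" where
  "prism D q \<sigma> =
    ((\<lambda>(e, j)\<in>{0, 1} \<times> {..q}. fst (fst \<sigma> j)),
     (\<lambda>((e, i), (e', j))\<in>le_pairs ({0, 1} \<times> {..q}).
        if e = e' then snd \<sigma> (i, j)
        else cat_comp D (fst (fst \<sigma> i)) (snd \<sigma> (i, j)) (snd (fst \<sigma> i))))"

text \<open>The realisation of a functor \<open>F\<close> from \<open>[1] \<times> [q]\<close> to \<open>D\<close> at a point of \<open>\<Delta>\<^sup>1 \<times> \<Delta>\<^sup>q\<close>, via the
  bijection between the realisation of the nerve of \<open>[1] \<times> [q]\<close> and \<open>\<Delta>\<^sup>1 \<times> \<Delta>\<^sup>q\<close> given by the two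
  projections.  The point \<open>s\<close> of \<open>[0,1]\<close> has barycentric coordinates \<open>(1 - s, s)\<close>.\<close>

definition prism_point ::
  "('o, 'm, 'z) cat_scheme \<Rightarrow> nat \<Rightarrow> (nat \<times> nat, 'o, 'm) diagram \<Rightarrow> real \<Rightarrow> (nat \<Rightarrow> real) \<Rightarrow>
   (nat \<times> (nat, 'o, 'm) diagram \<times> (nat \<Rightarrow> real)) set" where
  "prism_point D q F s u = (THE y. \<exists>m \<tau> w.
     mono_on {..m} \<tau> \<and> \<tau> ` {..m} \<subseteq> {0, 1} \<times> {..q} \<and> w \<in> standard_simplex m \<and>
     simplex_push m (fst \<circ> \<tau>) w = (\<lambda>e. if e = 0 then 1 - s else if e = 1 then s else 0) \<and>
     simplex_push m (snd \<circ> \<tau>) w = u \<and>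
     y = pt (nerve D) (m, pull {..m} \<tau> F, w))"

text \<open>The identification of \<open>wS\<^sub>k\<close> of the category of automorphisms with the category of self-maps
  in \<open>wS\<^sub>k C\<close> (when the weak equivalences of \<open>C\<close> are its isomorphisms).\<close>

definition aut_to_self ::
  "nat \<Rightarrow> ((nat \<times> nat, 'o \<times> 'm, 'm) diagram, nat \<times> nat \<Rightarrow> 'm,
           (nat \<times> nat, 'o, 'm) diagram \<times> (nat \<times> nat \<Rightarrow> 'm), nat \<times> nat \<Rightarrow> 'm) fctr" where
  "aut_to_self k =
    ((\<lambda>F. (push (Ar k) forget_end F, \<lambda>a\<in>Ar k. snd (fst F a))), \<lambda>_ _ \<eta>. \<eta>)"

definition coassembly_level ::
  "('o, 'm) wcat \<Rightarrow> nat \<Rightarrow> real \<Rightarrow> ('o \<times> 'm, 'm) S_level \<Rightarrow> ('o, 'm) S_level" where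
  "coassembly_level C k s = descend (\<lambda>(q, \<sigma>, u).
     prism_point (wS C k) q (prism (wS C k) q (push {..q} (aut_to_self k) \<sigma>)) s u)"

definition coassembly ::
  "('o, 'm) wcat \<Rightarrow> (real \<Rightarrow> ('o \<times> 'm, 'm) S_point) \<Rightarrow> real \<Rightarrow> real \<Rightarrow> ('o, 'm) S_point" where
  "coassembly C \<omega> = (\<lambda>s\<in>{0..1}. \<lambda>r\<in>{0..1}.
     realise_map (wS_space C) (\<lambda>k. coassembly_level C k s) (\<omega> r))"

section \<open>Finitely generated projective modules\<close>

text \<open>The locale \<^locale>\<open>module\<close> is about modules over commutative rings; here \<open>a \<odot> x\<close> is the right
  action of \<open>a\<close> on \<open>x\<close>.\<close>

locale right_module = R?: ring R + M?: abelian_group M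
  for R :: "('a, 'r) ring_scheme" (structure) and M :: "('a, 'b, 'm) module_scheme" (structure) +
  assumes ract_closed: "\<lbrakk>a \<in> carrier R; x \<in> carrier M\<rbrakk> \<Longrightarrow> a \<odot>\<^bsub>M\<^esub> x \<in> carrier M"
    and ract_l_distr: "\<lbrakk>a \<in> carrier R; b \<in> carrier R; x \<in> carrier M\<rbrakk> \<Longrightarrow>
      (a \<oplus>\<^bsub>R\<^esub> b) \<odot>\<^bsub>M\<^esub> x = a \<odot>\<^bsub>M\<^esub> x \<oplus>\<^bsub>M\<^esub> b \<odot>\<^bsub>M\<^esub> x"
    and ract_r_distr: "\<lbrakk>a \<in> carrier R; x \<in> carrier M; y \<in> carrier M\<rbrakk> \<Longrightarrow>
      a \<odot>\<^bsub>M\<^esub> (x \<oplus>\<^bsub>M\<^esub> y) = a \<odot>\<^bsub>M\<^esub> x \<oplus>\<^bsub>M\<^esub> a \<odot>\<^bsub>M\<^esub> y"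
    and ract_assoc: "\<lbrakk>a \<in> carrier R; b \<in> carrier R; x \<in> carrier M\<rbrakk> \<Longrightarrow>
      (a \<otimes>\<^bsub>R\<^esub> b) \<odot>\<^bsub>M\<^esub> x = b \<odot>\<^bsub>M\<^esub> (a \<odot>\<^bsub>M\<^esub> x)"
    and ract_one: "x \<in> carrier M \<Longrightarrow> \<one>\<^bsub>R\<^esub> \<odot>\<^bsub>M\<^esub> x = x"

definition free_mod :: "('a, 'r) ring_scheme \<Rightarrow> nat \<Rightarrow> ('a, nat \<Rightarrow> 'a) module" where
  "free_mod R n = \<lparr>
     carrier = {..<n} \<rightarrow>\<^sub>E carrier R, mult = undefined, one = undefined,
     zero = (\<lambda>i\<in>{..<n}. \<zero>\<^bsub>R\<^esub>),
     add = (\<lambda>x y. \<lambda>i\<in>{..<n}. x i \<oplus>\<^bsub>R\<^esub> y i),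
     smult = (\<lambda>a x. \<lambda>i\<in>{..<n}. x i \<otimes>\<^bsub>R\<^esub> a)\<rparr>"

definition linear_map ::
  "('a, 'r) ring_scheme \<Rightarrow> ('a, 'b, 'm) module_scheme \<Rightarrow> ('a, 'c, 'n) module_scheme \<Rightarrow> ('b \<Rightarrow> 'c) \<Rightarrow> bool"
  where "linear_map R M N h \<longleftrightarrow> h \<in> carrier M \<rightarrow>\<^sub>E carrier N \<and>
    (\<forall>x\<in>carrier M. \<forall>y\<in>carrier M. h (x \<oplus>\<^bsub>M\<^esub> y) = h x \<oplus>\<^bsub>N\<^esub> h y) \<and>
    (\<forall>a\<in>carrier R. \<forall>x\<in>carrier M. h (a \<odot>\<^bsub>M\<^esub> x) = a \<odot>\<^bsub>N\<^esub> h x)"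

text \<open>The small model of the category of finitely generated projective right modules used here is
  the full subcategory of the direct summands \<open>M\<close> of the modules \<open>R\<^sup>n\<close>, recorded as \<open>(n, M)\<close>; the
  lemma \<open>fg_projective_iso_summand\<close> below shows that every finitely generated projective right
  module is isomorphic to one of them.\<close>

type_synonym 'a summand = "nat \<times> (nat \<Rightarrow> 'a) set"

type_synonym 'a vfun = "(nat \<Rightarrow> 'a) \<Rightarrow> nat \<Rightarrow> 'a"

definition summands :: "('a, 'r) ring_scheme \<Rightarrow> 'a summand set" where
  "summands R = {(n, M). submodule M R (free_mod R n) \<and>
     (\<exists>N. submodule N R (free_mod R n) \<and> M \<inter> N = {\<zero>\<^bsub>free_mod R n\<^esub>} \<and>
        M <+>\<^bsub>free_mod R n\<^esub> N = carrier (free_mod R n))}"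

definition the_mod :: "('a, 'r) ring_scheme \<Rightarrow> 'a summand \<Rightarrow> ('a, nat \<Rightarrow> 'a) module" where
  "the_mod R X = (free_mod R (fst X))\<lparr>carrier := snd X\<rparr>"

definition fgproj_cat :: "('a, 'r) ring_scheme \<Rightarrow> ('a summand, 'a vfun) cat" where
  "fgproj_cat R = \<lparr>
     cat_ob = summands R,
     cat_hom = (\<lambda>X Y. {h. linear_map R (the_mod R X) (the_mod R Y) h}),
     cat_id = (\<lambda>X. \<lambda>x\<in>snd X. x),
     cat_comp = (\<lambda>X g f. compose (snd X) g f)\<rparr>"

text \<open>In the condition for a cofibration, \<open>q : Y \<rightarrow> Q\<close> exhibits a projective module \<open>Q\<close> as the
  cokernel of \<open>h\<close>.\<close>

definition fgproj :: "('a, 'r) ring_scheme \<Rightarrow> ('a summand, 'a vfun) wcat" where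
  "fgproj R = \<lparr>
     cat_ob = cat_ob (fgproj_cat R), cat_hom = cat_hom (fgproj_cat R),
     cat_id = cat_id (fgproj_cat R), cat_comp = cat_comp (fgproj_cat R),
     wzero = (0, carrier (free_mod R 0)),
     wcof = (\<lambda>X Y. {h \<in> cat_hom (fgproj_cat R) X Y. inj_on h (snd X) \<and>
        (\<exists>Q\<in>cat_ob (fgproj_cat R). \<exists>q\<in>cat_hom (fgproj_cat R) Y Q.
           q ` snd Y = snd Q \<and> {y \<in> snd Y. q y = \<zero>\<^bsub>the_mod R Q\<^esub>} = h ` snd X)}),
     weq = isos (fgproj_cat R)\<rparr>"

lemma free_mod_simps:
  "carrier (free_mod R n) = {..<n} \<rightarrow>\<^sub>E carrier R"
  "\<zero>\<^bsub>free_mod R n\<^esub> = (\<lambda>i\<in>{..<n}. \<zero>\<^bsub>R\<^esub>)"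
  "x \<oplus>\<^bsub>free_mod R n\<^esub> y = (\<lambda>i\<in>{..<n}. x i \<oplus>\<^bsub>R\<^esub> y i)"
  "a \<odot>\<^bsub>free_mod R n\<^esub> x = (\<lambda>i\<in>{..<n}. x i \<otimes>\<^bsub>R\<^esub> a)"
  by (simp_all add: free_mod_def)

lemma right_module_free_mod:
  assumes "ring R"
  shows "right_module R (free_mod R n)"
proof -
  interpret ring R by fact
  have "abelian_group (free_mod R n)"
  proof (rule abelian_groupI, goal_cases)
    case (6 x)
    then have "(\<lambda>i\<in>{..<n}. \<ominus>\<^bsub>R\<^esub> x i) \<in> carrier (free_mod R n)"
      "(\<lambda>i\<in>{..<n}. \<ominus>\<^bsub>R\<^esub> x i) \<oplus>\<^bsub>free_mod R n\<^esub> x = \<zero>\<^bsub>free_mod R n\<^esub>"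
      by (auto simp: free_mod_simps PiE_iff l_neg)
    then show ?case by blast
  qed (auto simp: free_mod_simps PiE_iff extensional_def a_ac fun_eq_iff)
  then show ?thesis
    by (intro right_module.intro right_module_axioms.intro \<open>ring R\<close>)
      (auto simp: free_mod_simps PiE_iff extensional_def fun_eq_iff l_distr r_distr m_assoc)
qed

lemma submodule_iff:
  assumes "right_module R M"
  shows "submodule H R M \<longleftrightarrow> H \<subseteq> carrier M \<and> \<zero>\<^bsub>M\<^esub> \<in> H \<and>
    (\<forall>x\<in>H. \<forall>y\<in>H. x \<oplus>\<^bsub>M\<^esub> y \<in> H) \<and> (\<forall>a\<in>carrier R. \<forall>x\<in>H. a \<odot>\<^bsub>M\<^esub> x \<in> H)"
proof -
  interpret right_module R M by fact
  have minus: "inv\<^bsub>add_monoid M\<^esub> x = (\<ominus>\<^bsub>R\<^esub> \<one>\<^bsub>R\<^esub>) \<odot>\<^bsub>M\<^esub> x" if x: "x \<in> carrier M" for x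
  proof -
    have z: "\<zero>\<^bsub>R\<^esub> \<odot>\<^bsub>M\<^esub> x = \<zero>\<^bsub>M\<^esub>"
      using ract_l_distr[of "\<zero>\<^bsub>R\<^esub>" "\<zero>\<^bsub>R\<^esub>" x] x ract_closed[of "\<zero>\<^bsub>R\<^esub>" x]
      by (metis M.add.r_cancel_one' R.l_zero R.zero_closed)
    have "(\<ominus>\<^bsub>R\<^esub> \<one>\<^bsub>R\<^esub>) \<odot>\<^bsub>M\<^esub> x \<oplus>\<^bsub>M\<^esub> x = \<zero>\<^bsub>M\<^esub>"
      using ract_l_distr[of "\<ominus>\<^bsub>R\<^esub> \<one>\<^bsub>R\<^esub>" "\<one>\<^bsub>R\<^esub>" x] x z by (simp add: ract_one R.l_neg)
    then have "\<ominus>\<^bsub>M\<^esub> x = (\<ominus>\<^bsub>R\<^esub> \<one>\<^bsub>R\<^esub>) \<odot>\<^bsub>M\<^esub> x"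
      using x ract_closed by (metis M.minus_equality R.one_closed R.a_inv_closed)
    then show ?thesis by (simp add: a_inv_def)
  qed
  show ?thesis
    unfolding submodule_def submodule_axioms_def subgroup_def
    using minus by (auto simp: subset_iff)
qed

lemma fg_projective_iso_summand:
  fixes R (structure)
  assumes M: "right_module R M"
    and fin_gen: "linear_map R (free_mod R n) M g" "g ` carrier (free_mod R n) = carrier M"
    and projective: "linear_map R M (free_mod R n) s" "\<And>x. x \<in> carrier M \<Longrightarrow> g (s x) = x"
  shows "\<exists>X\<in>summands R. \<exists>h. linear_map R M (the_mod R X) h \<and> bij_betw h (carrier M) (snd X)"
proof -
  interpret M: right_module R M by fact
  let ?F = "free_mod R n"
  have F': "right_module R ?F" by (rule right_module_free_mod) (rule M.R.ring_axioms)
  interpret F: right_module R ?F by fact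
  note L = fin_gen(1)[unfolded linear_map_def] projective(1)[unfolded linear_map_def]
  have gc: "g x \<in> carrier M" if "x \<in> carrier ?F" for x using L(1) that by auto
  have sc: "s x \<in> carrier ?F" if "x \<in> carrier M" for x using L(2) that by auto
  have s0: "s \<zero>\<^bsub>M\<^esub> = \<zero>\<^bsub>?F\<^esub>"
    using L(2) by (metis F.M.add.r_cancel_one' M.M.l_zero M.M.zero_closed sc)
  have g0: "g \<zero>\<^bsub>?F\<^esub> = \<zero>\<^bsub>M\<^esub>" using s0 projective(2) by (metis M.M.zero_closed)
  let ?N = "{y \<in> carrier ?F. g y = \<zero>\<^bsub>M\<^esub>}"
  have a0: "a \<odot>\<^bsub>M\<^esub> \<zero>\<^bsub>M\<^esub> = \<zero>\<^bsub>M\<^esub>" if "a \<in> carrier R" for a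
    using that by (metis M.M.add.r_cancel_one' M.M.l_zero M.M.zero_closed M.ract_closed M.ract_r_distr)
  have 1: "submodule (s ` carrier M) R ?F"
    unfolding submodule_iff[OF F']
  proof (intro conjI ballI)
    show "s ` carrier M \<subseteq> carrier ?F" using sc by auto
    show "\<zero>\<^bsub>?F\<^esub> \<in> s ` carrier M" using s0 by (metis M.M.zero_closed imageI)
  next
    fix x y assume "x \<in> s ` carrier M" "y \<in> s ` carrier M"
    then obtain x' y' where "x' \<in> carrier M" "y' \<in> carrier M" "x = s x'" "y = s y'" by blast
    then show "x \<oplus>\<^bsub>?F\<^esub> y \<in> s ` carrier M" 
      using L(2) by (intro image_eqI[of _ _ "x' \<oplus>\<^bsub>M\<^esub> y'"]) auto
  next
    fix a x assume "a \<in> carrier R" "x \<in> s ` carrier M"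
    then obtain x' where "a \<in> carrier R" "x' \<in> carrier M" "x = s x'" by blast
    then show "a \<odot>\<^bsub>?F\<^esub> x \<in> s ` carrier M" 
      using L(2) by (intro image_eqI[of _ _ "a \<odot>\<^bsub>M\<^esub> x'"]) (auto intro: M.ract_closed)
  qed
  have 2: "submodule ?N R ?F"
    unfolding submodule_iff[OF F'] using L(1) g0 a0 F.ract_closed by auto
  have 3: "s ` carrier M \<inter> ?N = {\<zero>\<^bsub>?F\<^esub>}"
  proof
    show "s ` carrier M \<inter> ?N \<subseteq> {\<zero>\<^bsub>?F\<^esub>}"
    proof
      fix y assume y: "y \<in> s ` carrier M \<inter> ?N"
      then obtain x where x: "x \<in> carrier M" "y = s x" by blast
      then have "x = \<zero>\<^bsub>M\<^esub>" using y projective(2)[of x] by simp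
      then show "y \<in> {\<zero>\<^bsub>?F\<^esub>}" using x s0 by simp
    qed
    have "\<zero>\<^bsub>?F\<^esub> \<in> s ` carrier M" 
      using imageI[OF M.M.zero_closed, of s] unfolding s0 .
    then show "{\<zero>\<^bsub>?F\<^esub>} \<subseteq> s ` carrier M \<inter> ?N" using g0 by simp
  qed
  have 4: "s ` carrier M <+>\<^bsub>?F\<^esub> ?N = carrier ?F"
  proof
    show "s ` carrier M <+>\<^bsub>?F\<^esub> ?N \<subseteq> carrier ?F"
      using sc by (auto simp: set_add_def')
    show "carrier ?F \<subseteq> s ` carrier M <+>\<^bsub>?F\<^esub> ?N"
    proof
      fix y assume y: "y \<in> carrier ?F"
      let ?x = "s (g y)" and ?z = "\<ominus>\<^bsub>?F\<^esub> s (g y) \<oplus>\<^bsub>?F\<^esub> y"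
      have x: "?x \<in> carrier ?F" using y gc sc by auto
      have z: "?z \<in> carrier ?F" using x y by simp
      have eq: "?x \<oplus>\<^bsub>?F\<^esub> ?z = y" by (rule F.M.r_neg2[OF x y])
      have "g (?x \<oplus>\<^bsub>?F\<^esub> ?z) = g ?x \<oplus>\<^bsub>M\<^esub> g ?z" using L(1) x z by blast
      then have "g y = g ?x \<oplus>\<^bsub>M\<^esub> g ?z" unfolding eq .
      also have "g ?x = g y" using projective(2) gc y by simp
      finally have "g ?z = \<zero>\<^bsub>M\<^esub>" 
        by (rule iffD1[OF M.M.add.l_cancel_one'[OF gc[OF y] gc[OF z]]])
      then show "y \<in> s ` carrier M <+>\<^bsub>?F\<^esub> ?N"
        using eq z gc[OF y] unfolding set_add_def' by blast
    qed
  qed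
  have "(n, s ` carrier M) \<in> summands R"
    unfolding summands_def using 1 2 3 4 by blast
  moreover have "linear_map R M (the_mod R (n, s ` carrier M)) s"
    using L(2) by (auto simp: linear_map_def the_mod_def free_mod_def)
  moreover have "bij_betw s (carrier M) (snd (n, s ` carrier M))"
    using projective(2) by (auto simp: bij_betw_def intro: inj_on_inverseI)
  ultimately show ?thesis by blast
qed

subsection \<open>Extension of scalars\<close>

text \<open>For a direct summand \<open>M\<close> of \<open>R\<^sup>n\<close> and a ring homomorphism \<open>\<phi>\<close> from \<open>R\<close> to \<open>R'\<close>, the
  map from \<open>M \<otimes>\<^sub>R R'\<close> to \<open>R'\<^sup>n\<close> is injective, and \<open>M \<otimes>\<^sub>R R'\<close> is taken to be its image, the submodule
  spanned by \<open>\<phi>(M)\<close>; its universal property is the lemma \<open>ext_universal\<close> below.  This model is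
  strictly functorial in \<open>\<phi>\<close> and strictly preserves the zero object.\<close>

definition vec_map :: "('a \<Rightarrow> 'b) \<Rightarrow> nat \<Rightarrow> (nat \<Rightarrow> 'a) \<Rightarrow> nat \<Rightarrow> 'b" where
  "vec_map \<phi> n x = (\<lambda>i\<in>{..<n}. \<phi> (x i))"

definition ext_ob :: "('b, 'r) ring_scheme \<Rightarrow> ('a \<Rightarrow> 'b) \<Rightarrow> 'a summand \<Rightarrow> 'b summand" where
  "ext_ob R' \<phi> X = (fst X,
     \<Inter>{N. submodule N R' (free_mod R' (fst X)) \<and> vec_map \<phi> (fst X) ` snd X \<subseteq> N})"

context right_module begin

lemma finsum_ract:
  assumes "finite J" "a \<in> carrier R" "f \<in> J \<rightarrow> carrier M"
  shows "a \<odot>\<^bsub>M\<^esub> (\<Oplus>\<^bsub>M\<^esub>j\<in>J. f j) = (\<Oplus>\<^bsub>M\<^esub>j\<in>J. a \<odot>\<^bsub>M\<^esub> f j)"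
  using assms
proof (induction J rule: finite_induct)
  case empty
  have "a \<odot>\<^bsub>M\<^esub> \<zero>\<^bsub>M\<^esub> = \<zero>\<^bsub>M\<^esub>"
    using empty by (metis M.add.r_cancel_one' M.l_zero M.zero_closed ract_closed ract_r_distr)
  then show ?case by simp
next
  case (insert i J)
  then have "f \<in> J \<rightarrow> carrier M" "f i \<in> carrier M" "(\<lambda>j. a \<odot>\<^bsub>M\<^esub> f j) \<in> J \<rightarrow> carrier M"
    by (auto intro: ract_closed)
  with insert show ?case by (simp add: M.finsum_insert ract_closed ract_r_distr)
qed

end

lemma finsum_additive:
  assumes "abelian_group M" "abelian_group N" "finite J" "H \<subseteq> carrier M" "\<zero>\<^bsub>M\<^esub> \<in> H"
    and add: "\<And>x y. x \<in> H \<Longrightarrow> y \<in> H \<Longrightarrow> x \<oplus>\<^bsub>M\<^esub> y \<in> H \<and> g (x \<oplus>\<^bsub>M\<^esub> y) = g x \<oplus>\<^bsub>N\<^esub> g y"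
    and g: "g \<in> H \<rightarrow> carrier N" and f: "f \<in> J \<rightarrow> H"
  shows "(\<Oplus>\<^bsub>M\<^esub>j\<in>J. f j) \<in> H \<and> g (\<Oplus>\<^bsub>M\<^esub>j\<in>J. f j) = (\<Oplus>\<^bsub>N\<^esub>j\<in>J. g (f j))"
  using \<open>finite J\<close> f
proof (induction J rule: finite_induct)
  case empty
  interpret M: abelian_group M by fact
  interpret N: abelian_group N by fact
  have "g \<zero>\<^bsub>M\<^esub> = g \<zero>\<^bsub>M\<^esub> \<oplus>\<^bsub>N\<^esub> g \<zero>\<^bsub>M\<^esub>" using add[of "\<zero>\<^bsub>M\<^esub>" "\<zero>\<^bsub>M\<^esub>"] assms(5) by simp
  then have "g \<zero>\<^bsub>M\<^esub> = \<zero>\<^bsub>N\<^esub>" using g assms(5) by (metis N.add.r_cancel_one' funcset_mem)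
  then show ?case using assms(5) by simp
next
  case (insert i J)
  interpret M: abelian_group M by fact
  interpret N: abelian_group N by fact
  have "f \<in> J \<rightarrow> H" "f i \<in> H" using insert by auto
  moreover from this have "f \<in> J \<rightarrow> carrier M" "f i \<in> carrier M" "(\<lambda>j. g (f j)) \<in> J \<rightarrow> carrier N"
    "g (f i) \<in> carrier N"
    using assms(4) g by auto
  ultimately show ?case using insert add by (simp add: M.finsum_insert N.finsum_insert)
qed

lemma free_mod_finsum_nth:
  assumes R: "ring R" and J: "finite J" and f: "f \<in> J \<rightarrow> carrier (free_mod R n)" and i: "i < n"
  shows "(\<Oplus>\<^bsub>free_mod R n\<^esub>j\<in>J. f j) i = (\<Oplus>\<^bsub>R\<^esub>j\<in>J. f j i)"
proof -
  interpret R: ring R by fact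
  interpret F: right_module R "free_mod R n" by (rule right_module_free_mod) fact
  show ?thesis
    using finsum_additive[OF F.M.abelian_group_axioms R.abelian_group_axioms J, of "carrier (free_mod R n)" "\<lambda>x. x i" f] f i
    by (auto simp: free_mod_simps PiE_iff)
qed

lemma ext_universal:
  assumes R: "ring R" and R': "ring R'" and \<phi>: "\<phi> \<in> ring_hom R R'" and X: "X \<in> summands R"
    and N: "right_module R' N"
    and g: "g \<in> snd X \<rightarrow> carrier N"
    and g_add: "\<And>x y. x \<in> snd X \<Longrightarrow> y \<in> snd X \<Longrightarrow> g (x \<oplus>\<^bsub>the_mod R X\<^esub> y) = g x \<oplus>\<^bsub>N\<^esub> g y"
    and g_act: "\<And>a x. a \<in> carrier R \<Longrightarrow> x \<in> snd X \<Longrightarrow> g (a \<odot>\<^bsub>the_mod R X\<^esub> x) = \<phi> a \<odot>\<^bsub>N\<^esub> g x"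
  shows "\<exists>!g'. linear_map R' (the_mod R' (ext_ob R' \<phi> X)) N g' \<and>
    (\<forall>x\<in>snd X. g' (vec_map \<phi> (fst X) x) = g x)"
proof -
  obtain n M where Xeq: "X = (n, M)" by fastforce
  interpret R: ring R by fact
  interpret R': ring R' by fact
  let ?F = "free_mod R n" and ?F' = "free_mod R' n"
  have rF: "right_module R ?F" by (rule right_module_free_mod) fact
  have rF': "right_module R' ?F'" by (rule right_module_free_mod) fact
  interpret F: right_module R ?F by fact
  interpret F': right_module R' ?F' by fact
  interpret N: right_module R' N by fact
  have h\<phi>: "\<phi> \<in> carrier R \<rightarrow> carrier R'" using \<phi> by (auto simp: ring_hom_def)
  obtain C where subM: "submodule M R ?F" and subC: "submodule C R ?F"
    and int: "M \<inter> C = {\<zero>\<^bsub>?F\<^esub>}" and sum: "M <+>\<^bsub>?F\<^esub> C = carrier ?F"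
    using X unfolding summands_def Xeq by auto
  note M = subM[unfolded submodule_iff[OF rF]] and C = subC[unfolded submodule_iff[OF rF]]
  define e where "e j = (\<lambda>i\<in>{..<n}. if i = j then \<one>\<^bsub>R\<^esub> else \<zero>\<^bsub>R\<^esub>)" for j
  have "\<exists>m c. m \<in> M \<and> c \<in> C \<and> e j = m \<oplus>\<^bsub>?F\<^esub> c" for j
  proof -
    have "e j \<in> M <+>\<^bsub>?F\<^esub> C" unfolding sum by (auto simp: e_def free_mod_simps)
    then show ?thesis by (auto simp: set_add_def')
  qed
  then obtain m c where mc: "\<And>j. m j \<in> M" "\<And>j. c j \<in> C" "\<And>j. e j = m j \<oplus>\<^bsub>?F\<^esub> c j" by metis
  have dec: "x = (\<Oplus>\<^bsub>?F\<^esub>j\<in>{..<n}. x j \<odot>\<^bsub>?F\<^esub> m j)" if x: "x \<in> M" for x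
  proof -
    have xF: "x \<in> carrier ?F" using M x by auto
    then have xj: "\<And>j. j \<in> {..<n} \<Longrightarrow> x j \<in> carrier R" by (auto simp: free_mod_simps)
    have cl: "m j \<in> carrier ?F" "c j \<in> carrier ?F" for j using mc M C by auto
    have "(\<Oplus>\<^bsub>?F\<^esub>j\<in>{..<n}. x j \<odot>\<^bsub>?F\<^esub> e j) = x"
    proof
      fix i
      have ecl: "(\<lambda>j. x j \<odot>\<^bsub>?F\<^esub> e j) \<in> {..<n} \<rightarrow> carrier ?F"
        using xj by (auto simp: e_def free_mod_simps)
      show "(\<Oplus>\<^bsub>?F\<^esub>j\<in>{..<n}. x j \<odot>\<^bsub>?F\<^esub> e j) i = x i"
      proof (cases "i < n")
        case True
        have "(\<Oplus>\<^bsub>?F\<^esub>j\<in>{..<n}. x j \<odot>\<^bsub>?F\<^esub> e j) i = (\<Oplus>\<^bsub>R\<^esub>j\<in>{..<n}. (x j \<odot>\<^bsub>?F\<^esub> e j) i)"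
          by (rule free_mod_finsum_nth[OF R _ ecl True]) simp
        also have "\<dots> = (\<Oplus>\<^bsub>R\<^esub>j\<in>{..<n}. if i = j then x j else \<zero>\<^bsub>R\<^esub>)"
          using True xj by (intro R.finsum_cong') (auto simp: e_def free_mod_simps)
        also have "\<dots> = x i" using True xj by (intro R.finsum_singleton) auto
        finally show ?thesis .
      next
        case False
        moreover have "(\<Oplus>\<^bsub>?F\<^esub>j\<in>{..<n}. x j \<odot>\<^bsub>?F\<^esub> e j) \<in> carrier ?F" by (rule F.M.finsum_closed[OF ecl])
        ultimately show ?thesis using xF by (auto simp: free_mod_simps PiE_iff extensional_def)
      qed
    qed
    moreover have "(\<Oplus>\<^bsub>?F\<^esub>j\<in>{..<n}. x j \<odot>\<^bsub>?F\<^esub> e j) =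
        (\<Oplus>\<^bsub>?F\<^esub>j\<in>{..<n}. x j \<odot>\<^bsub>?F\<^esub> m j \<oplus>\<^bsub>?F\<^esub> x j \<odot>\<^bsub>?F\<^esub> c j)"
      using xj cl by (intro F.M.finsum_cong') (auto simp: mc(3) F.ract_r_distr F.ract_closed)
    moreover have "\<dots> = (\<Oplus>\<^bsub>?F\<^esub>j\<in>{..<n}. x j \<odot>\<^bsub>?F\<^esub> m j) \<oplus>\<^bsub>?F\<^esub> (\<Oplus>\<^bsub>?F\<^esub>j\<in>{..<n}. x j \<odot>\<^bsub>?F\<^esub> c j)"
      using xj cl by (intro F.M.finsum_addf) (auto simp: F.ract_closed)
    moreover have inM: "(\<Oplus>\<^bsub>?F\<^esub>j\<in>{..<n}. x j \<odot>\<^bsub>?F\<^esub> m j) \<in> M"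
      using finsum_additive[OF F.M.abelian_group_axioms F.M.abelian_group_axioms, of "{..<n}" M "\<lambda>x. x" "\<lambda>j. x j \<odot>\<^bsub>?F\<^esub> m j"]
        M mc xj by (auto simp: Pi_iff subset_iff)
    moreover have inC: "(\<Oplus>\<^bsub>?F\<^esub>j\<in>{..<n}. x j \<odot>\<^bsub>?F\<^esub> c j) \<in> C"
      using finsum_additive[OF F.M.abelian_group_axioms F.M.abelian_group_axioms, of "{..<n}" C "\<lambda>x. x" "\<lambda>j. x j \<odot>\<^bsub>?F\<^esub> c j"]
        C mc xj by (auto simp: Pi_iff subset_iff)
    ultimately have xeq: "x = (\<Oplus>\<^bsub>?F\<^esub>j\<in>{..<n}. x j \<odot>\<^bsub>?F\<^esub> m j) \<oplus>\<^bsub>?F\<^esub> (\<Oplus>\<^bsub>?F\<^esub>j\<in>{..<n}. x j \<odot>\<^bsub>?F\<^esub> c j)"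
      (is "x = ?a \<oplus>\<^bsub>?F\<^esub> ?b") by simp
    have ab: "?a \<in> carrier ?F" "?b \<in> carrier ?F" using inM inC M C by auto
    have "?b = \<ominus>\<^bsub>?F\<^esub> ?a \<oplus>\<^bsub>?F\<^esub> (?a \<oplus>\<^bsub>?F\<^esub> ?b)" using F.M.r_neg1[OF ab] by (rule sym)
    then have "?b = \<ominus>\<^bsub>?F\<^esub> ?a \<oplus>\<^bsub>?F\<^esub> x" unfolding xeq[symmetric] .
    moreover have "\<ominus>\<^bsub>?F\<^esub> ?a \<in> M"
      unfolding a_inv_def by (rule subgroup.m_inv_closed[OF submodule.axioms(1)[OF subM] inM])
    ultimately have "?b \<in> M" using M x by auto
    then have "?b = \<zero>\<^bsub>?F\<^esub>" using inC int by auto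
    then have "?a \<oplus>\<^bsub>?F\<^esub> ?b = ?a" using ab by simp
    then show ?thesis unfolding xeq[symmetric] .
  qed
  define E where "E = snd (ext_ob R' \<phi> X)"
  have E_def': "E = \<Inter>{N. submodule N R' ?F' \<and> vec_map \<phi> n ` M \<subseteq> N}"
    by (simp add: E_def ext_ob_def Xeq)
  have vF': "vec_map \<phi> n x \<in> carrier ?F'" if "x \<in> M" for x
    using that M h\<phi> by (auto simp: vec_map_def free_mod_simps)
  have carr: "submodule (carrier ?F') R' ?F'"
    unfolding submodule_iff[OF rF'] by (auto intro: F'.ract_closed)
  have EF: "E \<subseteq> carrier ?F'" unfolding E_def' using carr vF' by (intro Inter_lower) auto
  have subE: "submodule E R' ?F'"
    unfolding submodule_iff[OF rF']
    using EF by (auto simp: E_def' submodule_iff[OF rF'])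
  note E = subE[unfolded submodule_iff[OF rF']]
  have vE: "vec_map \<phi> n x \<in> E" if "x \<in> M" for x using that by (auto simp: E_def')
  have tm: "carrier (the_mod R' (ext_ob R' \<phi> X)) = E"
    "x \<oplus>\<^bsub>the_mod R' (ext_ob R' \<phi> X)\<^esub> y = x \<oplus>\<^bsub>?F'\<^esub> y"
    "a \<odot>\<^bsub>the_mod R' (ext_ob R' \<phi> X)\<^esub> x = a \<odot>\<^bsub>?F'\<^esub> x" for x y a
    by (auto simp: the_mod_def E_def ext_ob_def Xeq)
  have tm2: "x \<oplus>\<^bsub>the_mod R X\<^esub> y = x \<oplus>\<^bsub>?F\<^esub> y" "a \<odot>\<^bsub>the_mod R X\<^esub> x = a \<odot>\<^bsub>?F\<^esub> x" for x y a
    by (auto simp: the_mod_def Xeq)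
  note g_add' = g_add[unfolded tm2, unfolded Xeq snd_conv]
    and g_act' = g_act[unfolded tm2, unfolded Xeq snd_conv]
  define G where "G y = (\<Oplus>\<^bsub>N\<^esub>j\<in>{..<n}. y j \<odot>\<^bsub>N\<^esub> g (m j))" for y
  have gm: "g (m j) \<in> carrier N" for j using g mc by (auto simp: Xeq)
  have yj: "y j \<in> carrier R'" if "y \<in> E" "j < n" for y j using that EF by (auto simp: free_mod_simps)
  have "linear_map R' (the_mod R' (ext_ob R' \<phi> X)) N (restrict G E)"
    unfolding linear_map_def tm
  proof (intro conjI ballI)
    show "restrict G E \<in> E \<rightarrow>\<^sub>E carrier N"
      using gm yj by (auto simp: G_def intro!: N.M.finsum_closed N.ract_closed)
  next
    fix x y assume xy: "x \<in> E" "y \<in> E"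
    have "G (x \<oplus>\<^bsub>?F'\<^esub> y) = (\<Oplus>\<^bsub>N\<^esub>j\<in>{..<n}. x j \<odot>\<^bsub>N\<^esub> g (m j) \<oplus>\<^bsub>N\<^esub> y j \<odot>\<^bsub>N\<^esub> g (m j))"
      unfolding G_def using xy gm yj
      by (intro N.M.finsum_cong') (auto simp: free_mod_simps N.ract_l_distr N.ract_closed)
    also have "\<dots> = G x \<oplus>\<^bsub>N\<^esub> G y"
      unfolding G_def using xy gm yj by (intro N.M.finsum_addf) (auto simp: N.ract_closed)
    finally show "restrict G E (x \<oplus>\<^bsub>?F'\<^esub> y) = restrict G E x \<oplus>\<^bsub>N\<^esub> restrict G E y"
      using xy E by simp
  next
    fix a x assume ax: "a \<in> carrier R'" "x \<in> E"
    have "G (a \<odot>\<^bsub>?F'\<^esub> x) = (\<Oplus>\<^bsub>N\<^esub>j\<in>{..<n}. a \<odot>\<^bsub>N\<^esub> (x j \<odot>\<^bsub>N\<^esub> g (m j)))"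
      unfolding G_def using ax gm yj
      by (intro N.M.finsum_cong') (auto simp: free_mod_simps N.ract_assoc N.ract_closed)
    also have "\<dots> = a \<odot>\<^bsub>N\<^esub> G x"
      unfolding G_def using ax gm yj by (intro N.finsum_ract[symmetric]) (auto simp: N.ract_closed)
    finally show "restrict G E (a \<odot>\<^bsub>?F'\<^esub> x) = a \<odot>\<^bsub>N\<^esub> restrict G E x"
      using ax E by simp
  qed
  moreover have "restrict G E (vec_map \<phi> n x) = g x" if x: "x \<in> M" for x
  proof -
    have xj: "x j \<in> carrier R" if "j < n" for j using M x that by (auto simp: free_mod_simps)
    have "G (vec_map \<phi> n x) = (\<Oplus>\<^bsub>N\<^esub>j\<in>{..<n}. g (x j \<odot>\<^bsub>?F\<^esub> m j))"
      unfolding G_def using xj mc g[unfolded Xeq snd_conv] M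
      by (intro N.M.finsum_cong') (auto simp: vec_map_def g_act' Pi_iff intro!: N.ract_closed funcset_mem[OF h\<phi>])
    also have "\<dots> = g (\<Oplus>\<^bsub>?F\<^esub>j\<in>{..<n}. x j \<odot>\<^bsub>?F\<^esub> m j)"
      using finsum_additive[OF F.M.abelian_group_axioms N.M.abelian_group_axioms, of "{..<n}" M g "\<lambda>j. x j \<odot>\<^bsub>?F\<^esub> m j"]
        M mc xj g g_add' by (auto simp: Xeq)
    also have "\<dots> = g x" using dec[OF x] by simp
    finally show ?thesis using vE[OF x] by simp
  qed
  moreover have "g1 = g2"
    if 1: "linear_map R' (the_mod R' (ext_ob R' \<phi> X)) N g1" "\<forall>x\<in>M. g1 (vec_map \<phi> n x) = g x"
      and 2: "linear_map R' (the_mod R' (ext_ob R' \<phi> X)) N g2" "\<forall>x\<in>M. g2 (vec_map \<phi> n x) = g x" for g1 g2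
  proof -
    let ?D = "{y \<in> E. g1 y = g2 y}"
    note l = 1(1)[unfolded linear_map_def tm] 2(1)[unfolded linear_map_def tm]
    have "g1 \<zero>\<^bsub>?F'\<^esub> = \<zero>\<^bsub>N\<^esub>"
      using finsum_additive[OF F'.M.abelian_group_axioms N.M.abelian_group_axioms, of "{}" E g1 "\<lambda>x. x"] E l
      by auto
    moreover have "g2 \<zero>\<^bsub>?F'\<^esub> = \<zero>\<^bsub>N\<^esub>"
      using finsum_additive[OF F'.M.abelian_group_axioms N.M.abelian_group_axioms, of "{}" E g2 "\<lambda>x. x"] E l
      by auto
    ultimately have "submodule ?D R' ?F'"
      unfolding submodule_iff[OF rF'] using E l by auto
    moreover have "vec_map \<phi> n ` M \<subseteq> ?D" using vE 1(2) 2(2) by auto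
    ultimately have "E \<subseteq> ?D" unfolding E_def' by (intro Inter_lower) auto
    then show ?thesis using l by (intro PiE_ext[of g1 E _ g2]) auto
  qed
  ultimately show ?thesis unfolding Xeq fst_conv snd_conv by (intro ex1I[of _ "restrict G E"]) auto
qed

text \<open>The map \<open>h \<otimes> 1\<close> is the linear map with \<open>(h \<otimes> 1)(x \<otimes> 1) = h(x) \<otimes> 1\<close>.\<close>

definition ext_map :: "('b, 'r) ring_scheme \<Rightarrow> ('a \<Rightarrow> 'b) \<Rightarrow> 'a summand \<Rightarrow> 'a summand \<Rightarrow> 'a vfun \<Rightarrow> 'b vfun" where
  "ext_map R' \<phi> X Y h = (THE g. g \<in> cat_hom (fgproj R') (ext_ob R' \<phi> X) (ext_ob R' \<phi> Y) \<and>
     (\<forall>x\<in>snd X. g (vec_map \<phi> (fst X) x) = vec_map \<phi> (fst Y) (h x)))"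

definition ext_fctr :: "('b, 'r) ring_scheme \<Rightarrow> ('a \<Rightarrow> 'b) \<Rightarrow> ('a summand, 'a vfun, 'b summand, 'b vfun) fctr" where
  "ext_fctr R' \<phi> = (ext_ob R' \<phi>, ext_map R' \<phi>)"

section \<open>The maps\<close>

text \<open>\<open>p(f)\<close> acts by \<open>x \<mapsto> \<Sum>\<^sub>i f\<^sup>i(x) p\<^sub>i\<close>.\<close>

definition End_S :: "('a, 'r) ring_scheme \<Rightarrow> (nat \<Rightarrow> 'a) set \<Rightarrow> ('a summand \<times> 'a vfun, 'a vfun) wcat" where
  "End_S A S = full_sub (end_cat (fgproj A)) {(X, f). \<exists>p\<in>S. \<forall>x\<in>snd X.
     (\<Oplus>\<^bsub>the_mod A X\<^esub>i\<in>{..deg A p}. coeff (UP A) p i \<odot>\<^bsub>the_mod A X\<^esub> (f ^^ i) x) = \<zero>\<^bsub>the_mod A X\<^esub>}"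

definition tau_fctr ::
  "('a, 'r) ring_scheme \<Rightarrow> (nat \<Rightarrow> 'a) set \<Rightarrow> ('a summand \<times> 'a vfun, 'a vfun, _, _) fctr" where
  "tau_fctr A S =
    (let B = polys_at A S; \<phi> = const_at A S; t = indet_at A S in
     (\<lambda>(X, f). let Y = ext_ob B \<phi> X in
        (Y, \<lambda>x\<in>snd Y. (t \<odot>\<^bsub>the_mod B Y\<^esub> x) \<ominus>\<^bsub>the_mod B Y\<^esub> ext_map B \<phi> X X f x),
      \<lambda>X Y. ext_map B \<phi> (fst X) (fst Y)))"

definition zeta_fctr ::
  "('a, 'r) ring_scheme \<Rightarrow> (nat \<Rightarrow> 'a) set \<Rightarrow> ('a summand \<times> 'a vfun, 'a vfun, _, _) fctr" where
  "zeta_fctr A T =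
    (let B = polys_at A T; \<phi> = const_at A T; t = indet_at A T in
     (\<lambda>(X, f). let Y = ext_ob B \<phi> X in
        (Y, \<lambda>y\<in>snd Y. inv_into (snd Y)
              (\<lambda>x. x \<ominus>\<^bsub>the_mod B Y\<^esub> (t \<odot>\<^bsub>the_mod B Y\<^esub> ext_map B \<phi> X X f x)) y),
      \<lambda>X Y. ext_map B \<phi> (fst X) (fst Y)))"

definition mult_t_fctr ::
  "('a, 'r) ring_scheme \<Rightarrow> (nat \<Rightarrow> 'a) set \<Rightarrow> ('a summand, 'a vfun, _, _) fctr" where
  "mult_t_fctr A S =
    (let B = polys_at A S; \<phi> = const_at A S; t = indet_at A S in
     (\<lambda>X. let Y = ext_ob B \<phi> X in (Y, \<lambda>x\<in>snd Y. t \<odot>\<^bsub>the_mod B Y\<^esub> x),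
      ext_map B \<phi>))"

definition tau :: "('a, 'r) ring_scheme \<Rightarrow> (nat \<Rightarrow> 'a) set \<Rightarrow> (real \<Rightarrow> ('a summand \<times> 'a vfun, 'a vfun) S_point) \<Rightarrow> _" where
  "tau A S \<omega> = (let P = fgproj (polys_at A S) in
     coassembly P (K_map (aut_cat P) (tau_fctr A S) \<omega>))"

definition zeta :: "('a, 'r) ring_scheme \<Rightarrow> (nat \<Rightarrow> 'a) set \<Rightarrow> (real \<Rightarrow> ('a summand \<times> 'a vfun, 'a vfun) S_point) \<Rightarrow> _" where
  "zeta A T \<omega> = (let P = fgproj (polys_at A T) in
     coassembly P (K_map (aut_cat P) (zeta_fctr A T) \<omega>))"

definition zeta_inv :: "('a, 'r) ring_scheme \<Rightarrow> (nat \<Rightarrow> 'a) set \<Rightarrow> (real \<Rightarrow> ('a summand \<times> 'a vfun, 'a vfun) S_point) \<Rightarrow> _" where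
  "zeta_inv A S \<omega> = (let B = polys_at A S in
     LK_map (fgproj B) (ext_fctr B (invert_indet A S)) (zeta A (reversed A ` S) \<omega>))"

definition mult_t :: "('a, 'r) ring_scheme \<Rightarrow> (nat \<Rightarrow> 'a) set \<Rightarrow> (real \<Rightarrow> ('a summand \<times> 'a vfun, 'a vfun) S_point) \<Rightarrow> _" where
  "mult_t A S \<omega> = (let P = fgproj (polys_at A S) in
     coassembly P (K_map (aut_cat P) (mult_t_fctr A S) (K_map (fgproj A) forget_end \<omega>)))"

definition base_map :: "('a, 'r) ring_scheme \<Rightarrow> (nat \<Rightarrow> 'a) set \<Rightarrow> (real \<Rightarrow> ('a summand \<times> 'a vfun, 'a vfun) S_point) \<Rightarrow> _" where
  "base_map A S \<omega> = (let B = polys_at A S in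
     K_map (fgproj B) (ext_fctr B (const_at A S)) (K_map (fgproj A) forget_end \<omega>))"

end

theory Submission
  imports Defs
begin

text \<open>
  The theorem comes from a factorisation of natural automorphisms.  For \<open>(P, f)\<close> in \<open>End\<^sub>A\<^sup>S\<close>
  write \<open>B = A[t]\<^sub>S\<close>.  On the \<open>B\<close>-module \<open>P[t]\<^sub>S\<close>

    \<open>t = (t - f) (1 - f/t)\<^sup>-\<^sup>1\<close>,

  and \<open>(1 - f/t)\<^sup>-\<^sup>1\<close> is the base change along \<open>t \<mapsto> 1/t\<close> of the automorphism \<open>(1 - f t)\<^sup>-\<^sup>1\<close> of \<open>P[t]\<^sub>T\<close>.
  So the three automorphisms are the edges of a commutative triangle all of whose vertices are the
  functor \<open>(P, f) \<mapsto> P[t]\<^sub>S\<close>.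

  Such a triangle is a functor from \<open>[2] \<times> wS\<^sub>k End\<^sub>A\<^sup>S\<close> to \<open>wS\<^sub>k P(B)\<close>, naturally in \<open>k\<close>.  Realising it
  gives a continuous map \<open>\<Xi>\<close> from \<open>\<Delta>\<^sup>2 \<times> |wS End\<^sub>A\<^sup>S|\<close> to \<open>|wS P(B)|\<close>, which is \<open>K_family\<close> for \<open>p = 2\<close>.
  The coassembly map is the same construction for \<open>[1]\<close> and the tautological automorphism on
  \<open>Aut\<close>.  Hence \<open>\<zeta>(t\<^sup>-\<^sup>1)\<close>, \<open>\<tau>(t)\<close> and \<open>t\<close> are \<open>\<Xi>\<close> along the edges \<open>01\<close>, \<open>12\<close> and \<open>02\<close> of \<open>\<Delta>\<^sup>2\<close>
  (\<open>zeta_inv_eq_loops\<close>, \<open>tau_eq_loops\<close>, \<open>mult_t_eq_loops\<close>), and the concatenation of the first two is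
  \<open>\<Xi>\<close> along the path that runs through both edges.  A straight line in \<open>\<Delta>\<^sup>2\<close> deforms this path into
  the edge \<open>02\<close> and keeps its ends at the vertices \<open>0\<close> and \<open>2\<close>, where \<open>\<Xi>\<close> is the map induced by
  \<open>(P, f) \<mapsto> P[t]\<^sub>S\<close>.  So the homotopy is fibrewise (\<open>loops_homotopic\<close>).

  The topological work is the construction of \<open>\<Xi>\<close>.  A point of \<open>\<Delta>\<^sup>p \<times> \<Delta>\<^sup>q\<close> is a pair of distributions,
  and it lies in a simplex of the nerve of \<open>[p] \<times> [q]\<close> through their coupling along a chain.  That
  coupling is unique as a measure, so it determines a point of the realisation
  (\<open>pt_nerve_determined_by_measure\<close>, \<open>coupling_measure_unique\<close>); finitely many compact simplices
  cover the product, so the point depends continuously on both distributions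
  (\<open>continuous_map_shuffle_point\<close>).

  The algebraic work has two parts.  First, in every category used here the objects of \<open>S\<^sub>n\<close> are
  the diagrams whose squares give short exact sequences (\<open>mod_cat.S_obs_iff\<close>).  These sequences
  split, so extension of scalars preserves them and all functors in sight are exact.  Secondly,
  \<open>1 - f t\<close> is invertible over \<open>A[t]\<^sub>T\<close>: if \<open>p(f) = 0\<close>, it divides the unit \<open>\<Sum>\<^sub>i p\<^sub>i t\<^sup>d\<^sup>-\<^sup>i\<close>.  The
  invertibility of \<open>t - f\<close> then follows from the factorisation above.
\<close>

section \<open>Quotients and realisations\<close>

lemma istopology_realise:
  "istopology (\<lambda>U. U \<subseteq> pt X ` topspace (cells X) \<and>
     openin (cells X) {p \<in> topspace (cells X). pt X p \<in> U})"
proof -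
  have 1: "{p \<in> T. pt X p \<in> U \<inter> V} = {p \<in> T. pt X p \<in> U} \<inter> {p \<in> T. pt X p \<in> V}" for T U V
    by auto
  have 2: "{p \<in> T. pt X p \<in> \<Union>\<K>} = (\<Union>K\<in>\<K>. {p \<in> T. pt X p \<in> K})" for T \<K>
    by auto
  show ?thesis
    unfolding istopology_def 1 2 by blast
qed

lemma openin_realise:
  "openin (realise X) U \<longleftrightarrow> U \<subseteq> pt X ` topspace (cells X) \<and>
     openin (cells X) {p \<in> topspace (cells X). pt X p \<in> U}"
  by (simp add: realise_def istopology_realise)

lemma topspace_realise: "topspace (realise X) = pt X ` topspace (cells X)"
proof
  show "topspace (realise X) \<subseteq> pt X ` topspace (cells X)"
    using openin_realise openin_topspace by blast
  have "{p \<in> topspace (cells X). pt X p \<in> pt X ` topspace (cells X)} = topspace (cells X)" by auto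
  then have "openin (realise X) (pt X ` topspace (cells X))"
    unfolding openin_realise by simp
  then show "pt X ` topspace (cells X) \<subseteq> topspace (realise X)"
    by (rule openin_subset)
qed

lemma quotient_map_realise: "quotient_map (cells X) (realise X) (pt X)"
  unfolding quotient_map_def by (auto simp: topspace_realise openin_realise)

lemma glue_imp_pt_eq: "glue X p q \<Longrightarrow> pt X p = pt X q"
proof -
  assume "glue X p q"
  then have pq: "equivclp (glue X) p q" by (rule r_into_equivclp)
  show ?thesis
    unfolding pt_def using equivclp_trans[OF pq] equivclp_trans[OF equivclp_sym[OF pq]] by (intro Collect_cong iffI)
qed

text \<open>The equivalence closure in \<open>pt\<close> needs no attention: a function that is
  constant along single gluings is constant along zigzags of them.\<close>

lemma descend_pt:
  assumes "\<And>p q. glue X p q \<Longrightarrow> f p = f q"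
  shows "descend f (pt X p) = f p"
proof -
  have "f p = f q" if "equivclp (glue X) p q" for q
    using that by (induction rule: equivclp_induct) (auto dest: assms)
  then have "f ` pt X p = {f p}"
    unfolding pt_def by auto
  then show ?thesis unfolding descend_def by simp
qed

lemma topspace_cells:
  "topspace (cells X) = (SIGMA n:UNIV. topspace (slevel X n) \<times> standard_simplex n)"
  unfolding cells_def by (auto simp: topspace_standard_simplex)

lemma realise_cases:
  assumes "y \<in> topspace (realise X)"
  obtains n x u where "x \<in> topspace (slevel X n)" "u \<in> standard_simplex n" "y = pt X (n, x, u)"
  using assms unfolding topspace_realise topspace_cells by auto

lemma pt_in_realise:
  assumes "x \<in> topspace (slevel X n)" "u \<in> standard_simplex n"
  shows "pt X (n, x, u) \<in> topspace (realise X)"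
  using assms unfolding topspace_realise topspace_cells by auto

lemma continuous_map_prod_sum_topology:
  assumes "\<And>i. i \<in> I \<Longrightarrow> continuous_map (prod_topology Z (X i)) Y (\<lambda>(z, x). f (z, (i, x)))"
  shows "continuous_map (prod_topology Z (sum_topology X I)) Y f"
  unfolding continuous_map_def
proof (intro conjI allI impI)
  show "f \<in> topspace (prod_topology Z (sum_topology X I)) \<rightarrow> topspace Y"
  proof
    fix c assume "c \<in> topspace (prod_topology Z (sum_topology X I))"
    then obtain z i x where "c = (z, i, x)" "i \<in> I" "z \<in> topspace Z" "x \<in> topspace (X i)" by auto
    then show "f c \<in> topspace Y" using funcset_mem[OF continuous_map_funspace[OF assms], of i "(z, x)"] by simp
  qed
  fix U assume U: "openin Y U"
  show "openin (prod_topology Z (sum_topology X I)) {x \<in> topspace (prod_topology Z (sum_topology X I)). f x \<in> U}"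
    (is "openin _ ?W")
    unfolding openin_prod_topology_alt
  proof (intro allI impI)
    fix z c assume zc: "(z, c) \<in> ?W"
    obtain i x where c: "c = (i, x)" by fastforce
    have i: "i \<in> I" "z \<in> topspace Z" "x \<in> topspace (X i)" "f (z, (i, x)) \<in> U" using zc c by auto
    have "openin (prod_topology Z (X i)) {p \<in> topspace (prod_topology Z (X i)). (\<lambda>(z, x). f (z, (i, x))) p \<in> U}"
      using assms[OF i(1)] U unfolding continuous_map_def by blast
    then obtain V W where "openin Z V" "openin (X i) W" "z \<in> V" "x \<in> W"
      and VW: "V \<times> W \<subseteq> {p \<in> topspace (prod_topology Z (X i)). (\<lambda>(z, x). f (z, (i, x))) p \<in> U}"
      unfolding openin_prod_topology_alt using i by (auto 0 4)
    moreover from \<open>openin (X i) W\<close> have "openin (sum_topology X I) ((\<lambda>x. (i, x)) ` W)"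
      using open_map_component_injection[OF i(1)] unfolding open_map_def by blast
    moreover have "V \<times> ((\<lambda>x. (i, x)) ` W) \<subseteq> ?W" using VW i(1) by auto
    ultimately show "\<exists>V W. openin Z V \<and> openin (sum_topology X I) W \<and> z \<in> V \<and> c \<in> W \<and> V \<times> W \<subseteq> ?W"
      using c by blast
  qed
qed

text \<open>The product of a quotient map with a locally compact Hausdorff space is again a quotient
  map, so a map on \<open>Z \<times> |X|\<close> may be tested on the cells of \<open>X\<close>.
  This is how homotopies and families are built cell by cell.\<close>

lemma continuous_map_descend:
  assumes Z: "locally_compact_space Z" "Hausdorff_space Z"
    and glue: "\<And>z p q. z \<in> topspace Z \<Longrightarrow> glue X p q \<Longrightarrow> f z p = f z q"
    and cont: "\<And>n. continuous_map (prod_topology Z (prod_topology (slevel X n)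
        (subtopology (powertop_real UNIV) (standard_simplex n)))) Y (\<lambda>(z, x, u). f z (n, x, u))"
  shows "continuous_map (prod_topology Z (realise X)) Y (\<lambda>(z, y). descend (f z) y)"
proof -
  have q: "quotient_map (prod_topology Z (cells X)) (prod_topology Z (realise X)) (\<lambda>(z, p). (z, pt X p))"
    by (intro quotient_map_prod_right quotient_map_realise) (use Z in auto)
  have "continuous_map (prod_topology Z (cells X)) Y (\<lambda>(z, p). f z p)"
    unfolding cells_def
    by (rule continuous_map_prod_sum_topology) (use cont in \<open>simp add: case_prod_unfold\<close>)
  then have "continuous_map (prod_topology Z (cells X)) Y ((\<lambda>(z, y). descend (f z) y) \<circ> (\<lambda>(z, p). (z, pt X p)))"
    by (rule continuous_map_eq) (auto simp: descend_pt glue)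
  then show ?thesis
    using continuous_compose_quotient_map_eq[OF q] by blast
qed

lemma continuous_map_prod_discrete:
  assumes "\<And>x. x \<in> D \<Longrightarrow> continuous_map (prod_topology Z T) Y (\<lambda>(z, u). f (z, x, u))"
  shows "continuous_map (prod_topology Z (prod_topology (discrete_topology D) T)) Y f"
  unfolding continuous_map_def
proof (intro conjI allI impI)
  show "f \<in> topspace (prod_topology Z (prod_topology (discrete_topology D) T)) \<rightarrow> topspace Y"
  proof
    fix c assume "c \<in> topspace (prod_topology Z (prod_topology (discrete_topology D) T))"
    then obtain z x u where "c = (z, x, u)" "x \<in> D" "z \<in> topspace Z" "u \<in> topspace T" by auto
    then show "f c \<in> topspace Y" using funcset_mem[OF continuous_map_funspace[OF assms], of x "(z, u)"] by simp
  qed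
  fix U assume U: "openin Y U"
  show "openin (prod_topology Z (prod_topology (discrete_topology D) T))
      {p \<in> topspace (prod_topology Z (prod_topology (discrete_topology D) T)). f p \<in> U}" (is "openin _ ?W")
  proof (rule openin_prod_topology_alt[THEN iffD2], intro allI impI)
    fix z c assume zc: "(z, c) \<in> ?W"
    obtain x u where c: "c = (x, u)" by fastforce
    have i: "x \<in> D" "z \<in> topspace Z" "u \<in> topspace T" "f (z, (x, u)) \<in> U" using zc c by auto
    have "openin (prod_topology Z T) {p \<in> topspace (prod_topology Z T). (\<lambda>(z, u). f (z, x, u)) p \<in> U}"
      using assms[OF i(1)] U unfolding continuous_map_def by blast
    then obtain V W where VW: "openin Z V" "openin T W" "z \<in> V" "u \<in> W"
        "V \<times> W \<subseteq> {p \<in> topspace (prod_topology Z T). (\<lambda>(z, u). f (z, x, u)) p \<in> U}"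
      unfolding openin_prod_topology_alt using i by (auto 0 4)
    then have "openin (prod_topology (discrete_topology D) T) ({x} \<times> W)"
      using i by (simp add: openin_prod_Times_iff)
    moreover have "V \<times> ({x} \<times> W) \<subseteq> ?W" using VW i by auto
    ultimately show "\<exists>V W. openin Z V \<and> openin (prod_topology (discrete_topology D) T) W \<and> z \<in> V \<and> c \<in> W \<and> V \<times> W \<subseteq> ?W"
      using c VW by blast
  qed
qed

section \<open>Mapping spaces\<close>

text \<open>The subbasic set that belongs to the empty compact set consists of all continuous
  maps.\<close>

lemma topspace_mapping_space:
  "topspace (mapping_space X Y) = {f \<in> extensional (topspace X). continuous_map X Y f}"
    (is "_ = ?F")
proof -
  have "{f \<in> extensional (topspace X). continuous_map X Y f \<and> f ` {} \<subseteq> {}} = ?F" by blast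
  then have "?F \<in> {{f \<in> extensional (topspace X). continuous_map X Y f \<and> f ` K \<subseteq> U} | K U.
        compactin X K \<and> openin Y U}"
    using compactin_empty openin_empty by blast
  then show ?thesis unfolding mapping_space_def topology_generated_by_topspace by blast
qed

text \<open>By the tube lemma, a map that is continuous in two variables sends a neighbourhood of
  \<open>z\<close> into each subbasic set containing the curried map at \<open>z\<close>.\<close>

lemma continuous_map_curry:
  assumes f: "continuous_map (prod_topology Z X) Y (\<lambda>(z, x). f z x)"
  shows "continuous_map Z (mapping_space X Y) (\<lambda>z. \<lambda>x\<in>topspace X. f z x)"
proof -
  have c: "continuous_map X Y (\<lambda>x\<in>topspace X. f z x)" if "z \<in> topspace Z" for z
  proof -
    have "continuous_map X (prod_topology Z X) (\<lambda>x. (z, x))"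
      using that by (simp add: continuous_map_pairedI)
    from continuous_map_compose[OF this f] have "continuous_map X Y (f z)" by (simp add: o_def)
    then show ?thesis by (rule continuous_map_eq) simp
  qed
  show ?thesis
    unfolding mapping_space_def
  proof (rule continuous_on_generated_topo)
    show "(\<lambda>z. \<lambda>x\<in>topspace X. f z x) ` topspace Z \<subseteq>
      \<Union> {{f \<in> extensional (topspace X). continuous_map X Y f \<and> f ` K \<subseteq> U} | K U.
        compactin X K \<and> openin Y U}"
      using c topspace_mapping_space[of X Y] unfolding mapping_space_def topology_generated_by_topspace by auto
  next
    fix W assume "W \<in> {{f \<in> extensional (topspace X). continuous_map X Y f \<and> f ` K \<subseteq> U} | K U.
        compactin X K \<and> openin Y U}"
    then obtain K U where W: "W = {f \<in> extensional (topspace X). continuous_map X Y f \<and> f ` K \<subseteq> U}"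
      and K: "compactin X K" and U: "openin Y U" by blast
    have KX: "K \<subseteq> topspace X" using K by (rule compactin_subset_topspace)
    have op: "openin (prod_topology Z X) {p \<in> topspace (prod_topology Z X). (\<lambda>(z, x). f z x) p \<in> U}" (is "openin _ ?O")
      using f U unfolding continuous_map_def by blast
    show "openin Z ((\<lambda>z. \<lambda>x\<in>topspace X. f z x) -` W \<inter> topspace Z)"
    proof (subst openin_subopen, intro ballI)
      fix z assume z: "z \<in> (\<lambda>z. \<lambda>x\<in>topspace X. f z x) -` W \<inter> topspace Z"
      then have sub: "{z} \<times> K \<subseteq> ?O" using KX unfolding W by (auto simp: image_subset_iff split: if_splits)
      obtain V V' where V: "openin Z V" "openin X V'" "{z} \<subseteq> V" "K \<subseteq> V'" "V \<times> V' \<subseteq> ?O"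
        using Wallace_theorem_prod_topology[OF _ K op sub] z by auto
      have "V \<subseteq> (\<lambda>z. \<lambda>x\<in>topspace X. f z x) -` W \<inter> topspace Z"
      proof
        fix z' assume z': "z' \<in> V"
        then have "z' \<in> topspace Z" using V(1) openin_subset by blast
        moreover have "f z' x \<in> U" if "x \<in> K" for x
          using subsetD[OF V(5), of "(z', x)"] V(4) z' that by auto
        ultimately show "z' \<in> (\<lambda>z. \<lambda>x\<in>topspace X. f z x) -` W \<inter> topspace Z"
          using c[of z'] KX by (auto simp: W)
      qed
      then show "\<exists>T. openin Z T \<and> z \<in> T \<and> T \<subseteq> (\<lambda>z. \<lambda>x\<in>topspace X. f z x) -` W \<inter> topspace Z"
        using V by blast
    qed
  qed
qed

lemma continuous_map_evaluation:
  assumes "locally_compact_space X" "Hausdorff_space X"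
  shows "continuous_map (prod_topology (mapping_space X Y) X) Y (\<lambda>(f, x). f x)"
  unfolding continuous_map_def
proof (intro conjI allI impI)
  show "(\<lambda>(f, x). f x) \<in> topspace (prod_topology (mapping_space X Y) X) \<rightarrow> topspace Y"
    by (auto simp: topspace_mapping_space continuous_map_def)
  fix U assume U: "openin Y U"
  show "openin (prod_topology (mapping_space X Y) X)
      {p \<in> topspace (prod_topology (mapping_space X Y) X). (\<lambda>(f, x). f x) p \<in> U}" (is "openin _ ?W")
    unfolding openin_prod_topology_alt
  proof (intro allI impI)
    fix f x assume fx: "(f, x) \<in> ?W"
    then have f: "f \<in> extensional (topspace X)" "continuous_map X Y f" "x \<in> topspace X" "f x \<in> U"
      by (auto simp: topspace_mapping_space)
    have "openin X {x \<in> topspace X. f x \<in> U}" using f(2) U unfolding continuous_map_def by blast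
    moreover have "neighbourhood_base_of (compactin X) X"
      using assms by (simp add: locally_compact_space_neighbourhood_base)
    ultimately obtain V K where VK: "openin X V" "compactin X K" "x \<in> V" "V \<subseteq> K" "K \<subseteq> {x \<in> topspace X. f x \<in> U}"
      using f unfolding neighbourhood_base_of by (metis (no_types, lifting) mem_Collect_eq)
    let ?N = "{f \<in> extensional (topspace X). continuous_map X Y f \<and> f ` K \<subseteq> U}"
    have "openin (mapping_space X Y) ?N"
      unfolding mapping_space_def using VK U by (intro topology_generated_by_Basis) blast
    moreover have "f \<in> ?N" using f VK by auto
    moreover have "?N \<times> V \<subseteq> ?W"
      using VK by (auto simp: topspace_mapping_space)
    ultimately show "\<exists>V W. openin (mapping_space X Y) V \<and> openin X W \<and> f \<in> V \<and> x \<in> W \<and> V \<times> W \<subseteq> ?W"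
      using VK by blast
  qed
qed

section \<open>Simplices\<close>

abbreviation simplex_top :: "nat \<Rightarrow> (nat \<Rightarrow> real) topology" where
  "simplex_top n \<equiv> subtopology (powertop_real UNIV) (standard_simplex n)"

lemma simplex_push_in_simplex:
  assumes "\<theta> ` {..m} \<subseteq> {..n}" "u \<in> standard_simplex m"
  shows "simplex_push m \<theta> u \<in> standard_simplex n"
proof -
  have u: "\<And>i. 0 \<le> u i" "(\<Sum>i\<le>m. u i) = 1" using assms(2) by (auto simp: standard_simplex_def)
  have le: "simplex_push m \<theta> u i \<le> 1" for i
    unfolding simplex_push_def u(2)[symmetric] by (rule sum_mono2) (auto simp: u)
  have "(\<Sum>i\<le>n. simplex_push m \<theta> u i) = (\<Sum>j\<le>m. u j)"
    unfolding simplex_push_def using sum.group[of "{..m}" "{..n}" \<theta> u] assms(1) by (simp add: atMost_def)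
  moreover have "simplex_push m \<theta> u i = 0" if "i > n" for i
    unfolding simplex_push_def using assms(1) that by (intro sum.neutral) (fastforce simp: image_subset_iff)
  ultimately show ?thesis
    unfolding standard_simplex_def using u le by (auto simp: simplex_push_def intro: sum_nonneg)
qed

lemma simplex_push_comp:
  assumes "\<theta> ` {..m} \<subseteq> {..n}"
  shows "simplex_push n \<rho> (simplex_push m \<theta> u) = simplex_push m (\<rho> \<circ> \<theta>) u"
proof
  fix i
  have "(\<Sum>k | k \<le> n \<and> \<rho> k = i. \<Sum>j | j \<in> {j. j \<le> m \<and> \<rho> (\<theta> j) = i} \<and> \<theta> j = k. u j) = (\<Sum>j | j \<le> m \<and> \<rho> (\<theta> j) = i. u j)"
    by (rule sum.group) (use assms in auto)
  moreover have "(\<Sum>k | k \<le> n \<and> \<rho> k = i. \<Sum>j | j \<in> {j. j \<le> m \<and> \<rho> (\<theta> j) = i} \<and> \<theta> j = k. u j) =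
      (\<Sum>k | k \<le> n \<and> \<rho> k = i. \<Sum>j | j \<le> m \<and> \<theta> j = k. u j)"
    by (intro sum.cong) auto
  ultimately show "simplex_push n \<rho> (simplex_push m \<theta> u) i = simplex_push m (\<rho> \<circ> \<theta>) u i"
    unfolding simplex_push_def by simp
qed

lemma simplex_push_cong:
  "(\<And>j. j \<le> m \<Longrightarrow> \<theta> j = \<theta>' j) \<Longrightarrow> simplex_push m \<theta> u = simplex_push m \<theta>' u"
  unfolding simplex_push_def by (intro ext sum.cong) auto

lemma simplex_push_id:
  assumes "u \<in> standard_simplex m" shows "simplex_push m (\<lambda>j. j) u = u"
proof
  fix i
  have "{j. j \<le> m \<and> j = i} = (if i \<le> m then {i} else {})" by auto
  then show "simplex_push m (\<lambda>j. j) u i = u i"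
    using assms by (auto simp: simplex_push_def standard_simplex_def)
qed

lemma continuous_map_simplex_push:
  assumes "\<theta> ` {..m} \<subseteq> {..n}"
  shows "continuous_map (simplex_top m) (simplex_top n) (simplex_push m \<theta>)"
  unfolding continuous_map_in_subtopology
proof
  have "continuous_map (powertop_real UNIV) (powertop_real UNIV) (simplex_push m \<theta>)"
    unfolding simplex_push_def continuous_map_componentwise_UNIV
    by (auto intro!: continuous_map_sum continuous_map_product_projection)
  then show "continuous_map (simplex_top m) (powertop_real UNIV) (simplex_push m \<theta>)"
    by (rule continuous_map_from_subtopology)
  show "simplex_push m \<theta> \<in> topspace (simplex_top m) \<rightarrow> standard_simplex n"
    using simplex_push_in_simplex[OF assms] by (auto simp: topspace_standard_simplex)
qed

lemma compact_simplex_top: "compact_space (simplex_top n)"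
  using compactin_standard_simplex[of n] unfolding compactin_subspace by blast

lemma Hausdorff_simplex_top: "Hausdorff_space (simplex_top n)"
  by (intro Hausdorff_space_subtopology) (simp add: Hausdorff_space_product_topology)

section \<open>Diagrams\<close>

lemma pull_pull:
  assumes "mono_on J \<theta>" "\<theta> ` J \<subseteq> K"
  shows "pull J \<theta> (pull K \<rho> F) = pull J (\<rho> \<circ> \<theta>) F"
proof -
  have "\<theta> i \<in> K" "i \<le> j \<Longrightarrow> j \<in> J \<Longrightarrow> \<theta> i \<le> \<theta> j" if "i \<in> J" for i j
    using assms that by (auto simp: monotone_on_def)
  then show ?thesis by (auto simp: pull_def fun_eq_iff le_pairs_def)
qed

lemma pull_cong: "(\<And>j. j \<in> J \<Longrightarrow> \<theta> j = \<theta>' j) \<Longrightarrow> pull J \<theta> F = pull J \<theta>' F"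
  by (auto simp: pull_def fun_eq_iff le_pairs_def)

lemma diagramsD:
  assumes "F \<in> diagrams J C"
  shows "fst F \<in> J \<rightarrow>\<^sub>E cat_ob C"
    and "snd F \<in> extensional (le_pairs J)"
    and "\<And>i j. i \<in> J \<Longrightarrow> j \<in> J \<Longrightarrow> i \<le> j \<Longrightarrow> snd F (i, j) \<in> cat_hom C (fst F i) (fst F j)"
    and "\<And>i. i \<in> J \<Longrightarrow> snd F (i, i) = cat_id C (fst F i)"
    and "\<And>i j k. i \<in> J \<Longrightarrow> j \<in> J \<Longrightarrow> k \<in> J \<Longrightarrow> i \<le> j \<Longrightarrow> j \<le> k \<Longrightarrow>
        snd F (i, k) = cat_comp C (fst F i) (snd F (j, k)) (snd F (i, j))"
proof -
  note D = assms[unfolded diagrams_def mem_Collect_eq case_prod_unfold]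
  show "fst F \<in> J \<rightarrow>\<^sub>E cat_ob C" "snd F \<in> extensional (le_pairs J)"
    by (rule D[THEN conjunct1] D[THEN conjunct2, THEN conjunct1])+
  note D' = D[THEN conjunct2, THEN conjunct2]
  show "snd F (i, j) \<in> cat_hom C (fst F i) (fst F j)" if "i \<in> J" "j \<in> J" "i \<le> j" for i j
    by (rule D'[THEN conjunct1, rule_format, OF that])
  show "snd F (i, i) = cat_id C (fst F i)" if "i \<in> J" for i
    by (rule D'[THEN conjunct2, THEN conjunct1, rule_format, OF that])
  show "snd F (i, k) = cat_comp C (fst F i) (snd F (j, k)) (snd F (i, j))"
    if "i \<in> J" "j \<in> J" "k \<in> J" "i \<le> j" "j \<le> k" for i j k
    by (rule D'[THEN conjunct2, THEN conjunct2, rule_format, OF that])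
qed

lemma diagramsI:
  assumes "X \<in> J \<rightarrow>\<^sub>E cat_ob C" "x \<in> extensional (le_pairs J)"
    and "\<And>i j. i \<in> J \<Longrightarrow> j \<in> J \<Longrightarrow> i \<le> j \<Longrightarrow> x (i, j) \<in> cat_hom C (X i) (X j)"
    and "\<And>i. i \<in> J \<Longrightarrow> x (i, i) = cat_id C (X i)"
    and "\<And>i j k. i \<in> J \<Longrightarrow> j \<in> J \<Longrightarrow> k \<in> J \<Longrightarrow> i \<le> j \<Longrightarrow> j \<le> k \<Longrightarrow>
        x (i, k) = cat_comp C (X i) (x (j, k)) (x (i, j))"
  shows "(X, x) \<in> diagrams J C"
  unfolding diagrams_def mem_Collect_eq case_prod_conv by (intro conjI ballI impI assms)

lemma pull_in_diagrams:
  assumes "F \<in> diagrams K C" "mono_on J \<theta>" "\<theta> ` J \<subseteq> K"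
  shows "pull J \<theta> F \<in> diagrams J C"
proof -
  have m: "\<And>i j. i \<in> J \<Longrightarrow> j \<in> J \<Longrightarrow> i \<le> j \<Longrightarrow> \<theta> i \<le> \<theta> j" "\<And>i. i \<in> J \<Longrightarrow> \<theta> i \<in> K"
    using assms(2,3) by (auto simp: monotone_on_def)
  note D = diagramsD[OF assms(1)]
  show ?thesis
    unfolding pull_def
  proof (rule diagramsI)
    show "(\<lambda>i\<in>J. fst F (\<theta> i)) \<in> J \<rightarrow>\<^sub>E cat_ob C" using D(1) m by auto
  next
    fix i j k assume "i \<in> J" "j \<in> J" "k \<in> J" "i \<le> j" "j \<le> k"
    moreover from this have "snd F (\<theta> i, \<theta> k) = cat_comp C (fst F (\<theta> i)) (snd F (\<theta> j, \<theta> k)) (snd F (\<theta> i, \<theta> j))"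
      by (intro D(5) m)
    ultimately show "(\<lambda>(i, j)\<in>le_pairs J. snd F (\<theta> i, \<theta> j)) (i, k) = cat_comp C ((\<lambda>i\<in>J. fst F (\<theta> i)) i)
        ((\<lambda>(i, j)\<in>le_pairs J. snd F (\<theta> i, \<theta> j)) (j, k)) ((\<lambda>(i, j)\<in>le_pairs J. snd F (\<theta> i, \<theta> j)) (i, j))"
      using order_trans[of i j k] by (simp add: le_pairs_def)
  qed (use m D(3,4) in \<open>simp_all add: le_pairs_def\<close>)
qed

text \<open>A finite nonempty chain is enumerated in increasing order by an initial segment of the
  natural numbers: an element is sent to the number of its strict predecessors.\<close>

lemma chain_enumeration:
  fixes L :: "'i::order set"
  assumes fin: "finite L" and ne: "L \<noteq> {}" and chain: "\<And>a b. a \<in> L \<Longrightarrow> b \<in> L \<Longrightarrow> a \<le> b \<or> b \<le> a"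
  shows "\<exists>e n::nat. bij_betw e {..n} L \<and> (\<forall>i\<le>n. \<forall>j\<le>n. e i \<le> e j \<longleftrightarrow> i \<le> j)"
proof -
  define r where "r a = card {b \<in> L. b < a}" for a
  have less: "r a < r b" if "a \<in> L" "b \<in> L" "a < b" for a b
    unfolding r_def using that fin by (intro psubset_card_mono) auto
  have le: "r a \<le> r b \<longleftrightarrow> a \<le> b" if "a \<in> L" "b \<in> L" for a b
    using less[OF that] less[OF that(2,1)] chain[OF that] by fastforce
  have inj: "inj_on r L" by (rule inj_onI) (metis le order_antisym order_refl)
  have "r a < card L" if "a \<in> L" for a
    unfolding r_def using that fin by (intro psubset_card_mono) auto
  then have "r ` L = {..<card L}"
    using inj by (intro card_subset_eq) (auto simp: card_image)
  also have "\<dots> = {..card L - 1}"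
    using fin ne by (cases "card L") (auto simp: lessThan_Suc_atMost)
  finally have bij: "bij_betw r L {..card L - 1}" using inj by (simp add: bij_betw_def)
  let ?e = "inv_into L r"
  have b: "bij_betw ?e {..card L - 1} L" by (rule bij_betw_inv_into[OF bij])
  have c: "?e i \<le> ?e j \<longleftrightarrow> i \<le> j" if "i \<le> card L - 1" "j \<le> card L - 1" for i j
  proof -
    have "?e i \<in> L" "?e j \<in> L" using b that by (auto simp: bij_betw_def)
    from le[OF this] show ?thesis using bij_betw_inv_into_right[OF bij] that by simp
  qed
  show ?thesis using b c by blast
qed

lemma slevel_nerve [simp]: "slevel (nerve C) n = discrete_topology (diagrams {..n} C)"
  by (simp add: nerve_def)

lemma sact_nerve [simp]: "sact (nerve C) m \<theta> = pull {..m} \<theta>"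
  by (simp add: nerve_def)

text \<open>Degenerate and boundary simplices are glued to their sources along any monotone map, not
  only along faces and degeneracies.\<close>

lemma glue_nerve:
  assumes "mono_on {..m} \<theta>" "\<theta> ` {..m} \<subseteq> {..n}" "\<sigma> \<in> diagrams {..n} C" "u \<in> standard_simplex m"
  shows "pt (nerve C) (m, pull {..m} \<theta> \<sigma>, u) = pt (nerve C) (n, \<sigma>, simplex_push m \<theta> u)"
  by (rule glue_imp_pt_eq) (unfold glue_def, intro exI[of _ m] exI[of _ n] exI[of _ \<theta>] exI[of _ \<sigma>] exI[of _ u], use assms in simp)

text \<open>A point of the realisation of the nerve of a poset is a probability measure supported on a
  chain.  Both representatives below reduce to the one in which the support is enumerated without
  repetition.\<close>

lemma pt_nerve_determined_by_measure:
  fixes \<tau> \<tau>' :: "nat \<Rightarrow> 'i::order"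
  assumes F: "F \<in> diagrams J C"
    and \<tau>: "mono_on {..m} \<tau>" "\<tau> ` {..m} \<subseteq> J" "w \<in> standard_simplex m"
    and \<tau>': "mono_on {..m'} \<tau>'" "\<tau>' ` {..m'} \<subseteq> J" "w' \<in> standard_simplex m'"
    and eq: "\<And>a. (\<Sum>j | j \<le> m \<and> \<tau> j = a. w j) = (\<Sum>j | j \<le> m' \<and> \<tau>' j = a. w' j)"
  shows "pt (nerve C) (m, pull {..m} \<tau> F, w) = pt (nerve C) (m', pull {..m'} \<tau>' F, w')"
proof -
  define \<mu> where "\<mu> a = (\<Sum>j | j \<le> m \<and> \<tau> j = a. w j)" for a
  define L where "L = {a. \<mu> a > 0}"
  have supp: "L = \<tau> ` {j. j \<le> m \<and> w j > 0}" 
    if "w \<in> standard_simplex m" "\<And>a. \<mu> a = (\<Sum>j | j \<le> m \<and> \<tau> j = a. w j)" for m w and \<tau> :: "nat \<Rightarrow> 'i"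
  proof -
    have "\<mu> a > 0 \<longleftrightarrow> (\<exists>j\<le>m. \<tau> j = a \<and> w j > 0)" for a
    proof -
      have nn: "\<And>j. w j \<ge> 0" using that(1) by (auto simp: standard_simplex_def)
      have "\<mu> a = 0 \<longleftrightarrow> (\<forall>j. j \<le> m \<and> \<tau> j = a \<longrightarrow> w j = 0)"
        unfolding that(2) using nn by (subst sum_nonneg_eq_0_iff) auto
      moreover have "\<mu> a \<ge> 0" unfolding that(2) using nn by (simp add: sum_nonneg)
      ultimately have "\<mu> a > 0 \<longleftrightarrow> (\<exists>j. j \<le> m \<and> \<tau> j = a \<and> w j \<noteq> 0)" by auto
      moreover have "w j \<noteq> 0 \<longleftrightarrow> w j > 0" for j using nn[of j] by auto
      ultimately show ?thesis by auto
    qed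
    then show ?thesis unfolding L_def by auto
  qed
  have fin: "finite L" using supp[OF \<tau>(3) \<mu>_def] by simp
  have ex: "\<exists>j\<le>m. w j > 0" if "w \<in> standard_simplex m" for m and w :: "nat \<Rightarrow> real"
  proof (rule ccontr)
    assume "\<not> ?thesis"
    then have "(\<Sum>j\<le>m. w j) \<le> 0" by (intro sum_nonpos) (auto simp: not_less)
    then show False using that by (auto simp: standard_simplex_def)
  qed
  have ne: "L \<noteq> {}" using ex[OF \<tau>(3)] unfolding supp[OF \<tau>(3) \<mu>_def] by auto
  have chain: "a \<le> b \<or> b \<le> a" if ab: "a \<in> L" "b \<in> L" for a b
  proof -
    obtain j k where "a = \<tau> j" "b = \<tau> k" "j \<le> m" "k \<le> m"
      using ab unfolding supp[OF \<tau>(3) \<mu>_def] by blast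
    then show ?thesis using \<tau>(1) linear[of j k] by (auto simp: monotone_on_def)
  qed
  obtain e and n :: nat where e: "bij_betw e {..n} L" "\<And>i j. i \<le> n \<Longrightarrow> j \<le> n \<Longrightarrow> e i \<le> e j \<longleftrightarrow> i \<le> j"
    using chain_enumeration[OF fin ne chain] by auto
  define v where "v i = (if i \<le> n then \<mu> (e i) else 0)" for i
  have "pt (nerve C) (m, pull {..m} \<tau> F, w) = pt (nerve C) (n, pull {..n} e F, v)"
    if \<tau>: "mono_on {..m} \<tau>" "\<tau> ` {..m} \<subseteq> J" "w \<in> standard_simplex m"
      and \<mu>: "\<And>a. \<mu> a = (\<Sum>j | j \<le> m \<and> \<tau> j = a. w j)" for m w and \<tau> :: "nat \<Rightarrow> 'i"
  proof -
    note w = \<tau>(3)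
    have wnn: "w j \<ge> 0" for j using w by (auto simp: standard_simplex_def)
    define Q where "Q = {j. j \<le> m \<and> w j > 0}"
    have "finite Q" "Q \<noteq> {}" using ex[OF w] by (auto simp: Q_def)
    then obtain \<iota> and c :: nat where \<iota>: "bij_betw \<iota> {..c} Q" "\<And>i j. i \<le> c \<Longrightarrow> j \<le> c \<Longrightarrow> \<iota> i \<le> \<iota> j \<longleftrightarrow> i \<le> j"
      using chain_enumeration[OF _ _ linear[where 'a = nat], of Q] by auto
    have LQ: "L = \<tau> ` Q" using supp[OF w \<mu>] Q_def by simp
    have \<iota>Q: "\<iota> i \<in> Q" if "i \<le> c" for i using \<iota>(1) that by (auto simp: bij_betw_def)
    define \<sigma> where "\<sigma> i = inv_into {..n} e (\<tau> (\<iota> i))" for i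
    have \<sigma>: "\<sigma> i \<le> n" "e (\<sigma> i) = \<tau> (\<iota> i)" if "i \<le> c" for i
    proof -
      have "\<tau> (\<iota> i) \<in> L" using \<iota>Q[OF that] LQ by blast
      then show "\<sigma> i \<le> n" "e (\<sigma> i) = \<tau> (\<iota> i)"
        unfolding \<sigma>_def using bij_betw_inv_into_right[OF e(1)] bij_betw_inv_into[OF e(1)]
        by (auto simp: bij_betw_def)
    qed
    have \<iota>m: "mono_on {..c} \<iota>" "\<iota> ` {..c} \<subseteq> {..m}" using \<iota>(2) \<iota>Q by (auto simp: monotone_on_def Q_def)
    have \<sigma>m: "mono_on {..c} \<sigma>" "\<sigma> ` {..c} \<subseteq> {..n}"
    proof -
      show "mono_on {..c} \<sigma>"
      proof (rule mono_onI)
        fix i j assume "i \<in> {..c}" "j \<in> {..c}" "i \<le> j"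
        then have "\<tau> (\<iota> i) \<le> \<tau> (\<iota> j)"
          using \<iota>m \<tau>(1) by (auto simp: monotone_on_def image_subset_iff)
        then show "\<sigma> i \<le> \<sigma> j" using \<open>i \<in> _\<close> \<open>j \<in> _\<close> \<sigma> e(2) by (metis atMost_iff)
      qed
    qed (use \<sigma> in auto)
    have em: "mono_on {..n} e" "e ` {..n} \<subseteq> J"
    proof -
      show "mono_on {..n} e" using e(2) by (auto simp: monotone_on_def)
      show "e ` {..n} \<subseteq> J" using e(1) LQ \<tau>(2) by (auto simp: bij_betw_def Q_def)
    qed
    define x where "x i = (if i \<le> c then w (\<iota> i) else 0)" for i
    have sumQ: "(\<Sum>i | i \<le> c \<and> P (\<iota> i). x i) = (\<Sum>j | j \<in> Q \<and> P j. w j)" for P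
    proof (rule sum.reindex_bij_betw[symmetric, THEN trans[OF _ sum.cong], symmetric])
      show "bij_betw \<iota> {i. i \<le> c \<and> P (\<iota> i)} {j. j \<in> Q \<and> P j}"
      proof (rule bij_betw_subset[OF \<iota>(1)])
        have "\<iota> ` {..c} = Q" using \<iota>(1) by (simp add: bij_betw_def)
        then show "\<iota> ` {i. i \<le> c \<and> P (\<iota> i)} = {j. j \<in> Q \<and> P j}" by blast
      qed auto
    qed (auto simp: x_def)
    have Qall: "(\<Sum>j | j \<in> Q \<and> P j. w j) = (\<Sum>j | j \<le> m \<and> P j. w j)" for P
      using wnn by (intro sum.mono_neutral_left) (auto simp: Q_def less_eq_real_def)
    have push\<iota>: "simplex_push c \<iota> x = w"
    proof
      fix i
      have "{j. j \<le> m \<and> j = i} = (if i \<le> m then {i} else {})" by auto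
      then show "simplex_push c \<iota> x i = w i"
        unfolding simplex_push_def sumQ[of "\<lambda>j. j = i"] Qall[of "\<lambda>j. j = i"]
        using w by (auto simp: standard_simplex_def)
    qed
    have push\<sigma>: "simplex_push c \<sigma> x = v"
    proof
      fix i
      show "simplex_push c \<sigma> x i = v i"
      proof (cases "i \<le> n")
        case True
        have "{j. j \<le> c \<and> \<sigma> j = i} = {j. j \<le> c \<and> \<tau> (\<iota> j) = e i}"
          using \<sigma> e True by (auto simp: bij_betw_def inj_on_def)
        then show ?thesis unfolding simplex_push_def v_def \<mu>
          using True Qall[of "\<lambda>j. \<tau> j = e i"] sumQ[of "\<lambda>j. \<tau> j = e i"] by simp
      next
        case False
        then have "{j. j \<le> c \<and> \<sigma> j = i} = {}" using \<sigma> by auto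
        then show ?thesis using False by (simp only: simplex_push_def v_def) simp
      qed
    qed
    have x: "x \<in> standard_simplex c"
    proof -
      have "(\<Sum>i\<le>c. x i) = (\<Sum>j\<le>m. w j)" using sumQ[of "\<lambda>_. True"] Qall[of "\<lambda>_. True"]
        by (simp add: atMost_def)
      then show ?thesis using w by (auto simp: standard_simplex_def x_def)
    qed
    have "pt (nerve C) (m, pull {..m} \<tau> F, w) = pt (nerve C) (c, pull {..c} \<iota> (pull {..m} \<tau> F), x)"
      using glue_nerve[OF \<iota>m pull_in_diagrams[OF F \<tau>(1,2)] x] push\<iota> by simp
    also have "pull {..c} \<iota> (pull {..m} \<tau> F) = pull {..c} \<sigma> (pull {..n} e F)"
      unfolding pull_pull[OF \<iota>m] pull_pull[OF \<sigma>m] by (rule pull_cong) (use \<sigma> in auto)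
    also have "pt (nerve C) (c, pull {..c} \<sigma> (pull {..n} e F), x) = pt (nerve C) (n, pull {..n} e F, v)"
      using glue_nerve[OF \<sigma>m pull_in_diagrams[OF F em] x] push\<sigma> by simp
    finally show ?thesis .
  qed
  from this[OF \<tau> \<mu>_def] this[OF \<tau>' \<mu>_def[unfolded eq]] show ?thesis by simp
qed

section \<open>Products of simplices\<close>

text \<open>Here \<open>\<tau>\<close> and \<open>w\<close> describe a probability measure on a
  chain of \<open>[p] \<times> [q]\<close> with marginals \<open>v\<close> and \<open>u\<close>,
  that is, a point of the realisation of the nerve of \<open>[p] \<times> [q]\<close> that lies over
  \<open>(v, u)\<close>.\<close>

definition coupling ::
  "nat \<Rightarrow> nat \<Rightarrow> (nat \<Rightarrow> real) \<Rightarrow> (nat \<Rightarrow> real) \<Rightarrow> nat \<Rightarrow> (nat \<Rightarrow> nat \<times> nat) \<Rightarrow> (nat \<Rightarrow> real) \<Rightarrow> bool" where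
  "coupling p q v u m \<tau> w \<longleftrightarrow> mono_on {..m} \<tau> \<and> \<tau> ` {..m} \<subseteq> {..p} \<times> {..q} \<and> w \<in> standard_simplex m \<and>
     simplex_push m (fst \<circ> \<tau>) w = v \<and> simplex_push m (snd \<circ> \<tau>) w = u"

text \<open>On a chain, of the two events \<open>first coordinate below i\<close> and \<open>second
  coordinate below j\<close> one contains the other, so the mass of the intersection is the smaller
  of the two masses.\<close>

lemma coupling_mass_below:
  assumes c: "coupling p q v u m \<tau> w"
  shows "(\<Sum>l | l \<le> m \<and> fst (\<tau> l) < i \<and> snd (\<tau> l) < j. w l) = min (\<Sum>a<i. v a) (\<Sum>b<j. u b)"
proof -
  have mono: "\<And>k l. k \<le> l \<Longrightarrow> l \<le> m \<Longrightarrow> fst (\<tau> k) \<le> fst (\<tau> l) \<and> snd (\<tau> k) \<le> snd (\<tau> l)"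
    and w: "\<And>l. w l \<ge> 0" and v: "v = simplex_push m (fst \<circ> \<tau>) w" and u: "u = simplex_push m (snd \<circ> \<tau>) w"
    using c unfolding coupling_def by (auto simp: monotone_on_def less_eq_prod_def standard_simplex_def)
  let ?A = "{l. l \<le> m \<and> fst (\<tau> l) < i}" and ?B = "{l. l \<le> m \<and> snd (\<tau> l) < j}"
  have grp: "(\<Sum>a<i. simplex_push m f w a) = (\<Sum>l | l \<le> m \<and> f l < i. w l)" for f i
  proof -
    have "(\<Sum>a<i. \<Sum>l | l \<in> {l. l \<le> m \<and> f l < i} \<and> f l = a. w l) = (\<Sum>l | l \<le> m \<and> f l < i. w l)"
      by (rule sum.group) auto
    moreover have "(\<Sum>a<i. \<Sum>l | l \<in> {l. l \<le> m \<and> f l < i} \<and> f l = a. w l) = (\<Sum>a<i. simplex_push m f w a)"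
      unfolding simplex_push_def by (intro sum.cong) auto
    ultimately show ?thesis by simp
  qed
  have V: "(\<Sum>a<i. v a) = sum w ?A" and U: "(\<Sum>b<j. u b) = sum w ?B"
    unfolding v u grp by simp_all
  have "?A \<subseteq> ?B \<or> ?B \<subseteq> ?A"
  proof (rule ccontr)
    assume "\<not> ?thesis"
    then obtain k l where "k \<in> ?A" "k \<notin> ?B" "l \<in> ?B" "l \<notin> ?A" by blast
    then show False using mono[of k l] mono[of l k] linear[of k l] by fastforce
  qed
  moreover have "{l. l \<le> m \<and> fst (\<tau> l) < i \<and> snd (\<tau> l) < j} = ?A \<inter> ?B" by auto
  moreover have "sum w ?A \<le> sum w ?B" if "?A \<subseteq> ?B" by (rule sum_mono2[OF _ that]) (use w in auto)
  moreover have "sum w ?B \<le> sum w ?A" if "?B \<subseteq> ?A" by (rule sum_mono2[OF _ that]) (use w in auto)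
  ultimately show ?thesis
    unfolding V U by (elim disjE) (simp_all add: Int_absorb1 Int_absorb2 min_def)
qed

text \<open>A measure on the grid is determined by the masses of its lower left rectangles, and
  these are functions of the marginals.\<close>

lemma coupling_measure_unique:
  assumes c: "coupling p q v u m \<tau> w" and c': "coupling p q v u m' \<tau>' w'"
  shows "(\<Sum>l | l \<le> m \<and> \<tau> l = a. w l) = (\<Sum>l | l \<le> m' \<and> \<tau>' l = a. w' l)"
proof -
  obtain i j where a: "a = (i, j)" by fastforce
  define V where "V i = (\<Sum>a<i. v a)" for i
  define U where "U i = (\<Sum>a<i. u a)" for i
  have "(\<Sum>l | l \<le> m \<and> \<tau> l = a. w l) =
      min (V (Suc i)) (U (Suc j)) - min (V i) (U (Suc j)) - min (V (Suc i)) (U j) + min (V i) (U j)"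
    if c: "coupling p q v u m \<tau> w" for m \<tau> w
  proof -
    let ?S = "\<lambda>i j. {l. l \<le> m \<and> fst (\<tau> l) < i \<and> snd (\<tau> l) < j}"
    have fin: "finite (?S i j)" for i j by (rule finite_subset[of _ "{..m}"]) auto
    have eq: "?S (Suc i) (Suc j) = {l. l \<le> m \<and> \<tau> l = a} \<union> (?S i (Suc j) \<union> ?S (Suc i) j)"
      by (auto simp: a less_Suc_eq prod_eq_iff)
    have "sum w (?S (Suc i) (Suc j)) = sum w {l. l \<le> m \<and> \<tau> l = a} + sum w (?S i (Suc j) \<union> ?S (Suc i) j)"
      unfolding eq by (rule sum.union_disjoint) (auto simp: a)
    also have "sum w (?S i (Suc j) \<union> ?S (Suc i) j) =
        sum w (?S i (Suc j)) + sum w (?S (Suc i) j) - sum w (?S i (Suc j) \<inter> ?S (Suc i) j)"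
      by (rule sum_Un[OF fin fin])
    also have "?S i (Suc j) \<inter> ?S (Suc i) j = ?S i j" by auto
    finally show ?thesis
      unfolding coupling_mass_below[OF c] V_def U_def by simp
  qed
  from this[OF c] this[OF c'] show ?thesis by simp
qed

text \<open>Two finite distributions of the same mass are coupled along a monotone staircase: the last
  two atoms are matched, and the one with the smaller mass is used up (the north-west corner
  rule).\<close>

lemma staircase_exists:
  fixes v u :: "nat \<Rightarrow> real"
  assumes "\<And>i. v i \<ge> 0" "\<And>i. u i \<ge> 0" "(\<Sum>i\<le>p. v i) = (\<Sum>i\<le>q. u i)"
  shows "\<exists>\<tau> w. mono_on {..p + q} \<tau> \<and> \<tau> ` {..p + q} \<subseteq> {..p} \<times> {..q} \<and> (\<forall>l. w l \<ge> 0) \<and>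
    (\<forall>i\<le>p. (\<Sum>l | l \<le> p + q \<and> fst (\<tau> l) = i. w l) = v i) \<and>
    (\<forall>i\<le>q. (\<Sum>l | l \<le> p + q \<and> snd (\<tau> l) = i. w l) = u i)"
  using assms
proof (induction "p + q" arbitrary: p q v u)
  case 0
  then show ?case
    by (intro exI[of _ "\<lambda>_. (0, 0)"] exI[of _ v]) (auto simp: monotone_on_def)
next
  case (Suc k)
  have single: "{l. l \<le> q \<and> l = i} = (if i \<le> q then {i} else {})" for i q :: nat by auto
  consider "p = 0" | "q = 0" | p' q' where "p = Suc p'" "q = Suc q'" by (metis nat.exhaust)
  then show ?case
  proof cases
    case 1
    then show ?thesis using Suc
      by (intro exI[of _ "\<lambda>l. (0, l)"] exI[of _ u]) (auto simp: monotone_on_def single atMost_def)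
  next
    case 2
    then show ?thesis using Suc
      by (intro exI[of _ "\<lambda>l. (l, 0)"] exI[of _ v]) (auto simp: monotone_on_def single atMost_def)
  next
    case 3
    have sums: "(\<Sum>l | l \<le> Suc k \<and> f (if l = Suc k then x else \<tau> l) = i. if l = Suc k then c else w l) =
        (\<Sum>l | l \<le> k \<and> f (\<tau> l) = i. w l) + (if f x = i then c else 0)"
      for f :: "nat \<times> nat \<Rightarrow> nat" and \<tau> and w :: "nat \<Rightarrow> real" and c x i
    proof -
      have "{l. l \<le> Suc k \<and> f (if l = Suc k then x else \<tau> l) = i} =
          {l. l \<le> k \<and> f (\<tau> l) = i} \<union> (if f x = i then {Suc k} else {})"
        by auto
      moreover have "(\<Sum>l | l \<le> k \<and> f (\<tau> l) = i. if l = Suc k then c else w l) = (\<Sum>l | l \<le> k \<and> f (\<tau> l) = i. w l)"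
        by (intro sum.cong) auto
      ultimately show ?thesis by (simp add: sum.union_disjoint)
    qed
    have mono: "mono_on {..Suc k} (\<lambda>l. if l = Suc k then (p, q) else \<tau> l)"
      if "mono_on {..k} \<tau>" "\<tau> ` {..k} \<subseteq> {..p} \<times> {..q}" for \<tau>
    proof (rule mono_onI)
      fix x y assume xy: "x \<in> {..Suc k}" "y \<in> {..Suc k}" "x \<le> y"
      have "\<tau> x \<le> (p, q)" if "x \<le> k"
        using \<open>\<tau> ` {..k} \<subseteq> _\<close> that by (auto simp: less_eq_prod_def image_subset_iff mem_Times_iff)
      then show "(if x = Suc k then (p, q) else \<tau> x) \<le> (if y = Suc k then (p, q) else \<tau> y)"
        using xy \<open>mono_on {..k} \<tau>\<close> by (auto simp: monotone_on_def)
    qed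
    show ?thesis
    proof (cases "v p \<le> u q")
      case True
      define u' where "u' = u(q := u q - v p)"
      have "k = p' + q" "\<And>i. u' i \<ge> 0" "(\<Sum>i\<le>p'. v i) = (\<Sum>i\<le>q. u' i)"
        using Suc.hyps(2) Suc.prems 3 True by (auto simp: u'_def)
      from Suc.hyps(1)[OF this(1) Suc.prems(1) this(2,3)] obtain \<tau> w where IH:
        "mono_on {..k} \<tau>" "\<tau> ` {..k} \<subseteq> {..p'} \<times> {..q}" "\<And>l. w l \<ge> 0"
        "\<And>i. i \<le> p' \<Longrightarrow> (\<Sum>l | l \<le> k \<and> fst (\<tau> l) = i. w l) = v i"
        "\<And>i. i \<le> q \<Longrightarrow> (\<Sum>l | l \<le> k \<and> snd (\<tau> l) = i. w l) = u' i"
        unfolding \<open>k = p' + q\<close> by blast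
      have empty: "{l. l \<le> k \<and> fst (\<tau> l) = p} = {}" using IH(2) 3 by force
      let ?\<tau> = "\<lambda>l. if l = Suc k then (p, q) else \<tau> l" and ?w = "\<lambda>l. if l = Suc k then v p else w l"
      have "mono_on {..p + q} ?\<tau>" unfolding Suc.hyps(2)[symmetric]
        using IH(1,2) 3 by (intro mono) force+
      moreover have "?\<tau> ` {..p + q} \<subseteq> {..p} \<times> {..q}" unfolding Suc.hyps(2)[symmetric]
        using IH(2) 3 by (force simp: le_Suc_eq)
      moreover have "\<forall>l. ?w l \<ge> 0" using IH(3) Suc.prems by simp
      moreover have "\<forall>i\<le>p. (\<Sum>l | l \<le> p + q \<and> fst (?\<tau> l) = i. ?w l) = v i"
      proof (intro allI impI)
        fix i assume "i \<le> p"
        then consider "i = p" | "i \<le> p'" "i \<noteq> p" using 3 by linarith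
        then show "(\<Sum>l | l \<le> p + q \<and> fst (?\<tau> l) = i. ?w l) = v i"
          unfolding Suc.hyps(2)[symmetric] sums[where f = fst] by cases (simp_all only: empty, simp_all add: IH(4))
      qed
      moreover have "\<forall>i\<le>q. (\<Sum>l | l \<le> p + q \<and> snd (?\<tau> l) = i. ?w l) = u i"
        unfolding Suc.hyps(2)[symmetric] sums[where f = snd] using IH(5) by (simp add: u'_def)
      ultimately show ?thesis by (intro exI[of _ ?\<tau>] exI[of _ ?w] conjI)
    next
      case False
      define v' where "v' = v(p := v p - u q)"
      have "k = p + q'" "\<And>i. v' i \<ge> 0" "(\<Sum>i\<le>p. v' i) = (\<Sum>i\<le>q'. u i)"
        using Suc.hyps(2) Suc.prems 3 False by (auto simp: v'_def)
      from Suc.hyps(1)[OF this(1,2) Suc.prems(2) this(3)] obtain \<tau> w where IH: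
        "mono_on {..k} \<tau>" "\<tau> ` {..k} \<subseteq> {..p} \<times> {..q'}" "\<And>l. w l \<ge> 0"
        "\<And>i. i \<le> p \<Longrightarrow> (\<Sum>l | l \<le> k \<and> fst (\<tau> l) = i. w l) = v' i"
        "\<And>i. i \<le> q' \<Longrightarrow> (\<Sum>l | l \<le> k \<and> snd (\<tau> l) = i. w l) = u i"
        unfolding \<open>k = p + q'\<close> by blast
      have empty: "{l. l \<le> k \<and> snd (\<tau> l) = q} = {}" using IH(2) 3 by force
      let ?\<tau> = "\<lambda>l. if l = Suc k then (p, q) else \<tau> l" and ?w = "\<lambda>l. if l = Suc k then u q else w l"
      have "mono_on {..p + q} ?\<tau>" unfolding Suc.hyps(2)[symmetric]
        using IH(1,2) 3 by (intro mono) force+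
      moreover have "?\<tau> ` {..p + q} \<subseteq> {..p} \<times> {..q}" unfolding Suc.hyps(2)[symmetric]
        using IH(2) 3 by (force simp: le_Suc_eq)
      moreover have "\<forall>l. ?w l \<ge> 0" using IH(3) Suc.prems by simp
      moreover have "\<forall>i\<le>p. (\<Sum>l | l \<le> p + q \<and> fst (?\<tau> l) = i. ?w l) = v i"
        unfolding Suc.hyps(2)[symmetric] sums[where f = fst] using IH(4) by (simp add: v'_def)
      moreover have "\<forall>i\<le>q. (\<Sum>l | l \<le> p + q \<and> snd (?\<tau> l) = i. ?w l) = u i"
      proof (intro allI impI)
        fix i assume "i \<le> q"
        then consider "i = q" | "i \<le> q'" "i \<noteq> q" using 3 by linarith
        then show "(\<Sum>l | l \<le> p + q \<and> snd (?\<tau> l) = i. ?w l) = u i"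
          unfolding Suc.hyps(2)[symmetric] sums[where f = snd] by cases (simp_all only: empty, simp_all add: IH(5))
      qed
      ultimately show ?thesis by (intro exI[of _ ?\<tau>] exI[of _ ?w] conjI)
    qed
  qed
qed

lemma coupling_exists:
  assumes "v \<in> standard_simplex p" "u \<in> standard_simplex q"
  shows "\<exists>\<tau> w. coupling p q v u (p + q) \<tau> w"
proof -
  have vu: "\<And>i. v i \<ge> 0" "\<And>i. u i \<ge> 0" "(\<Sum>i\<le>p. v i) = 1" "(\<Sum>i\<le>q. u i) = 1"
      "\<And>i. i > p \<Longrightarrow> v i = 0" "\<And>i. i > q \<Longrightarrow> u i = 0"
    using assms by (auto simp: standard_simplex_def)
  obtain \<tau> w where \<tau>: "mono_on {..p + q} \<tau>" "\<tau> ` {..p + q} \<subseteq> {..p} \<times> {..q}" "\<And>l. w l \<ge> 0"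
      "\<And>i. i \<le> p \<Longrightarrow> (\<Sum>l | l \<le> p + q \<and> fst (\<tau> l) = i. w l) = v i"
      "\<And>i. i \<le> q \<Longrightarrow> (\<Sum>l | l \<le> p + q \<and> snd (\<tau> l) = i. w l) = u i"
    using staircase_exists[OF vu(1,2) vu(3)[folded vu(4)]] by blast
  define w' where "w' l = (if l \<le> p + q then w l else 0)" for l
  have push: "simplex_push (p + q) f w' i = (\<Sum>l | l \<le> p + q \<and> f l = i. w l)" for f i
    unfolding simplex_push_def w'_def by (intro sum.cong) auto
  have v: "simplex_push (p + q) (fst \<circ> \<tau>) w' = v"
  proof
    fix i
    show "simplex_push (p + q) (fst \<circ> \<tau>) w' i = v i"
    proof (cases "i \<le> p")
      case True
      then show ?thesis unfolding push using \<tau>(4) by simp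
    next
      case False
      then have "{l. l \<le> p + q \<and> (fst \<circ> \<tau>) l = i} = {}" using \<tau>(2) by force
      with False show ?thesis unfolding push using vu(5) by (simp only: sum.empty not_le)
    qed
  qed
  have u: "simplex_push (p + q) (snd \<circ> \<tau>) w' = u"
  proof
    fix i
    show "simplex_push (p + q) (snd \<circ> \<tau>) w' i = u i"
    proof (cases "i \<le> q")
      case True
      then show ?thesis unfolding push using \<tau>(5) by simp
    next
      case False
      then have "{l. l \<le> p + q \<and> (snd \<circ> \<tau>) l = i} = {}" using \<tau>(2) by force
      with False show ?thesis unfolding push using vu(6) by (simp only: sum.empty not_le)
    qed
  qed
  have "(\<Sum>i\<le>p. \<Sum>l | l \<in> {..p + q} \<and> fst (\<tau> l) = i. w l) = (\<Sum>l\<le>p + q. w l)"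
    using \<tau>(2) by (intro sum.group) force+
  then have "(\<Sum>l\<le>p + q. w l) = (\<Sum>i\<le>p. v i)" using \<tau>(4) by simp
  then have one: "(\<Sum>l\<le>p + q. w l) = 1" using vu by simp
  have "w l \<le> 1" if "l \<le> p + q" for l
    unfolding one[symmetric] using that \<tau>(3) by (intro member_le_sum) auto
  then have "w' \<in> standard_simplex (p + q)"
    using one \<tau>(3) by (auto simp: standard_simplex_def w'_def)
  then show ?thesis using \<tau> v u unfolding coupling_def by blast
qed

text \<open>This evaluates a functor \<open>F\<close> from \<open>[p] \<times> [q]\<close> at a
  point of \<open>\<Delta>\<^sup>p \<times> \<Delta>\<^sup>q\<close>; the coupling serves as the
  inverse of the homeomorphism from the realised nerve of \<open>[p] \<times> [q]\<close> to
  \<open>\<Delta>\<^sup>p \<times> \<Delta>\<^sup>q\<close>.\<close>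

definition shuffle_point ::
  "('o, 'm, 'z) cat_scheme \<Rightarrow> nat \<Rightarrow> nat \<Rightarrow> (nat \<times> nat, 'o, 'm) diagram \<Rightarrow> (nat \<Rightarrow> real) \<Rightarrow> (nat \<Rightarrow> real) \<Rightarrow>
   (nat \<times> (nat, 'o, 'm) diagram \<times> (nat \<Rightarrow> real)) set" where
  "shuffle_point C p q F v u =
    (THE y. \<exists>m \<tau> w. coupling p q v u m \<tau> w \<and> y = pt (nerve C) (m, pull {..m} \<tau> F, w))"

lemma coupling_pt_unique:
  assumes "F \<in> diagrams ({..p} \<times> {..q}) C"
    and c: "coupling p q v u m \<tau> w" and c': "coupling p q v u m' \<tau>' w'"
  shows "pt (nerve C) (m, pull {..m} \<tau> F, w) = pt (nerve C) (m', pull {..m'} \<tau>' F, w')"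
  by (rule pt_nerve_determined_by_measure[OF assms(1) _ _ _ _ _ _ coupling_measure_unique[OF c c']])
    (use c c' in \<open>simp_all add: coupling_def\<close>)

lemma shuffle_point_eq:
  assumes "F \<in> diagrams ({..p} \<times> {..q}) C" and c: "coupling p q v u m \<tau> w"
  shows "shuffle_point C p q F v u = pt (nerve C) (m, pull {..m} \<tau> F, w)"
  unfolding shuffle_point_def
  by (rule the_equality) (use c coupling_pt_unique[OF assms(1) _ c] in blast)+

lemma mono_on_map_prod:
  assumes "mono_on {..m} f" "mono_on {..n} g"
  shows "mono_on ({..m} \<times> {..n}) (map_prod f g)"
  using assms by (auto simp: monotone_on_def less_eq_prod_def)

lemma mono_on_compose:
  "mono_on A f \<Longrightarrow> mono_on B g \<Longrightarrow> f ` A \<subseteq> B \<Longrightarrow> mono_on A (g \<circ> f)"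
  by (auto simp: monotone_on_def image_subset_iff)

lemma coupling_map_prod:
  assumes "coupling p q v u k \<tau> w"
    and f: "mono_on {..p} f" "f ` {..p} \<subseteq> {..p'}" and g: "mono_on {..q} g" "g ` {..q} \<subseteq> {..q'}"
  shows "coupling p' q' (simplex_push p f v) (simplex_push q g u) k (map_prod f g \<circ> \<tau>) w"
proof -
  have a: "mono_on {..k} \<tau>" "\<tau> ` {..k} \<subseteq> {..p} \<times> {..q}" "w \<in> standard_simplex k"
    "simplex_push k (fst \<circ> \<tau>) w = v" "simplex_push k (snd \<circ> \<tau>) w = u"
    using assms(1) by (auto simp: coupling_def)
  have r: "fst ` \<tau> ` {..k} \<subseteq> {..p}" "snd ` \<tau> ` {..k} \<subseteq> {..q}" using a(2) by auto
  have "mono_on {..k} (map_prod f g \<circ> \<tau>)"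
    by (rule mono_on_compose[OF a(1) mono_on_map_prod[OF f(1) g(1)] a(2)])
  moreover have "(map_prod f g \<circ> \<tau>) ` {..k} \<subseteq> {..p'} \<times> {..q'}"
    using a(2) f(2) g(2) by (auto simp: image_subset_iff mem_Times_iff)
  moreover have "simplex_push k (fst \<circ> (map_prod f g \<circ> \<tau>)) w = simplex_push p f v"
    unfolding a(4)[symmetric] using r by (subst simplex_push_comp) (simp_all add: comp_def image_image)
  moreover have "simplex_push k (snd \<circ> (map_prod f g \<circ> \<tau>)) w = simplex_push q g u"
    unfolding a(5)[symmetric] using r by (subst simplex_push_comp) (simp_all add: comp_def image_image)
  ultimately show ?thesis unfolding coupling_def using a(3) by (intro conjI)
qed

text \<open>Naturality in \<open>[p]\<close> and \<open>[q]\<close>: pushing a coupling forward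
  along \<open>f \<times> g\<close> gives a coupling of the pushed marginals, supported on the image
  chain.\<close>

lemma shuffle_point_push:
  assumes F: "F \<in> diagrams ({..p'} \<times> {..q'}) C"
    and f: "mono_on {..p} f" "f ` {..p} \<subseteq> {..p'}" and g: "mono_on {..q} g" "g ` {..q} \<subseteq> {..q'}"
    and v: "v \<in> standard_simplex p" and u: "u \<in> standard_simplex q"
  shows "shuffle_point C p q (pull ({..p} \<times> {..q}) (map_prod f g) F) v u =
    shuffle_point C p' q' F (simplex_push p f v) (simplex_push q g u)"
proof -
  obtain \<tau> w where c: "coupling p q v u (p + q) \<tau> w" using coupling_exists[OF v u] by blast
  have r: "map_prod f g ` ({..p} \<times> {..q}) \<subseteq> {..p'} \<times> {..q'}"
    using f(2) g(2) by (auto simp: image_subset_iff)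
  have t: "mono_on {..p + q} \<tau>" "\<tau> ` {..p + q} \<subseteq> {..p} \<times> {..q}" using c by (auto simp: coupling_def)
  show ?thesis
    unfolding shuffle_point_eq[OF F coupling_map_prod[OF c f g]]
      shuffle_point_eq[OF pull_in_diagrams[OF F mono_on_map_prod[OF f(1) g(1)] r] c] pull_pull[OF t] ..
qed

text \<open>The chains cut the product of two simplices into finitely many compact pieces, on each of
  which the map is a map of simplices followed by the inclusion of a cell.\<close>

lemma continuous_map_shuffle_point:
  assumes F: "F \<in> diagrams ({..p} \<times> {..q}) C"
  shows "continuous_map (prod_topology (simplex_top p) (simplex_top q)) (realise (nerve C))
    (\<lambda>(v, u). shuffle_point C p q F v u)"
proof -
  \<comment> \<open>chains of length \<open>p + q\<close> suffice, by the staircase construction\<close>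
  define M where "M = {\<tau> \<in> {..p + q} \<rightarrow>\<^sub>E {..p} \<times> {..q}. mono_on {..p + q} \<tau>}"
  have finM: "finite M" unfolding M_def by (simp add: finite_PiE)
  let ?X = "prod_topology (discrete_topology M) (simplex_top (p + q))"
  let ?P = "prod_topology (simplex_top p) (simplex_top q)"
  define G where "G = (\<lambda>(\<tau>, w). (simplex_push (p + q) (fst \<circ> \<tau>) w, simplex_push (p + q) (snd \<circ> \<tau>) w))"
  have disc: "continuous_map ?X Y f" if "\<And>\<tau>. \<tau> \<in> M \<Longrightarrow> continuous_map (simplex_top (p + q)) Y (\<lambda>w. f (\<tau>, w))"
    for Y :: "'x topology" and f
  proof -
    have "continuous_map (prod_topology (discrete_topology {()}) ?X) Y (f \<circ> snd)"
    proof (rule continuous_map_prod_discrete)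
      fix \<tau> assume "\<tau> \<in> M"
      from continuous_map_compose[OF continuous_map_snd that[OF this]]
      show "continuous_map (prod_topology (discrete_topology {()}) (simplex_top (p + q))) Y
        (\<lambda>(z, u). (f \<circ> snd) (z, \<tau>, u))" by (simp add: o_def case_prod_unfold)
    qed
    moreover have "continuous_map ?X (prod_topology (discrete_topology {()}) ?X) (\<lambda>x. ((), x))"
      by (simp add: continuous_map_pairedI)
    ultimately have "continuous_map ?X Y ((f \<circ> snd) \<circ> (\<lambda>x. ((), x)))"
      by (rule continuous_map_compose[rotated])
    then show ?thesis by (simp add: o_def)
  qed
  have Mr: "(fst \<circ> \<tau>) ` {..p + q} \<subseteq> {..p}" "(snd \<circ> \<tau>) ` {..p + q} \<subseteq> {..q}" if "\<tau> \<in> M" for \<tau>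
    using that by (force simp: M_def)+
  have contG: "continuous_map ?X ?P G"
    by (rule disc) (unfold G_def case_prod_conv, intro continuous_map_pairedI continuous_map_simplex_push Mr)
  have cM: "coupling p q (fst (G (\<tau>, w))) (snd (G (\<tau>, w))) (p + q) \<tau> w"
    if "\<tau> \<in> M" "w \<in> standard_simplex (p + q)" for \<tau> w
  proof -
    have "\<tau> ` {..p + q} \<subseteq> {..p} \<times> {..q}" "mono_on {..p + q} \<tau>"
      using that(1) PiE_mem unfolding M_def by blast+
    then show ?thesis using that(2) by (simp add: coupling_def G_def)
  qed
  have "topspace ?P \<subseteq> G ` topspace ?X"
  proof
    fix y assume "y \<in> topspace ?P"
    then obtain v u where y: "y = (v, u)" "v \<in> standard_simplex p" "u \<in> standard_simplex q"
      by (auto simp: topspace_standard_simplex)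
    obtain \<tau> w where c: "coupling p q v u (p + q) \<tau> w" using coupling_exists[OF y(2,3)] by blast
    define \<tau>' where "\<tau>' = restrict \<tau> {..p + q}"
    have "\<tau>' \<in> M" "w \<in> standard_simplex (p + q)"
      using c by (auto simp: M_def coupling_def \<tau>'_def monotone_on_def image_subset_iff)
    moreover have "G (\<tau>', w) = y"
      unfolding y G_def using c simplex_push_cong[of "p + q" "fst \<circ> \<tau>'" "fst \<circ> \<tau>" w]
        simplex_push_cong[of "p + q" "snd \<circ> \<tau>'" "snd \<circ> \<tau>" w]
      by (simp add: coupling_def \<tau>'_def)
    ultimately show "y \<in> G ` topspace ?X" by (force simp: topspace_standard_simplex)
  qed
  then have surj: "G ` topspace ?X = topspace ?P"
    using continuous_map_image_subset_topspace[OF contG] by blast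
  have q: "quotient_map ?X ?P G"
    by (rule continuous_imp_quotient_map[OF contG _ _ surj])
      (auto simp: compact_space_prod_topology compact_simplex_top compact_space_discrete_topology
        Hausdorff_space_prod_topology Hausdorff_simplex_top finM)
  have "continuous_map ?X (realise (nerve C)) (\<lambda>(\<tau>, w). pt (nerve C) (p + q, pull {..p + q} \<tau> F, w))"
  proof (rule disc, simp only: case_prod_conv)
    fix \<tau> assume \<tau>: "\<tau> \<in> M"
    have "\<tau> ` {..p + q} \<subseteq> {..p} \<times> {..q}" "mono_on {..p + q} \<tau>"
      using \<tau> PiE_mem unfolding M_def by blast+
    then have "pull {..p + q} \<tau> F \<in> diagrams {..p + q} C"
      by (intro pull_in_diagrams[OF F])
    then have "continuous_map (simplex_top (p + q)) (prod_topology (slevel (nerve C) (p + q)) (simplex_top (p + q)))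
      (\<lambda>w. (pull {..p + q} \<tau> F, w))"
      by (simp add: continuous_map_pairedI)
    from continuous_map_compose[OF this continuous_map_component_injection[of "p + q" UNIV
        "\<lambda>n. prod_topology (slevel (nerve C) n) (simplex_top n)"]]
    have "continuous_map (simplex_top (p + q)) (cells (nerve C)) (\<lambda>w. (p + q, pull {..p + q} \<tau> F, w))"
      by (simp add: cells_def o_def)
    from continuous_map_compose[OF this quotient_imp_continuous_map[OF quotient_map_realise]]
    show "continuous_map (simplex_top (p + q)) (realise (nerve C))
      (\<lambda>w. pt (nerve C) (p + q, pull {..p + q} \<tau> F, w))" by (simp add: o_def)
  qed
  then have "continuous_map ?X (realise (nerve C)) ((\<lambda>(v, u). shuffle_point C p q F v u) \<circ> G)"
  proof (rule continuous_map_eq)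
    fix x assume "x \<in> topspace ?X"
    then obtain \<tau> w where x: "x = (\<tau>, w)" "\<tau> \<in> M" "w \<in> standard_simplex (p + q)"
      by (auto simp: topspace_standard_simplex)
    show "(\<lambda>(\<tau>, w). pt (nerve C) (p + q, pull {..p + q} \<tau> F, w)) x = ((\<lambda>(v, u). shuffle_point C p q F v u) \<circ> G) x"
      using shuffle_point_eq[OF F cM[OF x(2,3)]] by (simp add: x(1) case_prod_unfold)
  qed
  then show ?thesis
    using continuous_compose_quotient_map_eq[OF q] by blast
qed

section \<open>Families of functors indexed by a simplex\<close>

text \<open>A family is a functor from \<open>[p] \<times> C\<close> to \<open>D\<close> whose
  object map is independent of the vertex of \<open>[p]\<close>; \<open>A e e' X Y h\<close> is the
  arrow over \<open>e \<le> e'\<close> and \<open>h\<close>.  All families below consist of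
  automorphisms of one functor, so a single object map suffices, and \<open>p = 0\<close> gives
  functors.\<close>

locale family =
  fixes p :: nat and C :: "('o, 'm, 'z) cat_scheme" and D :: "('p, 'n, 'y) cat_scheme"
    and O\<^sub>A :: "'o \<Rightarrow> 'p" and A :: "nat \<Rightarrow> nat \<Rightarrow> 'o \<Rightarrow> 'o \<Rightarrow> 'm \<Rightarrow> 'n"
  assumes ob: "X \<in> cat_ob C \<Longrightarrow> O\<^sub>A X \<in> cat_ob D"
    and hom: "\<lbrakk>e \<le> e'; e' \<le> p; X \<in> cat_ob C; Y \<in> cat_ob C; h \<in> cat_hom C X Y\<rbrakk>
      \<Longrightarrow> A e e' X Y h \<in> cat_hom D (O\<^sub>A X) (O\<^sub>A Y)"
    and id: "\<lbrakk>e \<le> p; X \<in> cat_ob C\<rbrakk> \<Longrightarrow> A e e X X (cat_id C X) = cat_id D (O\<^sub>A X)"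
    and comp: "\<lbrakk>e \<le> e'; e' \<le> e''; e'' \<le> p; X \<in> cat_ob C; Y \<in> cat_ob C; Z \<in> cat_ob C;
        h \<in> cat_hom C X Y; g \<in> cat_hom C Y Z\<rbrakk>
      \<Longrightarrow> A e e'' X Z (cat_comp C X g h) = cat_comp D (O\<^sub>A X) (A e' e'' Y Z g) (A e e' X Y h)"

abbreviation is_functor where
  "is_functor C D \<Phi> \<equiv> family 0 C D (fst \<Phi>) (\<lambda>_ _. snd \<Phi>)"

lemma push_in_diagrams:
  assumes "is_functor C D \<Phi>" "F \<in> diagrams J C"
  shows "push J \<Phi> F \<in> diagrams J D"
proof -
  interpret family 0 C D "fst \<Phi>" "\<lambda>_ _. snd \<Phi>" by fact
  note d = diagramsD[OF assms(2)]
  have o: "i \<in> J \<Longrightarrow> fst F i \<in> cat_ob C" for i using d(1) by auto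
  show ?thesis
    unfolding push_def
  proof (rule diagramsI)
    fix i j k assume J: "i \<in> J" "j \<in> J" "k \<in> J" and le: "i \<le> j" "j \<le> k"
    then have "i \<le> k" by simp
    have "snd \<Phi> (fst F i) (fst F k) (snd F (i, k)) = cat_comp D (fst \<Phi> (fst F i))
        (snd \<Phi> (fst F j) (fst F k) (snd F (j, k))) (snd \<Phi> (fst F i) (fst F j) (snd F (i, j)))"
      unfolding d(5)[OF J le] using J le by (intro comp[of 0 0 0] o d(3)) auto
    then show "(\<lambda>(i, j)\<in>le_pairs J. snd \<Phi> (fst F i) (fst F j) (snd F (i, j))) (i, k) =
      cat_comp D ((\<lambda>i\<in>J. fst \<Phi> (fst F i)) i)
        ((\<lambda>(i, j)\<in>le_pairs J. snd \<Phi> (fst F i) (fst F j) (snd F (i, j))) (j, k))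
        ((\<lambda>(i, j)\<in>le_pairs J. snd \<Phi> (fst F i) (fst F j) (snd F (i, j))) (i, j))"
      using J le \<open>i \<le> k\<close> by (simp add: le_pairs_def)
  qed (use o ob in \<open>auto simp: le_pairs_def d(4) id intro!: hom[of 0 0] d(3)\<close>)
qed

lemma push_pull:
  assumes "mono_on J \<theta>" "\<theta> ` J \<subseteq> K"
  shows "push J \<Phi> (pull J \<theta> F) = pull J \<theta> (push K \<Phi> F)"
proof -
  have "\<theta> i \<in> K" "i \<le> j \<Longrightarrow> j \<in> J \<Longrightarrow> \<theta> i \<le> \<theta> j" if "i \<in> J" for i j
    using assms that by (auto simp: monotone_on_def)
  then show ?thesis by (auto simp: push_def pull_def fun_eq_iff le_pairs_def)
qed

lemma realise_map_pt:
  assumes "\<And>m n \<theta> x. \<lbrakk>mono_on {..m} \<theta>; \<theta> ` {..m} \<subseteq> {..n}; x \<in> topspace (slevel X n)\<rbrakk> \<Longrightarrow>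
      g m (sact X m \<theta> x) = sact Y m \<theta> (g n x)"
    and "\<And>n x. x \<in> topspace (slevel X n) \<Longrightarrow> g n x \<in> topspace (slevel Y n)"
  shows "realise_map Y g (pt X (n, x, u)) = pt Y (n, g n x, u)"
  unfolding realise_map_def
proof (subst descend_pt)
  fix a b assume "glue X a b"
  then obtain m n \<theta> x u where *: "mono_on {..m} \<theta>" "\<theta> ` {..m} \<subseteq> {..n}" "x \<in> topspace (slevel X n)"
    "u \<in> standard_simplex m" "a = (m, sact X m \<theta> x, u)" "b = (n, x, simplex_push m \<theta> u)"
    unfolding glue_def by blast
  have "glue Y (m, sact Y m \<theta> (g n x), u) (n, g n x, simplex_push m \<theta> u)"
    unfolding glue_def using * assms(2) by blast
  then show "(\<lambda>(n, x, u). pt Y (n, g n x, u)) a = (\<lambda>(n, x, u). pt Y (n, g n x, u)) b"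
    using * assms(1) by (simp add: glue_imp_pt_eq)
qed simp

lemma realise_map_nerve:
  assumes "is_functor C D \<Phi>"
  shows "realise_map (nerve D) (\<lambda>q. push {..q} \<Phi>) (pt (nerve C) (q, \<sigma>, u)) =
    pt (nerve D) (q, push {..q} \<Phi> \<sigma>, u)"
  by (rule realise_map_pt) (simp_all add: push_pull push_in_diagrams[OF assms])

text \<open>The composite of the family with \<open>[p] \<times> \<sigma>\<close> for a simplex
  \<open>\<sigma>\<close> of \<open>C\<close>.\<close>

definition prism_of ::
  "nat \<Rightarrow> nat \<Rightarrow> ('o \<Rightarrow> 'p) \<Rightarrow> (nat \<Rightarrow> nat \<Rightarrow> 'o \<Rightarrow> 'o \<Rightarrow> 'm \<Rightarrow> 'n) \<Rightarrow> (nat, 'o, 'm) diagram \<Rightarrow>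
   (nat \<times> nat, 'p, 'n) diagram" where
  "prism_of p q O\<^sub>A A \<sigma> =
    ((\<lambda>(e, j)\<in>{..p} \<times> {..q}. O\<^sub>A (fst \<sigma> j)),
     (\<lambda>((e, i), (e', j))\<in>le_pairs ({..p} \<times> {..q}). A e e' (fst \<sigma> i) (fst \<sigma> j) (snd \<sigma> (i, j))))"

lemma prism_of_cong:
  assumes "\<And>j. j \<le> q \<Longrightarrow> O\<^sub>A (fst \<sigma> j) = O\<^sub>A' (fst \<sigma>' j)"
    and "\<And>e e' i j. e \<le> e' \<Longrightarrow> e' \<le> p \<Longrightarrow> i \<le> j \<Longrightarrow> j \<le> q \<Longrightarrow>
      A e e' (fst \<sigma> i) (fst \<sigma> j) (snd \<sigma> (i, j)) = A' e e' (fst \<sigma>' i) (fst \<sigma>' j) (snd \<sigma>' (i, j))"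
  shows "prism_of p q O\<^sub>A A \<sigma> = prism_of p q O\<^sub>A' A' \<sigma>'"
  unfolding prism_of_def using assms by (auto simp: fun_eq_iff le_pairs_def restrict_def)

lemma pull_prism_of:
  assumes f: "mono_on {..p'} f" "f ` {..p'} \<subseteq> {..p}" and g: "mono_on {..q'} g" "g ` {..q'} \<subseteq> {..q}"
  shows "pull ({..p'} \<times> {..q'}) (map_prod f g) (prism_of p q O\<^sub>A A \<sigma>) =
    prism_of p' q' O\<^sub>A (\<lambda>e e'. A (f e) (f e')) (pull {..q'} g \<sigma>)"
proof -
  have "f i \<le> p" "g k \<le> q" if "i \<le> p'" "k \<le> q'" for i k
    using f(2) g(2) that by (auto simp: image_subset_iff)
  moreover have "f i \<le> f j" if "i \<le> j" "j \<le> p'" for i j using f(1) that by (auto simp: monotone_on_def)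
  moreover have "g i \<le> g j" if "i \<le> j" "j \<le> q'" for i j using g(1) that by (auto simp: monotone_on_def)
  ultimately show ?thesis
    by (auto simp: pull_def prism_of_def fun_eq_iff le_pairs_def restrict_def)
qed

definition level_map ::
  "nat \<Rightarrow> ('p, 'n, 'y) cat_scheme \<Rightarrow> ('o \<Rightarrow> 'p) \<Rightarrow> (nat \<Rightarrow> nat \<Rightarrow> 'o \<Rightarrow> 'o \<Rightarrow> 'm \<Rightarrow> 'n) \<Rightarrow> (nat \<Rightarrow> real) \<Rightarrow>
   (nat \<times> (nat, 'o, 'm) diagram \<times> (nat \<Rightarrow> real)) set \<Rightarrow> (nat \<times> (nat, 'p, 'n) diagram \<times> (nat \<Rightarrow> real)) set" where
  "level_map p D O\<^sub>A A v = descend (\<lambda>(q, \<sigma>, u). shuffle_point D p q (prism_of p q O\<^sub>A A \<sigma>) v u)"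

context family begin

lemma prism_of_in_diagrams:
  assumes "\<sigma> \<in> diagrams {..q} C"
  shows "prism_of p q O\<^sub>A A \<sigma> \<in> diagrams ({..p} \<times> {..q}) D"
proof -
  note d = diagramsD[OF assms]
  have o: "i \<le> q \<Longrightarrow> fst \<sigma> i \<in> cat_ob C" for i using d(1) by auto
  show ?thesis
    unfolding prism_of_def
  proof (rule diagramsI)
    fix x y z assume J: "x \<in> {..p} \<times> {..q}" "y \<in> {..p} \<times> {..q}" "z \<in> {..p} \<times> {..q}" and le: "x \<le> y" "y \<le> z"
    obtain e i e' j e'' k where xyz: "x = (e, i)" "y = (e', j)" "z = (e'', k)" by (metis prod.exhaust)
    have h: "e \<le> e'" "e' \<le> e''" "e'' \<le> p" "i \<le> j" "j \<le> k" "k \<le> q"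
      and h': "i \<in> {..q}" "j \<in> {..q}" "k \<in> {..q}" "e \<le> e''" "i \<le> k" "e' \<le> p" "e \<le> p"
      using J le unfolding xyz by auto
    have "A e e'' (fst \<sigma> i) (fst \<sigma> k) (snd \<sigma> (i, k)) = cat_comp D (O\<^sub>A (fst \<sigma> i))
        (A e' e'' (fst \<sigma> j) (fst \<sigma> k) (snd \<sigma> (j, k))) (A e e' (fst \<sigma> i) (fst \<sigma> j) (snd \<sigma> (i, j)))"
      unfolding d(5)[OF h'(1,2,3) h(4,5)] using h h' by (intro comp o d(3)) auto
    then show "(\<lambda>((e, i), (e', j))\<in>le_pairs ({..p} \<times> {..q}). A e e' (fst \<sigma> i) (fst \<sigma> j) (snd \<sigma> (i, j))) (x, z) =
      cat_comp D ((\<lambda>(e, j)\<in>{..p} \<times> {..q}. O\<^sub>A (fst \<sigma> j)) x)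
       ((\<lambda>((e, i), (e', j))\<in>le_pairs ({..p} \<times> {..q}). A e e' (fst \<sigma> i) (fst \<sigma> j) (snd \<sigma> (i, j))) (y, z))
       ((\<lambda>((e, i), (e', j))\<in>le_pairs ({..p} \<times> {..q}). A e e' (fst \<sigma> i) (fst \<sigma> j) (snd \<sigma> (i, j))) (x, y))"
      using h h' unfolding xyz by (simp add: le_pairs_def)
  qed (use o ob in \<open>auto simp: le_pairs_def d(4) id intro!: hom d(3)\<close>)
qed

text \<open>Both sides are evaluations of one functor on \<open>[p] \<times> [n]\<close> at points
  that the simplicial map identifies, by the naturality of \<open>shuffle_point\<close>.\<close>

lemma level_map_glue:
  assumes v: "v \<in> standard_simplex p" and "glue (nerve C) a b"
  shows "(\<lambda>(q, \<sigma>, u). shuffle_point D p q (prism_of p q O\<^sub>A A \<sigma>) v u) a =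
    (\<lambda>(q, \<sigma>, u). shuffle_point D p q (prism_of p q O\<^sub>A A \<sigma>) v u) b"
proof -
  obtain m n \<theta> \<sigma> u where *: "mono_on {..m} \<theta>" "\<theta> ` {..m} \<subseteq> {..n}" "\<sigma> \<in> diagrams {..n} C"
    "u \<in> standard_simplex m" "a = (m, pull {..m} \<theta> \<sigma>, u)" "b = (n, \<sigma>, simplex_push m \<theta> u)"
    using assms(2) unfolding glue_def by auto
  have id: "mono_on {..p} (\<lambda>e. e)" "(\<lambda>e. e) ` {..p} \<subseteq> {..p}" by (auto simp: monotone_on_def)
  show ?thesis
    using shuffle_point_push[OF prism_of_in_diagrams[OF *(3)] id *(1,2) v *(4)]
    unfolding *(5,6) pull_prism_of[OF id *(1,2)] simplex_push_id[OF v] by simp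
qed

lemma level_map_pt:
  assumes "v \<in> standard_simplex p"
  shows "level_map p D O\<^sub>A A v (pt (nerve C) (q, \<sigma>, u)) = shuffle_point D p q (prism_of p q O\<^sub>A A \<sigma>) v u"
  unfolding level_map_def by (subst descend_pt) (use level_map_glue[OF assms] in auto)

lemma continuous_map_level_map:
  "continuous_map (prod_topology (simplex_top p) (realise (nerve C))) (realise (nerve D))
    (\<lambda>(v, x). level_map p D O\<^sub>A A v x)"
  unfolding level_map_def
proof (rule continuous_map_descend)
  show "locally_compact_space (simplex_top p)"
    by (rule compact_imp_locally_compact_space) (rule compact_simplex_top)
  show "Hausdorff_space (simplex_top p)" by (rule Hausdorff_simplex_top)
  show "continuous_map (prod_topology (simplex_top p) (prod_topology (slevel (nerve C) n) (simplex_top n)))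
      (realise (nerve D)) (\<lambda>(v, \<sigma>, u). (\<lambda>(q, \<sigma>, u). shuffle_point D p q (prism_of p q O\<^sub>A A \<sigma>) v u) (n, \<sigma>, u))" for n
    unfolding slevel_nerve
  proof (rule continuous_map_prod_discrete)
    fix \<sigma> assume "\<sigma> \<in> diagrams {..n} C"
    from continuous_map_shuffle_point[OF prism_of_in_diagrams[OF this]]
    show "continuous_map (prod_topology (simplex_top p) (simplex_top n)) (realise (nerve D)) (\<lambda>(z, u).
        case (z, \<sigma>, u) of (v, \<sigma>, u) \<Rightarrow> (\<lambda>(q, \<sigma>, u). shuffle_point D p q (prism_of p q O\<^sub>A A \<sigma>) v u) (n, \<sigma>, u))"
      by simp
  qed
qed (rule level_map_glue, simp_all add: topspace_standard_simplex)

lemma level_map_in_realise: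
  assumes "v \<in> standard_simplex p" "x \<in> topspace (realise (nerve C))"
  shows "level_map p D O\<^sub>A A v x \<in> topspace (realise (nerve D))"
  using funcset_mem[OF continuous_map_funspace[OF continuous_map_level_map], of "(v, x)"] assms
  by (simp add: topspace_standard_simplex)

end

text \<open>Over a vertex of \<open>\<Delta>\<^sup>p\<close> the only coupling, as a measure, is the
  one on the slice \<open>{e} \<times> [q]\<close>.\<close>

lemma shuffle_point_vertex:
  assumes F: "F \<in> diagrams ({..p} \<times> {..q}) D" and e: "e \<le> p" and u: "u \<in> standard_simplex q"
  shows "shuffle_point D p q F (\<lambda>i. if i = e then 1 else 0) u = pt (nerve D) (q, pull {..q} (\<lambda>j. (e, j)) F, u)"
proof (rule shuffle_point_eq[OF F])
  have s: "sum u {..q} = 1" using u by (simp add: standard_simplex_def)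
  have "simplex_push q (fst \<circ> (\<lambda>j. (e, j))) u = (\<lambda>i. if i = e then 1 else 0)"
    by (auto simp: simplex_push_def fun_eq_iff s[unfolded atMost_def])
  moreover have "simplex_push q (snd \<circ> (\<lambda>j. (e, j))) u = u"
    using simplex_push_id[OF u] by (simp add: comp_def)
  ultimately show "coupling p q (\<lambda>i. if i = e then 1 else 0) u q (\<lambda>j. (e, j)) u"
    unfolding coupling_def using u e by (auto simp: monotone_on_def)
qed

section \<open>Families of exact functors and K-theory\<close>

text \<open>The condition \<open>diag\<close> says that the functors at the vertices of
  \<open>[p]\<close> agree on arrows as well as on objects.  It makes the family act on the diagrams
  in \<open>S\<^sub>k\<close>, and it is what makes the loops along the edges of
  \<open>\<Delta>\<^sup>p\<close> closed.\<close>

locale exact_family = family p C D O\<^sub>A A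
  for p :: nat and C :: "('o, 'm) wcat" and D :: "('p, 'n) wcat"
    and O\<^sub>A :: "'o \<Rightarrow> 'p" and A :: "nat \<Rightarrow> nat \<Rightarrow> 'o \<Rightarrow> 'o \<Rightarrow> 'm \<Rightarrow> 'n" +
  assumes weq_hom: "\<lbrakk>X \<in> cat_ob C; Y \<in> cat_ob C; h \<in> weq C X Y\<rbrakk> \<Longrightarrow> h \<in> cat_hom C X Y"
    and weq_pres: "\<lbrakk>e \<le> e'; e' \<le> p; X \<in> cat_ob C; Y \<in> cat_ob C; h \<in> weq C X Y\<rbrakk>
      \<Longrightarrow> A e e' X Y h \<in> weq D (O\<^sub>A X) (O\<^sub>A Y)"
    and diag: "\<lbrakk>e \<le> p; X \<in> cat_ob C; Y \<in> cat_ob C; h \<in> cat_hom C X Y\<rbrakk> \<Longrightarrow> A e e X Y h = A 0 0 X Y h"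
    and S_pres: "F \<in> S_obs C k \<Longrightarrow> push (Ar k) (O\<^sub>A, A 0 0) F \<in> S_obs D k"

abbreviation exact_functor where
  "exact_functor C D \<Phi> \<equiv> exact_family 0 C D (fst \<Phi>) (\<lambda>_ _. snd \<Phi>)"

definition S_ob :: "nat \<Rightarrow> ('o \<Rightarrow> 'p) \<Rightarrow> (nat \<Rightarrow> nat \<Rightarrow> 'o \<Rightarrow> 'o \<Rightarrow> 'm \<Rightarrow> 'n) \<Rightarrow>
    (nat \<times> nat, 'o, 'm) diagram \<Rightarrow> (nat \<times> nat, 'p, 'n) diagram" where
  "S_ob k O\<^sub>A A = push (Ar k) (O\<^sub>A, A 0 0)"

definition S_arr :: "nat \<Rightarrow> (nat \<Rightarrow> nat \<Rightarrow> 'o \<Rightarrow> 'o \<Rightarrow> 'm \<Rightarrow> 'n) \<Rightarrow> nat \<Rightarrow> nat \<Rightarrow>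
    (nat \<times> nat, 'o, 'm) diagram \<Rightarrow> (nat \<times> nat, 'o, 'm) diagram \<Rightarrow> (nat \<times> nat \<Rightarrow> 'm) \<Rightarrow> nat \<times> nat \<Rightarrow> 'n" where
  "S_arr k A e e' F G \<eta> = (\<lambda>a\<in>Ar k. A e e' (fst F a) (fst G a) (\<eta> a))"

lemma S_obs_diagram: "F \<in> S_obs C k \<Longrightarrow> F \<in> diagrams (Ar k) C"
  by (auto simp: S_obs_def)

lemma S_obs_ob: "F \<in> S_obs C k \<Longrightarrow> a \<in> Ar k \<Longrightarrow> fst F a \<in> cat_ob C"
  using diagramsD(1)[OF S_obs_diagram] by blast

lemma wS_simps [simp]:
  "cat_ob (wS C k) = S_obs C k"
  "cat_id (wS C k) F = (\<lambda>a\<in>Ar k. cat_id C (fst F a))"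
  "cat_comp (wS C k) F \<eta>' \<eta> = (\<lambda>a\<in>Ar k. cat_comp C (fst F a) (\<eta>' a) (\<eta> a))"
  by (simp_all add: wS_def)

lemma wS_hom:
  "\<eta> \<in> cat_hom (wS C k) F G \<longleftrightarrow> \<eta> \<in> extensional (Ar k) \<and>
    (\<forall>a\<in>Ar k. \<eta> a \<in> weq C (fst F a) (fst G a)) \<and>
    (\<forall>a\<in>Ar k. \<forall>b\<in>Ar k. a \<le> b \<longrightarrow>
       cat_comp C (fst F a) (\<eta> b) (snd F (a, b)) = cat_comp C (fst F a) (snd G (a, b)) (\<eta> a))"
  by (simp add: wS_def)

lemma wS_fctr_eq: "wS_fctr k \<Phi> = (S_ob k (fst \<Phi>) (\<lambda>_ _. snd \<Phi>), S_arr k (\<lambda>_ _. snd \<Phi>) 0 0)"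
  by (simp add: wS_fctr_def S_ob_def S_arr_def fun_eq_iff)

context exact_family begin

text \<open>An exact family acts on \<open>S\<^sub>k\<close> objectwise; the arrow over \<open>e
  \<le> e'\<close> is natural with respect to the maps in the diagram because these are arrows over
  the identity of \<open>e\<close> and of \<open>e'\<close>.\<close>

lemma S_family: "family p (wS C k) (wS D k) (S_ob k O\<^sub>A A) (S_arr k A)"
proof
  fix F assume "F \<in> cat_ob (wS C k)"
  then show "S_ob k O\<^sub>A A F \<in> cat_ob (wS D k)" using S_pres by (simp add: S_ob_def)
next
  fix e e' F G \<eta>
  assume e: "e \<le> e'" "e' \<le> p" and "F \<in> cat_ob (wS C k)" "G \<in> cat_ob (wS C k)" "\<eta> \<in> cat_hom (wS C k) F G"
  then have F: "F \<in> S_obs C k" and G: "G \<in> S_obs C k"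
    and \<eta>: "\<And>a. a \<in> Ar k \<Longrightarrow> \<eta> a \<in> weq C (fst F a) (fst G a)"
    and sq: "\<And>a b. a \<in> Ar k \<Longrightarrow> b \<in> Ar k \<Longrightarrow> a \<le> b \<Longrightarrow>
       cat_comp C (fst F a) (\<eta> b) (snd F (a, b)) = cat_comp C (fst F a) (snd G (a, b)) (\<eta> a)"
    by (auto simp: wS_hom)
  note oF = S_obs_ob[OF F] and oG = S_obs_ob[OF G]
  note dF = diagramsD[OF S_obs_diagram[OF F]] and dG = diagramsD[OF S_obs_diagram[OF G]]
  note h\<eta> = weq_hom[OF oF oG \<eta>]
  have "cat_comp D (O\<^sub>A (fst F a)) (A e e' (fst F b) (fst G b) (\<eta> b)) (A 0 0 (fst F a) (fst F b) (snd F (a, b))) =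
    cat_comp D (O\<^sub>A (fst F a)) (A 0 0 (fst G a) (fst G b) (snd G (a, b))) (A e e' (fst F a) (fst G a) (\<eta> a))"
    if ab: "a \<in> Ar k" "b \<in> Ar k" "a \<le> b" for a b
  proof -
    note o = oF[OF ab(1)] oF[OF ab(2)] oG[OF ab(1)] oG[OF ab(2)] and h = dF(3)[OF ab] dG(3)[OF ab]
      and h\<eta>' = h\<eta>[OF ab(1,1,1)] h\<eta>[OF ab(2,2,2)]
    have "A e e' (fst F a) (fst G b) (cat_comp C (fst F a) (\<eta> b) (snd F (a, b))) =
      cat_comp D (O\<^sub>A (fst F a)) (A e e' (fst F b) (fst G b) (\<eta> b)) (A 0 0 (fst F a) (fst F b) (snd F (a, b)))"
      using comp[of e e e', OF _ e o(1,2,4) h(1) h\<eta>'(2)] diag[OF _ o(1,2) h(1), of e] e by simp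
    moreover have "A e e' (fst F a) (fst G b) (cat_comp C (fst F a) (snd G (a, b)) (\<eta> a)) =
      cat_comp D (O\<^sub>A (fst F a)) (A 0 0 (fst G a) (fst G b) (snd G (a, b))) (A e e' (fst F a) (fst G a) (\<eta> a))"
      using comp[of e e' e', OF e(1) _ e(2) o(1,3,4) h\<eta>'(1) h(2)] diag[OF e(2) o(3,4) h(2)] by simp
    ultimately show ?thesis using sq[OF ab] by simp
  qed
  then show "S_arr k A e e' F G \<eta> \<in> cat_hom (wS D k) (S_ob k O\<^sub>A A F) (S_ob k O\<^sub>A A G)"
    using weq_pres[OF e oF oG \<eta>] by (auto simp: wS_hom S_arr_def S_ob_def push_def le_pairs_def)
next
  fix e F assume "e \<le> p" "F \<in> cat_ob (wS C k)"
  then show "S_arr k A e e F F (cat_id (wS C k) F) = cat_id (wS D k) (S_ob k O\<^sub>A A F)"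
    using S_obs_ob[of F C k] id by (auto simp: S_arr_def S_ob_def push_def fun_eq_iff)
next
  fix e e' e'' F G H \<eta> \<eta>'
  assume e: "e \<le> e'" "e' \<le> e''" "e'' \<le> p"
    and F: "F \<in> cat_ob (wS C k)" and G: "G \<in> cat_ob (wS C k)" and H: "H \<in> cat_ob (wS C k)"
    and \<eta>: "\<eta> \<in> cat_hom (wS C k) F G" and \<eta>': "\<eta>' \<in> cat_hom (wS C k) G H"
  have "A e e'' (fst F a) (fst H a) (cat_comp C (fst F a) (\<eta>' a) (\<eta> a)) =
    cat_comp D (O\<^sub>A (fst F a)) (A e' e'' (fst G a) (fst H a) (\<eta>' a)) (A e e' (fst F a) (fst G a) (\<eta> a))"
    if a: "a \<in> Ar k" for a
    using F G H \<eta> \<eta>' a by (intro comp[OF e] weq_hom) (auto simp: wS_hom intro: S_obs_ob)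
  then show "S_arr k A e e'' F H (cat_comp (wS C k) F \<eta>' \<eta>) =
      cat_comp (wS D k) (S_ob k O\<^sub>A A F) (S_arr k A e' e'' G H \<eta>') (S_arr k A e e' F G \<eta>)"
    by (auto simp: S_arr_def S_ob_def push_def fun_eq_iff)
qed

end

lemma pull_S_obs:
  assumes F: "F \<in> S_obs C n" and \<theta>: "mono_on {..m} \<theta>" "\<theta> ` {..m} \<subseteq> {..n}"
  shows "pull (Ar m) (map_prod \<theta> \<theta>) F \<in> S_obs C m"
proof -
  have le: "\<theta> i \<le> \<theta> j" if "i \<le> j" "j \<le> m" for i j using \<theta>(1) that by (auto simp: monotone_on_def)
  have n: "\<theta> i \<le> n" if "i \<le> m" for i using \<theta>(2) that by auto
  have m: "mono_on (Ar m) (map_prod \<theta> \<theta>)" "map_prod \<theta> \<theta> ` Ar m \<subseteq> Ar n"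
    using le n by (auto simp: monotone_on_def Ar_def)
  have d: "pull (Ar m) (map_prod \<theta> \<theta>) F \<in> diagrams (Ar m) C"
    by (rule pull_in_diagrams[OF S_obs_diagram[OF F] m])
  show ?thesis
    using F d le n by (auto simp: S_obs_def pull_def Ar_def le_pairs_def)
qed

lemma wS_act_functor:
  assumes \<theta>: "mono_on {..m} \<theta>" "\<theta> ` {..m} \<subseteq> {..n}"
  shows "is_functor (wS C n) (wS C m) (wS_act m \<theta>)"
proof -
  have le: "\<theta> i \<le> \<theta> j" if "i \<le> j" "j \<le> m" for i j using \<theta>(1) that by (auto simp: monotone_on_def)
  have n: "\<theta> i \<le> n" if "i \<le> m" for i using \<theta>(2) that by auto
  have m: "map_prod \<theta> \<theta> a \<in> Ar n" if "a \<in> Ar m" for a using that le n by (auto simp: Ar_def)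
  have m': "map_prod \<theta> \<theta> a \<le> map_prod \<theta> \<theta> b" if "a \<le> b" "a \<in> Ar m" "b \<in> Ar m" for a b
    using that le by (auto simp: Ar_def)
  show ?thesis
  proof
    fix F assume "F \<in> cat_ob (wS C n)"
    then show "fst (wS_act m \<theta>) F \<in> cat_ob (wS C m)" using pull_S_obs[OF _ \<theta>] by (simp add: wS_act_def)
  next
    fix F G \<eta> assume "\<eta> \<in> cat_hom (wS C n) F G"
    then show "snd (wS_act m \<theta>) F G \<eta> \<in> cat_hom (wS C m) (fst (wS_act m \<theta>) F) (fst (wS_act m \<theta>) G)"
      using m m' by (simp add: wS_hom wS_act_def pull_def le_pairs_def)
  next
    fix F
    show "snd (wS_act m \<theta>) F F (cat_id (wS C n) F) = cat_id (wS C m) (fst (wS_act m \<theta>) F)"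
      using m by (auto simp: wS_act_def pull_def fun_eq_iff)
  next
    fix F G H \<eta> \<eta>'
    show "snd (wS_act m \<theta>) F H (cat_comp (wS C n) F \<eta>' \<eta>) =
        cat_comp (wS C m) (fst (wS_act m \<theta>) F) (snd (wS_act m \<theta>) G H \<eta>') (snd (wS_act m \<theta>) F G \<eta>)"
      using m by (auto simp: wS_act_def pull_def fun_eq_iff)
  qed
qed

lemma slevel_wS_space [simp]: "slevel (wS_space C) n = realise (nerve (wS C n))"
  by (simp add: wS_space_def)

lemma sact_wS_space:
  "sact (wS_space C) m \<theta> = realise_map (nerve (wS C m)) (\<lambda>q. push {..q} (wS_act m \<theta>))"
  by (simp add: wS_space_def)

lemma nerve_realise_cases:
  assumes "x \<in> topspace (realise (nerve C))"
  obtains q \<sigma> u where "\<sigma> \<in> diagrams {..q} C" "u \<in> standard_simplex q" "x = pt (nerve C) (q, \<sigma>, u)"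
  using that by (rule realise_cases[OF assms, unfolded slevel_nerve topspace_discrete_topology])

lemma push_shuffle_point:
  assumes \<Phi>: "is_functor C D \<Phi>" and F: "F \<in> diagrams ({..p} \<times> {..q}) C"
    and v: "v \<in> standard_simplex p" and u: "u \<in> standard_simplex q"
  shows "realise_map (nerve D) (\<lambda>q. push {..q} \<Phi>) (shuffle_point C p q F v u) =
    shuffle_point D p q (push ({..p} \<times> {..q}) \<Phi> F) v u"
proof -
  obtain \<tau> w where c: "coupling p q v u (p + q) \<tau> w" using coupling_exists[OF v u] by blast
  then have t: "mono_on {..p + q} \<tau>" "\<tau> ` {..p + q} \<subseteq> {..p} \<times> {..q}" by (auto simp: coupling_def)
  show ?thesis
    unfolding shuffle_point_eq[OF F c] realise_map_nerve[OF \<Phi>] push_pull[OF t]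
      shuffle_point_eq[OF push_in_diagrams[OF \<Phi> F] c] ..
qed

text \<open>The map \<open>\<Xi>(v, -)\<close> on realisations at the point \<open>v\<close> of
  \<open>\<Delta>\<^sup>p\<close>.\<close>

definition K_family ::
  "nat \<Rightarrow> ('p, 'n) wcat \<Rightarrow> ('o \<Rightarrow> 'p) \<Rightarrow> (nat \<Rightarrow> nat \<Rightarrow> 'o \<Rightarrow> 'o \<Rightarrow> 'm \<Rightarrow> 'n) \<Rightarrow> (nat \<Rightarrow> real) \<Rightarrow>
   ('o, 'm) S_point \<Rightarrow> ('p, 'n) S_point" where
  "K_family p D O\<^sub>A A v = realise_map (wS_space D) (\<lambda>k. level_map p (wS D k) (S_ob k O\<^sub>A A) (S_arr k A) v)"

context exact_family begin

text \<open>The maps on the levels \<open>wS\<^sub>k\<close> are compatible with the simplicial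
  structure in \<open>k\<close>, since the structure maps only reindex the diagrams and the family
  acts entrywise.\<close>

lemma level_map_natural:
  assumes \<theta>: "mono_on {..m} \<theta>" "\<theta> ` {..m} \<subseteq> {..n}" and x: "x \<in> topspace (realise (nerve (wS C n)))"
    and v: "v \<in> standard_simplex p"
  shows "level_map p (wS D m) (S_ob m O\<^sub>A A) (S_arr m A) v (sact (wS_space C) m \<theta> x) =
    sact (wS_space D) m \<theta> (level_map p (wS D n) (S_ob n O\<^sub>A A) (S_arr n A) v x)"
proof -
  obtain q \<sigma> u where \<sigma>: "\<sigma> \<in> diagrams {..q} (wS C n)" "u \<in> standard_simplex q"
    and x: "x = pt (nerve (wS C n)) (q, \<sigma>, u)"
    using nerve_realise_cases[OF x] by blast
  have le: "\<theta> i \<le> \<theta> j" if "i \<le> j" "j \<le> m" for i j using \<theta>(1) that by (auto simp: monotone_on_def)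
  have r: "\<theta> i \<le> n" if "i \<le> m" for i using \<theta>(2) that by auto
  have "prism_of p q (S_ob m O\<^sub>A A) (S_arr m A) (push {..q} (wS_act m \<theta>) \<sigma>) =
    push ({..p} \<times> {..q}) (wS_act m \<theta>) (prism_of p q (S_ob n O\<^sub>A A) (S_arr n A) \<sigma>)"
    using le r by (auto simp: prism_of_def push_def fun_eq_iff le_pairs_def restrict_def wS_act_def pull_def
        S_ob_def S_arr_def Ar_def)
  then show ?thesis
    unfolding x sact_wS_space realise_map_nerve[OF wS_act_functor[OF \<theta>]] family.level_map_pt[OF S_family v]
      push_shuffle_point[OF wS_act_functor[OF \<theta>] family.prism_of_in_diagrams[OF S_family \<sigma>(1)] v \<sigma>(2)]
    by simp
qed

lemma K_family_pt:
  assumes "v \<in> standard_simplex p"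
  shows "K_family p D O\<^sub>A A v (pt (wS_space C) (k, x, u)) =
    pt (wS_space D) (k, level_map p (wS D k) (S_ob k O\<^sub>A A) (S_arr k A) v x, u)"
  unfolding K_family_def
proof (rule realise_map_pt)
  fix m n :: nat and \<theta> x
  assume "mono_on {..m} \<theta>" "\<theta> ` {..m} \<subseteq> {..n}" "x \<in> topspace (slevel (wS_space C) n)"
  then show "level_map p (wS D m) (S_ob m O\<^sub>A A) (S_arr m A) v (sact (wS_space C) m \<theta> x) =
    sact (wS_space D) m \<theta> (level_map p (wS D n) (S_ob n O\<^sub>A A) (S_arr n A) v x)"
    unfolding slevel_wS_space by (rule level_map_natural[OF _ _ _ assms])
next
  fix n :: nat and x assume "x \<in> topspace (slevel (wS_space C) n)"
  then show "level_map p (wS D n) (S_ob n O\<^sub>A A) (S_arr n A) v x \<in> topspace (slevel (wS_space D) n)"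
    unfolding slevel_wS_space by (rule family.level_map_in_realise[OF S_family assms])
qed

text \<open>Two applications of the cellwise criterion for maps out of a product with a realisation,
  one for the nerve direction and one for the \<open>S\<close>-direction.\<close>

lemma continuous_map_K_family:
  "continuous_map (prod_topology (simplex_top p) (realise (wS_space C))) (realise (wS_space D))
    (\<lambda>(v, y). K_family p D O\<^sub>A A v y)"
  unfolding K_family_def realise_map_def
proof (rule continuous_map_descend)
  show "locally_compact_space (simplex_top p)"
    by (rule compact_imp_locally_compact_space) (rule compact_simplex_top)
  show "Hausdorff_space (simplex_top p)" by (rule Hausdorff_simplex_top)
  let ?g = "\<lambda>v n. level_map p (wS D n) (S_ob n O\<^sub>A A) (S_arr n A) v"
  show "(\<lambda>(n, x, u). pt (wS_space D) (n, ?g v n x, u)) a = (\<lambda>(n, x, u). pt (wS_space D) (n, ?g v n x, u)) b"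
    if "v \<in> topspace (simplex_top p)" and ab: "glue (wS_space C) a b" for v a b
  proof -
    have v: "v \<in> standard_simplex p" using that by (simp add: topspace_standard_simplex)
    obtain k x u k' x' u' where ab': "a = (k, x, u)" "b = (k', x', u')" by (metis prod.exhaust)
    show ?thesis
      using glue_imp_pt_eq[OF ab] K_family_pt[OF v, of k x u] K_family_pt[OF v, of k' x' u'] by (simp add: ab')
  qed
  fix n
  let ?T = "prod_topology (simplex_top p) (prod_topology (slevel (wS_space C) n) (simplex_top n))"
  have x: "continuous_map ?T (realise (nerve (wS C n))) (\<lambda>z. fst (snd z))"
    using continuous_map_compose[OF continuous_map_snd continuous_map_fst] unfolding o_def slevel_wS_space .
  have 3: "continuous_map ?T (simplex_top n) (\<lambda>z. snd (snd z))"
    using continuous_map_compose[OF continuous_map_snd continuous_map_snd] unfolding o_def .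
  have 1: "continuous_map ?T (prod_topology (simplex_top p) (realise (nerve (wS C n)))) (\<lambda>z. (fst z, fst (snd z)))"
    by (rule continuous_map_pairedI[OF continuous_map_fst x])
  have 2: "continuous_map ?T (realise (nerve (wS D n))) (\<lambda>(v, x, u). ?g v n x)"
    using continuous_map_compose[OF 1 family.continuous_map_level_map[OF S_family]]
    by (simp add: o_def case_prod_unfold)
  from continuous_map_pairedI[OF 2 3]
  have "continuous_map ?T (prod_topology (slevel (wS_space D) n) (simplex_top n)) (\<lambda>(v, x, u). (?g v n x, u))"
    by (simp add: case_prod_unfold)
  from continuous_map_compose[OF this continuous_map_component_injection[of n UNIV
        "\<lambda>n. prod_topology (slevel (wS_space D) n) (simplex_top n)"]]
  have "continuous_map ?T (cells (wS_space D)) (\<lambda>(v, x, u). (n, ?g v n x, u))"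
    by (simp add: cells_def o_def case_prod_unfold)
  from continuous_map_compose[OF this quotient_imp_continuous_map[OF quotient_map_realise]]
  show "continuous_map ?T (realise (wS_space D)) (\<lambda>(v, x, u). (\<lambda>(n, x, u). pt (wS_space D) (n, ?g v n x, u)) (n, x, u))"
    by (simp add: o_def case_prod_unfold)
qed

end

section \<open>Laws for families and K-theory maps\<close>

abbreviation vertex :: "nat \<Rightarrow> nat \<Rightarrow> real" where
  "vertex e \<equiv> (\<lambda>i. if i = e then 1 else 0)"

definition edge :: "real \<Rightarrow> nat \<Rightarrow> real" where
  "edge s = (\<lambda>e. if e = 0 then 1 - s else if e = 1 then s else 0)"

lemma edge_in_simplex: "s \<in> {0..1} \<Longrightarrow> edge s \<in> standard_simplex 1"
  by (auto simp: standard_simplex_def edge_def)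

subsection \<open>Composition, reindexing and congruence of families\<close>

definition precomp where
  "precomp \<Phi> A = (\<lambda>e e' X Y h. A e e' (fst \<Phi> X) (fst \<Phi> Y) (snd \<Phi> X Y h))"

definition postcomp where
  "postcomp \<Psi> O\<^sub>A A = (\<lambda>e e' X Y h. snd \<Psi> (O\<^sub>A X) (O\<^sub>A Y) (A e e' X Y h))"

lemma push_push:
  "push J \<Psi> (push J \<Phi> F) = push J (fst \<Psi> \<circ> fst \<Phi>, \<lambda>X Y h. snd \<Psi> (fst \<Phi> X) (fst \<Phi> Y) (snd \<Phi> X Y h)) F"
  by (auto simp: push_def fun_eq_iff le_pairs_def)

lemma exact_family_precomp:
  assumes \<Phi>: "exact_functor C C' \<Phi>" and A: "exact_family p C' D O\<^sub>A A"
  shows "exact_family p C D (O\<^sub>A \<circ> fst \<Phi>) (precomp \<Phi> A)"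
proof -
  interpret \<Phi>: exact_family 0 C C' "fst \<Phi>" "\<lambda>_ _. snd \<Phi>" by fact
  interpret A: exact_family p C' D O\<^sub>A A by fact
  note \<Phi>hom = \<Phi>.hom[of 0 0, simplified] and \<Phi>weq = \<Phi>.weq_pres[of 0 0, simplified]
    and \<Phi>id = \<Phi>.id[of 0, simplified] and \<Phi>comp = \<Phi>.comp[of 0 0 0, simplified]
  show ?thesis
  proof
    fix F k assume "F \<in> S_obs C k"
    from A.S_pres[OF \<Phi>.S_pres[OF this]]
    show "push (Ar k) (O\<^sub>A \<circ> fst \<Phi>, precomp \<Phi> A 0 0) F \<in> S_obs D k"
      by (simp add: push_push precomp_def)
  next
    fix e e' e'' X Y Z h g
    assume *: "e \<le> e'" "e' \<le> e''" "e'' \<le> p" "X \<in> cat_ob C" "Y \<in> cat_ob C" "Z \<in> cat_ob C"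
      "h \<in> cat_hom C X Y" "g \<in> cat_hom C Y Z"
    show "precomp \<Phi> A e e'' X Z (cat_comp C X g h) =
      cat_comp D ((O\<^sub>A \<circ> fst \<Phi>) X) (precomp \<Phi> A e' e'' Y Z g) (precomp \<Phi> A e e' X Y h)"
      unfolding precomp_def o_apply \<Phi>comp[OF *(4-8)] by (intro A.comp \<Phi>.ob \<Phi>hom *)
  next
    fix e X Y h assume *: "e \<le> p" "X \<in> cat_ob C" "Y \<in> cat_ob C" "h \<in> cat_hom C X Y"
    show "precomp \<Phi> A e e X Y h = precomp \<Phi> A 0 0 X Y h"
      unfolding precomp_def by (intro A.diag \<Phi>.ob \<Phi>hom *)
  qed (simp_all add: precomp_def \<Phi>.ob A.ob \<Phi>hom A.hom \<Phi>id A.id \<Phi>.weq_hom \<Phi>weq A.weq_pres)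
qed

lemma exact_family_postcomp:
  assumes A: "exact_family p C D O\<^sub>A A" and \<Psi>: "exact_functor D D' \<Psi>"
  shows "exact_family p C D' (fst \<Psi> \<circ> O\<^sub>A) (postcomp \<Psi> O\<^sub>A A)"
proof -
  interpret \<Psi>: exact_family 0 D D' "fst \<Psi>" "\<lambda>_ _. snd \<Psi>" by fact
  interpret A: exact_family p C D O\<^sub>A A by fact
  note \<Psi>hom = \<Psi>.hom[of 0 0, simplified] and \<Psi>weq = \<Psi>.weq_pres[of 0 0, simplified]
    and \<Psi>id = \<Psi>.id[of 0, simplified] and \<Psi>comp = \<Psi>.comp[of 0 0 0, simplified]
  show ?thesis
  proof
    fix F k assume "F \<in> S_obs C k"
    from \<Psi>.S_pres[OF A.S_pres[OF this]]
    show "push (Ar k) (fst \<Psi> \<circ> O\<^sub>A, postcomp \<Psi> O\<^sub>A A 0 0) F \<in> S_obs D' k"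
      by (simp add: push_push postcomp_def)
  next
    fix e e' e'' X Y Z h g
    assume *: "e \<le> e'" "e' \<le> e''" "e'' \<le> p" "X \<in> cat_ob C" "Y \<in> cat_ob C" "Z \<in> cat_ob C"
      "h \<in> cat_hom C X Y" "g \<in> cat_hom C Y Z"
    have h: "A e e' X Y h \<in> cat_hom D (O\<^sub>A X) (O\<^sub>A Y)" "A e' e'' Y Z g \<in> cat_hom D (O\<^sub>A Y) (O\<^sub>A Z)"
      using * by (intro A.hom; simp)+
    show "postcomp \<Psi> O\<^sub>A A e e'' X Z (cat_comp C X g h) =
      cat_comp D' ((fst \<Psi> \<circ> O\<^sub>A) X) (postcomp \<Psi> O\<^sub>A A e' e'' Y Z g) (postcomp \<Psi> O\<^sub>A A e e' X Y h)"
      unfolding postcomp_def A.comp[OF *] o_apply by (intro \<Psi>comp A.ob * h)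
  next
    fix e e' X Y h assume "e \<le> e'" "e' \<le> p" "X \<in> cat_ob C" "Y \<in> cat_ob C" "h \<in> cat_hom C X Y"
    then show "postcomp \<Psi> O\<^sub>A A e e' X Y h \<in> cat_hom D' ((fst \<Psi> \<circ> O\<^sub>A) X) ((fst \<Psi> \<circ> O\<^sub>A) Y)"
      by (simp add: postcomp_def \<Psi>hom A.hom A.ob)
  next
    fix e X Y h assume *: "e \<le> p" "X \<in> cat_ob C" "Y \<in> cat_ob C" "h \<in> cat_hom C X Y"
    show "postcomp \<Psi> O\<^sub>A A e e X Y h = postcomp \<Psi> O\<^sub>A A 0 0 X Y h"
      unfolding postcomp_def A.diag[OF *] ..
  qed (simp_all add: postcomp_def \<Psi>.ob A.ob \<Psi>id A.id A.weq_hom \<Psi>weq A.weq_pres)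
qed

lemma exact_family_reindex:
  assumes A: "exact_family p C D O\<^sub>A A" and f: "mono_on {..p'} f" "f ` {..p'} \<subseteq> {..p}"
  shows "exact_family p' C D O\<^sub>A (\<lambda>e e'. A (f e) (f e'))"
proof -
  interpret A: exact_family p C D O\<^sub>A A by fact
  have le: "f i \<le> f j" if "i \<le> j" "j \<le> p'" for i j using f(1) that by (auto simp: monotone_on_def)
  have r: "f i \<le> p" if "i \<le> p'" for i using f(2) that by auto
  show ?thesis
  proof
    fix F k assume F: "F \<in> S_obs C k"
    note d = diagramsD[OF S_obs_diagram[OF F]]
    have "push (Ar k) (O\<^sub>A, A (f 0) (f 0)) F = push (Ar k) (O\<^sub>A, A 0 0) F"
      using A.diag[OF r[of 0] S_obs_ob[OF F] S_obs_ob[OF F] d(3)]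
      by (auto simp: push_def fun_eq_iff le_pairs_def)
    then show "push (Ar k) (O\<^sub>A, A (f 0) (f 0)) F \<in> S_obs D k" using A.S_pres[OF F] by simp
  next
    fix e X Y h assume *: "e \<le> p'" "X \<in> cat_ob C" "Y \<in> cat_ob C" "h \<in> cat_hom C X Y"
    show "A (f e) (f e) X Y h = A (f 0) (f 0) X Y h"
      using A.diag[OF r[OF *(1)] *(2-4)] A.diag[OF r[of 0] *(2-4)] by simp
  next
    fix e e' e'' X Y Z h g
    assume "e \<le> e'" "e' \<le> e''" "e'' \<le> p'" "X \<in> cat_ob C" "Y \<in> cat_ob C" "Z \<in> cat_ob C"
      "h \<in> cat_hom C X Y" "g \<in> cat_hom C Y Z"
    then show "A (f e) (f e'') X Z (cat_comp C X g h) = cat_comp D (O\<^sub>A X) (A (f e') (f e'') Y Z g) (A (f e) (f e') X Y h)"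
      by (intro A.comp le r) auto
  qed (use le r in \<open>auto intro!: A.ob A.hom A.id A.weq_hom A.weq_pres\<close>)
qed

lemma K_family_cases:
  assumes "y \<in> topspace (realise (wS_space C))"
  obtains k q \<sigma> u u' where "\<sigma> \<in> diagrams {..q} (wS C k)" "u \<in> standard_simplex q" "u' \<in> standard_simplex k"
    "y = pt (wS_space C) (k, pt (nerve (wS C k)) (q, \<sigma>, u), u')"
  using realise_cases[OF assms] nerve_realise_cases unfolding slevel_wS_space by metis

lemma wS_diagramD:
  assumes "\<sigma> \<in> diagrams {..q} (wS C k)" "a \<in> Ar k"
  shows "j \<le> q \<Longrightarrow> fst \<sigma> j \<in> S_obs C k"
    and "j \<le> q \<Longrightarrow> fst (fst \<sigma> j) a \<in> cat_ob C"
    and "i \<le> j \<Longrightarrow> j \<le> q \<Longrightarrow> snd \<sigma> (i, j) a \<in> weq C (fst (fst \<sigma> i) a) (fst (fst \<sigma> j) a)"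
proof -
  note d = diagramsD[OF assms(1)]
  show *: "fst \<sigma> j \<in> S_obs C k" if "j \<le> q" for j using PiE_mem[OF d(1), of j] that by simp
  show "fst (fst \<sigma> j) a \<in> cat_ob C" if "j \<le> q" for j using S_obs_ob[OF *[OF that] assms(2)] .
  show "snd \<sigma> (i, j) a \<in> weq C (fst (fst \<sigma> i) a) (fst (fst \<sigma> j) a)" if "i \<le> j" "j \<le> q" for i j
    using d(3)[of i j] that assms(2) by (simp add: wS_hom)
qed

context exact_family begin

lemma K_family_pt2:
  assumes "v \<in> standard_simplex p"
  shows "K_family p D O\<^sub>A A v (pt (wS_space C) (k, pt (nerve (wS C k)) (q, \<sigma>, u), u')) =
    pt (wS_space D) (k, shuffle_point (wS D k) p q (prism_of p q (S_ob k O\<^sub>A A) (S_arr k A) \<sigma>) v u, u')"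
  unfolding K_family_pt[OF assms] family.level_map_pt[OF S_family assms] ..

lemma K_family_in_realise:
  assumes "v \<in> standard_simplex p" "y \<in> topspace (realise (wS_space C))"
  shows "K_family p D O\<^sub>A A v y \<in> topspace (realise (wS_space D))"
  using funcset_mem[OF continuous_map_funspace[OF continuous_map_K_family], of "(v, y)"] assms
  by (simp add: topspace_standard_simplex)

lemma prism_of_in_S_diagrams:
  assumes "\<sigma> \<in> diagrams {..q} (wS C k)"
  shows "prism_of p q (S_ob k O\<^sub>A A) (S_arr k A) \<sigma> \<in> diagrams ({..p} \<times> {..q}) (wS D k)"
  by (rule family.prism_of_in_diagrams[OF S_family assms])

text \<open>Restriction of the family along a monotone map of index categories is restriction of
  \<open>\<Xi>\<close> along the affine map of simplices.  This is what identifies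
  \<open>\<Xi>\<close> along an edge of \<open>\<Delta>\<^sup>2\<close> with the map given by one
  automorphism.\<close>

lemma K_family_reindex:
  assumes f: "mono_on {..p'} f" "f ` {..p'} \<subseteq> {..p}"
    and v: "v \<in> standard_simplex p'" and y: "y \<in> topspace (realise (wS_space C))"
  shows "K_family p' D O\<^sub>A (\<lambda>e e'. A (f e) (f e')) v y = K_family p D O\<^sub>A A (simplex_push p' f v) y"
proof -
  interpret R: exact_family p' C D O\<^sub>A "\<lambda>e e'. A (f e) (f e')"
    by (rule exact_family_reindex[OF exact_family_axioms f])
  obtain k q \<sigma> u u' where \<sigma>: "\<sigma> \<in> diagrams {..q} (wS C k)" "u \<in> standard_simplex q" "u' \<in> standard_simplex k"
    "y = pt (wS_space C) (k, pt (nerve (wS C k)) (q, \<sigma>, u), u')"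
    using K_family_cases[OF y] by metis
  have id: "mono_on {..q} (\<lambda>e. e)" "(\<lambda>e. e) ` {..q} \<subseteq> {..q}" by (auto simp: monotone_on_def)
  have f0: "f 0 \<le> p" using f(2) by auto
  note o = wS_diagramD(1)[OF \<sigma>(1)]
  have ob: "S_ob k O\<^sub>A A F = S_ob k O\<^sub>A (\<lambda>e e'. A (f e) (f e')) F" if "F \<in> S_obs C k" for F
    using diag[OF f0 S_obs_ob[OF that] S_obs_ob[OF that] diagramsD(3)[OF S_obs_diagram[OF that]]]
    by (auto simp: S_ob_def push_def fun_eq_iff le_pairs_def)
  have F: "fst \<sigma> j \<in> S_obs C k" if "j \<le> q" for j
    using wS_diagramD(1)[OF \<sigma>(1), of "(0, 0)"] that by (simp add: Ar_def)
  have "prism_of p' q (S_ob k O\<^sub>A (\<lambda>e e'. A (f e) (f e'))) (S_arr k (\<lambda>e e'. A (f e) (f e'))) \<sigma> =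
    prism_of p' q (S_ob k O\<^sub>A A) (\<lambda>e e'. S_arr k A (f e) (f e')) (pull {..q} (\<lambda>e. e) \<sigma>)"
    by (rule prism_of_cong) (simp_all add: S_arr_def pull_def le_pairs_def ob[OF F])
  then show ?thesis
    unfolding \<sigma>(4) R.K_family_pt2[OF v] K_family_pt2[OF simplex_push_in_simplex[OF f(2) v]]
    using shuffle_point_push[OF prism_of_in_S_diagrams[OF \<sigma>(1)] f id v \<sigma>(2)]
    unfolding pull_prism_of[OF f id] simplex_push_id[OF \<sigma>(2)] by simp
qed

lemma K_family_cong:
  assumes A': "exact_family p C D O\<^sub>A' A'"
    and eq: "\<And>X. X \<in> cat_ob C \<Longrightarrow> O\<^sub>A X = O\<^sub>A' X"
      "\<And>e e' X Y h. \<lbrakk>e \<le> e'; e' \<le> p; X \<in> cat_ob C; Y \<in> cat_ob C; h \<in> cat_hom C X Y\<rbrakk> \<Longrightarrow> A e e' X Y h = A' e e' X Y h"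
    and v: "v \<in> standard_simplex p" and y: "y \<in> topspace (realise (wS_space C))"
  shows "K_family p D O\<^sub>A A v y = K_family p D O\<^sub>A' A' v y"
proof -
  interpret A': exact_family p C D O\<^sub>A' A' by fact
  obtain k q \<sigma> u u' where \<sigma>: "\<sigma> \<in> diagrams {..q} (wS C k)" "u \<in> standard_simplex q" "u' \<in> standard_simplex k"
    "y = pt (wS_space C) (k, pt (nerve (wS C k)) (q, \<sigma>, u), u')"
    using K_family_cases[OF y] by metis
  have F: "fst \<sigma> j \<in> S_obs C k" if "j \<le> q" for j
    using wS_diagramD(1)[OF \<sigma>(1), of "(0, 0)"] that by (simp add: Ar_def)
  have ob: "S_ob k O\<^sub>A A F = S_ob k O\<^sub>A' A' F" if "F \<in> S_obs C k" for F
    using S_obs_ob[OF that] diagramsD(3)[OF S_obs_diagram[OF that]]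
    by (auto simp: S_ob_def push_def fun_eq_iff le_pairs_def eq)
  have "prism_of p q (S_ob k O\<^sub>A A) (S_arr k A) \<sigma> = prism_of p q (S_ob k O\<^sub>A' A') (S_arr k A') \<sigma>"
    by (rule prism_of_cong)
      (auto simp: ob[OF F] S_arr_def fun_eq_iff wS_diagramD[OF \<sigma>(1)] intro!: eq weq_hom)
  then show ?thesis unfolding \<sigma>(4) K_family_pt2[OF v] A'.K_family_pt2[OF v] by simp
qed

end

lemma prism_of_0: "pull {..q} (\<lambda>j. (0, j)) (prism_of 0 q O\<^sub>A A \<sigma>) = push {..q} (O\<^sub>A, A 0 0) \<sigma>"
  by (auto simp: pull_def prism_of_def push_def fun_eq_iff le_pairs_def)

lemma exact_functor_pt2:
  assumes \<Phi>: "exact_functor C D \<Phi>" and \<sigma>: "\<sigma> \<in> diagrams {..q} (wS C k)" "u \<in> standard_simplex q"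
  shows "K_family 0 D (fst \<Phi>) (\<lambda>_ _. snd \<Phi>) (vertex 0) (pt (wS_space C) (k, pt (nerve (wS C k)) (q, \<sigma>, u), u')) =
    pt (wS_space D) (k, pt (nerve (wS D k)) (q, push {..q} (wS_fctr k \<Phi>) \<sigma>, u), u')"
proof -
  interpret \<Phi>: exact_family 0 C D "fst \<Phi>" "\<lambda>_ _. snd \<Phi>" by fact
  have v: "vertex 0 \<in> standard_simplex 0" by simp
  show ?thesis
    unfolding \<Phi>.K_family_pt2[OF v] shuffle_point_vertex[OF \<Phi>.prism_of_in_S_diagrams[OF \<sigma>(1)] le_refl \<sigma>(2)]
      prism_of_0 wS_fctr_eq ..
qed

lemma K_family_precomp:
  assumes \<Phi>: "exact_functor C C' \<Phi>" and A: "exact_family p C' D O\<^sub>A A"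
    and v: "v \<in> standard_simplex p" and y: "y \<in> topspace (realise (wS_space C))"
  shows "K_family p D O\<^sub>A A v (K_family 0 C' (fst \<Phi>) (\<lambda>_ _. snd \<Phi>) (vertex 0) y) =
    K_family p D (O\<^sub>A \<circ> fst \<Phi>) (precomp \<Phi> A) v y"
proof -
  interpret A: exact_family p C' D O\<^sub>A A by fact
  interpret P: exact_family p C D "O\<^sub>A \<circ> fst \<Phi>" "precomp \<Phi> A" by (rule exact_family_precomp[OF \<Phi> A])
  obtain k q \<sigma> u u' where \<sigma>: "\<sigma> \<in> diagrams {..q} (wS C k)" "u \<in> standard_simplex q" "u' \<in> standard_simplex k"
    "y = pt (wS_space C) (k, pt (nerve (wS C k)) (q, \<sigma>, u), u')"
    using K_family_cases[OF y] by metis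
  have "prism_of p q (S_ob k O\<^sub>A A) (S_arr k A) (push {..q} (wS_fctr k \<Phi>) \<sigma>) =
    prism_of p q (S_ob k (O\<^sub>A \<circ> fst \<Phi>) (precomp \<Phi> A)) (S_arr k (precomp \<Phi> A)) \<sigma>"
    by (rule prism_of_cong) (auto simp: push_push precomp_def wS_fctr_eq S_ob_def S_arr_def push_def fun_eq_iff le_pairs_def)
  then show ?thesis
    unfolding \<sigma>(4) exact_functor_pt2[OF \<Phi> \<sigma>(1,2)] A.K_family_pt2[OF v] P.K_family_pt2[OF v] by simp
qed

lemma K_family_postcomp:
  assumes A: "exact_family p C D O\<^sub>A A" and \<Psi>: "exact_functor D D' \<Psi>"
    and v: "v \<in> standard_simplex p" and y: "y \<in> topspace (realise (wS_space C))"
  shows "K_family 0 D' (fst \<Psi>) (\<lambda>_ _. snd \<Psi>) (vertex 0) (K_family p D O\<^sub>A A v y) =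
    K_family p D' (fst \<Psi> \<circ> O\<^sub>A) (postcomp \<Psi> O\<^sub>A A) v y"
proof -
  interpret A: exact_family p C D O\<^sub>A A by fact
  interpret P: exact_family p C D' "fst \<Psi> \<circ> O\<^sub>A" "postcomp \<Psi> O\<^sub>A A" by (rule exact_family_postcomp[OF A \<Psi>])
  interpret \<Psi>: exact_family 0 D D' "fst \<Psi>" "\<lambda>_ _. snd \<Psi>" by fact
  obtain k q \<sigma> u u' where \<sigma>: "\<sigma> \<in> diagrams {..q} (wS C k)" "u \<in> standard_simplex q" "u' \<in> standard_simplex k"
    "y = pt (wS_space C) (k, pt (nerve (wS C k)) (q, \<sigma>, u), u')"
    using K_family_cases[OF y] by metis
  let ?F = "prism_of p q (S_ob k O\<^sub>A A) (S_arr k A) \<sigma>"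
  obtain \<tau> w where c: "coupling p q v u (p + q) \<tau> w" using coupling_exists[OF v \<sigma>(2)] by blast
  then have t: "mono_on {..p + q} \<tau>" "\<tau> ` {..p + q} \<subseteq> {..p} \<times> {..q}" "w \<in> standard_simplex (p + q)"
    by (auto simp: coupling_def)
  have "push ({..p} \<times> {..q}) (wS_fctr k \<Psi>) ?F =
    prism_of p q (S_ob k (fst \<Psi> \<circ> O\<^sub>A) (postcomp \<Psi> O\<^sub>A A)) (S_arr k (postcomp \<Psi> O\<^sub>A A)) \<sigma>"
    by (auto simp: push_def prism_of_def wS_fctr_def S_ob_def S_arr_def postcomp_def fun_eq_iff le_pairs_def restrict_def)
  then show ?thesis
    unfolding \<sigma>(4) A.K_family_pt2[OF v] P.K_family_pt2[OF v]
      shuffle_point_eq[OF A.prism_of_in_S_diagrams[OF \<sigma>(1)] c]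
      exact_functor_pt2[OF \<Psi> pull_in_diagrams[OF A.prism_of_in_S_diagrams[OF \<sigma>(1)] t(1,2)] t(3)]
      shuffle_point_eq[OF P.prism_of_in_S_diagrams[OF \<sigma>(1)] c] push_pull[OF t(1,2)]
    by simp
qed

lemma sact_wS_space_in_realise:
  assumes \<theta>: "mono_on {..m} \<theta>" "\<theta> ` {..m} \<subseteq> {..n}" and x: "x \<in> topspace (realise (nerve (wS C n)))"
  shows "sact (wS_space C) m \<theta> x \<in> topspace (realise (nerve (wS C m)))"
proof -
  obtain q \<sigma> u where "\<sigma> \<in> diagrams {..q} (wS C n)" "u \<in> standard_simplex q" "x = pt (nerve (wS C n)) (q, \<sigma>, u)"
    using nerve_realise_cases[OF x] by blast
  then show ?thesis
    by (simp add: sact_wS_space realise_map_nerve[OF wS_act_functor[OF \<theta>]] pt_in_realise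
        push_in_diagrams[OF wS_act_functor[OF \<theta>]])
qed

lemma (in exact_family) realise_map_eq_K_family:
  assumes v: "v \<in> standard_simplex p"
    and g: "\<And>k x. x \<in> topspace (realise (nerve (wS C k))) \<Longrightarrow>
      g k x = level_map p (wS D k) (S_ob k O\<^sub>A A) (S_arr k A) v x"
    and y: "y \<in> topspace (realise (wS_space C))"
  shows "realise_map (wS_space D) g y = K_family p D O\<^sub>A A v y"
proof -
  obtain k x u where x: "x \<in> topspace (realise (nerve (wS C k)))" and y: "y = pt (wS_space C) (k, x, u)"
    using realise_cases[OF y] unfolding slevel_wS_space by metis
  have "realise_map (wS_space D) g (pt (wS_space C) (k, x, u)) = pt (wS_space D) (k, g k x, u)"
    by (rule realise_map_pt)
      (simp_all add: g sact_wS_space_in_realise level_map_natural[OF _ _ _ v] family.level_map_in_realise[OF S_family v])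
  then show ?thesis unfolding y K_family_pt[OF v] g[OF x] .
qed

lemma K_map_eq_K_family:
  assumes \<Phi>: "exact_functor C D \<Phi>" and y: "\<omega> r \<in> topspace (realise (wS_space C))" and r: "r \<in> {0..1}"
  shows "K_map D \<Phi> \<omega> r = K_family 0 D (fst \<Phi>) (\<lambda>_ _. snd \<Phi>) (vertex 0) (\<omega> r)"
proof -
  interpret exact_family 0 C D "fst \<Phi>" "\<lambda>_ _. snd \<Phi>" by fact
  have v: "vertex 0 \<in> standard_simplex 0" by simp
  have "realise_map (nerve (wS D k)) (\<lambda>q. push {..q} (wS_fctr k \<Phi>)) x =
      level_map 0 (wS D k) (S_ob k (fst \<Phi>) (\<lambda>_ _. snd \<Phi>)) (S_arr k (\<lambda>_ _. snd \<Phi>)) (vertex 0) x"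
    if x: "x \<in> topspace (realise (nerve (wS C k)))" for k x
  proof -
    obtain q \<sigma> u where \<sigma>: "\<sigma> \<in> diagrams {..q} (wS C k)" "u \<in> standard_simplex q" and x: "x = pt (nerve (wS C k)) (q, \<sigma>, u)"
      using nerve_realise_cases[OF x] by blast
    have f: "is_functor (wS C k) (wS D k) (wS_fctr k \<Phi>)"
      using S_family[of k] by (simp add: wS_fctr_eq family_def S_arr_def)
    show ?thesis
      unfolding x family.level_map_pt[OF S_family v] realise_map_nerve[OF f]
        shuffle_point_vertex[OF prism_of_in_S_diagrams[OF \<sigma>(1)] le_refl \<sigma>(2)] prism_of_0
      unfolding wS_fctr_eq ..
  qed
  from realise_map_eq_K_family[OF v this y] show ?thesis using r by (simp add: K_map_def)
qed

subsection \<open>Coassembly as a family\<close>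

text \<open>The tautological family on \<open>Aut\<close> over \<open>[1]\<close>: the nontrivial
  arrow of \<open>[1]\<close> at an object \<open>(X, f)\<close> is \<open>f\<close>.\<close>

definition self_map :: "('o, 'm) wcat \<Rightarrow> nat \<Rightarrow> nat \<Rightarrow> 'o \<times> 'm \<Rightarrow> 'o \<times> 'm \<Rightarrow> 'm \<Rightarrow> 'm" where
  "self_map D e e' X Y h = (if e = e' then h else cat_comp D (fst X) h (snd X))"

lemma prism_point_eq: "prism_point D q F s u = shuffle_point D 1 q F (edge s) u"
proof -
  have "{0, 1} = {..1::nat}" by auto
  then show ?thesis
    unfolding prism_point_def shuffle_point_def coupling_def edge_def by (simp only: conj_assoc)
qed

text \<open>Coassembly is built from the functors \<open>[1] \<times> [q] \<rightarrow> wS\<^sub>k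
  D\<close> that belong to the tautological family, and the point of the prism over \<open>s\<close>
  is the coupling with the distribution \<open>(1 - s, s)\<close>.\<close>

lemma coassembly_eq_K_family:
  assumes self: "exact_family 1 (aut_cat D) D fst (self_map D)"
    and y: "\<omega> r \<in> topspace (realise (wS_space (aut_cat D)))" and r: "r \<in> {0..1}" and s: "s \<in> {0..1}"
  shows "coassembly D \<omega> s r = K_family 1 D fst (self_map D) (edge s) (\<omega> r)"
proof -
  interpret exact_family 1 "aut_cat D" D fst "self_map D" by fact
  note v = edge_in_simplex[OF s]
  have *: "prism (wS D k) q (push {..q} (aut_to_self k) \<sigma>) = prism_of 1 q (S_ob k fst (self_map D)) (S_arr k (self_map D)) \<sigma>"
    if \<sigma>: "\<sigma> \<in> diagrams {..q} (wS (aut_cat D) k)" for q k \<sigma>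
  proof -
    have ext: "snd \<sigma> (i, j) \<in> extensional (Ar k)" if "i \<le> j" "j \<le> q" for i j
      using diagramsD(3)[OF \<sigma>, of i j] that by (simp add: wS_hom)
    have "snd \<sigma> (i, j) a = undefined" if "i \<le> j" "j \<le> q" "a \<notin> Ar k" for i j a
      using extensional_arb[OF ext[OF that(1,2)] that(3)] .
    then show ?thesis
      by (auto simp: prism_def prism_of_def push_def aut_to_self_def S_ob_def S_arr_def self_map_def forget_end_def
          fun_eq_iff le_pairs_def restrict_def)
  qed
  have "coassembly_level D k s x = level_map 1 (wS D k) (S_ob k fst (self_map D)) (S_arr k (self_map D)) (edge s) x"
    if x: "x \<in> topspace (realise (nerve (wS (aut_cat D) k)))" for k x
  proof -
    let ?f = "\<lambda>(q, \<sigma>, u). prism_point (wS D k) q (prism (wS D k) q (push {..q} (aut_to_self k) \<sigma>)) s u"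
    let ?g = "\<lambda>(q, \<sigma>, u). shuffle_point (wS D k) 1 q (prism_of 1 q (S_ob k fst (self_map D)) (S_arr k (self_map D)) \<sigma>) (edge s) u"
    have fg: "?f (q, \<sigma>, u) = ?g (q, \<sigma>, u)" if "\<sigma> \<in> diagrams {..q} (wS (aut_cat D) k)" for q \<sigma> u
      by (simp add: prism_point_eq *[OF that])
    have "?f a = ?f b" if ab: "glue (nerve (wS (aut_cat D) k)) a b" for a b
    proof -
      obtain m n \<theta> \<sigma> u where g: "mono_on {..m} \<theta>" "\<theta> ` {..m} \<subseteq> {..n}" "\<sigma> \<in> diagrams {..n} (wS (aut_cat D) k)"
        "a = (m, pull {..m} \<theta> \<sigma>, u)" "b = (n, \<sigma>, simplex_push m \<theta> u)"
        using ab unfolding glue_def by auto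
      show ?thesis
        using family.level_map_glue[OF S_family v ab] fg[OF g(3)] fg[OF pull_in_diagrams[OF g(3,1,2)]]
        by (simp add: g(4,5))
    qed
    note gl = this
    obtain q \<sigma> u where \<sigma>: "\<sigma> \<in> diagrams {..q} (wS (aut_cat D) k)" and x: "x = pt (nerve (wS (aut_cat D) k)) (q, \<sigma>, u)"
      using nerve_realise_cases[OF x] by blast
    have "coassembly_level D k s x = ?f (q, \<sigma>, u)"
      unfolding coassembly_level_def x by (rule descend_pt) (rule gl)
    also have "\<dots> = ?g (q, \<sigma>, u)" by (rule fg[OF \<sigma>])
    finally show ?thesis unfolding x family.level_map_pt[OF S_family v] by simp
  qed
  from realise_map_eq_K_family[OF v this y] show ?thesis using r s by (simp add: coassembly_def)
qed

section \<open>A composite of automorphisms gives a concatenation of loops\<close>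

lemma simplex_push_edge:
  "simplex_push (Suc 0) f u i = (if f 0 = i then u 0 else 0) + (if f (Suc 0) = i then u (Suc 0) else 0)"
proof -
  have "simplex_push (Suc 0) f u i = (\<Sum>j\<in>{..Suc 0}. if f j = i then u j else 0)"
    unfolding simplex_push_def by (simp add: sum.inter_filter[symmetric] atMost_def)
  then show ?thesis by simp
qed

text \<open>The path in \<open>\<Delta>\<^sup>2\<close> that runs along the edge \<open>01\<close>
  and then along the edge \<open>12\<close>, each at double speed.\<close>

definition two_edges :: "real \<Rightarrow> nat \<Rightarrow> real" where
  "two_edges s = (\<lambda>i. if i = 0 then max 0 (1 - 2 * s) else if i = 1 then min (2 * s) (2 - 2 * s)
     else if i = 2 then max 0 (2 * s - 1) else 0)"

lemma two_edges_first: "s \<le> 1 / 2 \<Longrightarrow> two_edges s = simplex_push 1 (\<lambda>e. e) (edge (2 * s))"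
  by (auto simp: fun_eq_iff simplex_push_edge two_edges_def edge_def)

lemma two_edges_second: "s \<ge> 1 / 2 \<Longrightarrow> two_edges s = simplex_push 1 Suc (edge (2 * s - 1))"
  by (auto simp: fun_eq_iff simplex_push_edge two_edges_def edge_def)

text \<open>The straight line in \<open>\<Delta>\<^sup>2\<close> from the two-edge path to the edge
  \<open>02\<close>.\<close>

definition sweep :: "real \<Rightarrow> real \<Rightarrow> nat \<Rightarrow> real" where
  "sweep x s = (\<lambda>i. (1 - x) * two_edges s i + x * simplex_push 1 (\<lambda>e. 2 * e) (edge s) i)"

lemma two_edges_in_simplex: "s \<in> {0..1} \<Longrightarrow> two_edges s \<in> standard_simplex 2"
proof (cases "s \<le> 1 / 2")
  case True
  assume "s \<in> {0..1}"
  then show ?thesis unfolding two_edges_first[OF True]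
    by (intro simplex_push_in_simplex edge_in_simplex) (use True in auto)
next
  case False
  assume "s \<in> {0..1}"
  then show ?thesis using False unfolding two_edges_second[OF less_imp_le[OF not_le_imp_less[OF False]]]
    by (intro simplex_push_in_simplex edge_in_simplex) auto
qed

lemma sweep_in_simplex:
  assumes "x \<in> {0..1}" "s \<in> {0..1}"
  shows "sweep x s \<in> standard_simplex 2"
  unfolding sweep_def
proof (rule convex_standard_simplex)
  show "simplex_push 1 (\<lambda>e. 2 * e) (edge s) \<in> standard_simplex 2"
    by (intro simplex_push_in_simplex edge_in_simplex assms) auto
qed (use assms two_edges_in_simplex in auto)

lemma sweep_ends: "sweep x 0 = vertex 0" "sweep x 1 = vertex 2"
  by (auto simp: fun_eq_iff sweep_def two_edges_def simplex_push_edge edge_def)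

lemma continuous_map_sweep:
  "continuous_map (prod_topology (top_of_set {0..1}) (top_of_set {0..1})) (simplex_top 2) (\<lambda>(x, s). sweep x s)"
  unfolding continuous_map_in_subtopology
proof
  show "continuous_map (prod_topology (top_of_set {0..1}) (top_of_set {0..1})) (powertop_real UNIV) (\<lambda>(x, s). sweep x s)"
    unfolding continuous_map_componentwise_UNIV
  proof
    fix i :: nat
    have "continuous_on ({0..1} \<times> {0..1}) (\<lambda>z. sweep (fst z) (snd z) i)"
      unfolding sweep_def two_edges_def One_nat_def simplex_push_edge edge_def
      by (cases "i = 0"; cases "i = 1"; cases "i = 2") (auto intro!: continuous_intros)
    then show "continuous_map (prod_topology (top_of_set {0..1}) (top_of_set {0..1})) euclideanreal
      (\<lambda>z. (\<lambda>(x, s). sweep x s) z i)"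
      by (simp add: case_prod_unfold)
  qed
  show "(\<lambda>(x, s). sweep x s) \<in> topspace (prod_topology (top_of_set {0..1}) (top_of_set {0..1})) \<rightarrow> standard_simplex 2"
    using sweep_in_simplex by auto
qed

definition zero_diagram :: "('o, 'm) wcat \<Rightarrow> (nat \<times> nat, 'o, 'm) diagram" where
  "zero_diagram C = const_diagram (Ar 0) C (wzero C)"

text \<open>The conditions on zero objects make \<open>\<Xi>(v, -)\<close> a based map for every
  \<open>v\<close>, so that it acts on the based loops that form the K-theory space.\<close>

locale homotopy_family = exact_family 2 C D O\<^sub>A A
  for C :: "('o, 'm) wcat" and D :: "('p, 'n) wcat" and O\<^sub>A A +
  assumes zero_simplex: "const_diagram {..0::nat} (wS C 0) (zero_diagram C) \<in> diagrams {..0} (wS C 0)"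
    and zero_ob: "O\<^sub>A (wzero C) = wzero D"
    and zero_hom: "h \<in> cat_hom D (wzero D) (wzero D) \<Longrightarrow> h = cat_id D (wzero D)"
begin

lemma K_family_S_base:
  assumes v: "v \<in> standard_simplex 2"
  shows "K_family 2 D O\<^sub>A A v (S_base C) = S_base D"
proof -
  let ?\<sigma> = "const_diagram {..0::nat} (wS C 0) (zero_diagram C)" and ?\<sigma>' = "const_diagram {..0::nat} (wS D 0) (zero_diagram D)"
  have Ar0: "Ar 0 = {(0, 0)}" by (auto simp: Ar_def)
  have Z: "zero_diagram C \<in> S_obs C 0"
    using PiE_mem[OF diagramsD(1)[OF zero_simplex], of 0] by (simp add: const_diagram_def)
  have zC: "wzero C \<in> cat_ob C"
    using S_obs_ob[OF Z, of "(0, 0)"] by (simp add: Ar0 zero_diagram_def const_diagram_def)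
  have idC: "cat_id C (wzero C) \<in> cat_hom C (wzero C) (wzero C)"
    using diagramsD(3)[OF S_obs_diagram[OF Z], of "(0, 0)" "(0, 0)"]
    by (simp add: Ar0 zero_diagram_def const_diagram_def le_pairs_def)
  have idD: "A e e' (wzero C) (wzero C) (cat_id C (wzero C)) = cat_id D (wzero D)" if "e \<le> e'" "e' \<le> 2" for e e'
    using zero_hom hom[OF that zC zC idC] by (simp add: zero_ob)
  let ?F = "prism_of 2 0 (S_ob 0 O\<^sub>A A) (S_arr 0 A) ?\<sigma>"
  have ob: "S_ob 0 O\<^sub>A A (zero_diagram C) = zero_diagram D"
    by (auto simp: S_ob_def zero_diagram_def const_diagram_def push_def Ar0 le_pairs_def zero_ob idD fun_eq_iff)
  have arr: "S_arr 0 A e e' (zero_diagram C) (zero_diagram C) (\<lambda>a\<in>Ar 0. cat_id C (fst (zero_diagram C) a)) =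
      (\<lambda>a\<in>Ar 0. cat_id D (fst (zero_diagram D) a))" if "e \<le> e'" "e' \<le> 2" for e e'
    using idD[OF that] by (auto simp: S_arr_def zero_diagram_def const_diagram_def Ar0 fun_eq_iff)
  have F: "?F \<in> diagrams ({..2} \<times> {..0}) (wS D 0)" by (rule prism_of_in_S_diagrams[OF zero_simplex])
  have "pull {..0} (\<lambda>_. (0, 0)) ?F = ?\<sigma>'"
    by (auto simp: pull_def prism_of_def const_diagram_def le_pairs_def ob arr fun_eq_iff)
  then have \<sigma>': "?\<sigma>' \<in> diagrams {..0} (wS D 0)"
    using pull_in_diagrams[OF F, of "{..0::nat}" "\<lambda>_. (0, 0)"] by (simp add: monotone_on_def)
  have c: "coupling 2 0 v (vertex 0) 2 (\<lambda>e. (e, 0)) v"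
    using simplex_push_id[OF v] v by (auto simp: coupling_def monotone_on_def comp_def simplex_push_def
        standard_simplex_def atMost_def fun_eq_iff)
  have "pull {..2} (\<lambda>e. (e, 0)) ?F = pull {..2} (\<lambda>_. 0) ?\<sigma>'"
    by (auto simp: pull_def prism_of_def const_diagram_def le_pairs_def ob arr fun_eq_iff)
  then have "shuffle_point (wS D 0) 2 0 ?F v (vertex 0) = pt (nerve (wS D 0)) (2, pull {..2} (\<lambda>_. 0) ?\<sigma>', v)"
    unfolding shuffle_point_eq[OF F c] by simp
  also have "\<dots> = pt (nerve (wS D 0)) (0, ?\<sigma>', simplex_push 2 (\<lambda>_. 0) v)"
    by (rule glue_nerve[OF _ _ \<sigma>' v]) (auto simp: monotone_on_def)
  also have "simplex_push 2 (\<lambda>_. 0) v = vertex 0"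
    using v by (auto simp: simplex_push_def standard_simplex_def atMost_def fun_eq_iff)
  finally show ?thesis
    unfolding S_base_def Let_def zero_diagram_def[symmetric] K_family_pt2[OF v] by simp
qed

text \<open>The functors at the vertices \<open>0\<close> and \<open>2\<close> coincide, so paths
  between these vertices give free loops.\<close>

lemma K_family_ends:
  assumes "y \<in> topspace (realise (wS_space C))"
  shows "K_family 2 D O\<^sub>A A (vertex 2) y = K_family 2 D O\<^sub>A A (vertex 0) y"
proof -
  have v: "vertex 0 \<in> standard_simplex 0" by simp
  have f: "mono_on {..0} (\<lambda>_. e)" "(\<lambda>_. e) ` {..0::nat} \<subseteq> {..2}" if "e \<le> 2" for e :: nat
    using that by (auto simp: monotone_on_def)
  have push: "simplex_push 0 (\<lambda>_. e) (vertex 0) = vertex e" for e by (auto simp: simplex_push_def fun_eq_iff)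
  have "K_family 0 D O\<^sub>A (\<lambda>_ _. A 2 2) (vertex 0) y = K_family 0 D O\<^sub>A (\<lambda>_ _. A 0 0) (vertex 0) y"
  proof (rule exact_family.K_family_cong[OF _ _ _ _ v assms])
    show "exact_family 0 C D O\<^sub>A (\<lambda>_ _. A 2 2)" "exact_family 0 C D O\<^sub>A (\<lambda>_ _. A 0 0)"
      using exact_family_reindex[OF exact_family_axioms f] by simp_all
    show "A 2 2 X Y h = A 0 0 X Y h" if "X \<in> cat_ob C" "Y \<in> cat_ob C" "h \<in> cat_hom C X Y" for X Y h
      using that by (intro diag) auto
  qed simp
  then show ?thesis
    using K_family_reindex[OF f v assms, of 2] K_family_reindex[OF f v assms, of 0] by (simp add: push)
qed

definition loops :: "(nat \<Rightarrow> nat) \<Rightarrow> (real \<Rightarrow> ('o, 'm) S_point) \<Rightarrow> real \<Rightarrow> real \<Rightarrow> ('p, 'n) S_point" where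
  "loops f \<omega> = (\<lambda>s\<in>{0..1::real}. \<lambda>r\<in>{0..1::real}. K_family 2 D O\<^sub>A A (simplex_push 1 f (edge s)) (\<omega> r))"

lemma continuous_map_sweep_K:
  "continuous_map
    (prod_topology (prod_topology (prod_topology (top_of_set {0..1}) (K_space C)) (top_of_set {0..1})) (top_of_set {0..1}))
    (realise (wS_space D)) (\<lambda>(((x, \<omega>), s), r). K_family 2 D O\<^sub>A A (sweep x s) (\<omega> r))"
    (is "continuous_map ?T _ _")
proof -
  have c: "continuous_map ?T (prod_topology (top_of_set {0..1}) (K_space C)) (\<lambda>z. fst (fst z))"
    using continuous_map_compose[OF continuous_map_fst continuous_map_fst] unfolding o_def .
  have x: "continuous_map ?T (top_of_set {0..1}) (\<lambda>z. fst (fst (fst z)))"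
    using continuous_map_compose[OF c continuous_map_fst] unfolding o_def .
  have \<omega>: "continuous_map ?T (mapping_space (top_of_set {0..1}) (realise (wS_space C))) (\<lambda>z. snd (fst (fst z)))"
    using continuous_map_compose[OF c continuous_map_snd] unfolding o_def K_space_def based_loops_def
    by (rule continuous_map_into_fulltopology)
  have s: "continuous_map ?T (top_of_set {0..1}) (\<lambda>z. snd (fst z))"
    using continuous_map_compose[OF continuous_map_fst continuous_map_snd] unfolding o_def .
  have "compact_space (top_of_set {0..1::real})" by (simp add: compact_space_subtopology)
  then have I: "locally_compact_space (top_of_set {0..1::real})" "Hausdorff_space (top_of_set {0..1::real})"
    by (auto simp: compact_imp_locally_compact_space Hausdorff_space_subtopology)
  have v: "continuous_map ?T (simplex_top 2) (\<lambda>z. sweep (fst (fst (fst z))) (snd (fst z)))"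
    using continuous_map_compose[OF continuous_map_pairedI[OF x s] continuous_map_sweep] by (simp add: o_def)
  have y: "continuous_map ?T (realise (wS_space C)) (\<lambda>z. (snd (fst (fst z))) (snd z))"
    using continuous_map_compose[OF continuous_map_pairedI[OF \<omega> continuous_map_snd] continuous_map_evaluation[OF I]]
    by (simp add: o_def)
  show ?thesis
    using continuous_map_compose[OF continuous_map_pairedI[OF v y] continuous_map_K_family]
    by (simp add: o_def case_prod_unfold)
qed

text \<open>The homotopy is \<open>\<Xi>\<close> along the sweep.  It is fibrewise since the sweep
  fixes both ends of the path.\<close>

theorem loops_homotopic:
  "homotopic_with
    (\<lambda>h. \<forall>\<omega>\<in>topspace (K_space C). h \<omega> 0 = (\<lambda>r\<in>{0..1::real}. K_family 2 D O\<^sub>A A (vertex 0) (\<omega> r)))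
    (K_space C) (free_loops (K_space D))
    (\<lambda>\<omega>. loop_concat (loops (\<lambda>e. e) \<omega>) (loops Suc \<omega>)) (loops (\<lambda>e. 2 * e))"
proof -
  \<comment> \<open>the real \<open>x\<close> is the time of the homotopy, \<open>s\<close> the parameter of the free loop and \<open>r\<close> that of the based loop\<close>
  define H where "H = (\<lambda>(x, \<omega>). \<lambda>s\<in>{0..1::real}. \<lambda>r\<in>{0..1::real}. K_family 2 D O\<^sub>A A (sweep x s) (\<omega> r))"
  let ?I = "top_of_set {0..1::real}"
  have \<omega>D: "\<omega> 0 = S_base C" "\<omega> 1 = S_base C" "\<And>r. r \<in> {0..1} \<Longrightarrow> \<omega> r \<in> topspace (realise (wS_space C))"
    if "\<omega> \<in> topspace (K_space C)" for \<omega>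
    using that unfolding K_space_def based_loops_def
    by (auto simp: topspace_mapping_space continuous_map_def)
  have "continuous_map (prod_topology (prod_topology ?I (K_space C)) ?I) (K_space D)
      (\<lambda>((x, \<omega>), s). \<lambda>r\<in>topspace ?I. K_family 2 D O\<^sub>A A (sweep x s) (\<omega> r))"
    unfolding K_space_def[of D] based_loops_def continuous_map_in_subtopology
  proof
    show "continuous_map (prod_topology (prod_topology ?I (K_space C)) ?I) (mapping_space ?I (realise (wS_space D)))
      (\<lambda>((x, \<omega>), s). \<lambda>r\<in>topspace ?I. K_family 2 D O\<^sub>A A (sweep x s) (\<omega> r))"
      using continuous_map_curry[of "prod_topology (prod_topology ?I (K_space C)) ?I" ?I _
          "\<lambda>((x, \<omega>), s) r. K_family 2 D O\<^sub>A A (sweep x s) (\<omega> r)"] continuous_map_sweep_K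
      by (simp add: case_prod_unfold)
  qed (auto simp: \<omega>D K_family_S_base sweep_in_simplex)
  then have "continuous_map (prod_topology ?I (K_space C)) (mapping_space ?I (K_space D))
      (\<lambda>z. \<lambda>s\<in>topspace ?I. \<lambda>r\<in>topspace ?I. K_family 2 D O\<^sub>A A (sweep (fst z) s) (snd z r))"
    by (intro continuous_map_curry) (simp add: case_prod_unfold)
  then have "continuous_map (prod_topology ?I (K_space C)) (mapping_space ?I (K_space D)) H"
    by (simp add: H_def case_prod_unfold)
  moreover have "H z 0 = H z 1" if "z \<in> topspace (prod_topology ?I (K_space C))" for z
    using that \<omega>D by (auto simp: H_def sweep_ends K_family_ends fun_eq_iff restrict_def)
  ultimately have cont: "continuous_map (prod_topology ?I (K_space C)) (free_loops (K_space D)) H"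
    unfolding free_loops_def continuous_map_in_subtopology by auto
  show ?thesis
    unfolding homotopic_with_def
  proof (intro exI[of _ H] conjI allI ballI)
    show "continuous_map (prod_topology ?I (K_space C)) (free_loops (K_space D)) H" by (rule cont)
    show "H (0, \<omega>) = loop_concat (loops (\<lambda>e. e) \<omega>) (loops Suc \<omega>)" for \<omega>
      by (auto simp: H_def loop_concat_def loops_def sweep_def two_edges_first two_edges_second fun_eq_iff)
    show "H (1, \<omega>) = loops (\<lambda>e. 2 * e) \<omega>" for \<omega>
      by (auto simp: H_def loops_def sweep_def fun_eq_iff)
    show "H (x, \<omega>) 0 = (\<lambda>r\<in>{0..1::real}. K_family 2 D O\<^sub>A A (vertex 0) (\<omega> r))" for x \<omega>
      by (simp add: H_def sweep_ends)
  qed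
qed

end

section \<open>Localisation at a central multiplicative set\<close>

lemma the_elem_image_const:
  assumes "x\<^sub>0 \<in> X" "\<And>x. x \<in> X \<Longrightarrow> f x = c"
  shows "the_elem (f ` X) = c"
proof -
  have "f ` X = {c}" using assms by auto
  then show ?thesis by simp
qed

text \<open>Over a central multiplicative set the fractions obey the commutative rules although the
  ring is not commutative.\<close>

locale central_loc = R?: ring R for R :: "('a, 'r) ring_scheme" (structure) +
  fixes S :: "'a set"
  assumes S: "submonoid S R" and S_center: "S \<subseteq> ring_center R"
begin

lemma S_closed: "s \<in> S \<Longrightarrow> s \<in> carrier R" using S by (auto simp: submonoid_def)
lemma S_mult: "s \<in> S \<Longrightarrow> t \<in> S \<Longrightarrow> s \<otimes> t \<in> S" using S by (auto simp: submonoid_def)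
lemma S_one: "\<one> \<in> S" using S by (auto simp: submonoid_def)
lemma S_comm: "s \<in> S \<Longrightarrow> x \<in> carrier R \<Longrightarrow> x \<otimes> s = s \<otimes> x"
  using S_center by (auto simp: ring_center_def)
lemma S_comm2: "s \<in> S \<Longrightarrow> x \<in> carrier R \<Longrightarrow> s \<otimes> x = x \<otimes> s"
  using S_comm by simp
lemma S_lcomm: "s \<in> S \<Longrightarrow> x \<in> carrier R \<Longrightarrow> y \<in> carrier R \<Longrightarrow> x \<otimes> (s \<otimes> y) = s \<otimes> (x \<otimes> y)"
  by (simp add: S_comm S_closed flip: m_assoc)
lemma S_lcomm2: "s \<in> S \<Longrightarrow> x \<in> carrier R \<Longrightarrow> y \<in> carrier R \<Longrightarrow> s \<otimes> (x \<otimes> y) = x \<otimes> (s \<otimes> y)"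
  by (simp add: S_lcomm)

lemmas S_ac = m_assoc S_comm S_comm2 S_lcomm S_lcomm2 S_closed S_mult

lemma loc_rel_iff:
  "((a, s), (b, r)) \<in> loc_rel R S \<longleftrightarrow> a \<in> carrier R \<and> b \<in> carrier R \<and> s \<in> S \<and> r \<in> S \<and>
     (\<exists>u\<in>S. u \<otimes> (r \<otimes> a) = u \<otimes> (s \<otimes> b))"
  by (simp add: loc_rel_def)

lemma equiv_loc_rel: "equiv (carrier R \<times> S) (loc_rel R S)"
proof (rule equivI)
  show "loc_rel R S \<subseteq> (carrier R \<times> S) \<times> (carrier R \<times> S)" by (auto simp: loc_rel_def)
  show "refl_on (carrier R \<times> S) (loc_rel R S)"
    by (rule refl_onI) (auto simp: loc_rel_iff S_one intro!: bexI[of _ \<one>])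
  show "sym (loc_rel R S)" by (rule symI) (force simp: loc_rel_def)
  show "trans (loc_rel R S)"
  proof (rule transI)
    fix x y z assume "(x, y) \<in> loc_rel R S" "(y, z) \<in> loc_rel R S"
    then obtain a s b r c t u w where e: "x = (a, s)" "y = (b, r)" "z = (c, t)"
      and m: "a \<in> carrier R" "b \<in> carrier R" "c \<in> carrier R" "s \<in> S" "r \<in> S" "t \<in> S" "u \<in> S" "w \<in> S"
      and u: "u \<otimes> (r \<otimes> a) = u \<otimes> (s \<otimes> b)" and w: "w \<otimes> (t \<otimes> b) = w \<otimes> (r \<otimes> c)"
      by (auto simp: loc_rel_def)
    have "(u \<otimes> (w \<otimes> r)) \<otimes> (t \<otimes> a) = (w \<otimes> t) \<otimes> (u \<otimes> (r \<otimes> a))" using m by (simp add: S_ac)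
    also have "\<dots> = (u \<otimes> s) \<otimes> (w \<otimes> (t \<otimes> b))" unfolding u using m by (simp add: S_ac)
    also have "\<dots> = (u \<otimes> (w \<otimes> r)) \<otimes> (s \<otimes> c)" unfolding w using m by (simp add: S_ac)
    finally have "(u \<otimes> (w \<otimes> r)) \<otimes> (t \<otimes> a) = (u \<otimes> (w \<otimes> r)) \<otimes> (s \<otimes> c)" .
    moreover have "u \<otimes> (w \<otimes> r) \<in> S" using m by (simp add: S_mult)
    ultimately show "(x, z) \<in> loc_rel R S" using m unfolding e loc_rel_iff by blast
  qed
qed

lemma frac_eq_iff:
  assumes "a \<in> carrier R" "s \<in> S" "b \<in> carrier R" "r \<in> S"
  shows "frac R S a s = frac R S b r \<longleftrightarrow> (\<exists>u\<in>S. u \<otimes> (r \<otimes> a) = u \<otimes> (s \<otimes> b))"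
proof -
  have "frac R S a s = frac R S b r \<longleftrightarrow> ((a, s), (b, r)) \<in> loc_rel R S"
    unfolding frac_def using eq_equiv_class_iff[OF equiv_loc_rel, of "(a, s)" "(b, r)"] assms by simp
  then show ?thesis using assms by (simp add: loc_rel_iff)
qed

lemma frac_cancel:
  assumes "a \<in> carrier R" "s \<in> S" "t \<in> S"
  shows "frac R S (t \<otimes> a) (t \<otimes> s) = frac R S a s"
  using assms by (subst frac_eq_iff) (auto simp: S_closed S_mult S_one S_ac intro!: bexI[of _ \<one>])

lemma mem_fracD:
  assumes "a \<in> carrier R" "s \<in> S" and x: "(a', s') \<in> frac R S a s"
  shows "a' \<in> carrier R" "s' \<in> S" "frac R S a' s' = frac R S a s"
proof -
  have r: "((a, s), (a', s')) \<in> loc_rel R S" using x by (simp add: frac_def)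
  then show "a' \<in> carrier R" "s' \<in> S" by (simp_all add: loc_rel_iff)
  show "frac R S a' s' = frac R S a s"
    unfolding frac_def by (rule equiv_class_eq[OF equiv_loc_rel r, symmetric])
qed

lemma frac_self: "a \<in> carrier R \<Longrightarrow> s \<in> S \<Longrightarrow> (a, s) \<in> frac R S a s"
  by (auto simp: frac_def loc_rel_iff S_one intro!: bexI[of _ \<one>])

lemma carrier_loc: "carrier (loc R S) = {frac R S a s | a s. a \<in> carrier R \<and> s \<in> S}"
  by (auto simp: loc_def quotient_def frac_def)

lemma frac_closed [simp]: "a \<in> carrier R \<Longrightarrow> s \<in> S \<Longrightarrow> frac R S a s \<in> carrier (loc R S)"
  by (auto simp: carrier_loc)

lemma loc_one: "\<one>\<^bsub>loc R S\<^esub> = frac R S \<one> \<one>" and loc_zero: "\<zero>\<^bsub>loc R S\<^esub> = frac R S \<zero> \<one>"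
  by (simp_all add: loc_def)

lemma mult_frac:
  assumes "a \<in> carrier R" "s \<in> S" "b \<in> carrier R" "r \<in> S"
  shows "frac R S a s \<otimes>\<^bsub>loc R S\<^esub> frac R S b r = frac R S (a \<otimes> b) (s \<otimes> r)"
proof -
  have "frac R S (a' \<otimes> b') (s' \<otimes> r') = frac R S (a \<otimes> b) (s \<otimes> r)"
    if "(a', s') \<in> frac R S a s" "(b', r') \<in> frac R S b r" for a' s' b' r'
  proof -
    have m: "a' \<in> carrier R" "s' \<in> S" "b' \<in> carrier R" "r' \<in> S"
      and "frac R S a' s' = frac R S a s" "frac R S b' r' = frac R S b r"
      using mem_fracD[OF assms(1,2) that(1)] mem_fracD[OF assms(3,4) that(2)] by blast+
    then have "\<exists>u\<in>S. u \<otimes> (s \<otimes> a') = u \<otimes> (s' \<otimes> a)" "\<exists>v\<in>S. v \<otimes> (r \<otimes> b') = v \<otimes> (r' \<otimes> b)"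
      using assms by (simp_all add: frac_eq_iff)
    then obtain u v where uv: "u \<in> S" "v \<in> S"
      and u: "u \<otimes> (s \<otimes> a') = u \<otimes> (s' \<otimes> a)" and v: "v \<otimes> (r \<otimes> b') = v \<otimes> (r' \<otimes> b)"
      by blast
    have sh: "(x \<otimes> y) \<otimes> ((x' \<otimes> y') \<otimes> (c \<otimes> d)) = (x \<otimes> (x' \<otimes> c)) \<otimes> (y \<otimes> (y' \<otimes> d))"
      if "x \<in> S" "y \<in> S" "x' \<in> S" "y' \<in> S" "c \<in> carrier R" "d \<in> carrier R" for x y x' y' c d
    proof -
      have "(x \<otimes> (x' \<otimes> c)) \<otimes> (y \<otimes> (y' \<otimes> d)) = (x \<otimes> x') \<otimes> (c \<otimes> ((y \<otimes> y') \<otimes> d))"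
        using that by (simp add: S_closed m_assoc)
      also have "c \<otimes> ((y \<otimes> y') \<otimes> d) = (y \<otimes> y') \<otimes> (c \<otimes> d)" using that by (intro S_lcomm) (auto simp: S_mult)
      also have "(x \<otimes> x') \<otimes> ((y \<otimes> y') \<otimes> (c \<otimes> d)) = (x \<otimes> y) \<otimes> ((x' \<otimes> y') \<otimes> (c \<otimes> d))"
        using that S_lcomm[of y x' "y' \<otimes> (c \<otimes> d)"] by (simp add: S_closed m_assoc)
      finally show ?thesis ..
    qed
    have "(u \<otimes> v) \<otimes> ((s \<otimes> r) \<otimes> (a' \<otimes> b')) = (u \<otimes> v) \<otimes> ((s' \<otimes> r') \<otimes> (a \<otimes> b))"
      using sh[of u v s r a' b'] sh[of u v s' r' a b] u v uv m assms by simp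
    then show ?thesis
      using uv m assms S_mult by (subst frac_eq_iff) (auto intro!: bexI[of _ "u \<otimes> v"])
  qed
  note eq = this
  have "the_elem ((\<lambda>((a, s), (b, r)). frac R S (a \<otimes> b) (s \<otimes> r)) ` (frac R S a s \<times> frac R S b r)) =
      frac R S (a \<otimes> b) (s \<otimes> r)"
  proof (rule the_elem_image_const)
    show "((a, s), (b, r)) \<in> frac R S a s \<times> frac R S b r" using assms by (simp add: frac_self)
    fix z assume "z \<in> frac R S a s \<times> frac R S b r"
    moreover obtain a' s' b' r' where z: "z = ((a', s'), (b', r'))" by (metis prod.exhaust)
    ultimately have m: "(a', s') \<in> frac R S a s" "(b', r') \<in> frac R S b r" by auto
    show "(\<lambda>((a, s), (b, r)). frac R S (a \<otimes> b) (s \<otimes> r)) z = frac R S (a \<otimes> b) (s \<otimes> r)"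
      unfolding z using eq[OF m] by simp
  qed
  then show ?thesis by (simp add: loc_def)
qed

lemma add_frac:
  assumes "a \<in> carrier R" "s \<in> S" "b \<in> carrier R" "r \<in> S"
  shows "frac R S a s \<oplus>\<^bsub>loc R S\<^esub> frac R S b r = frac R S (r \<otimes> a \<oplus> s \<otimes> b) (s \<otimes> r)"
proof -
  have "frac R S (r' \<otimes> a' \<oplus> s' \<otimes> b') (s' \<otimes> r') = frac R S (r \<otimes> a \<oplus> s \<otimes> b) (s \<otimes> r)"
    if "(a', s') \<in> frac R S a s" "(b', r') \<in> frac R S b r" for a' s' b' r'
  proof -
    have m: "a' \<in> carrier R" "s' \<in> S" "b' \<in> carrier R" "r' \<in> S"
      and "frac R S a' s' = frac R S a s" "frac R S b' r' = frac R S b r"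
      using mem_fracD[OF assms(1,2) that(1)] mem_fracD[OF assms(3,4) that(2)] by blast+
    then have "\<exists>u\<in>S. u \<otimes> (s \<otimes> a') = u \<otimes> (s' \<otimes> a)" "\<exists>v\<in>S. v \<otimes> (r \<otimes> b') = v \<otimes> (r' \<otimes> b)"
      using assms by (simp_all add: frac_eq_iff)
    then obtain u v where uv: "u \<in> S" "v \<in> S"
      and u: "u \<otimes> (s \<otimes> a') = u \<otimes> (s' \<otimes> a)" and v: "v \<otimes> (r \<otimes> b') = v \<otimes> (r' \<otimes> b)"
      by blast
    have "(u \<otimes> v) \<otimes> ((s \<otimes> r) \<otimes> (r' \<otimes> a' \<oplus> s' \<otimes> b')) =
        (v \<otimes> (r \<otimes> r')) \<otimes> (u \<otimes> (s \<otimes> a')) \<oplus> (u \<otimes> (s \<otimes> s')) \<otimes> (v \<otimes> (r \<otimes> b'))"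
      using uv m assms by (simp add: S_ac r_distr)
    also have "\<dots> = (u \<otimes> v) \<otimes> ((s' \<otimes> r') \<otimes> (r \<otimes> a \<oplus> s \<otimes> b))"
      unfolding u v using uv m assms by (simp add: S_ac r_distr)
    finally show ?thesis
      using uv m assms S_mult S_closed by (subst frac_eq_iff) (auto intro!: bexI[of _ "u \<otimes> v"])
  qed
  note eq = this
  have "the_elem ((\<lambda>((a, s), (b, r)). frac R S (r \<otimes> a \<oplus> s \<otimes> b) (s \<otimes> r)) ` (frac R S a s \<times> frac R S b r)) =
      frac R S (r \<otimes> a \<oplus> s \<otimes> b) (s \<otimes> r)"
  proof (rule the_elem_image_const)
    show "((a, s), (b, r)) \<in> frac R S a s \<times> frac R S b r" using assms by (simp add: frac_self)
    fix z assume "z \<in> frac R S a s \<times> frac R S b r"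
    moreover obtain a' s' b' r' where z: "z = ((a', s'), (b', r'))" by (metis prod.exhaust)
    ultimately have m: "(a', s') \<in> frac R S a s" "(b', r') \<in> frac R S b r" by auto
    show "(\<lambda>((a, s), (b, r)). frac R S (r \<otimes> a \<oplus> s \<otimes> b) (s \<otimes> r)) z = frac R S (r \<otimes> a \<oplus> s \<otimes> b) (s \<otimes> r)"
      unfolding z using eq[OF m] by simp
  qed
  then show ?thesis by (simp add: loc_def)
qed

lemma add_frac_same:
  assumes "a \<in> carrier R" "b \<in> carrier R" "s \<in> S"
  shows "frac R S a s \<oplus>\<^bsub>loc R S\<^esub> frac R S b s = frac R S (a \<oplus> b) s"
  using assms frac_cancel[of "a \<oplus> b" s s] by (simp add: add_frac r_distr S_closed)

lemma loc_common2:
  assumes "x \<in> carrier (loc R S)" "y \<in> carrier (loc R S)"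
  obtains a b s where "a \<in> carrier R" "b \<in> carrier R" "s \<in> S" "x = frac R S a s" "y = frac R S b s"
proof -
  obtain a s b r where *: "a \<in> carrier R" "s \<in> S" "b \<in> carrier R" "r \<in> S" "x = frac R S a s" "y = frac R S b r"
    using assms by (auto simp: carrier_loc)
  show ?thesis
    by (rule that[of "r \<otimes> a" "s \<otimes> b" "s \<otimes> r"])
      (use * frac_cancel[of a s r] frac_cancel[of b r s] in \<open>auto simp: S_mult S_closed S_comm\<close>)
qed

text \<open>The ring axioms are checked on fractions with a common denominator, where addition is
  addition of numerators.\<close>

lemma loc_common3:
  assumes "x \<in> carrier (loc R S)" "y \<in> carrier (loc R S)" "z \<in> carrier (loc R S)"
  obtains a b c s where "a \<in> carrier R" "b \<in> carrier R" "c \<in> carrier R" "s \<in> S"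
    "x = frac R S a s" "y = frac R S b s" "z = frac R S c s"
proof -
  obtain a b s where 1: "a \<in> carrier R" "b \<in> carrier R" "s \<in> S" "x = frac R S a s" "y = frac R S b s"
    using loc_common2[OF assms(1,2)] by metis
  obtain c r where 2: "c \<in> carrier R" "r \<in> S" "z = frac R S c r" using assms(3) by (auto simp: carrier_loc)
  show ?thesis
    by (rule that[of "r \<otimes> a" "r \<otimes> b" "s \<otimes> c" "r \<otimes> s"])
      (use 1 2 frac_cancel[of a s r] frac_cancel[of b s r] frac_cancel[of c r s] in \<open>auto simp: S_mult S_closed S_comm\<close>)
qed

lemma ring_loc: "ring (loc R S)"
proof (rule ringI)
  show "abelian_group (loc R S)"
  proof (rule abelian_groupI)
    fix x y assume "x \<in> carrier (loc R S)" "y \<in> carrier (loc R S)"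
    then obtain a b s where "a \<in> carrier R" "b \<in> carrier R" "s \<in> S" "x = frac R S a s" "y = frac R S b s"
      by (rule loc_common2)
    note xy = this
    then show "x \<oplus>\<^bsub>loc R S\<^esub> y \<in> carrier (loc R S)" by (simp add: add_frac_same)
    show "x \<oplus>\<^bsub>loc R S\<^esub> y = y \<oplus>\<^bsub>loc R S\<^esub> x"
      unfolding xy(4,5) add_frac_same[OF xy(1-3)] add_frac_same[OF xy(2,1,3)] a_comm[OF xy(1,2)] ..
  next
    fix x y z assume "x \<in> carrier (loc R S)" "y \<in> carrier (loc R S)" "z \<in> carrier (loc R S)"
    then obtain a b c s where "a \<in> carrier R" "b \<in> carrier R" "c \<in> carrier R" "s \<in> S"
      "x = frac R S a s" "y = frac R S b s" "z = frac R S c s"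
      by (rule loc_common3)
    then show "x \<oplus>\<^bsub>loc R S\<^esub> y \<oplus>\<^bsub>loc R S\<^esub> z = x \<oplus>\<^bsub>loc R S\<^esub> (y \<oplus>\<^bsub>loc R S\<^esub> z)"
      by (simp add: add_frac_same a_assoc)
  next
    fix x assume "x \<in> carrier (loc R S)"
    then obtain a s where x: "a \<in> carrier R" "s \<in> S" "x = frac R S a s" by (auto simp: carrier_loc)
    then show "\<zero>\<^bsub>loc R S\<^esub> \<oplus>\<^bsub>loc R S\<^esub> x = x" by (simp add: loc_zero add_frac S_closed S_one)
    have "frac R S (\<ominus> a) s \<oplus>\<^bsub>loc R S\<^esub> x = \<zero>\<^bsub>loc R S\<^esub>"
      using x by (simp add: add_frac_same l_neg loc_zero frac_eq_iff S_one S_closed) (use S_one in blast)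
    then show "\<exists>y\<in>carrier (loc R S). y \<oplus>\<^bsub>loc R S\<^esub> x = \<zero>\<^bsub>loc R S\<^esub>"
      using x by (intro bexI[of _ "frac R S (\<ominus> a) s"]) auto
  qed (simp add: loc_zero S_one)
  show "monoid (loc R S)"
  proof (rule monoidI)
    fix x y assume "x \<in> carrier (loc R S)" "y \<in> carrier (loc R S)"
    then obtain a b s where "a \<in> carrier R" "b \<in> carrier R" "s \<in> S" "x = frac R S a s" "y = frac R S b s"
      by (rule loc_common2)
    then show "x \<otimes>\<^bsub>loc R S\<^esub> y \<in> carrier (loc R S)" by (simp add: mult_frac S_mult)
  next
    fix x y z assume "x \<in> carrier (loc R S)" "y \<in> carrier (loc R S)" "z \<in> carrier (loc R S)"
    then obtain a b c s where "a \<in> carrier R" "b \<in> carrier R" "c \<in> carrier R" "s \<in> S"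
      "x = frac R S a s" "y = frac R S b s" "z = frac R S c s"
      by (rule loc_common3)
    then show "x \<otimes>\<^bsub>loc R S\<^esub> y \<otimes>\<^bsub>loc R S\<^esub> z = x \<otimes>\<^bsub>loc R S\<^esub> (y \<otimes>\<^bsub>loc R S\<^esub> z)"
      by (simp add: mult_frac S_mult m_assoc S_closed)
  next
    show "\<one>\<^bsub>loc R S\<^esub> \<in> carrier (loc R S)" by (simp add: loc_one S_one)
  qed (auto simp: loc_one carrier_loc mult_frac S_one S_closed)
  fix x y z assume xyz: "x \<in> carrier (loc R S)" "y \<in> carrier (loc R S)" "z \<in> carrier (loc R S)"
  then obtain a b c s where *: "a \<in> carrier R" "b \<in> carrier R" "c \<in> carrier R" "s \<in> S"
    "x = frac R S a s" "y = frac R S b s" "z = frac R S c s"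
    by (rule loc_common3)
  then show "(x \<oplus>\<^bsub>loc R S\<^esub> y) \<otimes>\<^bsub>loc R S\<^esub> z = x \<otimes>\<^bsub>loc R S\<^esub> z \<oplus>\<^bsub>loc R S\<^esub> y \<otimes>\<^bsub>loc R S\<^esub> z"
    "z \<otimes>\<^bsub>loc R S\<^esub> (x \<oplus>\<^bsub>loc R S\<^esub> y) = z \<otimes>\<^bsub>loc R S\<^esub> x \<oplus>\<^bsub>loc R S\<^esub> z \<otimes>\<^bsub>loc R S\<^esub> y"
    by (simp_all add: add_frac_same mult_frac S_mult l_distr r_distr)
qed

lemma frac_hom: "(\<lambda>a. frac R S a \<one>) \<in> ring_hom R (loc R S)"
  by (rule ring_hom_memI) (simp_all add: S_one mult_frac add_frac_same loc_one)

lemma frac_inverse: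
  assumes "s \<in> S" "r \<in> S"
  shows "frac R S s r \<otimes>\<^bsub>loc R S\<^esub> frac R S r s = \<one>\<^bsub>loc R S\<^esub>"
  using assms frac_cancel[of \<one> \<one> "s \<otimes> r"] by (simp add: mult_frac S_closed loc_one S_one S_mult S_comm2[of s r])

lemma frac_Units: "s \<in> S \<Longrightarrow> r \<in> S \<Longrightarrow> frac R S s r \<in> Units (loc R S)"
  using frac_inverse[of s r] frac_inverse[of r s] unfolding Units_def by (auto simp: S_closed)

lemma frac_central:
  assumes "z \<in> ring_center R" "s \<in> S"
  shows "frac R S z s \<in> ring_center (loc R S)"
  using assms by (auto simp: ring_center_def carrier_loc mult_frac S_comm S_closed)

definition loc_lift :: "('c, 'q) ring_scheme \<Rightarrow> ('a \<Rightarrow> 'c) \<Rightarrow> ('a \<times> 'a) set \<Rightarrow> 'c" where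
  "loc_lift B g X = the_elem ((\<lambda>(a, s). g a \<otimes>\<^bsub>B\<^esub> inv\<^bsub>B\<^esub> (g s)) ` X)"

context
  fixes B :: "('c, 'q) ring_scheme" and g
  assumes B: "ring B" and g: "g \<in> ring_hom R B" and units: "\<And>s. s \<in> S \<Longrightarrow> g s \<in> Units B"
begin

interpretation B: ring B by (rule B)

lemma g_simps:
  "a \<in> carrier R \<Longrightarrow> g a \<in> carrier B"
  "a \<in> carrier R \<Longrightarrow> b \<in> carrier R \<Longrightarrow> g (a \<otimes> b) = g a \<otimes>\<^bsub>B\<^esub> g b"
  "a \<in> carrier R \<Longrightarrow> b \<in> carrier R \<Longrightarrow> g (a \<oplus> b) = g a \<oplus>\<^bsub>B\<^esub> g b"
  "g \<one> = \<one>\<^bsub>B\<^esub>"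
  using g by (auto simp: ring_hom_def)

lemma g_comm:
  assumes "s \<in> S" "a \<in> carrier R"
  shows "g a \<otimes>\<^bsub>B\<^esub> g s = g s \<otimes>\<^bsub>B\<^esub> g a" "g a \<otimes>\<^bsub>B\<^esub> inv\<^bsub>B\<^esub> (g s) = inv\<^bsub>B\<^esub> (g s) \<otimes>\<^bsub>B\<^esub> g a"
proof -
  show 1: "g a \<otimes>\<^bsub>B\<^esub> g s = g s \<otimes>\<^bsub>B\<^esub> g a"
    using arg_cong[OF S_comm[OF assms], of g] assms by (simp add: g_simps S_closed)
  have c: "g a \<in> carrier B" "g s \<in> carrier B" "inv\<^bsub>B\<^esub> (g s) \<in> carrier B"
    using assms units by (auto simp: g_simps S_closed)
  have "g a \<otimes>\<^bsub>B\<^esub> inv\<^bsub>B\<^esub> (g s) = inv\<^bsub>B\<^esub> (g s) \<otimes>\<^bsub>B\<^esub> (g s \<otimes>\<^bsub>B\<^esub> g a) \<otimes>\<^bsub>B\<^esub> inv\<^bsub>B\<^esub> (g s)"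
    using c units[OF assms(1)] by (simp add: B.m_assoc[symmetric])
  also have "\<dots> = inv\<^bsub>B\<^esub> (g s) \<otimes>\<^bsub>B\<^esub> g a"
    unfolding 1[symmetric] using c units[OF assms(1)] by (simp add: B.m_assoc)
  finally show "g a \<otimes>\<^bsub>B\<^esub> inv\<^bsub>B\<^esub> (g s) = inv\<^bsub>B\<^esub> (g s) \<otimes>\<^bsub>B\<^esub> g a" .
qed

lemma loc_lift_unique_value:
  assumes "a \<in> carrier R" "s \<in> S" "b \<in> carrier R" "r \<in> S" "frac R S a s = frac R S b r"
  shows "g a \<otimes>\<^bsub>B\<^esub> inv\<^bsub>B\<^esub> (g s) = g b \<otimes>\<^bsub>B\<^esub> inv\<^bsub>B\<^esub> (g r)"
proof -
  obtain u where u: "u \<in> S" "u \<otimes> (r \<otimes> a) = u \<otimes> (s \<otimes> b)" using assms by (auto simp: frac_eq_iff)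
  have c: "g a \<in> carrier B" "g b \<in> carrier B" "g s \<in> carrier B" "g r \<in> carrier B" "g u \<in> carrier B"
    "inv\<^bsub>B\<^esub> (g s) \<in> carrier B" "inv\<^bsub>B\<^esub> (g r) \<in> carrier B"
    using assms u units by (auto simp: g_simps S_closed)
  have "g u \<otimes>\<^bsub>B\<^esub> (g r \<otimes>\<^bsub>B\<^esub> g a) = g u \<otimes>\<^bsub>B\<^esub> (g s \<otimes>\<^bsub>B\<^esub> g b)"
    using arg_cong[OF u(2), of g] assms u(1) by (simp add: g_simps S_closed)
  then have e: "g r \<otimes>\<^bsub>B\<^esub> g a = g s \<otimes>\<^bsub>B\<^esub> g b"
    using B.Units_l_cancel[OF units[OF u(1)]] c by simp
  have "g a \<otimes>\<^bsub>B\<^esub> inv\<^bsub>B\<^esub> (g s) = inv\<^bsub>B\<^esub> (g r) \<otimes>\<^bsub>B\<^esub> (g r \<otimes>\<^bsub>B\<^esub> g a) \<otimes>\<^bsub>B\<^esub> inv\<^bsub>B\<^esub> (g s)"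
    using c units[OF assms(4)] by (simp add: B.m_assoc[symmetric])
  also have "\<dots> = inv\<^bsub>B\<^esub> (g r) \<otimes>\<^bsub>B\<^esub> (g b \<otimes>\<^bsub>B\<^esub> g s) \<otimes>\<^bsub>B\<^esub> inv\<^bsub>B\<^esub> (g s)"
    unfolding e using g_comm(1)[OF assms(2,3)] by simp
  also have "\<dots> = g b \<otimes>\<^bsub>B\<^esub> inv\<^bsub>B\<^esub> (g r)"
    using c units[OF assms(2)] g_comm(2)[OF assms(4,3)] by (simp add: B.m_assoc)
  finally show ?thesis .
qed

lemma loc_lift_frac:
  assumes "a \<in> carrier R" "s \<in> S"
  shows "loc_lift B g (frac R S a s) = g a \<otimes>\<^bsub>B\<^esub> inv\<^bsub>B\<^esub> (g s)"
proof -
  have "g a' \<otimes>\<^bsub>B\<^esub> inv\<^bsub>B\<^esub> (g s') = g a \<otimes>\<^bsub>B\<^esub> inv\<^bsub>B\<^esub> (g s)" if "(a', s') \<in> frac R S a s" for a' s'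
  proof -
    have "a' \<in> carrier R" "s' \<in> S" "frac R S a' s' = frac R S a s" using mem_fracD[OF assms that] by blast+
    then show ?thesis using assms by (intro loc_lift_unique_value)
  qed
  note eq = this
  show ?thesis
    unfolding loc_lift_def
    by (rule the_elem_image_const[OF frac_self[OF assms]]) (use eq in \<open>auto split: prod.splits\<close>)
qed

text \<open>Elements \<open>g(s)\<close> with \<open>s \<in> S\<close> commute with the image of
  \<open>g\<close>, and so do their inverses, which makes \<open>g(a) g(s)\<^sup>-\<^sup>1\<close>
  multiplicative.\<close>

lemma loc_lift_hom: "loc_lift B g \<in> ring_hom (loc R S) B"
proof (rule ring_hom_memI)
  fix x assume "x \<in> carrier (loc R S)"
  then show "loc_lift B g x \<in> carrier B" using units by (auto simp: carrier_loc loc_lift_frac g_simps)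
next
  fix x y assume "x \<in> carrier (loc R S)" "y \<in> carrier (loc R S)"
  then obtain a b s where *: "a \<in> carrier R" "b \<in> carrier R" "s \<in> S" "x = frac R S a s" "y = frac R S b s"
    by (rule loc_common2)
  have c: "g a \<in> carrier B" "g b \<in> carrier B" "g s \<in> carrier B" "inv\<^bsub>B\<^esub> (g s) \<in> carrier B"
    using * units by (auto simp: g_simps S_closed)
  show "loc_lift B g (x \<oplus>\<^bsub>loc R S\<^esub> y) = loc_lift B g x \<oplus>\<^bsub>B\<^esub> loc_lift B g y"
    using * c by (simp add: add_frac_same loc_lift_frac g_simps B.l_distr)
  have "inv\<^bsub>B\<^esub> (g s \<otimes>\<^bsub>B\<^esub> g s) = inv\<^bsub>B\<^esub> (g s) \<otimes>\<^bsub>B\<^esub> inv\<^bsub>B\<^esub> (g s)"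
    using c units[OF *(3)] by (intro B.inv_unique'[symmetric]) (simp_all add: B.m_assoc[symmetric], simp_all add: B.m_assoc)
  moreover have "g b \<otimes>\<^bsub>B\<^esub> (inv\<^bsub>B\<^esub> (g s) \<otimes>\<^bsub>B\<^esub> inv\<^bsub>B\<^esub> (g s)) =
      (g b \<otimes>\<^bsub>B\<^esub> inv\<^bsub>B\<^esub> (g s)) \<otimes>\<^bsub>B\<^esub> inv\<^bsub>B\<^esub> (g s)"
    using c by (simp add: B.m_assoc)
  moreover have "\<dots> = inv\<^bsub>B\<^esub> (g s) \<otimes>\<^bsub>B\<^esub> (g b \<otimes>\<^bsub>B\<^esub> inv\<^bsub>B\<^esub> (g s))"
    using c g_comm(2)[OF *(3,2)] by (simp add: B.m_assoc)
  ultimately show "loc_lift B g (x \<otimes>\<^bsub>loc R S\<^esub> y) = loc_lift B g x \<otimes>\<^bsub>B\<^esub> loc_lift B g y"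
    using * c by (simp add: mult_frac loc_lift_frac g_simps S_mult S_closed B.m_assoc)
next
  show "loc_lift B g \<one>\<^bsub>loc R S\<^esub> = \<one>\<^bsub>B\<^esub>" by (simp add: loc_one loc_lift_frac S_one g_simps)
qed

end

end

section \<open>Evaluation and reversal of polynomials over a noncommutative ring\<close>

lemma center_pow:
  assumes "ring B" "c \<in> ring_center B"
  shows "c [^]\<^bsub>B\<^esub> (n::nat) \<in> ring_center B"
proof -
  interpret B: ring B by fact
  have c: "c \<in> carrier B" "\<And>x. x \<in> carrier B \<Longrightarrow> c \<otimes>\<^bsub>B\<^esub> x = x \<otimes>\<^bsub>B\<^esub> c"
    using assms(2) by (auto simp: ring_center_def)
  have "c [^]\<^bsub>B\<^esub> n \<otimes>\<^bsub>B\<^esub> x = x \<otimes>\<^bsub>B\<^esub> c [^]\<^bsub>B\<^esub> n" if x: "x \<in> carrier B" for x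
  proof (induction n)
    case (Suc n)
    have "c [^]\<^bsub>B\<^esub> n \<otimes>\<^bsub>B\<^esub> c \<otimes>\<^bsub>B\<^esub> x = (c [^]\<^bsub>B\<^esub> n \<otimes>\<^bsub>B\<^esub> x) \<otimes>\<^bsub>B\<^esub> c" using c x by (simp add: B.m_assoc)
    also have "\<dots> = x \<otimes>\<^bsub>B\<^esub> (c [^]\<^bsub>B\<^esub> n \<otimes>\<^bsub>B\<^esub> c)" unfolding Suc using c x by (simp add: B.m_assoc)
    finally show ?case by simp
  qed (use x in simp)
  then show ?thesis using c by (auto simp: ring_center_def)
qed

lemma (in UP_ring) ring_UP: "ring P" by (rule UP_ring)

lemma (in UP_ring) monom_eq: "a \<in> carrier R \<Longrightarrow> monom P a n = monom P a 0 \<otimes>\<^bsub>P\<^esub> monom P \<one> 1 [^]\<^bsub>P\<^esub> n"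
proof -
  have m: "monom P \<one> n = monom P \<one> 1 [^]\<^bsub>P\<^esub> n"
  proof (induction n)
    case (Suc n)
    then show ?case using monom_one_Suc[of n] by simp
  qed simp
  assume "a \<in> carrier R"
  then show ?thesis using monom_mult[of a \<one> 0 n] m by simp
qed

text \<open>Evaluation is a homomorphism on a polynomial ring with noncommuting coefficients only at
  a point that commutes with the image of the coefficients; a central point suffices here.\<close>

locale eval_central = UP_ring R P for R :: "('a, 'r) ring_scheme" (structure) and P (structure) +
  fixes B :: "('b, 's) ring_scheme" and \<phi> :: "'a \<Rightarrow> 'b" and c :: 'b
  assumes B: "ring B" and \<phi>: "\<phi> \<in> ring_hom R B" and c: "c \<in> ring_center B"
begin

sublocale B: ring B by (rule B)
sublocale \<phi>: ring_hom_ring R B \<phi> by (intro ring_hom_ringI2 R.ring_axioms B \<phi>)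

lemma pow_closed [simp]: "c [^]\<^bsub>B\<^esub> (n::nat) \<in> carrier B"
  using center_pow[OF B c] by (auto simp: ring_center_def)

lemma pow_comm: "x \<in> carrier B \<Longrightarrow> c [^]\<^bsub>B\<^esub> (n::nat) \<otimes>\<^bsub>B\<^esub> x = x \<otimes>\<^bsub>B\<^esub> c [^]\<^bsub>B\<^esub> n"
  using center_pow[OF B c] by (auto simp: ring_center_def)

lemma c_closed: "c \<in> carrier B" using c by (auto simp: ring_center_def)

lemma eval_le:
  assumes "p \<in> carrier P" "deg R p \<le> n"
  shows "eval R B \<phi> c p = (\<Oplus>\<^bsub>B\<^esub>i\<in>{..n}. \<phi> (coeff P p i) \<otimes>\<^bsub>B\<^esub> c [^]\<^bsub>B\<^esub> i)"
  unfolding eval_on_carrier[OF assms(1)]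
  by (rule B.add.finprod_mono_neutral_cong_left) (use assms deg_aboveD in auto)

lemma eval_closed: "p \<in> carrier P \<Longrightarrow> eval R B \<phi> c p \<in> carrier B"
  by (subst eval_on_carrier) (auto intro!: B.finsum_closed)

lemma eval_hom: "eval R B \<phi> c \<in> ring_hom P B"
proof (rule ring_hom_memI)
  fix p q assume pq: "p \<in> carrier P" "q \<in> carrier P"
  let ?n = "max (deg R p) (deg R q)"
  have "eval R B \<phi> c (p \<oplus>\<^bsub>P\<^esub> q) =
      (\<Oplus>\<^bsub>B\<^esub>i\<in>{..?n}. \<phi> (coeff P p i) \<otimes>\<^bsub>B\<^esub> c [^]\<^bsub>B\<^esub> i \<oplus>\<^bsub>B\<^esub> \<phi> (coeff P q i) \<otimes>\<^bsub>B\<^esub> c [^]\<^bsub>B\<^esub> i)"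
    using pq by (subst eval_le[of _ ?n]) (auto intro!: B.finsum_cong' simp: B.l_distr)
  also have "\<dots> = eval R B \<phi> c p \<oplus>\<^bsub>B\<^esub> eval R B \<phi> c q"
    using pq by (subst B.finsum_addf) (auto simp: eval_le[of _ ?n])
  finally show "eval R B \<phi> c (p \<oplus>\<^bsub>P\<^esub> q) = eval R B \<phi> c p \<oplus>\<^bsub>B\<^esub> eval R B \<phi> c q" .
  let ?f = "\<lambda>p i. \<phi> (coeff P p i) \<otimes>\<^bsub>B\<^esub> c [^]\<^bsub>B\<^esub> i"
  have bound: "bound \<zero>\<^bsub>B\<^esub> (deg R p) (?f p)" if "p \<in> carrier P" for p
    using that deg_aboveD by (intro bound.intro) simp
  have trm: "?f (p \<otimes>\<^bsub>P\<^esub> q) k = (\<Oplus>\<^bsub>B\<^esub>i\<in>{..k}. ?f p i \<otimes>\<^bsub>B\<^esub> ?f q (k - i))" for k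
  proof -
    have "?f (p \<otimes>\<^bsub>P\<^esub> q) k = (\<Oplus>\<^bsub>B\<^esub>i\<in>{..k}. \<phi> (coeff P p i \<otimes> coeff P q (k - i))) \<otimes>\<^bsub>B\<^esub> c [^]\<^bsub>B\<^esub> k"
      using pq by (simp add: Pi_def o_def)
    also have "\<dots> = (\<Oplus>\<^bsub>B\<^esub>i\<in>{..k}. \<phi> (coeff P p i \<otimes> coeff P q (k - i)) \<otimes>\<^bsub>B\<^esub> c [^]\<^bsub>B\<^esub> k)"
      using pq by (intro B.finsum_ldistr) auto
    also have "\<dots> = (\<Oplus>\<^bsub>B\<^esub>i\<in>{..k}. ?f p i \<otimes>\<^bsub>B\<^esub> ?f q (k - i))"
    proof (rule B.finsum_cong')
      fix i assume i: "i \<in> {..k}"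
      let ?x = "\<phi> (coeff P p i)" and ?y = "\<phi> (coeff P q (k - i))"
      have xy: "?x \<in> carrier B" "?y \<in> carrier B" using pq by auto
      have "?f p i \<otimes>\<^bsub>B\<^esub> ?f q (k - i) = ?x \<otimes>\<^bsub>B\<^esub> (c [^]\<^bsub>B\<^esub> i \<otimes>\<^bsub>B\<^esub> ?y) \<otimes>\<^bsub>B\<^esub> c [^]\<^bsub>B\<^esub> (k - i)"
        using xy by (simp add: B.m_assoc)
      also have "\<dots> = (?x \<otimes>\<^bsub>B\<^esub> ?y) \<otimes>\<^bsub>B\<^esub> (c [^]\<^bsub>B\<^esub> i \<otimes>\<^bsub>B\<^esub> c [^]\<^bsub>B\<^esub> (k - i))"
        unfolding pow_comm[OF xy(2)] using xy by (simp add: B.m_assoc)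
      also have "c [^]\<^bsub>B\<^esub> i \<otimes>\<^bsub>B\<^esub> c [^]\<^bsub>B\<^esub> (k - i) = c [^]\<^bsub>B\<^esub> k"
        using i c_closed by (simp add: B.nat_pow_mult)
      finally show "\<phi> (coeff P p i \<otimes> coeff P q (k - i)) \<otimes>\<^bsub>B\<^esub> c [^]\<^bsub>B\<^esub> k = ?f p i \<otimes>\<^bsub>B\<^esub> ?f q (k - i)"
        using pq by simp
    qed (use pq in auto)
    finally show ?thesis .
  qed
  have "eval R B \<phi> c (p \<otimes>\<^bsub>P\<^esub> q) = (\<Oplus>\<^bsub>B\<^esub>k\<in>{..deg R p + deg R q}. ?f (p \<otimes>\<^bsub>P\<^esub> q) k)"
    using pq by (intro eval_le deg_mult_ring) auto
  also have "\<dots> = eval R B \<phi> c p \<otimes>\<^bsub>B\<^esub> eval R B \<phi> c q"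
    unfolding trm eval_on_carrier[OF pq(1)] eval_on_carrier[OF pq(2)]
    using pq by (intro B.cauchy_product bound) auto
  finally show "eval R B \<phi> c (p \<otimes>\<^bsub>P\<^esub> q) = eval R B \<phi> c p \<otimes>\<^bsub>B\<^esub> eval R B \<phi> c q" .
next
  show "eval R B \<phi> c \<one>\<^bsub>P\<^esub> = \<one>\<^bsub>B\<^esub>" by (subst eval_le[of _ 0]) auto
qed (rule eval_closed)

lemma eval_monom: "a \<in> carrier R \<Longrightarrow> eval R B \<phi> c (monom P a n) = \<phi> a \<otimes>\<^bsub>B\<^esub> c [^]\<^bsub>B\<^esub> n"
proof -
  assume a: "a \<in> carrier R"
  have "eval R B \<phi> c (monom P a n) = (\<Oplus>\<^bsub>B\<^esub>i\<in>{..n}. if n = i then \<phi> a \<otimes>\<^bsub>B\<^esub> c [^]\<^bsub>B\<^esub> i else \<zero>\<^bsub>B\<^esub>)"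
    using a deg_monom_le by (subst eval_le[of _ n]) (auto intro!: B.finsum_cong')
  also have "\<dots> = \<phi> a \<otimes>\<^bsub>B\<^esub> c [^]\<^bsub>B\<^esub> n" using a by (subst B.finsum_singleton) auto
  finally show ?thesis .
qed

end

lemma (in UP_ring) hom_eq_sum:
  assumes B: "ring B" and g: "g \<in> ring_hom P B" and p: "p \<in> carrier P" "deg R p \<le> n"
  shows "g p = (\<Oplus>\<^bsub>B\<^esub>i\<in>{..n}. g (monom P (coeff P p i) 0) \<otimes>\<^bsub>B\<^esub> g (monom P \<one> 1) [^]\<^bsub>B\<^esub> i)"
proof -
  interpret g: ring_hom_ring P B g by (intro ring_hom_ringI2 UP_ring B g)
  have pow: "g (monom P \<one> 1 [^]\<^bsub>P\<^esub> i) = g (monom P \<one> 1) [^]\<^bsub>B\<^esub> (i::nat)" for i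
    by (induction i) simp_all
  have "g p = g (\<Oplus>\<^bsub>P\<^esub>i\<in>{..n}. monom P (coeff P p i) i)" using up_repr_le[OF p(2,1)] by simp
  also have "\<dots> = (\<Oplus>\<^bsub>B\<^esub>i\<in>{..n}. g (monom P (coeff P p i) i))"
    using p by (subst g.hom_finsum) (auto simp: o_def)
  also have "\<dots> = (\<Oplus>\<^bsub>B\<^esub>i\<in>{..n}. g (monom P (coeff P p i) 0) \<otimes>\<^bsub>B\<^esub> g (monom P \<one> 1) [^]\<^bsub>B\<^esub> i)"
  proof (rule g.S.finsum_cong')
    fix i
    have "monom P (coeff P p i) i = monom P (coeff P p i) 0 \<otimes>\<^bsub>P\<^esub> monom P \<one> 1 [^]\<^bsub>P\<^esub> i"
      using p by (intro monom_eq) simp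
    then show "g (monom P (coeff P p i) i) = g (monom P (coeff P p i) 0) \<otimes>\<^bsub>B\<^esub> g (monom P \<one> 1) [^]\<^bsub>B\<^esub> i"
      using p by (simp only: pow[symmetric]) (simp del: monom_mult)
  qed (use p in auto)
  finally show ?thesis .
qed

context UP_ring begin

lemma coeff_mult_const_right:
  assumes "p \<in> carrier P" "a \<in> carrier R"
  shows "coeff P (p \<otimes>\<^bsub>P\<^esub> monom P a 0) n = coeff P p n \<otimes> a"
proof -
  have "coeff P (p \<otimes>\<^bsub>P\<^esub> monom P a 0) n = (\<Oplus>i\<in>{..n}. if n = i then coeff P p i \<otimes> a else \<zero>)"
    using assms by (auto intro!: R.finsum_cong')
  also have "\<dots> = coeff P p n \<otimes> a" using assms by (subst R.finsum_singleton) auto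
  finally show ?thesis .
qed

lemma center_UP_iff:
  "p \<in> ring_center P \<longleftrightarrow> p \<in> carrier P \<and> (\<forall>n. coeff P p n \<in> ring_center R)"
proof (intro iffI conjI allI)
  assume p: "p \<in> ring_center P"
  then show pP: "p \<in> carrier P" by (simp add: ring_center_def)
  fix n
  have "coeff P p n \<otimes> a = a \<otimes> coeff P p n" if a: "a \<in> carrier R" for a
    using p a coeff_mult_const_right[OF pP a, of n]
    by (simp add: ring_center_def monom_mult_is_smult pP flip: coeff_smult)
  then show "coeff P p n \<in> ring_center R" using pP by (auto simp: ring_center_def)
next
  assume p: "p \<in> carrier P \<and> (\<forall>n. coeff P p n \<in> ring_center R)"
  have "p \<otimes>\<^bsub>P\<^esub> q = q \<otimes>\<^bsub>P\<^esub> p" if q: "q \<in> carrier P" for q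
  proof (rule up_eqI)
    fix n
    have "coeff P (p \<otimes>\<^bsub>P\<^esub> q) n = (\<Oplus>i\<in>{..n}. coeff P q (n - i) \<otimes> coeff P p i)"
      using p q by (auto intro!: R.finsum_cong' simp: ring_center_def)
    also have "\<dots> = (\<Oplus>i\<in>(\<lambda>i. n - i) ` {..n}. coeff P q i \<otimes> coeff P p (n - i))"
      using p q by (subst R.finsum_reindex) (auto intro!: R.finsum_cong' inj_onI)
    also have "(\<lambda>i. n - i) ` {..n} = {..n}"
    proof (intro equalityI subsetI)
      fix i assume "i \<in> {..n}"
      then show "i \<in> (\<lambda>i. n - i) ` {..n}" by (intro image_eqI[of _ _ "n - i"]) auto
    qed auto
    finally show "coeff P (p \<otimes>\<^bsub>P\<^esub> q) n = coeff P (q \<otimes>\<^bsub>P\<^esub> p) n" using p q by simp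
  qed (use p q in auto)
  then show "p \<in> ring_center P" using p by (auto simp: ring_center_def)
qed

text \<open>Reversal with respect to a bound \<open>d\<close> for the degree, \<open>t\<^sup>d
  p(1/t)\<close>.  With a bound in place of the degree it is multiplicative without assumptions on
  leading coefficients.\<close>

definition rev_at :: "nat \<Rightarrow> (nat \<Rightarrow> 'a) \<Rightarrow> nat \<Rightarrow> 'a" where
  "rev_at d p = (\<lambda>i. if i \<le> d then coeff P p (d - i) else \<zero>)"

lemma reversed_eq: "reversed R p = rev_at (deg R p) p"
  unfolding reversed_def rev_at_def P_def ..

lemma rev_at_closed [simp]: "p \<in> carrier P \<Longrightarrow> rev_at d p \<in> carrier P"
  and coeff_rev_at: "p \<in> carrier P \<Longrightarrow> coeff P (rev_at d p) i = (if i \<le> d then coeff P p (d - i) else \<zero>)"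
proof -
  assume p: "p \<in> carrier P"
  have "bound \<zero> d (rev_at d p)" by (rule bound.intro) (simp add: rev_at_def)
  then have u: "rev_at d p \<in> up R" using p by (intro mem_upI) (auto simp: rev_at_def)
  then show "rev_at d p \<in> carrier P" by (simp add: P_def UP_def)
  show "coeff P (rev_at d p) i = (if i \<le> d then coeff P p (d - i) else \<zero>)"
    using u by (simp add: P_def UP_def) (simp add: rev_at_def P_def UP_def)
qed

lemma deg_rev_at_le: "p \<in> carrier P \<Longrightarrow> deg R (rev_at d p) \<le> d"
  by (rule deg_aboveI) (simp_all add: coeff_rev_at)

text \<open>Both sides have as coefficient at \<open>n\<close> the sum of \<open>p\<^sub>i
  q\<^sub>j\<close> over \<open>i + j = d + e - n\<close>.\<close>

lemma rev_at_mult: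
  assumes p: "p \<in> carrier P" "deg R p \<le> d" and q: "q \<in> carrier P" "deg R q \<le> e"
  shows "rev_at d p \<otimes>\<^bsub>P\<^esub> rev_at e q = rev_at (d + e) (p \<otimes>\<^bsub>P\<^esub> q)"
proof (rule up_eqI)
  fix k
  let ?J = "{j. j \<le> k \<and> j \<le> d \<and> k - j \<le> e}"
  have c: "coeff P p i \<in> carrier R" "coeff P q i \<in> carrier R" for i using p q by auto
  have "coeff P (rev_at d p \<otimes>\<^bsub>P\<^esub> rev_at e q) k =
      (\<Oplus>j\<in>?J. coeff P p (d - j) \<otimes> coeff P q (e - (k - j)))"
    unfolding coeff_mult[OF rev_at_closed[OF p(1)] rev_at_closed[OF q(1)]]
    by (rule R.add.finprod_mono_neutral_cong_right) (use p q in \<open>auto simp: coeff_rev_at\<close>)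
  also have "\<dots> = coeff P (rev_at (d + e) (p \<otimes>\<^bsub>P\<^esub> q)) k"
  proof (cases "k \<le> d + e")
    case True
    have "(\<Oplus>j\<in>?J. coeff P p (d - j) \<otimes> coeff P q (e - (k - j))) =
        (\<Oplus>j\<in>?J. coeff P p (d - j) \<otimes> coeff P q (d + e - k - (d - j)))"
      using c by (intro R.finsum_cong') (auto intro!: arg_cong[of _ _ "\<lambda>i. _ \<otimes> coeff P q i"])
    also have "\<dots> = (\<Oplus>i\<in>(\<lambda>j. d - j) ` ?J. coeff P p i \<otimes> coeff P q (d + e - k - i))"
      using c by (subst R.finsum_reindex) (auto intro!: inj_onI)
    also have "(\<lambda>j. d - j) ` ?J = {i. i \<le> d + e - k \<and> i \<le> d \<and> d \<le> i + k}"
    proof (intro equalityI subsetI)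
      fix i assume "i \<in> {i. i \<le> d + e - k \<and> i \<le> d \<and> d \<le> i + k}"
      then show "i \<in> (\<lambda>j. d - j) ` ?J" using True by (intro image_eqI[of _ _ "d - i"]) auto
    qed (use True in auto)
    also have "(\<Oplus>i\<in>{i. i \<le> d + e - k \<and> i \<le> d \<and> d \<le> i + k}. coeff P p i \<otimes> coeff P q (d + e - k - i)) =
        (\<Oplus>i\<in>{..d + e - k}. coeff P p i \<otimes> coeff P q (d + e - k - i))"
    proof (rule R.add.finprod_mono_neutral_cong_left)
      fix i assume i: "i \<in> {..d + e - k} - {i. i \<le> d + e - k \<and> i \<le> d \<and> d \<le> i + k}"
      then have "deg R p < i \<or> deg R q < d + e - k - i" using p q by auto
      then show "coeff P p i \<otimes> coeff P q (d + e - k - i) = \<zero>\<^bsub>R\<^esub>"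
        using p q c deg_aboveD by auto
    qed (use c in auto)
    finally show ?thesis using True p q by (simp add: coeff_rev_at)
  next
    case False
    then have "?J = {}" by auto
    then show ?thesis using False p q by (simp only: R.finsum_empty) (simp add: coeff_rev_at)
  qed
  finally show "coeff P (rev_at d p \<otimes>\<^bsub>P\<^esub> rev_at e q) k = coeff P (rev_at (d + e) (p \<otimes>\<^bsub>P\<^esub> q)) k" .
qed (use p q in auto)

lemma deg_mult_monic:
  assumes "monic R p" "monic R q" "\<one> \<noteq> \<zero>"
  shows "deg R (p \<otimes>\<^bsub>P\<^esub> q) = deg R p + deg R q"
proof (rule antisym)
  have p: "p \<in> carrier P" "coeff P p (deg R p) = \<one>" and q: "q \<in> carrier P" "coeff P q (deg R q) = \<one>"
    using assms unfolding monic_def P_def by auto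
  show "deg R (p \<otimes>\<^bsub>P\<^esub> q) \<le> deg R p + deg R q" using p q by (intro deg_mult_ring) auto
  have "coeff P (p \<otimes>\<^bsub>P\<^esub> q) (deg R p + deg R q) =
      (\<Oplus>i\<in>{..deg R p + deg R q}. if deg R p = i then \<one> else \<zero>)"
  proof -
    have "coeff P p i \<otimes> coeff P q (deg R p + deg R q - i) = (if deg R p = i then \<one> else \<zero>)" for i
    proof (cases "deg R p" i rule: linorder_cases)
      case greater
      then have "coeff P q (deg R p + deg R q - i) = \<zero>" using q by (intro deg_aboveD) auto
      then show ?thesis using greater p by simp
    qed (use p q deg_aboveD in auto)
    then show ?thesis using p q by (simp del: deg_mult_ring)
  qed
  also have "\<dots> = \<one>" by (subst R.finsum_singleton) auto
  finally show "deg R p + deg R q \<le> deg R (p \<otimes>\<^bsub>P\<^esub> q)"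
    using p q assms(3) by (intro deg_belowI) auto
qed

text \<open>For monic polynomials the degrees add, so the reversals with respect to the degree
  multiply.  Over the zero ring all polynomials agree.\<close>

lemma reversed_submonoid:
  assumes S: "submonoid S P" and monic: "\<And>p. p \<in> S \<Longrightarrow> monic R p"
  shows "submonoid (reversed R ` S) P"
proof
  have SP: "p \<in> carrier P" if "p \<in> S" for p using S that by (auto simp: submonoid_def)
  show "reversed R ` S \<subseteq> carrier P" using SP by (auto simp: reversed_eq)
  have "reversed R \<one>\<^bsub>P\<^esub> = \<one>\<^bsub>P\<^esub>"
    by (rule up_eqI) (auto simp: reversed_eq coeff_rev_at)
  then show "\<one>\<^bsub>P\<^esub> \<in> reversed R ` S" using S by (metis imageI submonoid.one_closed)
  fix x y assume "x \<in> reversed R ` S" "y \<in> reversed R ` S"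
  then obtain p q where pq: "p \<in> S" "q \<in> S" "x = reversed R p" "y = reversed R q" by blast
  have "reversed R p \<otimes>\<^bsub>P\<^esub> reversed R q = reversed R (p \<otimes>\<^bsub>P\<^esub> q)"
  proof (cases "\<one> = \<zero>")
    case True
    then have "carrier R = {\<zero>}" using R.one_zeroD by blast
    then have "coeff P r n = \<zero>" if "r \<in> carrier P" for r n using that coeff_closed by blast
    then show ?thesis using SP[OF pq(1)] SP[OF pq(2)] by (intro up_eqI) (auto simp: reversed_eq)
  next
    case False
    then show ?thesis using SP[OF pq(1)] SP[OF pq(2)] monic pq deg_mult_monic
      by (simp add: reversed_eq rev_at_mult)
  qed
  then show "x \<otimes>\<^bsub>P\<^esub> y \<in> reversed R ` S"
    unfolding pq(3,4) using pq(1,2) S by (metis imageI submonoid.m_closed)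
qed

lemma reversed_central:
  assumes "S \<subseteq> ring_center P"
  shows "reversed R ` S \<subseteq> ring_center P"
proof
  fix x assume "x \<in> reversed R ` S"
  then obtain p where p: "p \<in> S" "x = reversed R p" by blast
  then have c: "p \<in> carrier P" "\<And>n. coeff P p n \<in> ring_center R" using assms center_UP_iff by auto
  have "\<zero> \<in> ring_center R" by (auto simp: ring_center_def)
  then show "x \<in> ring_center P"
    using c unfolding p(2) reversed_eq center_UP_iff by (auto simp: coeff_rev_at)
qed

lemma indet_central: "monom P \<one> 1 \<in> ring_center P"
  unfolding center_UP_iff by (auto simp: ring_center_def)

end

section \<open>The rings \<open>A[t]\<^sub>S\<close> and \<open>A[t]\<^sub>T\<close>\<close>

locale poly_at = UP_ring A P for A :: "('a, 'r) ring_scheme" (structure) and P (structure) +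
  fixes S :: "(nat \<Rightarrow> 'a) set"
  assumes S_sub: "submonoid S P" and S_cen: "S \<subseteq> ring_center P"
begin

abbreviation B where "B \<equiv> polys_at A S"
abbreviation const where "const \<equiv> const_at A S"
abbreviation t where "t \<equiv> indet_at A S"

lemma B_def: "B = loc P S" by (simp add: polys_at_def P_def)

sublocale loc: central_loc P S
  by (intro central_loc.intro UP_ring central_loc_axioms.intro S_sub S_cen)

sublocale B: ring B unfolding B_def by (rule loc.ring_loc)

lemma const_eq: "const a = frac P S (monom P a 0) \<one>\<^bsub>P\<^esub>" by (simp add: const_at_def P_def)
lemma t_eq: "t = frac P S (monom P \<one> 1) \<one>\<^bsub>P\<^esub>" by (simp add: indet_at_def P_def)

lemma const_hom: "const \<in> ring_hom A B"
  using ring_hom_trans[OF const_ring_hom loc.frac_hom] by (simp add: B_def const_eq[abs_def] o_def)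

lemma t_central: "t \<in> ring_center B"
  unfolding B_def t_eq by (rule loc.frac_central[OF indet_central loc.S_one])

lemma const_central: "a \<in> ring_center A \<Longrightarrow> const a \<in> ring_center B"
  unfolding B_def const_eq
  by (rule loc.frac_central[OF _ loc.S_one]) (auto simp: center_UP_iff, auto simp: ring_center_def)

lemma frac_eq_sum:
  assumes "p \<in> carrier P" "deg A p \<le> n"
  shows "frac P S p \<one>\<^bsub>P\<^esub> = (\<Oplus>\<^bsub>B\<^esub>i\<in>{..n}. const (coeff P p i) \<otimes>\<^bsub>B\<^esub> t [^]\<^bsub>B\<^esub> i)"
  using hom_eq_sum[OF B.ring_axioms loc.frac_hom[folded B_def] assms] by (simp add: const_eq t_eq)

lemma frac_unit: "p \<in> S \<Longrightarrow> frac P S p \<one>\<^bsub>P\<^esub> \<in> Units B"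
  unfolding B_def by (rule loc.frac_Units[OF _ loc.S_one])

end

lemma (in ring) finsum_reverse:
  assumes "\<And>i. i \<le> d \<Longrightarrow> f i \<in> carrier R"
  shows "(\<Oplus>i\<in>{..d::nat}. f (d - i)) = (\<Oplus>i\<in>{..d}. f i)"
proof -
  have im: "(\<lambda>i. d - i) ` {..d} = {..d}"
  proof (intro equalityI subsetI)
    fix i assume "i \<in> {..d}"
    then show "i \<in> (\<lambda>i. d - i) ` {..d}" by (intro image_eqI[of _ _ "d - i"]) auto
  qed auto
  have "(\<Oplus>i\<in>(\<lambda>i. d - i) ` {..d}. f i) = (\<Oplus>i\<in>{..d}. f (d - i))"
    by (rule finsum_reindex) (use assms in \<open>auto intro!: inj_onI\<close>)
  then show ?thesis unfolding im by simp
qed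

locale poly_loc = UP_ring A P for A :: "('a, 'r) ring_scheme" (structure) and P (structure) +
  fixes S :: "(nat \<Rightarrow> 'a) set"
  assumes S_submonoid: "submonoid S P" and S_monic: "\<And>p. p \<in> S \<Longrightarrow> monic A p"
    and S_central: "S \<subseteq> ring_center P" and indet_in_S: "monom P \<one> 1 \<in> S"
begin

abbreviation T where "T \<equiv> reversed A ` S"

sublocale S: poly_at A P S
  by (intro poly_at.intro poly_at_axioms.intro UP_ring_axioms
      S_submonoid[unfolded P_def] S_central[unfolded P_def]) (rule P_def)

sublocale T: poly_at A P T
  by (intro poly_at.intro poly_at_axioms.intro UP_ring_axioms
      reversed_submonoid[OF S_submonoid S_monic, unfolded P_def] reversed_central[OF S_central, unfolded P_def]) (assumption, rule P_def)

abbreviation ti where "ti \<equiv> inv_indet_at A S"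

lemma ti_eq: "ti = frac P S \<one>\<^bsub>P\<^esub> (monom P \<one> 1)" by (simp add: inv_indet_at_def P_def)

lemma t_ti: "S.t \<otimes>\<^bsub>S.B\<^esub> ti = \<one>\<^bsub>S.B\<^esub>" "ti \<otimes>\<^bsub>S.B\<^esub> S.t = \<one>\<^bsub>S.B\<^esub>"
  unfolding S.t_eq ti_eq S.B_def using S.loc.frac_inverse indet_in_S S.loc.S_one by auto

lemma ti_central: "ti \<in> ring_center S.B"
  unfolding ti_eq S.B_def
  by (rule S.loc.frac_central) (use indet_in_S center_UP_iff in \<open>auto simp: ring_center_def\<close>)

sublocale ev: eval_central A P S.B S.const ti
  by unfold_locales (rule S.const_hom ti_central)+

lemma t_closed: "S.t \<in> carrier S.B" and ti_closed: "ti \<in> carrier S.B"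
  using S.t_central ti_central by (auto simp: ring_center_def)

lemma t_pow_ti_pow: "n \<le> d \<Longrightarrow> S.t [^]\<^bsub>S.B\<^esub> d \<otimes>\<^bsub>S.B\<^esub> ti [^]\<^bsub>S.B\<^esub> n = S.t [^]\<^bsub>S.B\<^esub> (d - n :: nat)"
proof (induction n)
  case (Suc n)
  have "S.t [^]\<^bsub>S.B\<^esub> d \<otimes>\<^bsub>S.B\<^esub> ti [^]\<^bsub>S.B\<^esub> Suc n = (S.t [^]\<^bsub>S.B\<^esub> d \<otimes>\<^bsub>S.B\<^esub> ti [^]\<^bsub>S.B\<^esub> n) \<otimes>\<^bsub>S.B\<^esub> ti"
    using t_closed ti_closed by (simp add: S.B.m_assoc)
  also have "\<dots> = S.t [^]\<^bsub>S.B\<^esub> Suc (d - Suc n) \<otimes>\<^bsub>S.B\<^esub> ti"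
    using Suc by (simp add: Suc_diff_Suc)
  also have "\<dots> = S.t [^]\<^bsub>S.B\<^esub> (d - Suc n) \<otimes>\<^bsub>S.B\<^esub> (S.t \<otimes>\<^bsub>S.B\<^esub> ti)"
    using t_closed ti_closed by (simp add: S.B.m_assoc)
  finally show ?case using t_closed by (simp add: t_ti)
qed (use t_closed in simp)

text \<open>The substitution \<open>t \<mapsto> 1/t\<close> sends \<open>t\<^sup>d p(1/t)\<close> to \<open>t\<^sup>-\<^sup>d p(t)\<close>, which is invertible because \<open>p\<close> and
  \<open>t\<close> are in \<open>S\<close>.\<close>

lemma eval_reversed_unit:
  assumes "p \<in> S"
  shows "eval A S.B S.const ti (reversed A p) \<in> Units S.B"
proof -
  let ?d = "deg A p" and ?e = "eval A S.B S.const ti (reversed A p)"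
  have p: "p \<in> carrier P" using assms S.loc.S_closed by blast
  have cc: "S.const (coeff P p i) \<in> carrier S.B" for i using p by simp
  have tp: "S.t [^]\<^bsub>S.B\<^esub> (n::nat) \<otimes>\<^bsub>S.B\<^esub> x = x \<otimes>\<^bsub>S.B\<^esub> S.t [^]\<^bsub>S.B\<^esub> n" if "x \<in> carrier S.B" for n x
    using center_pow[OF S.B.ring_axioms S.t_central] that by (auto simp: ring_center_def)
  have "?e = (\<Oplus>\<^bsub>S.B\<^esub>i\<in>{..?d}. S.const (coeff P p (?d - i)) \<otimes>\<^bsub>S.B\<^esub> ti [^]\<^bsub>S.B\<^esub> i)"
    unfolding reversed_eq[of p] ev.eval_le[OF rev_at_closed[OF p] deg_rev_at_le[OF p]]
    using p cc by (intro S.B.finsum_cong') (auto simp: coeff_rev_at)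
  then have "S.t [^]\<^bsub>S.B\<^esub> ?d \<otimes>\<^bsub>S.B\<^esub> ?e = S.t [^]\<^bsub>S.B\<^esub> ?d \<otimes>\<^bsub>S.B\<^esub>
      (\<Oplus>\<^bsub>S.B\<^esub>i\<in>{..?d}. S.const (coeff P p (?d - i)) \<otimes>\<^bsub>S.B\<^esub> ti [^]\<^bsub>S.B\<^esub> i)"
    by simp
  also have "\<dots> = (\<Oplus>\<^bsub>S.B\<^esub>i\<in>{..?d}. S.t [^]\<^bsub>S.B\<^esub> ?d \<otimes>\<^bsub>S.B\<^esub> (S.const (coeff P p (?d - i)) \<otimes>\<^bsub>S.B\<^esub> ti [^]\<^bsub>S.B\<^esub> i))"
    using cc t_closed by (intro S.B.finsum_rdistr) auto
  also have "\<dots> = (\<Oplus>\<^bsub>S.B\<^esub>i\<in>{..?d}. S.const (coeff P p (?d - i)) \<otimes>\<^bsub>S.B\<^esub> S.t [^]\<^bsub>S.B\<^esub> (?d - i))"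
  proof (rule S.B.finsum_cong')
    fix i assume i: "i \<in> {..?d}"
    have "S.t [^]\<^bsub>S.B\<^esub> ?d \<otimes>\<^bsub>S.B\<^esub> (S.const (coeff P p (?d - i)) \<otimes>\<^bsub>S.B\<^esub> ti [^]\<^bsub>S.B\<^esub> i) =
      (S.t [^]\<^bsub>S.B\<^esub> ?d \<otimes>\<^bsub>S.B\<^esub> S.const (coeff P p (?d - i))) \<otimes>\<^bsub>S.B\<^esub> ti [^]\<^bsub>S.B\<^esub> i"
      using cc t_closed by (simp add: S.B.m_assoc)
    also have "\<dots> = S.const (coeff P p (?d - i)) \<otimes>\<^bsub>S.B\<^esub> (S.t [^]\<^bsub>S.B\<^esub> ?d \<otimes>\<^bsub>S.B\<^esub> ti [^]\<^bsub>S.B\<^esub> i)"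
      unfolding tp[OF cc] using cc t_closed by (simp add: S.B.m_assoc)
    finally show "S.t [^]\<^bsub>S.B\<^esub> ?d \<otimes>\<^bsub>S.B\<^esub> (S.const (coeff P p (?d - i)) \<otimes>\<^bsub>S.B\<^esub> ti [^]\<^bsub>S.B\<^esub> i) =
      S.const (coeff P p (?d - i)) \<otimes>\<^bsub>S.B\<^esub> S.t [^]\<^bsub>S.B\<^esub> (?d - i)"
      using i by (simp add: t_pow_ti_pow)
  qed (use cc t_closed in auto)
  also have "\<dots> = frac P S p \<one>\<^bsub>P\<^esub>"
    unfolding S.frac_eq_sum[OF p order_refl] using cc t_closed
    by (intro S.B.finsum_reverse[where f = "\<lambda>i. S.const (coeff P p i) \<otimes>\<^bsub>S.B\<^esub> S.t [^]\<^bsub>S.B\<^esub> i"]) auto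
  finally have e: "S.t [^]\<^bsub>S.B\<^esub> ?d \<otimes>\<^bsub>S.B\<^esub> ?e = frac P S p \<one>\<^bsub>P\<^esub>" .
  have ec: "?e \<in> carrier S.B" using p by (intro ev.eval_closed) (simp add: reversed_eq)
  have tu: "S.t \<in> Units S.B" using t_ti t_closed ti_closed unfolding Units_def by blast
  have tpu: "S.t [^]\<^bsub>S.B\<^esub> (n::nat) \<in> Units S.B" for n
    by (induction n) (use tu in \<open>auto intro: S.B.Units_m_closed\<close>)
  have "?e = inv\<^bsub>S.B\<^esub> (S.t [^]\<^bsub>S.B\<^esub> ?d) \<otimes>\<^bsub>S.B\<^esub> frac P S p \<one>\<^bsub>P\<^esub>"
    unfolding e[symmetric] using tpu[of ?d] ec S.B.Units_closed[OF tpu] by (simp add: S.B.m_assoc[symmetric])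
  also have "\<dots> \<in> Units S.B" using tpu[of ?d] S.frac_unit[OF assms] by (intro S.B.Units_m_closed) auto
  finally show ?thesis .
qed

lemma invert_indet_eq: "invert_indet A S = T.loc.loc_lift S.B (eval A S.B S.const ti)"
  by (simp add: fun_eq_iff invert_indet_def T.loc.loc_lift_def Let_def)

lemma invert_indet_hom: "invert_indet A S \<in> ring_hom T.B S.B"
  unfolding invert_indet_eq T.B_def
  by (rule T.loc.loc_lift_hom[OF S.B.ring_axioms ev.eval_hom]) (use eval_reversed_unit in auto)

lemma invert_indet_frac_one:
  assumes "p \<in> carrier P"
  shows "invert_indet A S (frac P T p \<one>\<^bsub>P\<^esub>) = eval A S.B S.const ti p"
proof -
  have e1: "eval A S.B S.const ti \<one>\<^bsub>P\<^esub> = \<one>\<^bsub>S.B\<^esub>" using ev.eval_hom by (simp add: ring_hom_def)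
  show ?thesis
    unfolding invert_indet_eq
    by (subst T.loc.loc_lift_frac[OF S.B.ring_axioms ev.eval_hom])
      (use assms eval_reversed_unit ev.eval_closed[OF assms] T.loc.S_one e1 in auto)
qed

lemma invert_indet_const: "a \<in> carrier A \<Longrightarrow> invert_indet A S (T.const a) = S.const a"
  by (simp add: T.const_eq invert_indet_frac_one ev.eval_monom)

lemma invert_indet_t: "invert_indet A S T.t = ti"
  using invert_indet_frac_one[of "monom P \<one> 1"] ti_closed by (simp add: T.t_eq ev.eval_monom)

text \<open>The sum is the image in \<open>A[t]\<^sub>T\<close> of the reversed polynomial, an
  element of \<open>T\<close>.\<close>

lemma reversed_sum_unit:
  assumes "p \<in> S"
  shows "(\<Oplus>\<^bsub>T.B\<^esub>i\<in>{..deg A p}. T.const (coeff P p i) \<otimes>\<^bsub>T.B\<^esub> T.t [^]\<^bsub>T.B\<^esub> (deg A p - i)) \<in> Units T.B"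
proof -
  let ?d = "deg A p"
  have p: "p \<in> carrier P" using assms S.loc.S_closed by blast
  interpret T: ring_hom_ring A T.B T.const by (intro ring_hom_ringI2 R.ring_axioms T.B.ring_axioms T.const_hom)
  have cc: "T.const (coeff P p i) \<in> carrier T.B" for i using p by simp
  have tc: "T.t \<in> carrier T.B" using T.t_central by (auto simp: ring_center_def)
  let ?f = "\<lambda>i. T.const (coeff P p (?d - i)) \<otimes>\<^bsub>T.B\<^esub> T.t [^]\<^bsub>T.B\<^esub> i"
  have "frac P T (reversed A p) \<one>\<^bsub>P\<^esub> = (\<Oplus>\<^bsub>T.B\<^esub>i\<in>{..?d}. ?f i)"
    unfolding reversed_eq[of p] T.frac_eq_sum[OF rev_at_closed[OF p] deg_rev_at_le[OF p]]
    using p cc tc by (intro T.B.finsum_cong') (auto simp: coeff_rev_at)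
  also have "\<dots> = (\<Oplus>\<^bsub>T.B\<^esub>i\<in>{..?d}. ?f (?d - i))"
    using cc tc by (intro T.B.finsum_reverse[symmetric]) auto
  also have "\<dots> = (\<Oplus>\<^bsub>T.B\<^esub>i\<in>{..?d}. T.const (coeff P p i) \<otimes>\<^bsub>T.B\<^esub> T.t [^]\<^bsub>T.B\<^esub> (?d - i))"
    using cc tc by (intro T.B.finsum_cong') auto
  finally show ?thesis using T.frac_unit[of "reversed A p"] assms by simp
qed

end

section \<open>Summands of free modules and extension of scalars\<close>

lemma the_mod_simps [simp]:
  "carrier (the_mod R X) = snd X"
  "\<zero>\<^bsub>the_mod R X\<^esub> = \<zero>\<^bsub>free_mod R (fst X)\<^esub>"
  "x \<oplus>\<^bsub>the_mod R X\<^esub> y = x \<oplus>\<^bsub>free_mod R (fst X)\<^esub> y"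
  "a \<odot>\<^bsub>the_mod R X\<^esub> x = a \<odot>\<^bsub>free_mod R (fst X)\<^esub> x"
  by (simp_all add: the_mod_def)

lemma right_module_submodule:
  assumes M: "right_module R M" and H: "submodule H R M"
  shows "right_module R (M\<lparr>carrier := H\<rparr>)"
proof -
  interpret right_module R M by fact
  have sub: "H \<subseteq> carrier M" "\<zero>\<^bsub>M\<^esub> \<in> H" "\<And>x y. x \<in> H \<Longrightarrow> y \<in> H \<Longrightarrow> x \<oplus>\<^bsub>M\<^esub> y \<in> H"
    "\<And>a x. a \<in> carrier R \<Longrightarrow> x \<in> H \<Longrightarrow> a \<odot>\<^bsub>M\<^esub> x \<in> H"
    using H unfolding submodule_iff[OF M] by auto
  have neg: "\<ominus>\<^bsub>M\<^esub> x \<in> H" if "x \<in> H" for x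
    unfolding a_inv_def by (rule subgroup.m_inv_closed[OF submodule.axioms(1)[OF H] that])
  have c: "x \<in> carrier M" if "x \<in> H" for x using sub(1) that by blast
  have "abelian_group (M\<lparr>carrier := H\<rparr>)"
  proof (rule abelian_groupI)
    fix x assume "x \<in> carrier (M\<lparr>carrier := H\<rparr>)"
    then show "\<exists>y\<in>carrier (M\<lparr>carrier := H\<rparr>). y \<oplus>\<^bsub>M\<lparr>carrier := H\<rparr>\<^esub> x = \<zero>\<^bsub>M\<lparr>carrier := H\<rparr>\<^esub>"
      using neg[of x] c[of x] by (intro bexI[of _ "\<ominus>\<^bsub>M\<^esub> x"]) (auto simp: M.l_neg)
  qed (use sub c in \<open>auto simp: M.a_assoc intro: M.a_comm\<close>)
  then show ?thesis
    by (intro right_module.intro right_module_axioms.intro R.ring_axioms)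
      (use sub c in \<open>auto simp: ract_l_distr ract_r_distr ract_assoc ract_one\<close>)
qed

lemma right_module_the_mod:
  assumes "ring R" "X \<in> summands R"
  shows "right_module R (the_mod R X)"
  unfolding the_mod_def
  by (rule right_module_submodule[OF right_module_free_mod[OF assms(1)]]) (use assms(2) in \<open>auto simp: summands_def\<close>)

lemma linear_mapD:
  assumes "linear_map R M N h"
  shows "x \<in> carrier M \<Longrightarrow> h x \<in> carrier N"
    and "h \<in> extensional (carrier M)"
    and "x \<in> carrier M \<Longrightarrow> y \<in> carrier M \<Longrightarrow> h (x \<oplus>\<^bsub>M\<^esub> y) = h x \<oplus>\<^bsub>N\<^esub> h y"
    and "a \<in> carrier R \<Longrightarrow> x \<in> carrier M \<Longrightarrow> h (a \<odot>\<^bsub>M\<^esub> x) = a \<odot>\<^bsub>N\<^esub> h x"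
  using assms by (auto simp: linear_map_def PiE_iff)

lemma linear_mapI:
  assumes "\<And>x. x \<in> carrier M \<Longrightarrow> h x \<in> carrier N" "h \<in> extensional (carrier M)"
    and "\<And>x y. x \<in> carrier M \<Longrightarrow> y \<in> carrier M \<Longrightarrow> h (x \<oplus>\<^bsub>M\<^esub> y) = h x \<oplus>\<^bsub>N\<^esub> h y"
    and "\<And>a x. a \<in> carrier R \<Longrightarrow> x \<in> carrier M \<Longrightarrow> h (a \<odot>\<^bsub>M\<^esub> x) = a \<odot>\<^bsub>N\<^esub> h x"
  shows "linear_map R M N h"
  using assms by (auto simp: linear_map_def PiE_iff)

lemma linear_map_compose:
  assumes M: "right_module R M" and f: "linear_map R M N f" and g: "linear_map R N K g"
  shows "linear_map R M K (compose (carrier M) g f)"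
proof -
  interpret M: right_module R M by fact
  show ?thesis
    by (rule linear_mapI) (use linear_mapD[OF f] linear_mapD[OF g] in \<open>auto simp: compose_def M.ract_closed\<close>)
qed

lemma linear_map_zero:
  assumes "right_module R M" "right_module R N" "linear_map R M N h"
  shows "h \<zero>\<^bsub>M\<^esub> = \<zero>\<^bsub>N\<^esub>"
proof -
  interpret M: right_module R M by fact
  interpret N: right_module R N by fact
  have "h \<zero>\<^bsub>M\<^esub> = h \<zero>\<^bsub>M\<^esub> \<oplus>\<^bsub>N\<^esub> h \<zero>\<^bsub>M\<^esub>" using linear_mapD(3)[OF assms(3), of "\<zero>\<^bsub>M\<^esub>" "\<zero>\<^bsub>M\<^esub>"] by simp
  then show ?thesis using linear_mapD(1)[OF assms(3), of "\<zero>\<^bsub>M\<^esub>"] by (metis M.M.zero_closed N.M.add.r_cancel_one')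
qed

lemma linear_map_minus:
  assumes "right_module R M" "right_module R N" "linear_map R M N h" "x \<in> carrier M" "y \<in> carrier M"
  shows "h (x \<ominus>\<^bsub>M\<^esub> y) = h x \<ominus>\<^bsub>N\<^esub> h y"
proof -
  interpret M: right_module R M by fact
  interpret N: right_module R N by fact
  have c: "h x \<in> carrier N" "h y \<in> carrier N" "h (x \<ominus>\<^bsub>M\<^esub> y) \<in> carrier N"
    using assms by (auto intro!: linear_mapD(1)[OF assms(3)])
  have "h (x \<ominus>\<^bsub>M\<^esub> y) \<oplus>\<^bsub>N\<^esub> h y = h ((x \<ominus>\<^bsub>M\<^esub> y) \<oplus>\<^bsub>M\<^esub> y)"
    using assms by (subst linear_mapD(3)[OF assms(3)]) auto
  also have "(x \<ominus>\<^bsub>M\<^esub> y) \<oplus>\<^bsub>M\<^esub> y = x" using assms(4,5) by (simp add: a_minus_def M.M.a_assoc M.M.l_neg)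
  finally have e: "h (x \<ominus>\<^bsub>M\<^esub> y) \<oplus>\<^bsub>N\<^esub> h y = h x" .
  show ?thesis unfolding e[symmetric] using c by (simp add: a_minus_def N.M.a_assoc N.M.r_neg)
qed

lemma right_module_minus_eq_zero:
  assumes "right_module R M" "x \<in> carrier M" "y \<in> carrier M" "x \<ominus>\<^bsub>M\<^esub> y = \<zero>\<^bsub>M\<^esub>"
  shows "x = y"
proof -
  interpret right_module R M by fact
  have "x = (x \<ominus>\<^bsub>M\<^esub> y) \<oplus>\<^bsub>M\<^esub> y" using assms(2,3) by (simp add: a_minus_def M.a_assoc M.l_neg)
  then show ?thesis using assms(3,4) by simp
qed

lemma linear_map_finsum:
  assumes "right_module R M" "right_module R N" "linear_map R M N h" "finite J" "f \<in> J \<rightarrow> carrier M"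
  shows "h (\<Oplus>\<^bsub>M\<^esub>j\<in>J. f j) = (\<Oplus>\<^bsub>N\<^esub>j\<in>J. h (f j))"
proof -
  interpret M: right_module R M by fact
  interpret N: right_module R N by fact
  show ?thesis
    using finsum_additive[OF M.M.abelian_group_axioms N.M.abelian_group_axioms assms(4), of "carrier M" h f]
      linear_mapD[OF assms(3)] assms(5) by auto
qed

lemma submodule_finsum:
  assumes "right_module R M" "submodule H R M" "finite J" "f \<in> J \<rightarrow> H"
  shows "(\<Oplus>\<^bsub>M\<^esub>j\<in>J. f j) \<in> H"
proof -
  interpret M: right_module R M by fact
  show ?thesis
    using finsum_additive[OF M.M.abelian_group_axioms M.M.abelian_group_axioms assms(3), of H "\<lambda>x. x" f]
      assms(2,4) unfolding submodule_iff[OF assms(1)] by auto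
qed

definition unit_vec :: "('a, 'r) ring_scheme \<Rightarrow> nat \<Rightarrow> nat \<Rightarrow> nat \<Rightarrow> 'a" where
  "unit_vec R n j = (\<lambda>i\<in>{..<n}. if i = j then \<one>\<^bsub>R\<^esub> else \<zero>\<^bsub>R\<^esub>)"

lemma unit_vec_closed: "ring R \<Longrightarrow> unit_vec R n j \<in> carrier (free_mod R n)"
  using ring.ring_simprules(2,6) by (auto simp: unit_vec_def free_mod_simps)

lemma free_mod_nth: "x \<in> carrier (free_mod R n) \<Longrightarrow> j < n \<Longrightarrow> x j \<in> carrier R"
  by (auto simp: free_mod_simps)

lemma free_mod_expand:
  assumes R: "ring R" and x: "x \<in> carrier (free_mod R n)"
  shows "(\<Oplus>\<^bsub>free_mod R n\<^esub>j\<in>{..<n}. x j \<odot>\<^bsub>free_mod R n\<^esub> unit_vec R n j) = x"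
proof
  interpret R: ring R by fact
  interpret F: right_module R "free_mod R n" by (rule right_module_free_mod) fact
  fix i
  have ecl: "(\<lambda>j. x j \<odot>\<^bsub>free_mod R n\<^esub> unit_vec R n j) \<in> {..<n} \<rightarrow> carrier (free_mod R n)"
    using free_mod_nth[OF x] unit_vec_closed[OF R] by (intro funcsetI F.ract_closed) auto
  show "(\<Oplus>\<^bsub>free_mod R n\<^esub>j\<in>{..<n}. x j \<odot>\<^bsub>free_mod R n\<^esub> unit_vec R n j) i = x i"
  proof (cases "i < n")
    case True
    have "(\<Oplus>\<^bsub>free_mod R n\<^esub>j\<in>{..<n}. x j \<odot>\<^bsub>free_mod R n\<^esub> unit_vec R n j) i =
        (\<Oplus>\<^bsub>R\<^esub>j\<in>{..<n}. (x j \<odot>\<^bsub>free_mod R n\<^esub> unit_vec R n j) i)"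
      by (rule free_mod_finsum_nth[OF R _ ecl True]) simp
    also have "\<dots> = (\<Oplus>\<^bsub>R\<^esub>j\<in>{..<n}. if i = j then x j else \<zero>\<^bsub>R\<^esub>)"
      using True free_mod_nth[OF x] by (intro R.finsum_cong') (auto simp: unit_vec_def free_mod_simps)
    also have "\<dots> = x i" using True free_mod_nth[OF x] by (intro R.finsum_singleton) auto
    finally show ?thesis .
  next
    case False
    moreover have "(\<Oplus>\<^bsub>free_mod R n\<^esub>j\<in>{..<n}. x j \<odot>\<^bsub>free_mod R n\<^esub> unit_vec R n j) \<in> carrier (free_mod R n)"
      by (rule F.M.finsum_closed[OF ecl])
    ultimately show ?thesis using x by (auto simp: free_mod_simps PiE_iff extensional_def)
  qed
qed

definition lin_comb :: "('a, 'r) ring_scheme \<Rightarrow> ('a, 'b, 'm) module_scheme \<Rightarrow> nat \<Rightarrow> (nat \<Rightarrow> 'b) \<Rightarrow> (nat \<Rightarrow> 'a) \<Rightarrow> 'b" where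
  "lin_comb R N n g = (\<lambda>y\<in>carrier (free_mod R n). \<Oplus>\<^bsub>N\<^esub>j\<in>{..<n}. y j \<odot>\<^bsub>N\<^esub> g j)"

lemma linear_map_lin_comb:
  assumes R: "ring R" and N: "right_module R N" and g: "\<And>j. j < n \<Longrightarrow> g j \<in> carrier N"
  shows "linear_map R (free_mod R n) N (lin_comb R N n g)"
proof -
  interpret N: right_module R N by fact
  interpret F: right_module R "free_mod R n" by (rule right_module_free_mod) fact
  show ?thesis
  proof (rule linear_mapI)
    fix x assume x: "x \<in> carrier (free_mod R n)"
    show "lin_comb R N n g x \<in> carrier N"
      using x g free_mod_nth[OF x] by (auto simp: lin_comb_def intro!: N.M.finsum_closed N.ract_closed)
  next
    fix x y assume x: "x \<in> carrier (free_mod R n)" and y: "y \<in> carrier (free_mod R n)"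
    have "(\<Oplus>\<^bsub>N\<^esub>j\<in>{..<n}. (x \<oplus>\<^bsub>free_mod R n\<^esub> y) j \<odot>\<^bsub>N\<^esub> g j) =
        (\<Oplus>\<^bsub>N\<^esub>j\<in>{..<n}. x j \<odot>\<^bsub>N\<^esub> g j \<oplus>\<^bsub>N\<^esub> y j \<odot>\<^bsub>N\<^esub> g j)"
      using g free_mod_nth[OF x] free_mod_nth[OF y]
      by (intro N.M.finsum_cong') (auto simp: free_mod_simps N.ract_l_distr N.ract_closed)
    also have "\<dots> = (\<Oplus>\<^bsub>N\<^esub>j\<in>{..<n}. x j \<odot>\<^bsub>N\<^esub> g j) \<oplus>\<^bsub>N\<^esub> (\<Oplus>\<^bsub>N\<^esub>j\<in>{..<n}. y j \<odot>\<^bsub>N\<^esub> g j)"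
      using g free_mod_nth[OF x] free_mod_nth[OF y] by (intro N.M.finsum_addf) (auto simp: N.ract_closed)
    finally show "lin_comb R N n g (x \<oplus>\<^bsub>free_mod R n\<^esub> y) = lin_comb R N n g x \<oplus>\<^bsub>N\<^esub> lin_comb R N n g y"
      using x y by (simp add: lin_comb_def)
  next
    fix a x assume a: "a \<in> carrier R" and x: "x \<in> carrier (free_mod R n)"
    have "(\<Oplus>\<^bsub>N\<^esub>j\<in>{..<n}. (a \<odot>\<^bsub>free_mod R n\<^esub> x) j \<odot>\<^bsub>N\<^esub> g j) = (\<Oplus>\<^bsub>N\<^esub>j\<in>{..<n}. a \<odot>\<^bsub>N\<^esub> (x j \<odot>\<^bsub>N\<^esub> g j))"
      using a g free_mod_nth[OF x] by (intro N.M.finsum_cong') (auto simp: free_mod_simps N.ract_assoc N.ract_closed)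
    also have "\<dots> = a \<odot>\<^bsub>N\<^esub> (\<Oplus>\<^bsub>N\<^esub>j\<in>{..<n}. x j \<odot>\<^bsub>N\<^esub> g j)"
      using a g free_mod_nth[OF x] by (intro N.finsum_ract[symmetric]) (auto simp: N.ract_closed)
    finally show "lin_comb R N n g (a \<odot>\<^bsub>free_mod R n\<^esub> x) = a \<odot>\<^bsub>N\<^esub> lin_comb R N n g x"
      using a x by (simp add: lin_comb_def F.ract_closed)
  qed (simp add: lin_comb_def)
qed

lemma summands_iff_retract:
  assumes R: "ring R"
  shows "X \<in> summands R \<longleftrightarrow> submodule (snd X) R (free_mod R (fst X)) \<and>
    (\<exists>\<pi>. linear_map R (free_mod R (fst X)) (free_mod R (fst X)) \<pi> \<and>
       \<pi> ` carrier (free_mod R (fst X)) \<subseteq> snd X \<and> (\<forall>x\<in>snd X. \<pi> x = x))"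
proof -
  obtain n M where X: "X = (n, M)" by fastforce
  let ?F = "free_mod R n"
  have F: "right_module R ?F" by (rule right_module_free_mod[OF R])
  interpret F: right_module R ?F by (rule F)
  show ?thesis
  proof
    assume "X \<in> summands R"
    then obtain N where M: "submodule M R ?F" and N: "submodule N R ?F"
      and int: "M \<inter> N = {\<zero>\<^bsub>?F\<^esub>}" and sum: "M <+>\<^bsub>?F\<^esub> N = carrier ?F"
      by (auto simp: X summands_def)
    note M' = M[unfolded submodule_iff[OF F]] and N' = N[unfolded submodule_iff[OF F]]
    have neg: "\<ominus>\<^bsub>?F\<^esub> x \<in> H" if "submodule H R ?F" "x \<in> H" for H x
      unfolding a_inv_def by (rule subgroup.m_inv_closed[OF submodule.axioms(1)[OF that(1)] that(2)])
    have uniq: "m = m'" if "m \<in> M" "m' \<in> M" "c \<in> N" "c' \<in> N" "m \<oplus>\<^bsub>?F\<^esub> c = m' \<oplus>\<^bsub>?F\<^esub> c'" for m m' c c'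
    proof -
      have cl: "m \<in> carrier ?F" "m' \<in> carrier ?F" "c \<in> carrier ?F" "c' \<in> carrier ?F" using that M' N' by auto
      have "m \<ominus>\<^bsub>?F\<^esub> m' = (m \<oplus>\<^bsub>?F\<^esub> c) \<oplus>\<^bsub>?F\<^esub> (\<ominus>\<^bsub>?F\<^esub> c \<oplus>\<^bsub>?F\<^esub> \<ominus>\<^bsub>?F\<^esub> m')"
        using cl by (simp add: a_minus_def F.M.a_assoc F.M.r_neg2)
      also have "\<dots> = (c' \<oplus>\<^bsub>?F\<^esub> m') \<oplus>\<^bsub>?F\<^esub> (\<ominus>\<^bsub>?F\<^esub> m' \<oplus>\<^bsub>?F\<^esub> \<ominus>\<^bsub>?F\<^esub> c)"
        unfolding that(5) using cl F.M.a_comm[of m' c'] F.M.a_comm[of "\<ominus>\<^bsub>?F\<^esub> c" "\<ominus>\<^bsub>?F\<^esub> m'"] by simp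
      also have "\<dots> = c' \<ominus>\<^bsub>?F\<^esub> c"
        using cl by (simp add: a_minus_def F.M.a_assoc F.M.r_neg2)
      finally have "m \<ominus>\<^bsub>?F\<^esub> m' = c' \<ominus>\<^bsub>?F\<^esub> c" .
      moreover have "m \<ominus>\<^bsub>?F\<^esub> m' \<in> M" using that M' neg[OF M] by (auto simp: a_minus_def)
      moreover have "c' \<ominus>\<^bsub>?F\<^esub> c \<in> N" using that N' neg[OF N] by (auto simp: a_minus_def)
      ultimately have "m \<ominus>\<^bsub>?F\<^esub> m' = \<zero>\<^bsub>?F\<^esub>" using int by auto
      then show ?thesis by (rule right_module_minus_eq_zero[OF F cl(1,2)])
    qed
    have "\<exists>m. m \<in> M \<and> (\<exists>c\<in>N. y = m \<oplus>\<^bsub>?F\<^esub> c)" if "y \<in> carrier ?F" for y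
      using that unfolding sum[symmetric] by (auto simp: set_add_def')
    then obtain f where f: "\<And>y. y \<in> carrier ?F \<Longrightarrow> f y \<in> M \<and> (\<exists>c\<in>N. y = f y \<oplus>\<^bsub>?F\<^esub> c)" by metis
    have fI: "f y = m" if "y \<in> carrier ?F" "m \<in> M" "c \<in> N" "y = m \<oplus>\<^bsub>?F\<^esub> c" for y m c
      using f[OF that(1)] uniq that by metis
    let ?\<pi> = "restrict f (carrier ?F)"
    have "linear_map R ?F ?F ?\<pi>"
    proof (rule linear_mapI)
      fix x y assume xy: "x \<in> carrier ?F" "y \<in> carrier ?F"
      obtain c d where cd: "c \<in> N" "d \<in> N" "x = f x \<oplus>\<^bsub>?F\<^esub> c" "y = f y \<oplus>\<^bsub>?F\<^esub> d" using f xy by blast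
      have cl: "f x \<in> carrier ?F" "f y \<in> carrier ?F" "c \<in> carrier ?F" "d \<in> carrier ?F" using f xy M' N' cd by auto
      have "f (x \<oplus>\<^bsub>?F\<^esub> y) = f x \<oplus>\<^bsub>?F\<^esub> f y"
      proof (rule fI)
        show "x \<oplus>\<^bsub>?F\<^esub> y = (f x \<oplus>\<^bsub>?F\<^esub> f y) \<oplus>\<^bsub>?F\<^esub> (c \<oplus>\<^bsub>?F\<^esub> d)"
          by (subst cd(3), subst cd(4)) (use cl in \<open>simp add: F.M.a_ac\<close>)
      qed (use xy f M' N' cd in auto)
      then show "?\<pi> (x \<oplus>\<^bsub>?F\<^esub> y) = ?\<pi> x \<oplus>\<^bsub>?F\<^esub> ?\<pi> y" using xy by simp
    next
      fix a x assume a: "a \<in> carrier R" and x: "x \<in> carrier ?F"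
      obtain c where c: "c \<in> N" "x = f x \<oplus>\<^bsub>?F\<^esub> c" using f x by blast
      have cl: "f x \<in> carrier ?F" "c \<in> carrier ?F" using f x M' N' c by auto
      have "f (a \<odot>\<^bsub>?F\<^esub> x) = a \<odot>\<^bsub>?F\<^esub> f x"
      proof (rule fI)
        show "a \<odot>\<^bsub>?F\<^esub> x = a \<odot>\<^bsub>?F\<^esub> f x \<oplus>\<^bsub>?F\<^esub> a \<odot>\<^bsub>?F\<^esub> c"
          by (subst c(2)) (use a cl in \<open>simp add: F.ract_r_distr\<close>)
      qed (use a x f M' N' c F.ract_closed in auto)
      then show "?\<pi> (a \<odot>\<^bsub>?F\<^esub> x) = a \<odot>\<^bsub>?F\<^esub> ?\<pi> x" using a x by (simp add: F.ract_closed)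
    qed (use f M' in auto)
    moreover have "?\<pi> x = x" if "x \<in> M" for x
    proof -
      have xc: "x \<in> carrier ?F" using M' that by auto
      show ?thesis using xc fI[of x x "\<zero>\<^bsub>?F\<^esub>"] N' that by simp
    qed
    moreover have "?\<pi> ` carrier ?F \<subseteq> M" using f by auto
    ultimately show "submodule (snd X) R (free_mod R (fst X)) \<and>
      (\<exists>\<pi>. linear_map R (free_mod R (fst X)) (free_mod R (fst X)) \<pi> \<and>
       \<pi> ` carrier (free_mod R (fst X)) \<subseteq> snd X \<and> (\<forall>x\<in>snd X. \<pi> x = x))"
      unfolding X fst_conv snd_conv using M by blast
  next
    assume "submodule (snd X) R (free_mod R (fst X)) \<and>
      (\<exists>\<pi>. linear_map R (free_mod R (fst X)) (free_mod R (fst X)) \<pi> \<and>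
       \<pi> ` carrier (free_mod R (fst X)) \<subseteq> snd X \<and> (\<forall>x\<in>snd X. \<pi> x = x))"
    then obtain \<pi> where M: "submodule M R ?F" and \<pi>: "linear_map R ?F ?F \<pi>" and im: "\<pi> ` carrier ?F \<subseteq> M"
      and fix': "\<And>x. x \<in> M \<Longrightarrow> \<pi> x = x" by (auto simp: X)
    note M' = M[unfolded submodule_iff[OF F]]
    let ?N = "{y \<in> carrier ?F. \<pi> y = \<zero>\<^bsub>?F\<^esub>}"
    have \<pi>0: "\<pi> \<zero>\<^bsub>?F\<^esub> = \<zero>\<^bsub>?F\<^esub>" by (rule linear_map_zero[OF F F \<pi>])
    have a0: "a \<odot>\<^bsub>?F\<^esub> \<zero>\<^bsub>?F\<^esub> = \<zero>\<^bsub>?F\<^esub>" if "a \<in> carrier R" for a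
      using that F.finsum_ract[of "{}" a] by simp
    have N: "submodule ?N R ?F"
      unfolding submodule_iff[OF F] using linear_mapD[OF \<pi>] \<pi>0 a0 F.ract_closed by auto
    have "M \<inter> ?N = {\<zero>\<^bsub>?F\<^esub>}" using fix' M' \<pi>0 by auto
    moreover have "M <+>\<^bsub>?F\<^esub> ?N = carrier ?F"
    proof (intro equalityI subsetI)
      fix y assume y: "y \<in> carrier ?F"
      have c: "\<pi> y \<in> carrier ?F" "\<pi> y \<in> M" using im M' y by auto
      have "\<pi> (y \<ominus>\<^bsub>?F\<^esub> \<pi> y) = \<zero>\<^bsub>?F\<^esub>"
        using linear_map_minus[OF F F \<pi> y c(1)] fix'[OF c(2)] c by (simp add: a_minus_def F.M.r_neg)
      moreover have "y = \<pi> y \<oplus>\<^bsub>?F\<^esub> (y \<ominus>\<^bsub>?F\<^esub> \<pi> y)" using y c by (simp add: a_minus_def F.M.a_lcomm F.M.r_neg)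
      ultimately show "y \<in> M <+>\<^bsub>?F\<^esub> ?N" using y c unfolding set_add_def' by blast
    next
      fix y assume "y \<in> M <+>\<^bsub>?F\<^esub> ?N"
      then show "y \<in> carrier ?F" using M' by (auto simp: set_add_def')
    qed
    ultimately show "X \<in> summands R" unfolding X summands_def using M N by blast
  qed
qed

lemma summand_retract:
  assumes "ring R" "X \<in> summands R"
  obtains \<pi> where "linear_map R (free_mod R (fst X)) (free_mod R (fst X)) \<pi>"
    "\<pi> ` carrier (free_mod R (fst X)) \<subseteq> snd X" "\<forall>x\<in>snd X. \<pi> x = x"
  using assms(2) unfolding summands_iff_retract[OF assms(1)] by (elim conjE exE) simp

lemma summand_subset: "X \<in> summands R \<Longrightarrow> ring R \<Longrightarrow> snd X \<subseteq> carrier (free_mod R (fst X))"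
  using summands_iff_retract submodule_iff[OF right_module_free_mod] by metis

section \<open>Linear maps between summands\<close>

lemma fgproj_simps [simp]:
  "cat_ob (fgproj R) = summands R"
  "cat_hom (fgproj R) X Y = {h. linear_map R (the_mod R X) (the_mod R Y) h}"
  "cat_id (fgproj R) X = (\<lambda>x\<in>snd X. x)"
  "cat_comp (fgproj R) X g f = compose (snd X) g f"
  "wzero (fgproj R) = (0, carrier (free_mod R 0))"
  "weq (fgproj R) = isos (fgproj_cat R)"
  by (simp_all add: fgproj_def fgproj_cat_def)

lemma fgproj_cat_simps:
  "cat_ob (fgproj_cat R) = summands R"
  "cat_hom (fgproj_cat R) X Y = {h. linear_map R (the_mod R X) (the_mod R Y) h}"
  "cat_id (fgproj_cat R) X = (\<lambda>x\<in>snd X. x)"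
  "cat_comp (fgproj_cat R) X g f = compose (snd X) g f"
  by (simp_all add: fgproj_cat_def)

abbreviation lin where "lin R X Y h \<equiv> linear_map R (the_mod R X) (the_mod R Y) h"

lemma linD:
  assumes "lin R X Y h"
  shows "x \<in> snd X \<Longrightarrow> h x \<in> snd Y" and "h \<in> extensional (snd X)"
  using linear_mapD[OF assms] by auto

lemma lin_eqI: "lin R X Y h \<Longrightarrow> lin R X Y k \<Longrightarrow> (\<And>x. x \<in> snd X \<Longrightarrow> h x = k x) \<Longrightarrow> h = k"
  using linD(2) extensionalityI by metis

lemma lin_compose: "ring R \<Longrightarrow> X \<in> summands R \<Longrightarrow> lin R X Y f \<Longrightarrow> lin R Y Z g \<Longrightarrow> lin R X Z (compose (snd X) g f)"
  using linear_map_compose[OF right_module_the_mod, of R X "the_mod R Y" f "the_mod R Z" g] by simp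

lemma summand_closed:
  assumes "ring R" "X \<in> summands R"
  shows "\<zero>\<^bsub>free_mod R (fst X)\<^esub> \<in> snd X"
    "x \<in> snd X \<Longrightarrow> y \<in> snd X \<Longrightarrow> x \<oplus>\<^bsub>free_mod R (fst X)\<^esub> y \<in> snd X"
    "a \<in> carrier R \<Longrightarrow> x \<in> snd X \<Longrightarrow> a \<odot>\<^bsub>free_mod R (fst X)\<^esub> x \<in> snd X"
proof -
  have "submodule (snd X) R (free_mod R (fst X))" using assms summands_iff_retract by blast
  note s = this[unfolded submodule_iff[OF right_module_free_mod[OF assms(1)]]]
  show "\<zero>\<^bsub>free_mod R (fst X)\<^esub> \<in> snd X"
    "x \<in> snd X \<Longrightarrow> y \<in> snd X \<Longrightarrow> x \<oplus>\<^bsub>free_mod R (fst X)\<^esub> y \<in> snd X"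
    "a \<in> carrier R \<Longrightarrow> x \<in> snd X \<Longrightarrow> a \<odot>\<^bsub>free_mod R (fst X)\<^esub> x \<in> snd X"
    using s by blast+
qed

lemma lin_id: "ring R \<Longrightarrow> X \<in> summands R \<Longrightarrow> lin R X X (\<lambda>x\<in>snd X. x)"
  by (rule linear_mapI) (simp_all add: summand_closed)

lemma lin_zero:
  assumes "ring R" "X \<in> summands R" "Y \<in> summands R" "lin R X Y h"
  shows "h \<zero>\<^bsub>free_mod R (fst X)\<^esub> = \<zero>\<^bsub>free_mod R (fst Y)\<^esub>"
  using linear_map_zero[OF right_module_the_mod right_module_the_mod assms(4)] assms by simp

text \<open>The inverse map is the one that occurs in the definition of
  \<open>\<zeta>(t)\<close>.\<close>

lemma lin_inverse:
  assumes R: "ring R" and X: "X \<in> summands R" and Y: "Y \<in> summands R"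
    and h: "lin R X Y h" and b: "bij_betw h (snd X) (snd Y)"
  shows "lin R Y X (\<lambda>y\<in>snd Y. inv_into (snd X) h y)"
proof -
  interpret X: right_module R "the_mod R X" by (rule right_module_the_mod[OF R X])
  let ?g = "\<lambda>y\<in>snd Y. inv_into (snd X) h y"
  have g: "inv_into (snd X) h y \<in> snd X" "h (inv_into (snd X) h y) = y" if "y \<in> snd Y" for y
    using b that by (auto simp: bij_betw_def inv_into_into f_inv_into_f)
  have gh: "inv_into (snd X) h (h x) = x" if "x \<in> snd X" for x using b that by (simp add: bij_betw_def)
  show ?thesis
  proof (rule linear_mapI)
    fix x y assume "x \<in> carrier (the_mod R Y)" "y \<in> carrier (the_mod R Y)"
    then have xy: "x \<in> snd Y" "y \<in> snd Y" by auto
    have "h (inv_into (snd X) h x \<oplus>\<^bsub>the_mod R X\<^esub> inv_into (snd X) h y) = x \<oplus>\<^bsub>the_mod R Y\<^esub> y"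
      using linear_mapD(3)[OF h, of "inv_into (snd X) h x" "inv_into (snd X) h y"] g xy by simp
    then have "inv_into (snd X) h (x \<oplus>\<^bsub>the_mod R Y\<^esub> y) = inv_into (snd X) h x \<oplus>\<^bsub>the_mod R X\<^esub> inv_into (snd X) h y"
      using gh[of "inv_into (snd X) h x \<oplus>\<^bsub>the_mod R X\<^esub> inv_into (snd X) h y"] g xy summand_closed(2)[OF R X] by simp
    then show "?g (x \<oplus>\<^bsub>the_mod R Y\<^esub> y) = ?g x \<oplus>\<^bsub>the_mod R X\<^esub> ?g y"
      using xy summand_closed(2)[OF R Y] by simp
  next
    fix a x assume "a \<in> carrier R" "x \<in> carrier (the_mod R Y)"
    then have ax: "a \<in> carrier R" "x \<in> snd Y" by auto
    have "h (a \<odot>\<^bsub>the_mod R X\<^esub> inv_into (snd X) h x) = a \<odot>\<^bsub>the_mod R Y\<^esub> x"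
      using linear_mapD(4)[OF h, of a "inv_into (snd X) h x"] g ax by simp
    then have "inv_into (snd X) h (a \<odot>\<^bsub>the_mod R Y\<^esub> x) = a \<odot>\<^bsub>the_mod R X\<^esub> inv_into (snd X) h x"
      using gh[of "a \<odot>\<^bsub>the_mod R X\<^esub> inv_into (snd X) h x"] g ax summand_closed(3)[OF R X] by simp
    then show "?g (a \<odot>\<^bsub>the_mod R Y\<^esub> x) = a \<odot>\<^bsub>the_mod R X\<^esub> ?g x"
      using ax summand_closed(3)[OF R Y] by simp
  qed (use g in auto)
qed

lemma isos_iff_bij:
  assumes R: "ring R" and X: "X \<in> summands R" and Y: "Y \<in> summands R"
  shows "h \<in> isos (fgproj_cat R) X Y \<longleftrightarrow> lin R X Y h \<and> bij_betw h (snd X) (snd Y)"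
proof
  assume "h \<in> isos (fgproj_cat R) X Y"
  then obtain g where h: "lin R X Y h" and g: "lin R Y X g"
    and gh: "compose (snd X) g h = (\<lambda>x\<in>snd X. x)" and hg: "compose (snd Y) h g = (\<lambda>x\<in>snd Y. x)"
    by (auto simp: isos_def fgproj_cat_simps)
  have "g (h x) = x" if "x \<in> snd X" for x using fun_cong[OF gh, of x] that by (simp add: compose_def)
  moreover have "h (g y) = y" if "y \<in> snd Y" for y using fun_cong[OF hg, of y] that by (simp add: compose_def)
  ultimately have "bij_betw h (snd X) (snd Y)"
    using linD(1)[OF h] linD(1)[OF g] by (intro bij_betwI[of _ _ _ g]) auto
  then show "lin R X Y h \<and> bij_betw h (snd X) (snd Y)" using h by blast
next
  assume *: "lin R X Y h \<and> bij_betw h (snd X) (snd Y)"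
  then have h: "lin R X Y h" and b: "bij_betw h (snd X) (snd Y)" by auto
  let ?g = "\<lambda>y\<in>snd Y. inv_into (snd X) h y"
  have g: "inv_into (snd X) h y \<in> snd X" "h (inv_into (snd X) h y) = y" if "y \<in> snd Y" for y
    using b that by (auto simp: bij_betw_def inv_into_into f_inv_into_f)
  have gh: "inv_into (snd X) h (h x) = x" if "x \<in> snd X" for x using b that by (simp add: bij_betw_def)
  have "lin R Y X ?g" by (rule lin_inverse[OF R X Y h b])
  moreover have "compose (snd X) ?g h = (\<lambda>x\<in>snd X. x)" "compose (snd Y) h ?g = (\<lambda>x\<in>snd Y. x)"
    using g gh linD(1)[OF h] by (auto simp: compose_def fun_eq_iff)
  ultimately show "h \<in> isos (fgproj_cat R) X Y"
    using h by (auto simp: isos_def fgproj_cat_simps)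
qed

lemma lin_factor:
  assumes R: "ring R" and Y: "Y \<in> summands R" and q: "lin R Y Q q" and surj: "q ` snd Y = snd Q"
    and N: "N \<in> summands R" and y: "lin R Y N y"
    and ker: "\<And>v. v \<in> snd Y \<Longrightarrow> q v = \<zero>\<^bsub>the_mod R Q\<^esub> \<Longrightarrow> y v = \<zero>\<^bsub>the_mod R N\<^esub>" and Q: "Q \<in> summands R"
  obtains w where "lin R Q N w" "\<And>v. v \<in> snd Y \<Longrightarrow> w (q v) = y v"
proof -
  interpret Y: right_module R "the_mod R Y" by (rule right_module_the_mod[OF R Y])
  interpret Q: right_module R "the_mod R Q" by (rule right_module_the_mod[OF R Q])
  interpret N: right_module R "the_mod R N" by (rule right_module_the_mod[OF R N])
  have Ym: "right_module R (the_mod R Y)" and Qm: "right_module R (the_mod R Q)" and Nm: "right_module R (the_mod R N)"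
    by (rule right_module_the_mod[OF R] Y Q N)+
  define w where "w = (\<lambda>z\<in>snd Q. y (inv_into (snd Y) q z))"
  have wq: "w (q v) = y v" if v: "v \<in> snd Y" for v
  proof -
    let ?u = "inv_into (snd Y) q (q v)"
    have qv: "q v \<in> q ` snd Y" using v by blast
    have u: "?u \<in> snd Y" "q ?u = q v" using inv_into_into[OF qv] f_inv_into_f[OF qv] by auto
    have c: "?u \<in> carrier (the_mod R Y)" "v \<in> carrier (the_mod R Y)" using u v by auto
    have "q (?u \<ominus>\<^bsub>the_mod R Y\<^esub> v) = q v \<ominus>\<^bsub>the_mod R Q\<^esub> q v"
      using linear_map_minus[OF Ym Qm q c] u by simp
    also have "\<dots> = \<zero>\<^bsub>the_mod R Q\<^esub>" unfolding a_minus_def using linear_mapD(1)[OF q c(2)] by (rule Q.M.r_neg)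
    finally have "y (?u \<ominus>\<^bsub>the_mod R Y\<^esub> v) = \<zero>\<^bsub>the_mod R N\<^esub>"
      using Y.M.minus_closed[OF c] by (intro ker) auto
    then have "y ?u \<ominus>\<^bsub>the_mod R N\<^esub> y v = \<zero>\<^bsub>the_mod R N\<^esub>" using linear_map_minus[OF Ym Nm y c] by simp
    then have "y ?u = y v"
      by (rule right_module_minus_eq_zero[OF Nm linear_mapD(1)[OF y c(1)] linear_mapD(1)[OF y c(2)]])
    then show ?thesis using linD(1)[OF q v] by (simp add: w_def)
  qed
  have lift: "\<exists>v\<in>snd Y. z = q v" if "z \<in> snd Q" for z using that surj by blast
  have "lin R Q N w"
  proof (rule linear_mapI)
    fix z assume "z \<in> carrier (the_mod R Q)"
    then obtain v where "v \<in> snd Y" "z = q v" using lift by auto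
    then show "w z \<in> carrier (the_mod R N)" using wq linD(1)[OF y] by simp
  next
    fix z z' assume "z \<in> carrier (the_mod R Q)" "z' \<in> carrier (the_mod R Q)"
    then obtain v v' where v: "v \<in> snd Y" "z = q v" "v' \<in> snd Y" "z' = q v'" using lift by (metis the_mod_simps(1))
    have "z \<oplus>\<^bsub>the_mod R Q\<^esub> z' = q (v \<oplus>\<^bsub>the_mod R Y\<^esub> v')" using v linear_mapD(3)[OF q, of v v'] by simp
    moreover have "v \<oplus>\<^bsub>the_mod R Y\<^esub> v' \<in> snd Y" using v Y.M.a_closed[of v v'] by simp
    ultimately have "w (z \<oplus>\<^bsub>the_mod R Q\<^esub> z') = y (v \<oplus>\<^bsub>the_mod R Y\<^esub> v')" by (metis wq)
    then show "w (z \<oplus>\<^bsub>the_mod R Q\<^esub> z') = w z \<oplus>\<^bsub>the_mod R N\<^esub> w z'"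
      using v wq linear_mapD(3)[OF y, of v v'] by simp
  next
    fix a z assume a: "a \<in> carrier R" and "z \<in> carrier (the_mod R Q)"
    then obtain v where v: "v \<in> snd Y" "z = q v" using lift by auto
    have "a \<odot>\<^bsub>the_mod R Q\<^esub> z = q (a \<odot>\<^bsub>the_mod R Y\<^esub> v)" using v a linear_mapD(4)[OF q a, of v] by simp
    moreover have "a \<odot>\<^bsub>the_mod R Y\<^esub> v \<in> snd Y" using v Y.ract_closed[OF a, of v] by simp
    ultimately have "w (a \<odot>\<^bsub>the_mod R Q\<^esub> z) = y (a \<odot>\<^bsub>the_mod R Y\<^esub> v)" by (metis wq)
    then show "w (a \<odot>\<^bsub>the_mod R Q\<^esub> z) = a \<odot>\<^bsub>the_mod R N\<^esub> w z"
      using v wq linear_mapD(4)[OF y a, of v] by simp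
  qed (simp add: w_def)
  then show ?thesis using that wq by blast
qed

section \<open>Short exact sequences\<close>

definition ses :: "('a, 'r) ring_scheme \<Rightarrow> 'a summand \<Rightarrow> 'a summand \<Rightarrow> 'a summand \<Rightarrow> 'a vfun \<Rightarrow> 'a vfun \<Rightarrow> bool" where
  "ses R X Y Z h y \<longleftrightarrow> inj_on h (snd X) \<and> y ` snd Y = snd Z \<and>
     {v \<in> snd Y. y v = \<zero>\<^bsub>the_mod R Z\<^esub>} = h ` snd X"

lemma add_middle_swap:
  assumes "abelian_group M" "a \<in> carrier M" "b \<in> carrier M" "c \<in> carrier M" "d \<in> carrier M"
  shows "a \<oplus>\<^bsub>M\<^esub> b \<oplus>\<^bsub>M\<^esub> (c \<oplus>\<^bsub>M\<^esub> d) = a \<oplus>\<^bsub>M\<^esub> c \<oplus>\<^bsub>M\<^esub> (b \<oplus>\<^bsub>M\<^esub> d)"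
proof -
  interpret abelian_group M by fact
  show ?thesis using assms(2-5) by (simp add: a_ac)
qed

text \<open>The last term is a retract of a free module, so the surjection has a section: lift the
  images of the unit vectors.  The retraction onto the first term is what remains after the section
  is subtracted.\<close>

lemma ses_split:
  assumes R: "ring R" and X: "X \<in> summands R" and Y: "Y \<in> summands R" and Z: "Z \<in> summands R"
    and h: "lin R X Y h" and y: "lin R Y Z y" and ses: "ses R X Y Z h y"
  obtains s r where "lin R Z Y s" "lin R Y X r" "\<And>z. z \<in> snd Z \<Longrightarrow> y (s z) = z"
    "\<And>x. x \<in> snd X \<Longrightarrow> r (h x) = x"
    "\<And>v. v \<in> snd Y \<Longrightarrow> h (r v) \<oplus>\<^bsub>the_mod R Y\<^esub> s (y v) = v"
proof -
  have Xm: "right_module R (the_mod R X)" and Ym: "right_module R (the_mod R Y)" and Zm: "right_module R (the_mod R Z)"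
    by (rule right_module_the_mod[OF R] X Y Z)+
  interpret X: right_module R "the_mod R X" by (rule Xm)
  interpret Y: right_module R "the_mod R Y" by (rule Ym)
  interpret Z: right_module R "the_mod R Z" by (rule Zm)
  let ?n = "fst Z" and ?F = "free_mod R (fst Z)"
  have Fm: "right_module R ?F" by (rule right_module_free_mod[OF R])
  obtain \<pi> where \<pi>: "linear_map R ?F ?F \<pi>" "\<pi> ` carrier ?F \<subseteq> snd Z" "\<forall>z\<in>snd Z. \<pi> z = z"
    by (rule summand_retract[OF R Z])
  have "\<exists>l. l \<in> snd Y \<and> y l = \<pi> (unit_vec R ?n j)" for j
  proof -
    have "\<pi> (unit_vec R ?n j) \<in> snd Z" using \<pi>(2) unit_vec_closed[OF R] by blast
    then have "\<pi> (unit_vec R ?n j) \<in> y ` snd Y" using ses by (simp add: ses_def)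
    then show ?thesis by auto
  qed
  then have "\<exists>l. \<forall>j. l j \<in> snd Y \<and> y (l j) = \<pi> (unit_vec R ?n j)" by (rule choice[OF allI])
  then obtain l where l: "\<And>j. l j \<in> snd Y" "\<And>j. y (l j) = \<pi> (unit_vec R ?n j)" by auto
  let ?L = "lin_comb R (the_mod R Y) ?n l"
  have L: "linear_map R ?F (the_mod R Y) ?L" by (rule linear_map_lin_comb[OF R Ym]) (use l in auto)
  have ZF: "z \<in> carrier ?F" if "z \<in> snd Z" for z using summand_subset[OF Z R] that by blast
  let ?s = "restrict ?L (snd Z)"
  have s: "lin R Z Y ?s"
    by (rule linear_mapI) (use linear_mapD[OF L] ZF summand_closed[OF R Z] in auto)
  have ys: "y (?s z) = z" if z: "z \<in> snd Z" for z
  proof -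
    note zj = free_mod_nth[OF ZF[OF z]]
    have "y (?L z) = (\<Oplus>\<^bsub>the_mod R Z\<^esub>j\<in>{..<?n}. y (z j \<odot>\<^bsub>the_mod R Y\<^esub> l j))"
      unfolding lin_comb_def restrict_apply'[OF ZF[OF z]] using zj l Y.ract_closed
      by (intro linear_map_finsum[OF Ym Zm y]) auto
    also have "\<dots> = (\<Oplus>\<^bsub>the_mod R Z\<^esub>j\<in>{..<?n}. z j \<odot>\<^bsub>?F\<^esub> \<pi> (unit_vec R ?n j))"
    proof (rule Z.M.finsum_cong')
      fix j assume "j \<in> {..<?n}"
      then show "y (z j \<odot>\<^bsub>the_mod R Y\<^esub> l j) = z j \<odot>\<^bsub>?F\<^esub> \<pi> (unit_vec R ?n j)"
        using zj l linear_mapD(4)[OF y, of "z j" "l j"] by simp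
    next
      show "(\<lambda>j. z j \<odot>\<^bsub>?F\<^esub> \<pi> (unit_vec R ?n j)) \<in> {..<?n} \<rightarrow> carrier (the_mod R Z)"
      proof
        fix j assume "j \<in> {..<?n}"
        then show "z j \<odot>\<^bsub>?F\<^esub> \<pi> (unit_vec R ?n j) \<in> carrier (the_mod R Z)"
          using zj \<pi>(2) unit_vec_closed[OF R] summand_closed(3)[OF R Z] by (simp add: image_subset_iff)
      qed
    qed simp
    also have "\<dots> = (\<Oplus>\<^bsub>?F\<^esub>j\<in>{..<?n}. z j \<odot>\<^bsub>?F\<^esub> \<pi> (unit_vec R ?n j))"
    proof -
      interpret F: right_module R ?F by (rule Fm)
      have "linear_map R (the_mod R Z) ?F (\<lambda>z\<in>snd Z. z)"
        by (rule linear_mapI) (use ZF summand_closed[OF R Z] in auto)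
      from linear_map_finsum[OF Zm Fm this, of "{..<?n}" "\<lambda>j. z j \<odot>\<^bsub>?F\<^esub> \<pi> (unit_vec R ?n j)"]
      have *: "(\<lambda>z\<in>snd Z. z) (\<Oplus>\<^bsub>the_mod R Z\<^esub>j\<in>{..<?n}. z j \<odot>\<^bsub>?F\<^esub> \<pi> (unit_vec R ?n j)) =
        (\<Oplus>\<^bsub>?F\<^esub>j\<in>{..<?n}. (\<lambda>z\<in>snd Z. z) (z j \<odot>\<^bsub>?F\<^esub> \<pi> (unit_vec R ?n j)))"
        using zj \<pi>(2) unit_vec_closed[OF R] summand_closed(3)[OF R Z] by (auto simp: image_subset_iff)
      have m: "z j \<odot>\<^bsub>?F\<^esub> \<pi> (unit_vec R ?n j) \<in> snd Z" if "j < ?n" for j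
        using zj[OF that] \<pi>(2) unit_vec_closed[OF R] summand_closed(3)[OF R Z] by (auto simp: image_subset_iff)
      have "(\<Oplus>\<^bsub>the_mod R Z\<^esub>j\<in>{..<?n}. z j \<odot>\<^bsub>?F\<^esub> \<pi> (unit_vec R ?n j)) \<in> snd Z"
        using Z.M.finsum_closed[of "\<lambda>j. z j \<odot>\<^bsub>?F\<^esub> \<pi> (unit_vec R ?n j)" "{..<?n}"] m by auto
      moreover have "(\<Oplus>\<^bsub>?F\<^esub>j\<in>{..<?n}. (\<lambda>z\<in>snd Z. z) (z j \<odot>\<^bsub>?F\<^esub> \<pi> (unit_vec R ?n j))) =
          (\<Oplus>\<^bsub>?F\<^esub>j\<in>{..<?n}. z j \<odot>\<^bsub>?F\<^esub> \<pi> (unit_vec R ?n j))"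
        using m ZF by (intro F.M.finsum_cong') auto
      ultimately show ?thesis using * by simp
    qed
    also have "\<dots> = \<pi> (\<Oplus>\<^bsub>?F\<^esub>j\<in>{..<?n}. z j \<odot>\<^bsub>?F\<^esub> unit_vec R ?n j)"
    proof -
      interpret F: right_module R ?F by (rule Fm)
      have "\<pi> (\<Oplus>\<^bsub>?F\<^esub>j\<in>{..<?n}. z j \<odot>\<^bsub>?F\<^esub> unit_vec R ?n j) = (\<Oplus>\<^bsub>?F\<^esub>j\<in>{..<?n}. \<pi> (z j \<odot>\<^bsub>?F\<^esub> unit_vec R ?n j))"
        using zj unit_vec_closed[OF R] F.ract_closed by (intro linear_map_finsum[OF Fm Fm \<pi>(1)]) auto
      also have "\<dots> = (\<Oplus>\<^bsub>?F\<^esub>j\<in>{..<?n}. z j \<odot>\<^bsub>?F\<^esub> \<pi> (unit_vec R ?n j))"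
        using zj unit_vec_closed[OF R] F.ract_closed linear_mapD[OF \<pi>(1)] by (intro F.M.finsum_cong') auto
      finally show ?thesis ..
    qed
    also have "\<dots> = z" using free_mod_expand[OF R ZF[OF z]] bspec[OF \<pi>(3) z] by simp
    finally show ?thesis using z by simp
  qed
  define d where "d v = v \<ominus>\<^bsub>the_mod R Y\<^esub> ?s (y v)" for v
  have sy: "?s (y v) \<in> snd Y" if "v \<in> snd Y" for v using linD(1)[OF s linD(1)[OF y that]] .
  have dY: "d v \<in> snd Y" if "v \<in> snd Y" for v
    using Y.M.minus_closed[of v "?s (y v)"] sy[OF that] that by (simp add: d_def)
  have dk: "d v \<in> h ` snd X" if v: "v \<in> snd Y" for v
  proof -
    have c: "v \<in> carrier (the_mod R Y)" "?s (y v) \<in> carrier (the_mod R Y)" using v sy by auto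
    have "y (d v) = y v \<ominus>\<^bsub>the_mod R Z\<^esub> y v"
      unfolding d_def linear_map_minus[OF Ym Zm y c] ys[OF linD(1)[OF y v]] ..
    also have "\<dots> = \<zero>\<^bsub>the_mod R Z\<^esub>" unfolding a_minus_def using linear_mapD(1)[OF y c(1)] by (rule Z.M.r_neg)
    finally show ?thesis using dY[OF v] ses unfolding ses_def by blast
  qed
  have inj: "inj_on h (snd X)" using ses by (simp add: ses_def)
  define r where "r = (\<lambda>v\<in>snd Y. inv_into (snd X) h (d v))"
  have r: "r v \<in> snd X" "h (r v) = d v" if "v \<in> snd Y" for v
    using inv_into_into[OF dk[OF that]] f_inv_into_f[OF dk[OF that]] that by (auto simp: r_def)
  have dec: "h (r v) \<oplus>\<^bsub>the_mod R Y\<^esub> ?s (y v) = v" if v: "v \<in> snd Y" for v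
  proof -
    have "v \<in> carrier (the_mod R Y)" "?s (y v) \<in> carrier (the_mod R Y)" using v sy by auto
    then show ?thesis unfolding r(2)[OF v] d_def by (metis Y.M.a_assoc Y.M.a_inv_closed Y.M.l_neg Y.M.minus_eq Y.M.r_zero)
  qed
  have canc: "a = b" if "a \<in> snd Y" "b \<in> snd Y" "c \<in> snd Y" "a \<oplus>\<^bsub>the_mod R Y\<^esub> c = b \<oplus>\<^bsub>the_mod R Y\<^esub> c" for a b c
    using that Y.M.add.right_cancel[of c a b] by simp
  have rlin: "lin R Y X r"
  proof (rule linear_mapI)
    fix v w assume "v \<in> carrier (the_mod R Y)" "w \<in> carrier (the_mod R Y)"
    then have vw: "v \<in> snd Y" "w \<in> snd Y" by auto
    have vwY: "v \<oplus>\<^bsub>the_mod R Y\<^esub> w \<in> snd Y" using vw Y.M.a_closed[of v w] by simp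
    have cY: "h (r v) \<in> carrier (the_mod R Y)" "h (r w) \<in> carrier (the_mod R Y)"
        "?s (y v) \<in> carrier (the_mod R Y)" "?s (y w) \<in> carrier (the_mod R Y)"
      using vw r dY sy by auto
    have "h (r (v \<oplus>\<^bsub>the_mod R Y\<^esub> w)) = h (r v) \<oplus>\<^bsub>the_mod R Y\<^esub> h (r w)"
    proof (rule canc)
      have s_add: "?s (y (v \<oplus>\<^bsub>the_mod R Y\<^esub> w)) = ?s (y v) \<oplus>\<^bsub>the_mod R Y\<^esub> ?s (y w)"
        using linear_mapD(3)[OF y, of v w] linear_mapD(3)[OF s, of "y v" "y w"] vw linD(1)[OF y] by simp
      have "h (r (v \<oplus>\<^bsub>the_mod R Y\<^esub> w)) \<oplus>\<^bsub>the_mod R Y\<^esub> ?s (y (v \<oplus>\<^bsub>the_mod R Y\<^esub> w)) = (h (r v) \<oplus>\<^bsub>the_mod R Y\<^esub> ?s (y v)) \<oplus>\<^bsub>the_mod R Y\<^esub> (h (r w) \<oplus>\<^bsub>the_mod R Y\<^esub> ?s (y w))"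
        by (simp only: dec[OF vwY] dec[OF vw(1)] dec[OF vw(2)])
      also have "\<dots> = h (r v) \<oplus>\<^bsub>the_mod R Y\<^esub> h (r w) \<oplus>\<^bsub>the_mod R Y\<^esub> (?s (y v) \<oplus>\<^bsub>the_mod R Y\<^esub> ?s (y w))"
        by (rule add_middle_swap[OF Y.M.abelian_group_axioms cY(1,3,2,4)])
      also have "\<dots> = h (r v) \<oplus>\<^bsub>the_mod R Y\<^esub> h (r w) \<oplus>\<^bsub>the_mod R Y\<^esub> ?s (y (v \<oplus>\<^bsub>the_mod R Y\<^esub> w))" unfolding s_add ..
      finally show "h (r (v \<oplus>\<^bsub>the_mod R Y\<^esub> w)) \<oplus>\<^bsub>the_mod R Y\<^esub> ?s (y (v \<oplus>\<^bsub>the_mod R Y\<^esub> w)) = h (r v) \<oplus>\<^bsub>the_mod R Y\<^esub> h (r w) \<oplus>\<^bsub>the_mod R Y\<^esub> ?s (y (v \<oplus>\<^bsub>the_mod R Y\<^esub> w))" .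
      show "h (r (v \<oplus>\<^bsub>the_mod R Y\<^esub> w)) \<in> snd Y" using r dY vwY by simp
      show "h (r v) \<oplus>\<^bsub>the_mod R Y\<^esub> h (r w) \<in> snd Y" using Y.M.a_closed[OF cY(1,2)] by simp
      show "?s (y (v \<oplus>\<^bsub>the_mod R Y\<^esub> w)) \<in> snd Y" by (rule sy[OF vwY])
    qed
    also have "\<dots> = h (r v \<oplus>\<^bsub>the_mod R X\<^esub> r w)" using linear_mapD(3)[OF h, of "r v" "r w"] r vw by simp
    finally have eq: "h (r (v \<oplus>\<^bsub>the_mod R Y\<^esub> w)) = h (r v \<oplus>\<^bsub>the_mod R X\<^esub> r w)" .
    have "r v \<oplus>\<^bsub>the_mod R X\<^esub> r w \<in> snd X" using X.M.a_closed[of "r v" "r w"] r vw by simp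
    with eq r(1)[OF vwY] show "r (v \<oplus>\<^bsub>the_mod R Y\<^esub> w) = r v \<oplus>\<^bsub>the_mod R X\<^esub> r w" by (rule inj_onD[OF inj])
  next
    fix a v assume a: "a \<in> carrier R" and "v \<in> carrier (the_mod R Y)"
    then have v: "v \<in> snd Y" by simp
    have avY: "a \<odot>\<^bsub>the_mod R Y\<^esub> v \<in> snd Y" using a v Y.ract_closed[of a v] by simp
    have cY: "h (r v) \<in> carrier (the_mod R Y)" "?s (y v) \<in> carrier (the_mod R Y)" using v r dY sy by auto
    have "h (r (a \<odot>\<^bsub>the_mod R Y\<^esub> v)) = a \<odot>\<^bsub>the_mod R Y\<^esub> h (r v)"
    proof (rule canc)
      have s_act: "?s (y (a \<odot>\<^bsub>the_mod R Y\<^esub> v)) = a \<odot>\<^bsub>the_mod R Y\<^esub> ?s (y v)"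
        using linear_mapD(4)[OF y a, of v] linear_mapD(4)[OF s a, of "y v"] v linD(1)[OF y] by simp
      have "h (r (a \<odot>\<^bsub>the_mod R Y\<^esub> v)) \<oplus>\<^bsub>the_mod R Y\<^esub> ?s (y (a \<odot>\<^bsub>the_mod R Y\<^esub> v)) = a \<odot>\<^bsub>the_mod R Y\<^esub> (h (r v) \<oplus>\<^bsub>the_mod R Y\<^esub> ?s (y v))"
        by (simp only: dec[OF avY] dec[OF v])
      also have "\<dots> = a \<odot>\<^bsub>the_mod R Y\<^esub> h (r v) \<oplus>\<^bsub>the_mod R Y\<^esub> a \<odot>\<^bsub>the_mod R Y\<^esub> ?s (y v)" by (rule Y.ract_r_distr[OF a cY])
      also have "\<dots> = a \<odot>\<^bsub>the_mod R Y\<^esub> h (r v) \<oplus>\<^bsub>the_mod R Y\<^esub> ?s (y (a \<odot>\<^bsub>the_mod R Y\<^esub> v))" unfolding s_act ..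
      finally show "h (r (a \<odot>\<^bsub>the_mod R Y\<^esub> v)) \<oplus>\<^bsub>the_mod R Y\<^esub> ?s (y (a \<odot>\<^bsub>the_mod R Y\<^esub> v)) = a \<odot>\<^bsub>the_mod R Y\<^esub> h (r v) \<oplus>\<^bsub>the_mod R Y\<^esub> ?s (y (a \<odot>\<^bsub>the_mod R Y\<^esub> v))" .
      show "h (r (a \<odot>\<^bsub>the_mod R Y\<^esub> v)) \<in> snd Y" using r dY avY by simp
      show "a \<odot>\<^bsub>the_mod R Y\<^esub> h (r v) \<in> snd Y" using Y.ract_closed[OF a cY(1)] by simp
      show "?s (y (a \<odot>\<^bsub>the_mod R Y\<^esub> v)) \<in> snd Y" by (rule sy[OF avY])
    qed
    also have "\<dots> = h (a \<odot>\<^bsub>the_mod R X\<^esub> r v)" using linear_mapD(4)[OF h a, of "r v"] r v by simp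
    finally have eq: "h (r (a \<odot>\<^bsub>the_mod R Y\<^esub> v)) = h (a \<odot>\<^bsub>the_mod R X\<^esub> r v)" .
    have "a \<odot>\<^bsub>the_mod R X\<^esub> r v \<in> snd X" using X.ract_closed[OF a, of "r v"] r v by simp
    with eq r(1)[OF avY] show "r (a \<odot>\<^bsub>the_mod R Y\<^esub> v) = a \<odot>\<^bsub>the_mod R X\<^esub> r v" by (rule inj_onD[OF inj])
  qed (use r in \<open>auto simp: r_def\<close>)
  have rh: "r (h x) = x" if x: "x \<in> snd X" for x
  proof -
    have hx: "h x \<in> snd Y" using linD(1)[OF h x] .
    have "y (h x) = \<zero>\<^bsub>the_mod R Z\<^esub>" using ses x unfolding ses_def by blast
    then have "?s (y (h x)) = \<zero>\<^bsub>the_mod R Y\<^esub>" using linear_map_zero[OF Zm Ym s] by simp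
    then have "h (r (h x)) = h (r (h x)) \<oplus>\<^bsub>the_mod R Y\<^esub> ?s (y (h x))"
      using Y.M.r_zero[of "h (r (h x))"] r(2)[OF hx] dY[OF hx] by (simp only: the_mod_simps(1))
    then have "h (r (h x)) = h x" unfolding dec[OF hx] .
    then show ?thesis using r(1)[OF hx] x by (rule inj_onD[OF inj])
  qed
  show ?thesis by (rule that[OF s rlin ys rh dec])
qed

text \<open>A splitting is a collection of equations between maps, so additive functors preserve it;
  this lemma recovers exactness from the equations.\<close>

lemma ses_of_split:
  assumes R: "ring R" and X: "X \<in> summands R" and Y: "Y \<in> summands R" and Z: "Z \<in> summands R"
    and h: "lin R X Y h" and y: "lin R Y Z y" and s: "lin R Z Y s" and r: "lin R Y X r"
    and ys: "\<And>z. z \<in> snd Z \<Longrightarrow> y (s z) = z" and rh: "\<And>x. x \<in> snd X \<Longrightarrow> r (h x) = x"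
    and dec: "\<And>v. v \<in> snd Y \<Longrightarrow> h (r v) \<oplus>\<^bsub>the_mod R Y\<^esub> s (y v) = v"
    and yh: "\<And>x. x \<in> snd X \<Longrightarrow> y (h x) = \<zero>\<^bsub>the_mod R Z\<^esub>"
  shows "ses R X Y Z h y"
  unfolding ses_def
proof (intro conjI equalityI subsetI)
  show "inj_on h (snd X)" by (rule inj_on_inverseI[of _ r]) (rule rh)
  show "z \<in> snd Z" if "z \<in> y ` snd Y" for z using that linD(1)[OF y] by blast
  show "z \<in> y ` snd Y" if "z \<in> snd Z" for z using linD(1)[OF s that] ys[OF that] by (metis imageI)
  interpret Y: right_module R "the_mod R Y" by (rule right_module_the_mod[OF R Y])
  show "v \<in> h ` snd X" if "v \<in> {v \<in> snd Y. y v = \<zero>\<^bsub>the_mod R Z\<^esub>}" for v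
  proof -
    have v: "v \<in> snd Y" "y v = \<zero>\<^bsub>the_mod R Z\<^esub>" using that by auto
    have "s (y v) = \<zero>\<^bsub>the_mod R Y\<^esub>"
      unfolding v(2) by (rule linear_map_zero[OF right_module_the_mod[OF R Z] right_module_the_mod[OF R Y] s])
    then have "h (r v) = v"
      using dec[OF v(1)] linD(1)[OF h linD(1)[OF r v(1)]] Y.M.r_zero[of "h (r v)"] by simp
    then show ?thesis using linD(1)[OF r v(1)] by (metis imageI)
  qed
  show "v \<in> {v \<in> snd Y. y v = \<zero>\<^bsub>the_mod R Z\<^esub>}" if "v \<in> h ` snd X" for v
    using that yh linD(1)[OF h] by blast
qed

lemma compose_eqD: "compose A g f = restrict k A \<Longrightarrow> x \<in> A \<Longrightarrow> g (f x) = k x"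
  by (drule fun_cong[of _ _ x]) (simp add: compose_def)

lemma restrict_eqD: "restrict g A = restrict k A \<Longrightarrow> x \<in> A \<Longrightarrow> g x = k x"
  by (drule fun_cong[of _ _ x]) simp

section \<open>Extension of scalars is an exact functor\<close>

text \<open>Extension of scalars for summands: \<open>E X\<close> is the submodule of a free module
  over \<open>R'\<close> that the image of \<open>X\<close> under \<open>V\<close> spans.\<close>

locale ext_scalars =
  fixes R :: "('a, 'r) ring_scheme" and R' :: "('b, 's) ring_scheme" and \<phi> :: "'a \<Rightarrow> 'b"
  assumes R: "ring R" and R': "ring R'" and \<phi>: "\<phi> \<in> ring_hom R R'"
begin

abbreviation E where "E \<equiv> ext_ob R' \<phi>"
abbreviation V where "V n \<equiv> vec_map \<phi> n"

sublocale R: ring R by (rule R)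
sublocale R': ring R' by (rule R')
sublocale \<phi>: ring_hom_ring R R' \<phi> by (intro ring_hom_ringI2 R R' \<phi>)

lemma F': "right_module R' (free_mod R' n)" by (rule right_module_free_mod[OF R'])
lemma F: "right_module R (free_mod R n)" by (rule right_module_free_mod[OF R])

lemma V_closed: "x \<in> carrier (free_mod R n) \<Longrightarrow> V n x \<in> carrier (free_mod R' n)"
  and V_add: "x \<in> carrier (free_mod R n) \<Longrightarrow> y \<in> carrier (free_mod R n) \<Longrightarrow>
    V n (x \<oplus>\<^bsub>free_mod R n\<^esub> y) = V n x \<oplus>\<^bsub>free_mod R' n\<^esub> V n y"
  and V_act: "a \<in> carrier R \<Longrightarrow> x \<in> carrier (free_mod R n) \<Longrightarrow>
    V n (a \<odot>\<^bsub>free_mod R n\<^esub> x) = \<phi> a \<odot>\<^bsub>free_mod R' n\<^esub> V n x"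
  and V_zero: "V n \<zero>\<^bsub>free_mod R n\<^esub> = \<zero>\<^bsub>free_mod R' n\<^esub>"
  by (auto simp: vec_map_def free_mod_simps PiE_iff fun_eq_iff)

lemma fst_E [simp]: "fst (E X) = fst X" by (simp add: ext_ob_def)

lemma V_in_free: "X \<in> summands R \<Longrightarrow> x \<in> snd X \<Longrightarrow> V (fst X) x \<in> carrier (free_mod R' (fst X))"
  using summand_subset[OF _ R] V_closed by blast

lemma E_submodule:
  assumes "X \<in> summands R"
  shows "submodule (snd (E X)) R' (free_mod R' (fst X))"
proof -
  let ?F = "free_mod R' (fst X)"
  interpret F: right_module R' ?F by (rule F')
  have "submodule (carrier ?F) R' ?F" unfolding submodule_iff[OF F'] by (auto intro: F.ract_closed)
  then have "snd (E X) \<subseteq> carrier ?F"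
    using V_in_free[OF assms] by (auto simp: ext_ob_def)
  then show ?thesis
    unfolding submodule_iff[OF F'] by (auto simp: ext_ob_def submodule_iff[OF F'])
qed

lemma V_in_E: "x \<in> snd X \<Longrightarrow> V (fst X) x \<in> snd (E X)"
  by (auto simp: ext_ob_def)

lemma E_least:
  "submodule N R' (free_mod R' (fst X)) \<Longrightarrow> (\<And>x. x \<in> snd X \<Longrightarrow> V (fst X) x \<in> N) \<Longrightarrow> snd (E X) \<subseteq> N"
  by (auto simp: ext_ob_def)

text \<open>A retraction of \<open>R\<^sup>n\<close> onto a summand induces the retraction given by the same matrix.\<close>

lemma E_summand:
  assumes X: "X \<in> summands R"
  shows "E X \<in> summands R'"
proof -
  let ?n = "fst X" and ?F = "free_mod R (fst X)" and ?F' = "free_mod R' (fst X)"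
  interpret F: right_module R ?F by (rule F)
  interpret F': right_module R' ?F' by (rule F')
  note Es = E_submodule[OF X, unfolded submodule_iff[OF F']]
  obtain \<pi> where \<pi>: "linear_map R ?F ?F \<pi>" "\<pi> ` carrier ?F \<subseteq> snd X" "\<forall>x\<in>snd X. \<pi> x = x"
    by (rule summand_retract[OF R X])
  let ?g = "\<lambda>j. V ?n (\<pi> (unit_vec R ?n j))"
  let ?\<pi> = "lin_comb R' ?F' ?n ?g"
  have gE: "?g j \<in> snd (E X)" for j
    using \<pi>(2) unit_vec_closed[OF R] by (intro V_in_E) blast
  then have gF: "?g j \<in> carrier ?F'" for j using Es by blast
  have L: "linear_map R' ?F' ?F' ?\<pi>" by (rule linear_map_lin_comb[OF R' F' gF])
  have im: "?\<pi> y \<in> snd (E X)" if y: "y \<in> carrier ?F'" for y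
    unfolding lin_comb_def restrict_apply'[OF y]
    by (rule submodule_finsum[OF F' E_submodule[OF X]]) (use Es gE free_mod_nth[OF y] in auto)
  have fix': "?\<pi> (V ?n x) = V ?n x" if x: "x \<in> snd X" for x
  proof -
    have xF: "x \<in> carrier ?F" using summand_subset[OF X R] x by blast
    note xj = free_mod_nth[OF xF]
    have \<pi>u: "\<pi> (unit_vec R ?n j) \<in> carrier ?F" for j using linear_mapD(1)[OF \<pi>(1)] unit_vec_closed[OF R] by blast
    have "?\<pi> (V ?n x) = (\<Oplus>\<^bsub>?F'\<^esub>j\<in>{..<?n}. V ?n (x j \<odot>\<^bsub>?F\<^esub> \<pi> (unit_vec R ?n j)))"
      unfolding lin_comb_def restrict_apply'[OF V_closed[OF xF]]
    proof (rule F'.M.finsum_cong')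
      fix j assume j: "j \<in> {..<?n}"
      then show "V ?n x j \<odot>\<^bsub>?F'\<^esub> ?g j = V ?n (x j \<odot>\<^bsub>?F\<^esub> \<pi> (unit_vec R ?n j))"
        using V_act[OF xj \<pi>u, of j j] by (simp add: vec_map_def)
    next
      show "(\<lambda>j. V ?n (x j \<odot>\<^bsub>?F\<^esub> \<pi> (unit_vec R ?n j))) \<in> {..<?n} \<rightarrow> carrier ?F'"
        using xj \<pi>u by (intro funcsetI V_closed F.ract_closed) auto
    qed simp
    also have "\<dots> = V ?n (\<Oplus>\<^bsub>?F\<^esub>j\<in>{..<?n}. x j \<odot>\<^bsub>?F\<^esub> \<pi> (unit_vec R ?n j))"
      using finsum_additive[OF F.M.abelian_group_axioms F'.M.abelian_group_axioms, of "{..<?n}" "carrier ?F" "V ?n"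
          "\<lambda>j. x j \<odot>\<^bsub>?F\<^esub> \<pi> (unit_vec R ?n j)"] V_add V_closed xj \<pi>u F.ract_closed
      by (simp add: Pi_iff)
    also have "(\<Oplus>\<^bsub>?F\<^esub>j\<in>{..<?n}. x j \<odot>\<^bsub>?F\<^esub> \<pi> (unit_vec R ?n j)) = \<pi> (\<Oplus>\<^bsub>?F\<^esub>j\<in>{..<?n}. x j \<odot>\<^bsub>?F\<^esub> unit_vec R ?n j)"
    proof -
      have "\<pi> (\<Oplus>\<^bsub>?F\<^esub>j\<in>{..<?n}. x j \<odot>\<^bsub>?F\<^esub> unit_vec R ?n j) = (\<Oplus>\<^bsub>?F\<^esub>j\<in>{..<?n}. \<pi> (x j \<odot>\<^bsub>?F\<^esub> unit_vec R ?n j))"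
        using xj unit_vec_closed[OF R] F.ract_closed by (intro linear_map_finsum[OF F F \<pi>(1)]) auto
      also have "\<dots> = (\<Oplus>\<^bsub>?F\<^esub>j\<in>{..<?n}. x j \<odot>\<^bsub>?F\<^esub> \<pi> (unit_vec R ?n j))"
        using xj unit_vec_closed[OF R] F.ract_closed linear_mapD[OF \<pi>(1)] by (intro F.M.finsum_cong') auto
      finally show ?thesis ..
    qed
    also have "\<dots> = x" using free_mod_expand[OF R xF] bspec[OF \<pi>(3) x] by simp
    finally show ?thesis .
  qed
  let ?N = "{y \<in> snd (E X). ?\<pi> y = y}"
  have "submodule ?N R' ?F'"
    unfolding submodule_iff[OF F']
  proof (intro conjI ballI)
    show "?N \<subseteq> carrier ?F'" using Es by blast
    show "\<zero>\<^bsub>?F'\<^esub> \<in> ?N" using Es linear_map_zero[OF F' F' L] by blast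
  next
    fix x y assume "x \<in> ?N" "y \<in> ?N"
    moreover from this have "x \<in> carrier ?F'" "y \<in> carrier ?F'" using Es by blast+
    ultimately show "x \<oplus>\<^bsub>?F'\<^esub> y \<in> ?N" using Es linear_mapD(3)[OF L, of x y] by simp
  next
    fix a x assume "a \<in> carrier R'" "x \<in> ?N"
    moreover from this have "x \<in> carrier ?F'" using Es by blast
    ultimately show "a \<odot>\<^bsub>?F'\<^esub> x \<in> ?N" using Es linear_mapD(4)[OF L, of a x] by simp
  qed
  then have "snd (E X) \<subseteq> ?N" using fix' V_in_E by (intro E_least) auto
  then show ?thesis
    unfolding summands_iff_retract[OF R'] fst_E using E_submodule[OF X] L im by blast
qed

text \<open>Linear maps out of \<open>E X\<close> agree if they agree on the spanning set
  \<open>V(X)\<close>.  Every identity between extended maps below is proved in this way.\<close>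

lemma ext_unique:
  assumes X: "X \<in> summands R" and N: "right_module R' N"
    and g: "linear_map R' (the_mod R' (E X)) N g" and k: "linear_map R' (the_mod R' (E X)) N k"
    and eq: "\<And>x. x \<in> snd X \<Longrightarrow> g (V (fst X) x) = k (V (fst X) x)"
  shows "g = k"
proof (rule extensionalityI)
  show "g \<in> extensional (snd (E X))" "k \<in> extensional (snd (E X))"
    using linear_mapD(2)[OF g] linear_mapD(2)[OF k] by simp_all
  let ?F' = "free_mod R' (fst X)" and ?D = "{y \<in> snd (E X). g y = k y}"
  note Es = E_submodule[OF X, unfolded submodule_iff[OF F']]
  have "right_module R' (the_mod R' (E X))" by (rule right_module_the_mod[OF R' E_summand[OF X]])
  then have "g \<zero>\<^bsub>?F'\<^esub> = k \<zero>\<^bsub>?F'\<^esub>"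
    using linear_map_zero[OF _ N g] linear_map_zero[OF _ N k] by simp
  then have "submodule ?D R' ?F'"
    unfolding submodule_iff[OF F'] using Es linear_mapD(3,4)[OF g] linear_mapD(3,4)[OF k] by auto
  then have "snd (E X) \<subseteq> ?D" using eq V_in_E by (intro E_least) auto
  then show "g x = k x" if "x \<in> snd (E X)" for x using that by blast
qed

lemma ext_map:
  assumes X: "X \<in> summands R" and Y: "Y \<in> summands R" and h: "lin R X Y h"
  shows "lin R' (E X) (E Y) (ext_map R' \<phi> X Y h)"
    and "x \<in> snd X \<Longrightarrow> ext_map R' \<phi> X Y h (V (fst X) x) = V (fst Y) (h x)"
proof -
  have XF: "x \<in> carrier (free_mod R (fst X))" if "x \<in> snd X" for x using summand_subset[OF X R] that by blast
  have hY: "h x \<in> carrier (free_mod R (fst Y))" if "x \<in> snd X" for x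
    using summand_subset[OF Y R] linD(1)[OF h that] by blast
  have "\<exists>!g. linear_map R' (the_mod R' (E X)) (the_mod R' (E Y)) g \<and> (\<forall>x\<in>snd X. g (V (fst X) x) = V (fst Y) (h x))"
  proof (rule ext_universal[OF R R' \<phi> X right_module_the_mod[OF R' E_summand[OF Y]]])
    show "(\<lambda>x. V (fst Y) (h x)) \<in> snd X \<rightarrow> carrier (the_mod R' (E Y))"
      using V_in_E linD(1)[OF h] by auto
    show "V (fst Y) (h (x \<oplus>\<^bsub>the_mod R X\<^esub> y)) = V (fst Y) (h x) \<oplus>\<^bsub>the_mod R' (E Y)\<^esub> V (fst Y) (h y)"
      if "x \<in> snd X" "y \<in> snd X" for x y
      using linear_mapD(3)[OF h, of x y] that by (simp add: V_add hY)
    show "V (fst Y) (h (a \<odot>\<^bsub>the_mod R X\<^esub> x)) = \<phi> a \<odot>\<^bsub>the_mod R' (E Y)\<^esub> V (fst Y) (h x)"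
      if "a \<in> carrier R" "x \<in> snd X" for a x
      using linear_mapD(4)[OF h, of a x] that by (simp add: V_act hY)
  qed
  then have "\<exists>!g. g \<in> cat_hom (fgproj R') (E X) (E Y) \<and> (\<forall>x\<in>snd X. g (V (fst X) x) = V (fst Y) (h x))" by simp
  note * = theI'[OF this, folded ext_map_def]
  show "lin R' (E X) (E Y) (ext_map R' \<phi> X Y h)" using * by simp
  show "ext_map R' \<phi> X Y h (V (fst X) x) = V (fst Y) (h x)" if "x \<in> snd X" using * that by simp
qed

lemma ext_mapI:
  assumes X: "X \<in> summands R" and Y: "Y \<in> summands R" and h: "lin R X Y h"
    and g: "lin R' (E X) (E Y) g" and eq: "\<And>x. x \<in> snd X \<Longrightarrow> g (V (fst X) x) = V (fst Y) (h x)"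
  shows "ext_map R' \<phi> X Y h = g"
  by (rule ext_unique[OF X right_module_the_mod[OF R' E_summand[OF Y]] ext_map(1)[OF X Y h] g])
    (simp add: ext_map(2)[OF X Y h] eq)

lemma ext_map_id: "X \<in> summands R \<Longrightarrow> ext_map R' \<phi> X X (\<lambda>x\<in>snd X. x) = (\<lambda>x\<in>snd (E X). x)"
  by (rule ext_mapI) (auto intro: lin_id R R' E_summand simp: V_in_E)

lemma ext_map_comp:
  assumes X: "X \<in> summands R" and Y: "Y \<in> summands R" and Z: "Z \<in> summands R" and h: "lin R X Y h" and g: "lin R Y Z g"
  shows "ext_map R' \<phi> X Z (compose (snd X) g h) = compose (snd (E X)) (ext_map R' \<phi> Y Z g) (ext_map R' \<phi> X Y h)"
proof (rule ext_mapI[OF X Z])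
  show "lin R X Z (compose (snd X) g h)" by (rule lin_compose[OF R X h g])
  show "lin R' (E X) (E Z) (compose (snd (E X)) (ext_map R' \<phi> Y Z g) (ext_map R' \<phi> X Y h))"
    by (rule lin_compose[OF R' E_summand[OF X] ext_map(1)[OF X Y h] ext_map(1)[OF Y Z g]])
qed (simp add: compose_def V_in_E ext_map(2)[OF X Y h] ext_map(2)[OF Y Z g] linD(1)[OF h])

lemma ext_functor: "is_functor (fgproj R) (fgproj R') (ext_fctr R' \<phi>)"
  by unfold_locales (auto simp: ext_fctr_def E_summand ext_map ext_map_id ext_map_comp)

lemma ext_zero: "E (0, carrier (free_mod R 0)) = (0, carrier (free_mod R' 0))"
proof -
  have c: "carrier (free_mod R' 0) = {\<zero>\<^bsub>free_mod R' 0\<^esub>}" by (auto simp: free_mod_simps)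
  have z: "(0, carrier (free_mod R 0)) \<in> summands R"
  proof -
    interpret F: right_module R "free_mod R 0" by (rule F)
    have s: "submodule (carrier (free_mod R 0)) R (free_mod R 0)"
      unfolding submodule_iff[OF F] by (auto intro: F.ract_closed)
    have "linear_map R (free_mod R 0) (free_mod R 0) (\<lambda>x\<in>carrier (free_mod R 0). x)"
      by (rule linear_mapI) (auto intro: F.ract_closed)
    then show ?thesis unfolding summands_iff_retract[OF R] using s by (intro conjI exI) auto
  qed
  have "snd (E (0, carrier (free_mod R 0))) = carrier (free_mod R' 0)"
  proof -
    note E_submodule[OF z, unfolded submodule_iff[OF F'] fst_conv]
    then have "snd (E (0, carrier (free_mod R 0))) \<subseteq> carrier (free_mod R' 0)"
      and "\<zero>\<^bsub>free_mod R' 0\<^esub> \<in> snd (E (0, carrier (free_mod R 0)))" by (fast, fast)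
    then show ?thesis unfolding c by blast
  qed
  then show ?thesis by (simp add: prod_eq_iff)
qed

text \<open>Extension of scalars preserves the equations of a splitting.\<close>

lemma ses_ext:
  assumes X: "X \<in> summands R" and Y: "Y \<in> summands R" and Z: "Z \<in> summands R"
    and h: "lin R X Y h" and y: "lin R Y Z y" and ses: "ses R X Y Z h y"
  shows "ses R' (E X) (E Y) (E Z) (ext_map R' \<phi> X Y h) (ext_map R' \<phi> Y Z y)"
proof -
  obtain s r where s: "lin R Z Y s" and r: "lin R Y X r" and ys: "\<And>z. z \<in> snd Z \<Longrightarrow> y (s z) = z"
    and rh: "\<And>x. x \<in> snd X \<Longrightarrow> r (h x) = x"
    and dec: "\<And>v. v \<in> snd Y \<Longrightarrow> h (r v) \<oplus>\<^bsub>the_mod R Y\<^esub> s (y v) = v"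
    using ses_split[OF R X Y Z h y ses] by blast
  let ?h = "ext_map R' \<phi> X Y h" and ?y = "ext_map R' \<phi> Y Z y" and ?s = "ext_map R' \<phi> Z Y s" and ?r = "ext_map R' \<phi> Y X r"
  note EX = E_summand[OF X] and EY = E_summand[OF Y] and EZ = E_summand[OF Z]
  note h' = ext_map[OF X Y h] and y' = ext_map[OF Y Z y] and s' = ext_map[OF Z Y s] and r' = ext_map[OF Y X r]
  interpret EY: right_module R' "the_mod R' (E Y)" by (rule right_module_the_mod[OF R' EY])
  interpret EZ: right_module R' "the_mod R' (E Z)" by (rule right_module_the_mod[OF R' EZ])
  have YF: "v \<in> carrier (free_mod R (fst Y))" if "v \<in> snd Y" for v using summand_subset[OF Y R] that by blast
  show ?thesis
  proof (rule ses_of_split[OF R' EX EY EZ h'(1) y'(1) s'(1) r'(1)])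
    have "compose (snd (E Z)) ?y ?s = (\<lambda>z\<in>snd (E Z). z)"
      by (rule ext_unique[OF Z right_module_the_mod[OF R' EZ] lin_compose[OF R' EZ s'(1) y'(1)] lin_id[OF R' EZ]])
        (simp add: compose_def V_in_E s'(2) y'(2) linD(1)[OF s] ys)
    then show "?y (?s z) = z" if "z \<in> snd (E Z)" for z using that by (rule compose_eqD)
    have "compose (snd (E X)) ?r ?h = (\<lambda>z\<in>snd (E X). z)"
      by (rule ext_unique[OF X right_module_the_mod[OF R' EX] lin_compose[OF R' EX h'(1) r'(1)] lin_id[OF R' EX]])
        (simp add: compose_def V_in_E h'(2) r'(2) linD(1)[OF h] rh)
    then show "?r (?h x) = x" if "x \<in> snd (E X)" for x using that by (rule compose_eqD)
    let ?d = "\<lambda>v\<in>snd (E Y). ?h (?r v) \<oplus>\<^bsub>the_mod R' (E Y)\<^esub> ?s (?y v)"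
    have cl: "?h (?r v) \<in> carrier (the_mod R' (E Y))" "?s (?y v) \<in> carrier (the_mod R' (E Y))" if "v \<in> snd (E Y)" for v
      using linD(1)[OF h'(1) linD(1)[OF r'(1) that]] linD(1)[OF s'(1) linD(1)[OF y'(1) that]] by simp_all
    have "lin R' (E Y) (E Y) ?d"
    proof (rule linear_mapI)
      fix v w assume "v \<in> carrier (the_mod R' (E Y))" "w \<in> carrier (the_mod R' (E Y))"
      then have vw: "v \<in> snd (E Y)" "w \<in> snd (E Y)" by auto
      let ?p = "v \<oplus>\<^bsub>the_mod R' (E Y)\<^esub> w"
      have p: "?p \<in> snd (E Y)" using EY.M.a_closed[of v w] vw by simp
      have "?h (?r ?p) = ?h (?r v) \<oplus>\<^bsub>the_mod R' (E Y)\<^esub> ?h (?r w)"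
        using linear_mapD(3)[OF r'(1), of v w] linear_mapD(3)[OF h'(1), of "?r v" "?r w"] vw linD(1)[OF r'(1)] by simp
      moreover have "?s (?y ?p) = ?s (?y v) \<oplus>\<^bsub>the_mod R' (E Y)\<^esub> ?s (?y w)"
        using linear_mapD(3)[OF y'(1), of v w] linear_mapD(3)[OF s'(1), of "?y v" "?y w"] vw linD(1)[OF y'(1)] by simp
      ultimately show "?d ?p = ?d v \<oplus>\<^bsub>the_mod R' (E Y)\<^esub> ?d w"
        using vw p EY.M.add.m_ac cl by (simp only: restrict_apply' EY.M.a_ac EY.M.a_closed cl)
    next
      fix a v assume a: "a \<in> carrier R'" and "v \<in> carrier (the_mod R' (E Y))"
      then have v: "v \<in> snd (E Y)" by auto
      have p: "a \<odot>\<^bsub>the_mod R' (E Y)\<^esub> v \<in> snd (E Y)" using EY.ract_closed[OF a, of v] v by simp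
      have "?h (?r (a \<odot>\<^bsub>the_mod R' (E Y)\<^esub> v)) = a \<odot>\<^bsub>the_mod R' (E Y)\<^esub> ?h (?r v)"
        using linear_mapD(4)[OF r'(1) a, of v] linear_mapD(4)[OF h'(1) a, of "?r v"] v linD(1)[OF r'(1)] by simp
      moreover have "?s (?y (a \<odot>\<^bsub>the_mod R' (E Y)\<^esub> v)) = a \<odot>\<^bsub>the_mod R' (E Y)\<^esub> ?s (?y v)"
        using linear_mapD(4)[OF y'(1) a, of v] linear_mapD(4)[OF s'(1) a, of "?y v"] v linD(1)[OF y'(1)] by simp
      ultimately show "?d (a \<odot>\<^bsub>the_mod R' (E Y)\<^esub> v) = a \<odot>\<^bsub>the_mod R' (E Y)\<^esub> ?d v"
        using v p by (simp only: restrict_apply' EY.ract_r_distr[OF a cl[OF v]])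
    qed (use cl EY.M.a_closed in auto)
    moreover have "?d (V (fst Y) v) = (\<lambda>v\<in>snd (E Y). v) (V (fst Y) v)" if v: "v \<in> snd Y" for v
      using arg_cong[OF dec[OF v], of "V (fst Y)"] V_in_E[OF v] v
      by (simp add: h'(2) r'(2) s'(2) y'(2) linD(1)[OF r] linD(1)[OF y] V_add YF linD(1)[OF h] linD(1)[OF s])
    ultimately have "?d = (\<lambda>v\<in>snd (E Y). v)"
      by (intro ext_unique[OF Y right_module_the_mod[OF R' EY] _ lin_id[OF R' EY]])
    then show "?h (?r v) \<oplus>\<^bsub>the_mod R' (E Y)\<^esub> ?s (?y v) = v" if "v \<in> snd (E Y)" for v
      using that by (rule restrict_eqD)
    have yh: "y (h x) = \<zero>\<^bsub>free_mod R (fst Z)\<^esub>" if "x \<in> snd X" for x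
      using ses that by (auto simp: ses_def)
    have "lin R' (E X) (E Z) (\<lambda>x\<in>snd (E X). \<zero>\<^bsub>the_mod R' (E Z)\<^esub>)"
      by (rule linear_mapI)
        (use EZ.M.zero_closed EZ.finsum_ract[of "{}"] EZ.M.r_zero summand_closed[OF R' EX] summand_closed[OF R' EZ] in auto)
    then have "compose (snd (E X)) ?y ?h = (\<lambda>x\<in>snd (E X). \<zero>\<^bsub>the_mod R' (E Z)\<^esub>)"
      by (intro ext_unique[OF X right_module_the_mod[OF R' EZ] lin_compose[OF R' EX h'(1) y'(1)]])
        (simp_all add: compose_def V_in_E h'(2) y'(2) linD(1)[OF h] yh V_zero)
    then show "?y (?h x) = \<zero>\<^bsub>the_mod R' (E Z)\<^esub>" if "x \<in> snd (E X)" for x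
      using that by (rule compose_eqD)
  qed
qed

end

lemma ext_ob_trans:
  assumes "ext_scalars R R' \<phi>" "ext_scalars R' R'' \<psi>" "ext_scalars R R'' \<rho>"
    and eq: "\<And>a. a \<in> carrier R \<Longrightarrow> \<psi> (\<phi> a) = \<rho> a" and X: "X \<in> summands R"
  shows "ext_ob R'' \<psi> (ext_ob R' \<phi> X) = ext_ob R'' \<rho> X"
    and "lin R X Y h \<Longrightarrow> Y \<in> summands R \<Longrightarrow>
      ext_map R'' \<psi> (ext_ob R' \<phi> X) (ext_ob R' \<phi> Y) (ext_map R' \<phi> X Y h) = ext_map R'' \<rho> X Y h"
proof -
  interpret A: ext_scalars R R' \<phi> by fact
  interpret B: ext_scalars R' R'' \<psi> by fact
  interpret C: ext_scalars R R'' \<rho> by fact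
  have V: "B.V (fst X) (A.V (fst X) x) = C.V (fst X) x" if "X \<in> summands R" "x \<in> snd X" for X x
  proof -
    have "x \<in> carrier (free_mod R (fst X))" using summand_subset[OF that(1) A.R] that(2) by blast
    then show ?thesis by (auto simp: vec_map_def fun_eq_iff eq free_mod_nth)
  qed
  have ob: "B.E (A.E X) = C.E X" if X: "X \<in> summands R" for X
  proof -
    let ?n = "fst X"
    have "snd (C.E X) \<subseteq> snd (B.E (A.E X))"
    proof (rule C.E_least)
      show "submodule (snd (B.E (A.E X))) R'' (free_mod R'' (fst X))"
        using B.E_submodule[OF A.E_summand[OF X]] by simp
      show "C.V (fst X) x \<in> snd (B.E (A.E X))" if "x \<in> snd X" for x
        using B.V_in_E[OF A.V_in_E[OF that]] V[OF X that] by simp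
    qed
    moreover have "snd (B.E (A.E X)) \<subseteq> snd (C.E X)"
    proof (rule B.E_least)
      show "submodule (snd (C.E X)) R'' (free_mod R'' (fst (A.E X)))" using C.E_submodule[OF X] by simp
      let ?N = "{y \<in> carrier (free_mod R' ?n). B.V ?n y \<in> snd (C.E X)}"
      note cs = C.E_submodule[OF X, unfolded submodule_iff[OF C.F']]
      interpret F: right_module R' "free_mod R' ?n" by (rule A.F')
      have "submodule ?N R' (free_mod R' ?n)"
        unfolding submodule_iff[OF A.F'] using cs B.V_add B.V_act B.V_zero F.ract_closed by auto
      then have "snd (A.E X) \<subseteq> ?N"
        using A.V_in_free[OF X] V[OF X] C.V_in_E by (intro A.E_least) auto
      then show "B.V (fst (A.E X)) y \<in> snd (C.E X)" if "y \<in> snd (A.E X)" for y using that by auto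
    qed
    ultimately show ?thesis by (simp add: prod_eq_iff)
  qed
  show "ext_ob R'' \<psi> (ext_ob R' \<phi> X) = ext_ob R'' \<rho> X" by (rule ob[OF X])
  show "ext_map R'' \<psi> (ext_ob R' \<phi> X) (ext_ob R' \<phi> Y) (ext_map R' \<phi> X Y h) = ext_map R'' \<rho> X Y h"
    if h: "lin R X Y h" and Y: "Y \<in> summands R"
  proof (rule C.ext_mapI[OF X Y h, symmetric])
    note m = A.ext_map[OF X Y h] and m' = B.ext_map[OF A.E_summand[OF X] A.E_summand[OF Y] A.ext_map(1)[OF X Y h]]
    show "lin R'' (C.E X) (C.E Y) (ext_map R'' \<psi> (A.E X) (A.E Y) (ext_map R' \<phi> X Y h))"
      using m'(1) ob[OF X] ob[OF Y] by simp
    show "ext_map R'' \<psi> (A.E X) (A.E Y) (ext_map R' \<phi> X Y h) (C.V (fst X) x) = C.V (fst Y) (h x)" if x: "x \<in> snd X" for x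
      using m'(2)[OF A.V_in_E[OF x]] m(2)[OF x] V[OF X x] V[OF Y linD(1)[OF h x]] by simp
  qed
qed

section \<open>Categories of projective modules with an endomorphism\<close>

lemma ses_iff:
  "ses R X Y Z h y \<longleftrightarrow> inj_on h (snd X) \<and> y ` snd Y = snd Z \<and>
     {v \<in> snd Y. y v = \<zero>\<^bsub>free_mod R (fst Z)\<^esub>} = h ` snd X"
  by (simp add: ses_def)

lemma fgproj_wcof:
  "h \<in> wcof (fgproj R) X Y \<longleftrightarrow> lin R X Y h \<and> (\<exists>Q\<in>summands R. \<exists>q. lin R Y Q q \<and> ses R X Y Q h q)"
  by (auto simp: fgproj_def fgproj_cat_def ses_def)

text \<open>The exact categories in the theorem have as objects summands \<open>\<pi> X\<close> with
  an endomorphism \<open>\<epsilon> X\<close>, the identity in the case of \<open>P(R)\<close>, and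
  as arrows the linear maps that commute with the endomorphisms.  The assumption
  \<open>coker\<close> says that cokernels of cofibrations carry an endomorphism in the category;
  without it pushouts in the category could differ from pushouts of modules.\<close>

locale mod_cat =
  fixes R :: "('a, 'r) ring_scheme" and C :: "('o, 'a vfun) wcat"
    and \<pi> :: "'o \<Rightarrow> 'a summand" and \<epsilon> :: "'o \<Rightarrow> 'a vfun"
  assumes R: "ring R"
    and ob: "X \<in> cat_ob C \<Longrightarrow> \<pi> X \<in> summands R"
    and endo: "X \<in> cat_ob C \<Longrightarrow> lin R (\<pi> X) (\<pi> X) (\<epsilon> X)"
    and hom: "\<lbrakk>X \<in> cat_ob C; Y \<in> cat_ob C\<rbrakk> \<Longrightarrow> h \<in> cat_hom C X Y \<longleftrightarrow>
      lin R (\<pi> X) (\<pi> Y) h \<and> (\<forall>x\<in>snd (\<pi> X). \<epsilon> Y (h x) = h (\<epsilon> X x))"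
    and comp: "cat_comp C X g h = compose (snd (\<pi> X)) g h"
    and id: "cat_id C X = (\<lambda>x\<in>snd (\<pi> X). x)"
    and zero: "wzero C \<in> cat_ob C" "\<pi> (wzero C) = (0, carrier (free_mod R 0))"
    and cof: "\<lbrakk>X \<in> cat_ob C; Y \<in> cat_ob C\<rbrakk> \<Longrightarrow>
      h \<in> wcof C X Y \<longleftrightarrow> h \<in> cat_hom C X Y \<and> h \<in> wcof (fgproj R) (\<pi> X) (\<pi> Y)"
    and weq: "\<lbrakk>X \<in> cat_ob C; Y \<in> cat_ob C\<rbrakk> \<Longrightarrow>
      h \<in> weq C X Y \<longleftrightarrow> h \<in> cat_hom C X Y \<and> bij_betw h (snd (\<pi> X)) (snd (\<pi> Y))"
    and coker: "\<lbrakk>X \<in> cat_ob C; Y \<in> cat_ob C; h \<in> cat_hom C X Y; Q \<in> summands R; lin R (\<pi> Y) Q q;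
      ses R (\<pi> X) (\<pi> Y) Q h q\<rbrakk> \<Longrightarrow> \<exists>W\<in>cat_ob C. \<pi> W = Q \<and> q \<in> cat_hom C Y W"
begin

abbreviation null where "null X \<equiv> \<zero>\<^bsub>free_mod R (fst (\<pi> X))\<^esub>"

lemma homD:
  assumes "X \<in> cat_ob C" "Y \<in> cat_ob C" "h \<in> cat_hom C X Y"
  shows "lin R (\<pi> X) (\<pi> Y) h" and "x \<in> snd (\<pi> X) \<Longrightarrow> h x \<in> snd (\<pi> Y)"
    and "x \<in> snd (\<pi> X) \<Longrightarrow> \<epsilon> Y (h x) = h (\<epsilon> X x)" and "h (null X) = null Y"
proof -
  show l: "lin R (\<pi> X) (\<pi> Y) h" and "x \<in> snd (\<pi> X) \<Longrightarrow> \<epsilon> Y (h x) = h (\<epsilon> X x)"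
    using hom[OF assms(1,2)] assms(3) by auto
  show "x \<in> snd (\<pi> X) \<Longrightarrow> h x \<in> snd (\<pi> Y)" by (rule linD(1)[OF l])
  show "h (null X) = null Y" by (rule lin_zero[OF R ob[OF assms(1)] ob[OF assms(2)] l])
qed

lemma in_zero: "x \<in> snd (\<pi> (wzero C)) \<longleftrightarrow> x = null (wzero C)"
  by (auto simp: zero(2) free_mod_simps)

lemma null_closed: "X \<in> cat_ob C \<Longrightarrow> null X \<in> snd (\<pi> X)"
  by (rule summand_closed(1)[OF R ob])

lemma via_zero:
  assumes "X \<in> cat_ob C" "W \<in> cat_ob C" "g \<in> cat_hom C X (wzero C)" "u \<in> cat_hom C (wzero C) W" "x \<in> snd (\<pi> X)"
  shows "u (g x) = null W"
  using homD(2)[OF assms(1) zero(1) assms(3,5)] homD(4)[OF zero(1) assms(2,4)] by (simp add: in_zero)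

lemma from_zero_unique:
  assumes W: "W \<in> cat_ob C" and u: "u \<in> cat_hom C (wzero C) W" and v: "v \<in> cat_hom C (wzero C) W"
  shows "u = v"
  by (rule lin_eqI[OF homD(1)[OF zero(1) W u] homD(1)[OF zero(1) W v]])
    (simp add: in_zero homD(4)[OF zero(1) W u] homD(4)[OF zero(1) W v])

lemma zero_map:
  assumes W: "W \<in> cat_ob C"
  shows "(\<lambda>x\<in>snd (\<pi> (wzero C)). null W) \<in> cat_hom C (wzero C) W"
proof -
  interpret W: right_module R "the_mod R (\<pi> W)" by (rule right_module_the_mod[OF R ob[OF W]])
  have z: "null W \<oplus>\<^bsub>free_mod R (fst (\<pi> W))\<^esub> null W = null W" using W.M.r_zero[OF W.M.zero_closed] by simp
  have a: "a \<odot>\<^bsub>free_mod R (fst (\<pi> W))\<^esub> null W = null W" if "a \<in> carrier R" for a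
    using W.finsum_ract[of "{}" a] that by simp
  have "lin R (\<pi> (wzero C)) (\<pi> W) (\<lambda>x\<in>snd (\<pi> (wzero C)). null W)"
    using summand_closed[OF R ob[OF zero(1)]] null_closed[OF W]
    by (intro linear_mapI) (simp_all add: z a)
  moreover have "\<epsilon> W (null W) = null W" by (rule lin_zero[OF R ob[OF W] ob[OF W] endo[OF W]])
  moreover have "\<epsilon> (wzero C) x \<in> snd (\<pi> (wzero C))" if "x \<in> snd (\<pi> (wzero C))" for x
    by (rule linD(1)[OF endo[OF zero(1)] that])
  ultimately show ?thesis unfolding hom[OF zero(1) W] by simp
qed

lemma hom_factor:
  assumes Y: "Y \<in> cat_ob C" and P: "P \<in> cat_ob C" and W: "W \<in> cat_ob C"
    and y: "y \<in> cat_hom C Y P" "y ` snd (\<pi> Y) = snd (\<pi> P)" and u: "u \<in> cat_hom C Y W"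
    and w: "lin R (\<pi> P) (\<pi> W) w" "\<And>v. v \<in> snd (\<pi> Y) \<Longrightarrow> w (y v) = u v"
  shows "w \<in> cat_hom C P W"
  unfolding hom[OF P W]
proof (intro conjI ballI w(1))
  fix x assume "x \<in> snd (\<pi> P)"
  then obtain v where v: "v \<in> snd (\<pi> Y)" "x = y v" using y(2) by blast
  have ev: "\<epsilon> Y v \<in> snd (\<pi> Y)" by (rule linD(1)[OF endo[OF Y] v(1)])
  have "\<epsilon> W (w x) = u (\<epsilon> Y v)" unfolding v(2) w(2)[OF v(1)] by (rule homD(3)[OF Y W u v(1)])
  also have "\<dots> = w (\<epsilon> P x)" unfolding v(2) homD(3)[OF Y P y(1) v(1)] w(2)[OF ev] ..
  finally show "\<epsilon> W (w x) = w (\<epsilon> P x)" .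
qed

lemma comp_eqI: "(\<And>x. x \<in> snd (\<pi> X) \<Longrightarrow> g (h x) = k x) \<Longrightarrow> k \<in> extensional (snd (\<pi> X)) \<Longrightarrow> cat_comp C X g h = k"
  unfolding comp by (auto simp: compose_def extensional_def fun_eq_iff)

lemma comp_eqD: "cat_comp C X g h = k \<Longrightarrow> x \<in> snd (\<pi> X) \<Longrightarrow> g (h x) = k x"
  unfolding comp by (auto simp: compose_def)

text \<open>A cofibration \<open>f\<close> has a cokernel \<open>q\<close> in the category, and it
  has the same universal property as \<open>y\<close> in the pushout square along the zero object.
  So \<open>y\<close> and \<open>q\<close> differ by an isomorphism.\<close>

lemma square_imp_ses:
  assumes X: "X \<in> cat_ob C" and Y: "Y \<in> cat_ob C" and P: "P \<in> cat_ob C"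
    and f: "f \<in> cat_hom C X Y" and g: "g \<in> cat_hom C X (wzero C)"
    and y: "y \<in> cat_hom C Y P" and z: "z \<in> cat_hom C (wzero C) P"
    and fc: "f \<in> wcof C X Y" and po: "pushout_square C X Y (wzero C) P f g y z"
  shows "ses R (\<pi> X) (\<pi> Y) (\<pi> P) f y"
proof -
  obtain Q q where Q: "Q \<in> summands R" and q: "lin R (\<pi> Y) Q q" and s: "ses R (\<pi> X) (\<pi> Y) Q f q"
    using fc unfolding cof[OF X Y] fgproj_wcof by blast
  obtain W where W: "W \<in> cat_ob C" and WQ: "\<pi> W = Q" and qW: "q \<in> cat_hom C Y W"
    using coker[OF X Y f Q q s] by blast
  note s' = s[unfolded ses_iff WQ[symmetric]]
  have qf: "q (f x) = null W" if "x \<in> snd (\<pi> X)" for x using s' that by blast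
  have yf: "y (f x) = null P" if x: "x \<in> snd (\<pi> X)" for x
  proof -
    have "cat_comp C X y f = cat_comp C X z g" using po unfolding pushout_square_def by blast
    from comp_eqD[OF this x] show ?thesis
      using via_zero[OF X P g z x] x by (simp add: comp compose_def)
  qed
  let ?n = "\<lambda>x\<in>snd (\<pi> (wzero C)). null W"
  have "cat_comp C X q f = cat_comp C X ?n g"
    unfolding comp compose_def using qf via_zero[OF X W g zero_map[OF W]] by (auto simp: fun_eq_iff)
  then have "\<exists>!w. w \<in> cat_hom C P W \<and> cat_comp C Y w y = q \<and> cat_comp C (wzero C) w z = ?n"
    using po W qW zero_map[OF W] unfolding pushout_square_def by blast
  then obtain w where w: "w \<in> cat_hom C P W" and wy: "cat_comp C Y w y = q" by blast
  have ker: "y v = \<zero>\<^bsub>the_mod R (\<pi> P)\<^esub>" if v: "v \<in> snd (\<pi> Y)" "q v = \<zero>\<^bsub>the_mod R Q\<^esub>" for v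
  proof -
    have "v \<in> f ` snd (\<pi> X)" using s v unfolding ses_def by blast
    then show ?thesis using yf by auto
  qed
  obtain w' where w': "lin R Q (\<pi> P) w'" and w'q: "\<And>v. v \<in> snd (\<pi> Y) \<Longrightarrow> w' (q v) = y v"
    by (rule lin_factor[OF R ob[OF Y] q _ ob[OF P] homD(1)[OF Y P y] ker Q]) (use s in \<open>auto simp: ses_def\<close>)
  have w'hom: "w' \<in> cat_hom C W P"
    by (rule hom_factor[OF Y W P qW _ y]) (use s' w' w'q WQ in auto)
  let ?k = "compose (snd (\<pi> P)) w' w" and ?i = "\<lambda>x\<in>snd (\<pi> P). x"
  have "?i \<in> cat_hom C P P" unfolding hom[OF P P]
    using lin_id[OF R ob[OF P]] linD(1)[OF endo[OF P]] by auto
  moreover have "?k \<in> cat_hom C P P" unfolding hom[OF P P]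
  proof (intro conjI ballI)
    show "lin R (\<pi> P) (\<pi> P) ?k"
      by (rule lin_compose[OF R ob[OF P] homD(1)[OF P W w]]) (use w' WQ in simp)
    show "\<epsilon> P (?k x) = ?k (\<epsilon> P x)" if "x \<in> snd (\<pi> P)" for x
      using that homD(2,3)[OF P W w] homD(3)[OF W P w'hom] linD(1)[OF endo[OF P]] by (simp add: compose_def)
  qed
  moreover have "cat_comp C Y ?i y = y"
    by (rule comp_eqI) (use homD(2)[OF Y P y] linD(2)[OF homD(1)[OF Y P y]] in auto)
  moreover have "cat_comp C Y ?k y = y"
    by (rule comp_eqI) (use homD(2)[OF Y P y] linD(2)[OF homD(1)[OF Y P y]] comp_eqD[OF wy] w'q in \<open>auto simp: compose_def\<close>)
  moreover have "cat_comp C (wzero C) ?i z = z"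
    by (rule comp_eqI) (use homD(2)[OF zero(1) P z] linD(2)[OF homD(1)[OF zero(1) P z]] in auto)
  moreover have "cat_comp C (wzero C) ?k z = z"
  proof (rule comp_eqI)
    fix x assume "x \<in> snd (\<pi> (wzero C))"
    then have "z x = null P" using homD(4)[OF zero(1) P z] by (simp add: in_zero)
    then show "?k (z x) = z x" using null_closed[OF P] homD(4)[OF P W w] homD(4)[OF W P w'hom] by (simp add: compose_def)
  qed (rule linD(2)[OF homD(1)[OF zero(1) P z]])
  moreover have "\<exists>!w. w \<in> cat_hom C P P \<and> cat_comp C Y w y = y \<and> cat_comp C (wzero C) w z = z"
    using po P y z unfolding pushout_square_def by blast
  \<comment> \<open>both maps are endomorphisms of the pushout that restrict to \<open>y\<close> and \<open>z\<close>\<close>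
  ultimately have ki: "?k = ?i" by blast
  have w'w: "w' (w x) = x" if "x \<in> snd (\<pi> P)" for x using compose_eqD[OF ki that] .
  show ?thesis unfolding ses_iff
  proof (intro conjI equalityI subsetI)
    show "inj_on f (snd (\<pi> X))" using s' by blast
    show "x \<in> snd (\<pi> P)" if "x \<in> y ` snd (\<pi> Y)" for x using that homD(2)[OF Y P y] by blast
    show "x \<in> y ` snd (\<pi> Y)" if x: "x \<in> snd (\<pi> P)" for x
    proof -
      have "w x \<in> q ` snd (\<pi> Y)" using homD(2)[OF P W w x] s' by blast
      then obtain v where "v \<in> snd (\<pi> Y)" "w x = q v" by blast
      then show ?thesis using w'q w'w[OF x] by (metis imageI)
    qed
    show "v \<in> f ` snd (\<pi> X)" if "v \<in> {v \<in> snd (\<pi> Y). y v = null P}" for v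
    proof -
      have v: "v \<in> snd (\<pi> Y)" "y v = null P" using that by auto
      have "q v = null W" using comp_eqD[OF wy v(1)] homD(4)[OF P W w] unfolding v(2) by simp
      then show ?thesis using s' v(1) by blast
    qed
    show "v \<in> {v \<in> snd (\<pi> Y). y v = null P}" if "v \<in> f ` snd (\<pi> X)" for v
      using that yf homD(2)[OF X Y f] by blast
  qed
qed

text \<open>A map that vanishes on \<open>f(X)\<close> factors uniquely through the surjection
  \<open>y\<close>, and the maps from the zero object impose no condition.\<close>

lemma ses_imp_square:
  assumes X: "X \<in> cat_ob C" and Y: "Y \<in> cat_ob C" and P: "P \<in> cat_ob C"
    and f: "f \<in> cat_hom C X Y" and g: "g \<in> cat_hom C X (wzero C)"
    and y: "y \<in> cat_hom C Y P" and z: "z \<in> cat_hom C (wzero C) P"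
    and s: "ses R (\<pi> X) (\<pi> Y) (\<pi> P) f y"
  shows "f \<in> wcof C X Y" and "pushout_square C X Y (wzero C) P f g y z"
proof -
  show "f \<in> wcof C X Y"
    unfolding cof[OF X Y] fgproj_wcof using f ob[OF P] homD(1)[OF X Y f] homD(1)[OF Y P y] s by blast
  note s' = s[unfolded ses_iff]
  have yf: "y (f x) = null P" if "x \<in> snd (\<pi> X)" for x using s' that by blast
  have surj: "y ` snd (\<pi> Y) = snd (\<pi> P)" using s' by blast
  show "pushout_square C X Y (wzero C) P f g y z"
    unfolding pushout_square_def
  proof (intro conjI ballI impI)
    show "cat_comp C X y f = cat_comp C X z g"
      unfolding comp compose_def using yf via_zero[OF X P g z] by (auto simp: fun_eq_iff)
    fix W u v assume W: "W \<in> cat_ob C" and u: "u \<in> cat_hom C Y W" and v: "v \<in> cat_hom C (wzero C) W"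
      and eq: "cat_comp C X u f = cat_comp C X v g"
    have uf: "u (f x) = null W" if x: "x \<in> snd (\<pi> X)" for x
      using comp_eqD[OF eq x] via_zero[OF X W g v x] x by (simp add: comp compose_def)
    have ker: "u a = \<zero>\<^bsub>the_mod R (\<pi> W)\<^esub>" if a: "a \<in> snd (\<pi> Y)" "y a = \<zero>\<^bsub>the_mod R (\<pi> P)\<^esub>" for a
    proof -
      have "a \<in> f ` snd (\<pi> X)" using s a unfolding ses_def by blast
      then show ?thesis using uf by auto
    qed
    obtain w where w: "lin R (\<pi> P) (\<pi> W) w" and wy: "\<And>a. a \<in> snd (\<pi> Y) \<Longrightarrow> w (y a) = u a"
      by (rule lin_factor[OF R ob[OF Y] homD(1)[OF Y P y] surj ob[OF W] homD(1)[OF Y W u] ker ob[OF P]], assumption, assumption, rule that, assumption, blast)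
    have wh: "w \<in> cat_hom C P W" by (rule hom_factor[OF Y P W y surj u w wy])
    show "\<exists>!w. w \<in> cat_hom C P W \<and> cat_comp C Y w y = u \<and> cat_comp C (wzero C) w z = v"
    proof (rule ex1I[of _ w], intro conjI)
      show "w \<in> cat_hom C P W" by (rule wh)
      show "cat_comp C Y w y = u" by (rule comp_eqI) (rule wy linD(2)[OF homD(1)[OF Y W u]], assumption?)+
      show "cat_comp C (wzero C) w z = v"
      proof (rule comp_eqI[OF _ linD(2)[OF homD(1)[OF zero(1) W v]]])
        fix x assume "x \<in> snd (\<pi> (wzero C))"
        then have "x = null (wzero C)" by (simp only: in_zero)
        then show "w (z x) = v x"
          using homD(4)[OF zero(1) P z] homD(4)[OF P W wh] homD(4)[OF zero(1) W v] by simp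
      qed
      fix w' assume w': "w' \<in> cat_hom C P W \<and> cat_comp C Y w' y = u \<and> cat_comp C (wzero C) w' z = v"
      show "w' = w"
      proof (rule lin_eqI[OF homD(1)[OF P W] w])
        show "w' \<in> cat_hom C P W" using w' by blast
        fix x assume "x \<in> snd (\<pi> P)"
        then obtain a where a: "a \<in> snd (\<pi> Y)" "x = y a" using surj by blast
        show "w' x = w x" unfolding a(2) wy[OF a(1)] by (rule comp_eqD[OF _ a(1)]) (use w' in blast)
      qed
    qed
  qed
qed

lemma S_obs_iff:
  "F \<in> S_obs C n \<longleftrightarrow> F \<in> diagrams (Ar n) C \<and> (\<forall>j\<le>n. fst F (j, j) = wzero C) \<and>
    (\<forall>i j k. i \<le> j \<and> j \<le> k \<and> k \<le> n \<longrightarrow>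
      ses R (\<pi> (fst F (i, j))) (\<pi> (fst F (i, k))) (\<pi> (fst F (j, k))) (snd F ((i, j), (i, k))) (snd F ((i, k), (j, k))))"
    (is "_ \<longleftrightarrow> ?d \<and> ?z \<and> ?s")
proof -
  have iff: "snd F ((i, j), (i, k)) \<in> wcof C (fst F (i, j)) (fst F (i, k)) \<and>
      pushout_square C (fst F (i, j)) (fst F (i, k)) (fst F (j, j)) (fst F (j, k))
        (snd F ((i, j), (i, k))) (snd F ((i, j), (j, j))) (snd F ((i, k), (j, k))) (snd F ((j, j), (j, k))) \<longleftrightarrow>
      ses R (\<pi> (fst F (i, j))) (\<pi> (fst F (i, k))) (\<pi> (fst F (j, k))) (snd F ((i, j), (i, k))) (snd F ((i, k), (j, k)))"
    if d: "?d" and z: "?z" and ijk: "i \<le> j" "j \<le> k" "k \<le> n" for i j k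
  proof -
    have ar: "(i, j) \<in> Ar n" "(i, k) \<in> Ar n" "(j, k) \<in> Ar n" "(j, j) \<in> Ar n" using ijk by (auto simp: Ar_def)
    have le: "(i, j) \<le> (i, k)" "(i, k) \<le> (j, k)" "(i, j) \<le> (j, j)" "(j, j) \<le> (j, k)" using ijk by auto
    note o = PiE_mem[OF diagramsD(1)[OF d]] and h = diagramsD(3)[OF d]
    have zj: "fst F (j, j) = wzero C" using z ijk by simp
    note facts = o[OF ar(1)] o[OF ar(2)] o[OF ar(3)] h[OF ar(1,2) le(1)] h[OF ar(1,4) le(3), unfolded zj]
      h[OF ar(2,3) le(2)] h[OF ar(4,3) le(4), unfolded zj]
    show ?thesis unfolding zj using square_imp_ses[OF facts] ses_imp_square[OF facts] by blast
  qed
  have "F \<in> S_obs C n \<longleftrightarrow> ?d \<and> ?z \<and> (\<forall>i j k. i \<le> j \<and> j \<le> k \<and> k \<le> n \<longrightarrow>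
      snd F ((i, j), (i, k)) \<in> wcof C (fst F (i, j)) (fst F (i, k)) \<and>
      pushout_square C (fst F (i, j)) (fst F (i, k)) (fst F (j, j)) (fst F (j, k))
        (snd F ((i, j), (i, k))) (snd F ((i, j), (j, j))) (snd F ((i, k), (j, k))) (snd F ((j, j), (j, k))))"
    by (simp only: S_obs_def mem_Collect_eq case_prod_unfold conj_assoc)
       (simp add: split_beta)
  also have "\<dots> \<longleftrightarrow> ?d \<and> ?z \<and> ?s"
    by (intro conj_cong refl all_cong1 imp_cong) (use iff in blast)
  finally show ?thesis .
qed

lemma zero_simplex: "const_diagram {..0::nat} (wS C 0) (zero_diagram C) \<in> diagrams {..0} (wS C 0)"
proof -
  have Ar0: "Ar 0 = {(0, 0)}" by (auto simp: Ar_def)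
  have idz: "cat_id C (wzero C) \<in> cat_hom C (wzero C) (wzero C)"
    unfolding hom[OF zero(1) zero(1)] id using lin_id[OF R ob[OF zero(1)]] linD(1)[OF endo[OF zero(1)]] by auto
  have idid: "cat_comp C (wzero C) (cat_id C (wzero C)) (cat_id C (wzero C)) = cat_id C (wzero C)"
    unfolding comp id by (auto simp: compose_def fun_eq_iff)
  have Z: "zero_diagram C \<in> S_obs C 0"
    unfolding S_obs_iff
  proof (intro conjI allI impI)
    show "zero_diagram C \<in> diagrams (Ar 0) C"
      unfolding zero_diagram_def const_diagram_def using zero(1) idz idid
      by (intro diagramsI) (auto simp: Ar0 le_pairs_def)
    show "fst (zero_diagram C) (j, j) = wzero C" if "j \<le> 0" for j
      using that by (simp add: zero_diagram_def const_diagram_def Ar0)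
    fix i j k :: nat assume "i \<le> j \<and> j \<le> k \<and> k \<le> 0"
    then have "i = 0" "j = 0" "k = 0" by auto
    moreover have "ses R (\<pi> (wzero C)) (\<pi> (wzero C)) (\<pi> (wzero C)) (cat_id C (wzero C)) (cat_id C (wzero C))"
      unfolding ses_iff id using null_closed[OF zero(1)] by (auto simp: in_zero)
    ultimately show "ses R (\<pi> (fst (zero_diagram C) (i, j))) (\<pi> (fst (zero_diagram C) (i, k))) (\<pi> (fst (zero_diagram C) (j, k)))
        (snd (zero_diagram C) ((i, j), i, k)) (snd (zero_diagram C) ((i, k), j, k))"
      by (simp add: zero_diagram_def const_diagram_def Ar0 le_pairs_def)
  qed
  have weqz: "cat_id C (wzero C) \<in> weq C (wzero C) (wzero C)"
    unfolding weq[OF zero(1) zero(1)] using idz by (auto simp: id bij_betw_def inj_on_def)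
  have Zf: "fst (zero_diagram C) (0, 0) = wzero C" "snd (zero_diagram C) ((0, 0), (0, 0)) = cat_id C (wzero C)"
    by (simp_all add: zero_diagram_def const_diagram_def Ar0 le_pairs_def)
  show ?thesis
    unfolding const_diagram_def
    by (rule diagramsI) (use Z weqz in \<open>auto simp: Ar0 le_pairs_def wS_def Zf idid intro!: restrict_ext\<close>)
qed

end

text \<open>Exactness of a functor only has to be tested on short exact sequences.\<close>

lemma exact_familyI:
  assumes C: "mod_cat R C \<pi> \<epsilon>" and D: "mod_cat R' D \<pi>' \<epsilon>'" and fam: "family p C D O\<^sub>A A"
    and diag: "\<And>e X Y h. e \<le> p \<Longrightarrow> X \<in> cat_ob C \<Longrightarrow> Y \<in> cat_ob C \<Longrightarrow> h \<in> cat_hom C X Y \<Longrightarrow> A e e X Y h = A 0 0 X Y h"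
    and zero: "O\<^sub>A (wzero C) = wzero D"
    and ses: "\<And>X Y Z h y. X \<in> cat_ob C \<Longrightarrow> Y \<in> cat_ob C \<Longrightarrow> Z \<in> cat_ob C \<Longrightarrow> h \<in> cat_hom C X Y \<Longrightarrow> y \<in> cat_hom C Y Z \<Longrightarrow>
      ses R (\<pi> X) (\<pi> Y) (\<pi> Z) h y \<Longrightarrow> ses R' (\<pi>' (O\<^sub>A X)) (\<pi>' (O\<^sub>A Y)) (\<pi>' (O\<^sub>A Z)) (A 0 0 X Y h) (A 0 0 Y Z y)"
    and bij: "\<And>e e' X Y h. e \<le> e' \<Longrightarrow> e' \<le> p \<Longrightarrow> X \<in> cat_ob C \<Longrightarrow> Y \<in> cat_ob C \<Longrightarrow> h \<in> cat_hom C X Y \<Longrightarrow>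
      bij_betw h (snd (\<pi> X)) (snd (\<pi> Y)) \<Longrightarrow> bij_betw (A e e' X Y h) (snd (\<pi>' (O\<^sub>A X))) (snd (\<pi>' (O\<^sub>A Y)))"
  shows "exact_family p C D O\<^sub>A A"
proof -
  interpret C: mod_cat R C \<pi> \<epsilon> by fact
  interpret D: mod_cat R' D \<pi>' \<epsilon>' by fact
  interpret family p C D O\<^sub>A A by fact
  have func: "is_functor C D (O\<^sub>A, A 0 0)"
    by unfold_locales (simp_all add: ob hom id comp)
  show ?thesis
  proof (intro exact_family.intro exact_family_axioms.intro fam)
    fix X Y h assume X: "X \<in> cat_ob C" and Y: "Y \<in> cat_ob C" and h: "h \<in> weq C X Y"
    show "h \<in> cat_hom C X Y" using h unfolding C.weq[OF X Y] by blast
    show "A e e' X Y h \<in> weq D (O\<^sub>A X) (O\<^sub>A Y)" if "e \<le> e'" "e' \<le> p" for e e'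
      using h hom[OF that X Y] bij[OF that X Y] unfolding C.weq[OF X Y] D.weq[OF ob[OF X] ob[OF Y]] by blast
  next
    fix e X Y h assume "e \<le> p" "X \<in> cat_ob C" "Y \<in> cat_ob C" "h \<in> cat_hom C X Y"
    then show "A e e X Y h = A 0 0 X Y h" by (rule diag)
  next
    fix F k assume "F \<in> S_obs C k"
    note F = this[unfolded C.S_obs_iff]
    have d: "F \<in> diagrams (Ar k) C" using F by blast
    show "push (Ar k) (O\<^sub>A, A 0 0) F \<in> S_obs D k"
      unfolding D.S_obs_iff
    proof (intro conjI allI impI)
      show "push (Ar k) (O\<^sub>A, A 0 0) F \<in> diagrams (Ar k) D" by (rule push_in_diagrams[OF func d])
      show "fst (push (Ar k) (O\<^sub>A, A 0 0) F) (j, j) = wzero D" if "j \<le> k" for j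
        using that F by (simp add: push_def Ar_def zero)
      fix i j l assume ijl: "i \<le> j \<and> j \<le> l \<and> l \<le> k"
      have ar: "(i, j) \<in> Ar k" "(i, l) \<in> Ar k" "(j, l) \<in> Ar k" using ijl by (auto simp: Ar_def)
      have le: "(i, j) \<le> (i, l)" "(i, l) \<le> (j, l)" using ijl by auto
      note o = PiE_mem[OF diagramsD(1)[OF d]] and h = diagramsD(3)[OF d]
      have "ses R (\<pi> (fst F (i, j))) (\<pi> (fst F (i, l))) (\<pi> (fst F (j, l))) (snd F ((i, j), (i, l))) (snd F ((i, l), (j, l)))"
        using F ijl by blast
      from ses[OF o[OF ar(1)] o[OF ar(2)] o[OF ar(3)] h[OF ar(1,2) le(1)] h[OF ar(2,3) le(2)] this]
      show "ses R' (\<pi>' (fst (push (Ar k) (O\<^sub>A, A 0 0) F) (i, j))) (\<pi>' (fst (push (Ar k) (O\<^sub>A, A 0 0) F) (i, l)))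
          (\<pi>' (fst (push (Ar k) (O\<^sub>A, A 0 0) F) (j, l))) (snd (push (Ar k) (O\<^sub>A, A 0 0) F) ((i, j), i, l))
          (snd (push (Ar k) (O\<^sub>A, A 0 0) F) ((i, l), j, l))"
        using ar le by (simp add: push_def le_pairs_def)
    qed
  qed
qed

section \<open>Exact functors and twisted families\<close>

lemma zero_summand:
  assumes R: "ring R"
  shows "(0, carrier (free_mod R 0)) \<in> summands R"
proof -
  have F: "right_module R (free_mod R 0)" by (rule right_module_free_mod[OF R])
  interpret F: right_module R "free_mod R 0" by (rule F)
  have s: "submodule (carrier (free_mod R 0)) R (free_mod R 0)"
    unfolding submodule_iff[OF F] by (auto intro: F.ract_closed)
  have "linear_map R (free_mod R 0) (free_mod R 0) (\<lambda>x\<in>carrier (free_mod R 0). x)"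
    by (rule linear_mapI) (auto intro: F.ract_closed)
  then show ?thesis unfolding summands_iff_retract[OF R] using s by (intro conjI exI) auto
qed

lemma isos_fgproj: "isos (fgproj R) = isos (fgproj_cat R)"
  by (simp add: isos_def fgproj_cat_simps fun_eq_iff)

lemma mod_cat_fgproj:
  assumes R: "ring R"
  shows "mod_cat R (fgproj R) (\<lambda>X. X) (\<lambda>X. \<lambda>x\<in>snd X. x)"
proof (rule mod_cat.intro)
  show "lin R X X (\<lambda>x\<in>snd X. x)" if "X \<in> cat_ob (fgproj R)" for X
    using lin_id[OF R] that by simp
  show "h \<in> cat_hom (fgproj R) X Y \<longleftrightarrow> lin R X Y h \<and> (\<forall>x\<in>snd X. (\<lambda>x\<in>snd Y. x) (h x) = h ((\<lambda>x\<in>snd X. x) x))" for X Y h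
    using linD(1)[of R X Y h] by auto
  show "h \<in> wcof (fgproj R) X Y \<longleftrightarrow> h \<in> cat_hom (fgproj R) X Y \<and> h \<in> wcof (fgproj R) X Y" for X Y h
    by (auto simp: fgproj_wcof)
  show "h \<in> weq (fgproj R) X Y \<longleftrightarrow> h \<in> cat_hom (fgproj R) X Y \<and> bij_betw h (snd X) (snd Y)"
    if "X \<in> cat_ob (fgproj R)" "Y \<in> cat_ob (fgproj R)" for X Y h
    using that isos_iff_bij[OF R] by simp
qed (use R zero_summand[OF R] in simp_all)

lemma full_sub_simps [simp]:
  "cat_ob (full_sub C U) = cat_ob C \<inter> U"
  "cat_hom (full_sub C U) = cat_hom C"
  "cat_id (full_sub C U) = cat_id C"
  "cat_comp (full_sub C U) = cat_comp C"
  by (simp_all add: full_sub_def)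

lemma full_sub_wcat_simps [simp]:
  fixes C :: "('o, 'm) wcat"
  shows "wzero (full_sub C U) = wzero C" "wcof (full_sub C U) = wcof C" "weq (full_sub C U) = weq C"
  by (simp_all add: full_sub_def)

lemma end_cat_simps [simp]:
  "cat_ob (end_cat C) = {(X, f). X \<in> cat_ob C \<and> f \<in> cat_hom C X X}"
  "cat_id (end_cat C) X = cat_id C (fst X)"
  "cat_comp (end_cat C) X = cat_comp C (fst X)"
  "wzero (end_cat C) = (wzero C, cat_id C (wzero C))"
  "wcof (end_cat C) X Y = cat_hom (end_cat C) X Y \<inter> wcof C (fst X) (fst Y)"
  "weq (end_cat C) X Y = cat_hom (end_cat C) X Y \<inter> weq C (fst X) (fst Y)"
  by (simp_all add: end_cat_def)

lemma end_cat_hom: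
  fixes R :: "('a, 'r) ring_scheme"
  shows "h \<in> cat_hom (end_cat (fgproj R)) X Y \<longleftrightarrow>
    lin R (fst X) (fst Y) h \<and> (\<forall>x\<in>snd (fst X). snd Y (h x) = h (snd X x))"
proof -
  have "compose A g h = compose A h f \<longleftrightarrow> (\<forall>x\<in>A. g (h x) = h (f x))" for A and g f h :: "'a vfun"
    by (auto simp: compose_def fun_eq_iff)
  then show ?thesis by (simp add: end_cat_def)
qed

text \<open>A cokernel of a map of modules with endomorphism inherits an endomorphism, so a full
  subcategory that is closed under cokernels has the same short exact sequences.\<close>

lemma mod_cat_end:
  assumes R: "ring R" and U0: "((0, carrier (free_mod R 0)), \<lambda>x\<in>carrier (free_mod R 0). x) \<in> U"
    and closed: "\<And>X Y Q f g g' h q. \<lbrakk>X \<in> summands R; Y \<in> summands R; Q \<in> summands R;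
        lin R X X f; lin R Y Y g; lin R Q Q g'; lin R X Y h; lin R Y Q q; (X, f) \<in> U; (Y, g) \<in> U;
        \<And>x. x \<in> snd X \<Longrightarrow> g (h x) = h (f x); \<And>y. y \<in> snd Y \<Longrightarrow> g' (q y) = q (g y); ses R X Y Q h q\<rbrakk>
      \<Longrightarrow> (Q, g') \<in> U"
  shows "mod_cat R (full_sub (end_cat (fgproj R)) U) fst snd"
proof (rule mod_cat.intro)
  fix X Y h Q q
  assume "X \<in> cat_ob (full_sub (end_cat (fgproj R)) U)" "Y \<in> cat_ob (full_sub (end_cat (fgproj R)) U)"
    and h: "h \<in> cat_hom (full_sub (end_cat (fgproj R)) U) X Y" and Q: "Q \<in> summands R" and q: "lin R (fst Y) Q q"
    and s: "ses R (fst X) (fst Y) Q h q"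
  then have X: "fst X \<in> summands R" "lin R (fst X) (fst X) (snd X)" "(fst X, snd X) \<in> U"
    and Y: "fst Y \<in> summands R" "lin R (fst Y) (fst Y) (snd Y)" "(fst Y, snd Y) \<in> U" by auto
  have h': "lin R (fst X) (fst Y) h" "\<And>x. x \<in> snd (fst X) \<Longrightarrow> snd Y (h x) = h (snd X x)"
    using h end_cat_hom[of h R X Y] by auto
  have qg: "lin R (fst Y) Q (compose (snd (fst Y)) q (snd Y))" by (rule lin_compose[OF R Y(1,2) q])
  have surj: "q ` snd (fst Y) = snd Q" using s by (simp add: ses_def)
  have ker: "compose (snd (fst Y)) q (snd Y) v = \<zero>\<^bsub>the_mod R Q\<^esub>" if v: "v \<in> snd (fst Y)" "q v = \<zero>\<^bsub>the_mod R Q\<^esub>" for v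
  proof -
    have "v \<in> h ` snd (fst X)" using s v unfolding ses_def by blast
    then obtain x where x: "x \<in> snd (fst X)" "v = h x" by blast
    have "h (snd X x) \<in> h ` snd (fst X)" using linD(1)[OF X(2) x(1)] by blast
    then have "q (h (snd X x)) = \<zero>\<^bsub>the_mod R Q\<^esub>" using s unfolding ses_def by blast
    then show ?thesis using x v(1) h'(2)[OF x(1)] by (simp add: compose_def)
  qed
  obtain g' where g': "lin R Q Q g'" and g'q: "\<And>v. v \<in> snd (fst Y) \<Longrightarrow> g' (q v) = compose (snd (fst Y)) q (snd Y) v"
    by (rule lin_factor[OF R Y(1) q surj Q qg ker Q], assumption, assumption, rule that, assumption, blast)
  have g'q': "g' (q v) = q (snd Y v)" if "v \<in> snd (fst Y)" for v using g'q[OF that] that by (simp add: compose_def)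
  have "(Q, g') \<in> U" by (rule closed[OF X(1) Y(1) Q X(2) Y(2) g' h'(1) q X(3) Y(3) h'(2) g'q' s])
  then have "(Q, g') \<in> cat_ob (full_sub (end_cat (fgproj R)) U)" using Q g' by simp
  moreover have "q \<in> cat_hom (full_sub (end_cat (fgproj R)) U) Y (Q, g')"
    using q g'q' by (simp add: end_cat_hom)
  ultimately show "\<exists>W\<in>cat_ob (full_sub (end_cat (fgproj R)) U). fst W = Q \<and> q \<in> cat_hom (full_sub (end_cat (fgproj R)) U) Y W"
    by (intro bexI[of _ "(Q, g')"]) auto
next
  fix X Y h assume "X \<in> cat_ob (full_sub (end_cat (fgproj R)) U)" "Y \<in> cat_ob (full_sub (end_cat (fgproj R)) U)"
  then show "h \<in> weq (full_sub (end_cat (fgproj R)) U) X Y \<longleftrightarrow>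
      h \<in> cat_hom (full_sub (end_cat (fgproj R)) U) X Y \<and> bij_betw h (snd (fst X)) (snd (fst Y))"
    using isos_iff_bij[OF R, of "fst X" "fst Y" h] by (auto simp: end_cat_hom)
next
  show "wzero (full_sub (end_cat (fgproj R)) U) \<in> cat_ob (full_sub (end_cat (fgproj R)) U)"
    using U0 zero_summand[OF R] lin_id[OF R zero_summand[OF R]] by simp
qed (use R in \<open>auto simp: end_cat_hom fgproj_wcof\<close>)

lemma mod_cat_aut:
  assumes R: "ring R"
  shows "mod_cat R (aut_cat (fgproj R)) fst snd"
  unfolding aut_cat_def
proof (rule mod_cat_end[OF R])
  have "lin R (0, carrier (free_mod R 0)) (0, carrier (free_mod R 0)) (\<lambda>x\<in>carrier (free_mod R 0). x)"
    using lin_id[OF R zero_summand[OF R]] by simp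
  then show "((0, carrier (free_mod R 0)), \<lambda>x\<in>carrier (free_mod R 0). x) \<in> {(X, f). f \<in> isos (fgproj R) X X}"
    using isos_iff_bij[OF R zero_summand[OF R] zero_summand[OF R]] by (simp add: isos_fgproj bij_betw_def inj_on_def)
next
  fix X Y Q f g g' h q
  assume X: "X \<in> summands R" and Y: "Y \<in> summands R" and Q: "Q \<in> summands R"
    and f: "lin R X X f" and g: "lin R Y Y g" and g': "lin R Q Q g'" and h: "lin R X Y h" and q: "lin R Y Q q"
    and XU: "(X, f) \<in> {(X, f). f \<in> isos (fgproj R) X X}" and YU: "(Y, g) \<in> {(X, f). f \<in> isos (fgproj R) X X}"
    and gh: "\<And>x. x \<in> snd X \<Longrightarrow> g (h x) = h (f x)" and g'q: "\<And>y. y \<in> snd Y \<Longrightarrow> g' (q y) = q (g y)"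
    and s: "ses R X Y Q h q"
  have bf: "bij_betw f (snd X) (snd X)" using XU isos_iff_bij[OF R X X] by (simp add: isos_fgproj)
  have bg: "bij_betw g (snd Y) (snd Y)" using YU isos_iff_bij[OF R Y Y] by (simp add: isos_fgproj)
  have surj: "q ` snd Y = snd Q" using s by (simp add: ses_def)
  have im: "g' ` snd Q = snd Q"
  proof -
    have "g' ` q ` snd Y = q ` g ` snd Y" using g'q by (auto simp: image_iff)
    then show ?thesis using bg by (simp add: surj bij_betw_def)
  qed
  have Qm: "right_module R (the_mod R Q)" and Ym: "right_module R (the_mod R Y)" by (rule right_module_the_mod[OF R] Q Y)+
  interpret Q: right_module R "the_mod R Q" by (rule Qm)
  interpret Y: right_module R "the_mod R Y" by (rule Ym)
  have inj0: "z = \<zero>\<^bsub>the_mod R Q\<^esub>" if z: "z \<in> snd Q" "g' z = \<zero>\<^bsub>the_mod R Q\<^esub>" for z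
  proof -
    obtain v where v: "v \<in> snd Y" "z = q v" using z surj by blast
    have gv: "g v \<in> snd Y" by (rule linD(1)[OF g v(1)])
    have "q (g v) = \<zero>\<^bsub>the_mod R Q\<^esub>" using z(2) g'q[OF v(1)] v(2) by simp
    then have "g v \<in> h ` snd X" using s gv unfolding ses_def by blast
    then obtain x where x: "x \<in> snd X" "g v = h x" by blast
    then obtain x' where x': "x' \<in> snd X" "x = f x'" using bf by (auto simp: bij_betw_def)
    have "g v = g (h x')" using gh[OF x'(1)] x(2) x'(2) by simp
    then have "v = h x'" using bg v(1) linD(1)[OF h x'(1)] unfolding bij_betw_def by (meson inj_onD)
    then have "v \<in> h ` snd X" using x'(1) by blast
    then show ?thesis using s v unfolding ses_def by blast
  qed
  have "inj_on g' (snd Q)"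
  proof (rule inj_onI)
    fix a b assume ab: "a \<in> snd Q" "b \<in> snd Q" "g' a = g' b"
    then have c: "a \<in> carrier (the_mod R Q)" "b \<in> carrier (the_mod R Q)" by auto
    have "g' (a \<ominus>\<^bsub>the_mod R Q\<^esub> b) = g' a \<ominus>\<^bsub>the_mod R Q\<^esub> g' b" by (rule linear_map_minus[OF Qm Qm g' c])
    also have "\<dots> = \<zero>\<^bsub>the_mod R Q\<^esub>" unfolding ab(3) a_minus_def using linear_mapD(1)[OF g' c(2)] by (rule Q.M.r_neg)
    finally have 0: "g' (a \<ominus>\<^bsub>the_mod R Q\<^esub> b) = \<zero>\<^bsub>the_mod R Q\<^esub>" .
    have "a \<ominus>\<^bsub>the_mod R Q\<^esub> b \<in> snd Q" using Q.M.minus_closed[OF c] by (simp only: the_mod_simps(1))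
    from inj0[OF this 0] show "a = b" by (rule right_module_minus_eq_zero[OF Qm c])
  qed
  then show "(Q, g') \<in> {(X, f). f \<in> isos (fgproj R) X X}"
    using im isos_iff_bij[OF R Q Q] g' by (simp add: isos_fgproj bij_betw_def)
qed

lemma (in mod_cat) forget_exact: "exact_functor C (fgproj R) (\<pi>, \<lambda>_ _ h. h)"
proof (rule exact_familyI[OF mod_cat_axioms mod_cat_fgproj[OF R]])
  show "family 0 C (fgproj R) (fst (\<pi>, \<lambda>_ _ h. h)) (\<lambda>_ _. snd (\<pi>, \<lambda>_ _ h. h))"
    by unfold_locales (simp_all add: ob homD(1) comp id)
qed (simp_all add: zero)

text \<open>A functor preserves inverses.\<close>

lemma (in ext_scalars) ext_bij:
  assumes X: "X \<in> summands R" and Y: "Y \<in> summands R" and h: "lin R X Y h" and b: "bij_betw h (snd X) (snd Y)"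
  shows "bij_betw (ext_map R' \<phi> X Y h) (snd (E X)) (snd (E Y))"
proof -
  let ?g = "\<lambda>y\<in>snd Y. inv_into (snd X) h y"
  have g: "lin R Y X ?g" by (rule lin_inverse[OF R X Y h b])
  have gh: "compose (snd X) ?g h = (\<lambda>x\<in>snd X. x)" and hg: "compose (snd Y) h ?g = (\<lambda>x\<in>snd Y. x)"
    using b linD(1)[OF h] by (auto simp: compose_def fun_eq_iff bij_betw_def f_inv_into_f)
  show ?thesis
  proof (rule bij_betwI[of _ _ _ "ext_map R' \<phi> Y X ?g"])
    show "ext_map R' \<phi> X Y h \<in> snd (E X) \<rightarrow> snd (E Y)" "ext_map R' \<phi> Y X ?g \<in> snd (E Y) \<rightarrow> snd (E X)"
      using linD(1)[OF ext_map(1)[OF X Y h]] linD(1)[OF ext_map(1)[OF Y X g]] by auto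
    have "compose (snd (E X)) (ext_map R' \<phi> Y X ?g) (ext_map R' \<phi> X Y h) = (\<lambda>x\<in>snd (E X). x)"
      by (simp only: ext_map_comp[OF X Y X h g, symmetric] gh ext_map_id[OF X])
    then show "ext_map R' \<phi> Y X ?g (ext_map R' \<phi> X Y h x) = x" if "x \<in> snd (E X)" for x
      using that by (rule compose_eqD)
    have "compose (snd (E Y)) (ext_map R' \<phi> X Y h) (ext_map R' \<phi> Y X ?g) = (\<lambda>y\<in>snd (E Y). y)"
      by (simp only: ext_map_comp[OF Y X Y g h, symmetric] hg ext_map_id[OF Y])
    then show "ext_map R' \<phi> X Y h (ext_map R' \<phi> Y X ?g y) = y" if "y \<in> snd (E Y)" for y
      using that by (rule compose_eqD)
  qed
qed

lemma (in ext_scalars) ext_exact: "exact_functor (fgproj R) (fgproj R') (ext_fctr R' \<phi>)"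
proof (rule exact_familyI[OF mod_cat_fgproj[OF R] mod_cat_fgproj[OF R'] ext_functor])
  show "fst (ext_fctr R' \<phi>) (wzero (fgproj R)) = wzero (fgproj R')"
    by (simp add: ext_fctr_def ext_zero)
qed (auto simp: ext_fctr_def ses_ext ext_bij)

text \<open>The functor \<open>\<Phi>\<close> with the automorphism \<open>\<alpha> e e'\<close>
  placed over the arrow \<open>e < e'\<close> of \<open>[p]\<close>.\<close>

definition twisted where
  "twisted \<Phi> \<alpha> e e' X Y h =
    (if e = e' then snd \<Phi> X Y h else compose (snd (fst \<Phi> X)) (snd \<Phi> X Y h) (\<alpha> e e' X))"

text \<open>Naturality and the cocycle condition of \<open>\<alpha>\<close> say that the twisted
  arrows compose; diagrams in \<open>S\<^sub>k\<close> are only acted on through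
  \<open>\<Phi>\<close>, so exactness is inherited.\<close>

lemma exact_family_twisted:
  assumes R': "ring R'" and \<Phi>: "exact_functor C (fgproj R') \<Phi>"
    and \<alpha>: "\<And>e e' X. \<lbrakk>e < e'; e' \<le> p; X \<in> cat_ob C\<rbrakk> \<Longrightarrow> lin R' (fst \<Phi> X) (fst \<Phi> X) (\<alpha> e e' X)"
      "\<And>e e' X. \<lbrakk>e < e'; e' \<le> p; X \<in> cat_ob C\<rbrakk> \<Longrightarrow> bij_betw (\<alpha> e e' X) (snd (fst \<Phi> X)) (snd (fst \<Phi> X))"
    and nat: "\<And>e e' X Y h x. \<lbrakk>e < e'; e' \<le> p; X \<in> cat_ob C; Y \<in> cat_ob C; h \<in> cat_hom C X Y; x \<in> snd (fst \<Phi> X)\<rbrakk>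
      \<Longrightarrow> \<alpha> e e' Y (snd \<Phi> X Y h x) = snd \<Phi> X Y h (\<alpha> e e' X x)"
    and cocycle: "\<And>e e' e'' X x. \<lbrakk>e < e'; e' < e''; e'' \<le> p; X \<in> cat_ob C; x \<in> snd (fst \<Phi> X)\<rbrakk>
      \<Longrightarrow> \<alpha> e e'' X x = \<alpha> e' e'' X (\<alpha> e e' X x)"
  shows "exact_family p C (fgproj R') (fst \<Phi>) (twisted \<Phi> \<alpha>)"
proof -
  interpret \<Phi>: exact_family 0 C "fgproj R'" "fst \<Phi>" "\<lambda>_ _. snd \<Phi>" by fact
  note \<Phi>ob = \<Phi>.ob[simplified] and \<Phi>hom = \<Phi>.hom[of 0 0, simplified] and \<Phi>weq = \<Phi>.weq_pres[of 0 0, simplified]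
    and \<Phi>id = \<Phi>.id[of 0, simplified] and \<Phi>comp = \<Phi>.comp[of 0 0 0, simplified]
  define \<beta> where "\<beta> e e' X x = (if e = e' then x else \<alpha> e e' X x)" for e e' :: nat and X x
  have \<beta>: "\<beta> e e' X x \<in> snd (fst \<Phi> X)" if "e \<le> e'" "e' \<le> p" "X \<in> cat_ob C" "x \<in> snd (fst \<Phi> X)" for e e' X x
    using that linD(1)[OF \<alpha>(1)[of e e' X]] by (auto simp: \<beta>_def)
  have \<beta>_nat: "\<beta> e e' Y (snd \<Phi> X Y h x) = snd \<Phi> X Y h (\<beta> e e' X x)"
    if "e \<le> e'" "e' \<le> p" "X \<in> cat_ob C" "Y \<in> cat_ob C" "h \<in> cat_hom C X Y" "x \<in> snd (fst \<Phi> X)" for e e' X Y h x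
    using that nat[of e e' X Y h x] by (auto simp: \<beta>_def)
  have \<beta>_coc: "\<beta> e e'' X x = \<beta> e' e'' X (\<beta> e e' X x)"
    if "e \<le> e'" "e' \<le> e''" "e'' \<le> p" "X \<in> cat_ob C" "x \<in> snd (fst \<Phi> X)" for e e' e'' X x
    using that cocycle[of e e' e'' X x] by (auto simp: \<beta>_def)
  have tw: "twisted \<Phi> \<alpha> e e' X Y h x = snd \<Phi> X Y h (\<beta> e e' X x)" if "x \<in> snd (fst \<Phi> X)" for e e' X Y h x
    using that by (simp add: twisted_def \<beta>_def compose_def)
  have tw_lin: "lin R' (fst \<Phi> X) (fst \<Phi> Y) (twisted \<Phi> \<alpha> e e' X Y h)"
    if "e \<le> e'" "e' \<le> p" "X \<in> cat_ob C" "Y \<in> cat_ob C" "h \<in> cat_hom C X Y" for e e' X Y h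
  proof (cases "e = e'")
    case True
    then show ?thesis using \<Phi>hom[OF that(3-5)] by (simp add: twisted_def)
  next
    case False
    then show ?thesis
      using lin_compose[OF R' \<Phi>ob[OF that(3)] \<alpha>(1) \<Phi>hom[OF that(3-5)]] that by (simp add: twisted_def)
  qed
  have fam: "family p C (fgproj R') (fst \<Phi>) (twisted \<Phi> \<alpha>)"
  proof
    fix e e' e'' X Y Z h g
    assume e: "e \<le> e'" "e' \<le> e''" "e'' \<le> p" and X: "X \<in> cat_ob C" and Y: "Y \<in> cat_ob C" and Z: "Z \<in> cat_ob C"
      and h: "h \<in> cat_hom C X Y" and g: "g \<in> cat_hom C Y Z"
    have eq: "snd \<Phi> X Z (cat_comp C X g h) = compose (snd (fst \<Phi> X)) (snd \<Phi> Y Z g) (snd \<Phi> X Y h)"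
      by (rule \<Phi>comp[OF X Y Z h g])
    show "twisted \<Phi> \<alpha> e e'' X Z (cat_comp C X g h) =
        cat_comp (fgproj R') (fst \<Phi> X) (twisted \<Phi> \<alpha> e' e'' Y Z g) (twisted \<Phi> \<alpha> e e' X Y h)"
    proof (rule extensionalityI[of _ "snd (fst \<Phi> X)"])
      show "twisted \<Phi> \<alpha> e e'' X Z (cat_comp C X g h) \<in> extensional (snd (fst \<Phi> X))"
        unfolding twisted_def eq by simp
      fix x assume x: "x \<in> snd (fst \<Phi> X)"
      have b: "\<beta> e e' X x \<in> snd (fst \<Phi> X)" by (rule \<beta>) (use e X x in auto)
      have b': "\<beta> e e'' X x \<in> snd (fst \<Phi> X)" by (rule \<beta>) (use e X x in auto)
      have ee: "e' \<le> p" using e by simp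
      have hb: "snd \<Phi> X Y h (\<beta> e e' X x) \<in> snd (fst \<Phi> Y)" by (rule linD(1)[OF \<Phi>hom[OF X Y h] b])
      have "twisted \<Phi> \<alpha> e e'' X Z (cat_comp C X g h) x = snd \<Phi> Y Z g (snd \<Phi> X Y h (\<beta> e e'' X x))"
        using b' by (simp add: tw[OF x] eq compose_def)
      also have "snd \<Phi> X Y h (\<beta> e e'' X x) = \<beta> e' e'' Y (snd \<Phi> X Y h (\<beta> e e' X x))"
        by (simp only: \<beta>_coc[OF e X x] \<beta>_nat[OF e(2,3) X Y h b])
      finally show "twisted \<Phi> \<alpha> e e'' X Z (cat_comp C X g h) x =
          cat_comp (fgproj R') (fst \<Phi> X) (twisted \<Phi> \<alpha> e' e'' Y Z g) (twisted \<Phi> \<alpha> e e' X Y h) x"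
        using x by (simp add: compose_def tw[OF x] tw[OF hb])
    qed simp
  qed (use tw_lin \<Phi>ob \<Phi>id in \<open>simp_all add: twisted_def\<close>)
  show ?thesis
  proof (intro exact_family.intro exact_family_axioms.intro fam)
    show "h \<in> cat_hom C X Y" if "X \<in> cat_ob C" "Y \<in> cat_ob C" "h \<in> weq C X Y" for X Y h
      by (rule \<Phi>.weq_hom[OF that])
    show "twisted \<Phi> \<alpha> e e X Y h = twisted \<Phi> \<alpha> 0 0 X Y h" for e X Y h by (simp add: twisted_def)
    show "push (Ar k) (fst \<Phi>, twisted \<Phi> \<alpha> 0 0) F \<in> S_obs (fgproj R') k" if "F \<in> S_obs C k" for F k
    proof -
      have "twisted \<Phi> \<alpha> 0 0 = snd \<Phi>" by (simp add: twisted_def fun_eq_iff)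
      then show ?thesis using \<Phi>.S_pres[OF that] by simp
    qed
    fix e e' X Y h assume e: "e \<le> e'" "e' \<le> p" and X: "X \<in> cat_ob C" and Y: "Y \<in> cat_ob C" and h: "h \<in> weq C X Y"
    note hh = \<Phi>.weq_hom[OF X Y h]
    have "snd \<Phi> X Y h \<in> isos (fgproj_cat R') (fst \<Phi> X) (fst \<Phi> Y)" using \<Phi>weq[OF X Y h] by simp
    then have b: "bij_betw (snd \<Phi> X Y h) (snd (fst \<Phi> X)) (snd (fst \<Phi> Y))"
      using isos_iff_bij[OF R' \<Phi>ob[OF X] \<Phi>ob[OF Y]] by blast
    have "bij_betw (twisted \<Phi> \<alpha> e e' X Y h) (snd (fst \<Phi> X)) (snd (fst \<Phi> Y))"
    proof (cases "e = e'")
      case True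
      then show ?thesis using b by (simp add: twisted_def)
    next
      case False
      then have "bij_betw (snd \<Phi> X Y h \<circ> \<alpha> e e' X) (snd (fst \<Phi> X)) (snd (fst \<Phi> Y))"
        using e by (intro bij_betw_trans[OF \<alpha>(2) b] X) auto
      then show ?thesis
        by (rule iffD1[OF bij_betw_cong, rotated]) (use False in \<open>simp add: twisted_def compose_def\<close>)
    qed
    then show "twisted \<Phi> \<alpha> e e' X Y h \<in> weq (fgproj R') (fst \<Phi> X) (fst \<Phi> Y)"
      using tw_lin[OF e X Y hh] isos_iff_bij[OF R' \<Phi>ob[OF X] \<Phi>ob[OF Y]] by simp
  qed
qed

lemma exact_family_self_map:
  assumes R: "ring R"
  shows "exact_family 1 (aut_cat (fgproj R)) (fgproj R) fst (self_map (fgproj R))"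
proof -
  interpret mod_cat R "aut_cat (fgproj R)" fst snd by (rule mod_cat_aut[OF R])
  have "self_map (fgproj R) = twisted forget_end (\<lambda>_ _. snd)"
    by (simp add: self_map_def twisted_def forget_end_def fun_eq_iff)
  moreover have "exact_family 1 (aut_cat (fgproj R)) (fgproj R) (fst forget_end) (twisted forget_end (\<lambda>_ _. snd))"
  proof (rule exact_family_twisted[OF R])
    show "exact_functor (aut_cat (fgproj R)) (fgproj R) forget_end" unfolding forget_end_def by (rule forget_exact)
    fix X assume X: "X \<in> cat_ob (aut_cat (fgproj R))"
    show "lin R (fst forget_end X) (fst forget_end X) (snd X)" using endo[OF X] by (simp add: forget_end_def)
    have "snd X \<in> isos (fgproj_cat R) (fst X) (fst X)"
      using X by (auto simp: aut_cat_def isos_fgproj)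
    then show "bij_betw (snd X) (snd (fst forget_end X)) (snd (fst forget_end X))"
      using isos_iff_bij[OF R ob[OF X] ob[OF X]] by (simp add: forget_end_def)
  qed (simp_all add: forget_end_def homD(3))
  ultimately show ?thesis by (simp add: forget_end_def)
qed

text \<open>Exactness in \<open>Aut\<close> is exactness of the underlying modules, so an exact
  functor with a natural automorphism lifts.\<close>

lemma exact_functor_aut:
  assumes R': "ring R'" and \<Phi>: "exact_functor C (fgproj R') \<Phi>" and zC: "wzero C \<in> cat_ob C"
    and zero: "fst \<Phi> (wzero C) = (0, carrier (free_mod R' 0))"
    and \<theta>: "\<And>X. X \<in> cat_ob C \<Longrightarrow> lin R' (fst \<Phi> X) (fst \<Phi> X) (\<theta> X)"
      "\<And>X. X \<in> cat_ob C \<Longrightarrow> bij_betw (\<theta> X) (snd (fst \<Phi> X)) (snd (fst \<Phi> X))"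
    and nat: "\<And>X Y h x. \<lbrakk>X \<in> cat_ob C; Y \<in> cat_ob C; h \<in> cat_hom C X Y; x \<in> snd (fst \<Phi> X)\<rbrakk>
      \<Longrightarrow> \<theta> Y (snd \<Phi> X Y h x) = snd \<Phi> X Y h (\<theta> X x)"
  shows "exact_functor C (aut_cat (fgproj R')) (\<lambda>X. (fst \<Phi> X, \<theta> X), snd \<Phi>)"
proof -
  interpret \<Phi>: exact_family 0 C "fgproj R'" "fst \<Phi>" "\<lambda>_ _. snd \<Phi>" by fact
  interpret D: mod_cat R' "aut_cat (fgproj R')" fst snd by (rule mod_cat_aut[OF R'])
  interpret P: mod_cat R' "fgproj R'" "\<lambda>X. X" "\<lambda>X. \<lambda>x\<in>snd X. x" by (rule mod_cat_fgproj[OF R'])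
  note \<Phi>ob = \<Phi>.ob[simplified] and \<Phi>hom = \<Phi>.hom[of 0 0, simplified] and \<Phi>weq = \<Phi>.weq_pres[of 0 0, simplified]
    and \<Phi>id = \<Phi>.id[of 0, simplified] and \<Phi>comp = \<Phi>.comp[of 0 0 0, simplified]
  have ob: "(fst \<Phi> X, \<theta> X) \<in> cat_ob (aut_cat (fgproj R'))" if X: "X \<in> cat_ob C" for X
    using \<Phi>ob[OF X] \<theta>[OF X] isos_iff_bij[OF R' \<Phi>ob[OF X] \<Phi>ob[OF X], of "\<theta> X"]
    by (simp add: aut_cat_def isos_fgproj)
  have hom: "snd \<Phi> X Y h \<in> cat_hom (aut_cat (fgproj R')) (fst \<Phi> X, \<theta> X) (fst \<Phi> Y, \<theta> Y)"
    if "X \<in> cat_ob C" "Y \<in> cat_ob C" "h \<in> cat_hom C X Y" for X Y h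
    using \<Phi>hom[OF that] nat[OF that] by (simp add: aut_cat_def end_cat_hom)
  have func: "is_functor C (aut_cat (fgproj R')) (\<lambda>X. (fst \<Phi> X, \<theta> X), snd \<Phi>)"
    by unfold_locales (simp_all add: ob hom, simp_all add: aut_cat_def \<Phi>id \<Phi>comp)
  show ?thesis
  proof (intro exact_family.intro exact_family_axioms.intro func)
    show "h \<in> cat_hom C X Y" if "X \<in> cat_ob C" "Y \<in> cat_ob C" "h \<in> weq C X Y" for X Y h
      by (rule \<Phi>.weq_hom[OF that])
    show "snd (\<lambda>X. (fst \<Phi> X, \<theta> X), snd \<Phi>) X Y h \<in>
        weq (aut_cat (fgproj R')) (fst (\<lambda>X. (fst \<Phi> X, \<theta> X), snd \<Phi>) X) (fst (\<lambda>X. (fst \<Phi> X, \<theta> X), snd \<Phi>) Y)"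
      if "X \<in> cat_ob C" "Y \<in> cat_ob C" "h \<in> weq C X Y" for X Y h
      using \<Phi>weq[OF that] hom[OF that(1,2) \<Phi>.weq_hom[OF that]] by (simp add: aut_cat_def)
  next
    fix F k assume F: "F \<in> S_obs C k"
    let ?\<Psi> = "(\<lambda>X. (fst \<Phi> X, \<theta> X), snd \<Phi>)"
    let ?G = "push (Ar k) ?\<Psi> F" and ?H = "push (Ar k) \<Phi> F"
    have H: "?H \<in> S_obs (fgproj R') k" using \<Phi>.S_pres[OF F] by simp
    note H' = H[unfolded P.S_obs_iff]
    have Fz: "fst F (j, j) = wzero C" if "j \<le> k" for j using F that by (auto simp: S_obs_def)
    have \<theta>0: "\<theta> (wzero C) = (\<lambda>x\<in>carrier (free_mod R' 0). x)"
    proof -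
      note l = \<theta>(1)[OF zC, unfolded zero]
      show ?thesis
        by (rule lin_eqI[OF l lin_id[OF R' zero_summand[OF R'], simplified]])
          (use linD(1)[OF l] in \<open>auto simp: free_mod_simps\<close>)
    qed
    have "?G \<in> S_obs (aut_cat (fgproj R')) k"
      unfolding D.S_obs_iff
    proof (intro conjI allI impI)
      show "?G \<in> diagrams (Ar k) (aut_cat (fgproj R'))"
        by (rule push_in_diagrams[OF func S_obs_diagram[OF F]])
      show "fst ?G (j, j) = wzero (aut_cat (fgproj R'))" if "j \<le> k" for j
        using that by (simp add: push_def Ar_def Fz zero \<theta>0 aut_cat_def)
      fix i j l assume ijl: "i \<le> j \<and> j \<le> l \<and> l \<le> k"
      have ar: "(i, j) \<in> Ar k" "(i, l) \<in> Ar k" "(j, l) \<in> Ar k" using ijl by (auto simp: Ar_def)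
      have le: "(i, j) \<le> (i, l)" "(i, l) \<le> (j, l)" using ijl by auto
      have "ses R' (fst ?H (i, j)) (fst ?H (i, l)) (fst ?H (j, l)) (snd ?H ((i, j), i, l)) (snd ?H ((i, l), j, l))"
        using H' ijl by blast
      then show "ses R' (fst (fst ?G (i, j))) (fst (fst ?G (i, l))) (fst (fst ?G (j, l)))
          (snd ?G ((i, j), i, l)) (snd ?G ((i, l), j, l))"
        using ar le by (simp add: push_def le_pairs_def)
    qed
    then show "push (Ar k) (fst ?\<Psi>, snd ?\<Psi>) F \<in> S_obs (aut_cat (fgproj R')) k" by simp
  qed simp
qed

section \<open>The automorphisms \<open>t - f\<close> and \<open>(1 - f t)\<^sup>-\<^sup>1\<close>\<close>

lemma (in ring) center_mult:
  assumes a: "a \<in> ring_center R" and b: "b \<in> ring_center R"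
  shows "a \<otimes> b \<in> ring_center R"
proof -
  have c: "a \<in> carrier R" "b \<in> carrier R" using a b unfolding ring_center_def by blast+
  have "a \<otimes> b \<otimes> x = x \<otimes> (a \<otimes> b)" if x: "x \<in> carrier R" for x
  proof -
    have bx: "b \<otimes> x = x \<otimes> b" and ax: "a \<otimes> x = x \<otimes> a" using a b x unfolding ring_center_def by blast+
    have "a \<otimes> b \<otimes> x = a \<otimes> (b \<otimes> x)" by (rule m_assoc[OF c x])
    also have "\<dots> = a \<otimes> x \<otimes> b" unfolding bx by (rule m_assoc[OF c(1) x c(2), symmetric])
    also have "\<dots> = x \<otimes> (a \<otimes> b)" unfolding ax by (rule m_assoc[OF x c])
    finally show ?thesis .
  qed
  then show ?thesis using c unfolding ring_center_def by blast
qed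

context right_module
begin

lemma ract_zero: "a \<in> carrier R \<Longrightarrow> a \<odot>\<^bsub>M\<^esub> \<zero>\<^bsub>M\<^esub> = \<zero>\<^bsub>M\<^esub>"
  using finsum_ract[of "{}" a] by simp

lemma ract_minus:
  assumes "a \<in> carrier R" "x \<in> carrier M" "y \<in> carrier M"
  shows "a \<odot>\<^bsub>M\<^esub> (x \<ominus>\<^bsub>M\<^esub> y) = a \<odot>\<^bsub>M\<^esub> x \<ominus>\<^bsub>M\<^esub> a \<odot>\<^bsub>M\<^esub> y"
proof -
  have c: "a \<odot>\<^bsub>M\<^esub> (x \<ominus>\<^bsub>M\<^esub> y) \<in> carrier M" "a \<odot>\<^bsub>M\<^esub> x \<in> carrier M" "a \<odot>\<^bsub>M\<^esub> y \<in> carrier M"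
    using assms by (auto intro: ract_closed)
  have "a \<odot>\<^bsub>M\<^esub> (x \<ominus>\<^bsub>M\<^esub> y) \<oplus>\<^bsub>M\<^esub> a \<odot>\<^bsub>M\<^esub> y = a \<odot>\<^bsub>M\<^esub> ((x \<ominus>\<^bsub>M\<^esub> y) \<oplus>\<^bsub>M\<^esub> y)"
    using assms by (intro ract_r_distr[symmetric]) auto
  also have "(x \<ominus>\<^bsub>M\<^esub> y) \<oplus>\<^bsub>M\<^esub> y = x" using assms by (simp add: a_minus_def M.a_assoc M.l_neg)
  finally have "a \<odot>\<^bsub>M\<^esub> x \<ominus>\<^bsub>M\<^esub> a \<odot>\<^bsub>M\<^esub> y = (a \<odot>\<^bsub>M\<^esub> (x \<ominus>\<^bsub>M\<^esub> y) \<oplus>\<^bsub>M\<^esub> a \<odot>\<^bsub>M\<^esub> y) \<ominus>\<^bsub>M\<^esub> a \<odot>\<^bsub>M\<^esub> y" by simp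
  also have "\<dots> = a \<odot>\<^bsub>M\<^esub> (x \<ominus>\<^bsub>M\<^esub> y)" using c by (simp add: a_minus_def M.a_assoc M.r_neg)
  finally show ?thesis by simp
qed

lemma ract_central:
  assumes "c \<in> ring_center R" "b \<in> carrier R" "x \<in> carrier M"
  shows "c \<odot>\<^bsub>M\<^esub> (b \<odot>\<^bsub>M\<^esub> x) = b \<odot>\<^bsub>M\<^esub> (c \<odot>\<^bsub>M\<^esub> x)"
proof -
  have c: "c \<in> carrier R" "c \<otimes>\<^bsub>R\<^esub> b = b \<otimes>\<^bsub>R\<^esub> c" using assms by (auto simp: ring_center_def)
  show ?thesis using ract_assoc[OF c(1) assms(2,3)] ract_assoc[OF assms(2) c(1) assms(3)] c(2) by simp
qed

lemma linear_scale:
  assumes "c \<in> ring_center R"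
  shows "linear_map R M M (\<lambda>x\<in>carrier M. c \<odot>\<^bsub>M\<^esub> x)"
proof -
  have c: "c \<in> carrier R" using assms by (simp add: ring_center_def)
  show ?thesis using c ract_central[OF assms] by (intro linear_mapI) (auto simp: ract_closed ract_r_distr)
qed

lemma linear_diff:
  assumes f: "linear_map R M M f" and g: "linear_map R M M g"
  shows "linear_map R M M (\<lambda>x\<in>carrier M. f x \<ominus>\<^bsub>M\<^esub> g x)"
proof (rule linear_mapI)
  fix x y assume xy: "x \<in> carrier M" "y \<in> carrier M"
  note c = linear_mapD(1)[OF f xy(1)] linear_mapD(1)[OF f xy(2)] linear_mapD(1)[OF g xy(1)] linear_mapD(1)[OF g xy(2)]
  have "(f x \<oplus>\<^bsub>M\<^esub> f y) \<ominus>\<^bsub>M\<^esub> (g x \<oplus>\<^bsub>M\<^esub> g y) = (f x \<ominus>\<^bsub>M\<^esub> g x) \<oplus>\<^bsub>M\<^esub> (f y \<ominus>\<^bsub>M\<^esub> g y)"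
    using c by (simp add: a_minus_def M.minus_add M.a_ac)
  then show "(\<lambda>x\<in>carrier M. f x \<ominus>\<^bsub>M\<^esub> g x) (x \<oplus>\<^bsub>M\<^esub> y) =
      (\<lambda>x\<in>carrier M. f x \<ominus>\<^bsub>M\<^esub> g x) x \<oplus>\<^bsub>M\<^esub> (\<lambda>x\<in>carrier M. f x \<ominus>\<^bsub>M\<^esub> g x) y"
    using xy by (simp add: linear_mapD(3)[OF f xy] linear_mapD(3)[OF g xy])
next
  fix a x assume ax: "a \<in> carrier R" "x \<in> carrier M"
  then show "(\<lambda>x\<in>carrier M. f x \<ominus>\<^bsub>M\<^esub> g x) (a \<odot>\<^bsub>M\<^esub> x) = a \<odot>\<^bsub>M\<^esub> (\<lambda>x\<in>carrier M. f x \<ominus>\<^bsub>M\<^esub> g x) x"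
    using linear_mapD(1)[OF f ax(2)] linear_mapD(1)[OF g ax(2)]
    by (simp add: ract_closed linear_mapD(4)[OF f ax] linear_mapD(4)[OF g ax] ract_minus)
qed (use linear_mapD(1)[OF f] linear_mapD(1)[OF g] in auto)

lemma linear_sum:
  assumes "finite J" "\<And>j. j \<in> J \<Longrightarrow> linear_map R M M (g j)"
  shows "linear_map R M M (\<lambda>x\<in>carrier M. \<Oplus>\<^bsub>M\<^esub>j\<in>J. g j x)"
proof (rule linear_mapI)
  note cl = linear_mapD(1)[OF assms(2)]
  show "(\<lambda>x\<in>carrier M. \<Oplus>\<^bsub>M\<^esub>j\<in>J. g j x) x \<in> carrier M" if "x \<in> carrier M" for x
    using that cl by (auto intro!: M.finsum_closed)
  fix x y assume xy: "x \<in> carrier M" "y \<in> carrier M"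
  have "(\<Oplus>\<^bsub>M\<^esub>j\<in>J. g j (x \<oplus>\<^bsub>M\<^esub> y)) = (\<Oplus>\<^bsub>M\<^esub>j\<in>J. g j x \<oplus>\<^bsub>M\<^esub> g j y)"
    using xy cl by (intro M.finsum_cong') (auto simp: linear_mapD(3)[OF assms(2)])
  also have "\<dots> = (\<Oplus>\<^bsub>M\<^esub>j\<in>J. g j x) \<oplus>\<^bsub>M\<^esub> (\<Oplus>\<^bsub>M\<^esub>j\<in>J. g j y)"
    using xy cl by (intro M.finsum_addf) auto
  finally show "(\<lambda>x\<in>carrier M. \<Oplus>\<^bsub>M\<^esub>j\<in>J. g j x) (x \<oplus>\<^bsub>M\<^esub> y) =
      (\<lambda>x\<in>carrier M. \<Oplus>\<^bsub>M\<^esub>j\<in>J. g j x) x \<oplus>\<^bsub>M\<^esub> (\<lambda>x\<in>carrier M. \<Oplus>\<^bsub>M\<^esub>j\<in>J. g j x) y" using xy by simp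
next
  note cl = linear_mapD(1)[OF assms(2)]
  fix a x assume ax: "a \<in> carrier R" "x \<in> carrier M"
  have "(\<Oplus>\<^bsub>M\<^esub>j\<in>J. g j (a \<odot>\<^bsub>M\<^esub> x)) = (\<Oplus>\<^bsub>M\<^esub>j\<in>J. a \<odot>\<^bsub>M\<^esub> g j x)"
    using ax cl by (intro M.finsum_cong') (auto simp: linear_mapD(4)[OF assms(2)] ract_closed)
  also have "\<dots> = a \<odot>\<^bsub>M\<^esub> (\<Oplus>\<^bsub>M\<^esub>j\<in>J. g j x)" using ax cl assms(1) by (intro finsum_ract[symmetric]) auto
  finally show "(\<lambda>x\<in>carrier M. \<Oplus>\<^bsub>M\<^esub>j\<in>J. g j x) (a \<odot>\<^bsub>M\<^esub> x) = a \<odot>\<^bsub>M\<^esub> (\<lambda>x\<in>carrier M. \<Oplus>\<^bsub>M\<^esub>j\<in>J. g j x) x"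
    using ax by (simp add: ract_closed)
qed simp

lemma linear_zero: "linear_map R M M (\<lambda>x\<in>carrier M. \<zero>\<^bsub>M\<^esub>)"
  by (rule linear_mapI) (simp_all add: ract_zero ract_closed)

lemma linear_pow:
  assumes F: "linear_map R M M F"
  shows "linear_map R M M (\<lambda>x\<in>carrier M. (F ^^ i) x)"
proof (induction i)
  case 0
  have "linear_map R M M (\<lambda>x\<in>carrier M. x)" by (rule linear_mapI) (simp_all add: ract_closed)
  then show ?case unfolding funpow_0 .
next
  case (Suc i)
  have eq: "(\<lambda>x\<in>carrier M. (F ^^ Suc i) x) = compose (carrier M) F (\<lambda>x\<in>carrier M. (F ^^ i) x)"
    by (simp add: compose_def fun_eq_iff)
  show ?case unfolding eq by (rule linear_map_compose[OF right_module_axioms Suc F])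
qed

lemma linear_one_minus:
  assumes F: "linear_map R M M F" and \<tau>: "\<tau> \<in> ring_center R"
  shows "linear_map R M M (\<lambda>x\<in>carrier M. x \<ominus>\<^bsub>M\<^esub> \<tau> \<odot>\<^bsub>M\<^esub> F x)"
proof -
  have 1: "linear_map R M M (\<lambda>x\<in>carrier M. x)" by (rule linear_mapI) (simp_all add: ract_closed)
  have 2: "linear_map R M M (compose (carrier M) (\<lambda>x\<in>carrier M. \<tau> \<odot>\<^bsub>M\<^esub> x) F)"
    by (rule linear_map_compose[OF right_module_axioms F linear_scale[OF \<tau>]])
  have "(\<lambda>x\<in>carrier M. (\<lambda>x\<in>carrier M. x) x \<ominus>\<^bsub>M\<^esub> compose (carrier M) (\<lambda>x\<in>carrier M. \<tau> \<odot>\<^bsub>M\<^esub> x) F x) =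
      (\<lambda>x\<in>carrier M. x \<ominus>\<^bsub>M\<^esub> \<tau> \<odot>\<^bsub>M\<^esub> F x)"
    by (rule restrict_ext) (simp only: compose_def restrict_apply' linear_mapD(1)[OF F])
  then show ?thesis using linear_diff[OF 1 2] by (simp only:)
qed

lemma pow_closed: "linear_map R M M F \<Longrightarrow> x \<in> carrier M \<Longrightarrow> (F ^^ i) x \<in> carrier M"
  using linear_mapD(1)[OF linear_pow[of F i], of x] by simp

lemma finsum_ract_l:
  assumes "finite J" "a \<in> J \<rightarrow> carrier R" "x \<in> carrier M"
  shows "(\<Oplus>\<^bsub>R\<^esub>j\<in>J. a j) \<odot>\<^bsub>M\<^esub> x = (\<Oplus>\<^bsub>M\<^esub>j\<in>J. a j \<odot>\<^bsub>M\<^esub> x)"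
  using finsum_additive[OF R.abelian_group_axioms M.abelian_group_axioms assms(1), of "carrier R" "\<lambda>a. a \<odot>\<^bsub>M\<^esub> x" a]
    assms by (auto simp: ract_l_distr ract_closed)

text \<open>Put \<open>N = 1 - \<tau> F\<close>.  Modulo the image of \<open>N\<close> (or the zero submodule, for an \<open>x\<close> in the kernel of \<open>N\<close>)
  one has \<open>x \<equiv> \<tau>\<^sup>i F\<^sup>i x\<close> for all \<open>i\<close>, hence \<open>\<Sum>\<^sub>i c\<^sub>i \<tau>\<^sup>d\<^sup>-\<^sup>i x \<equiv> \<tau>\<^sup>d \<Sum>\<^sub>i c\<^sub>i F\<^sup>i x = 0\<close>, and the sum on the left is a
  unit times \<open>x\<close>.\<close>

lemma one_minus_bij:
  fixes c :: "nat \<Rightarrow> 'a" and d :: nat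
  assumes F: "linear_map R M M F" and \<tau>: "\<tau> \<in> ring_center R" and c: "\<And>i. c i \<in> ring_center R"
    and unit: "(\<Oplus>\<^bsub>R\<^esub>i\<in>{..d}. c i \<otimes>\<^bsub>R\<^esub> \<tau> [^]\<^bsub>R\<^esub> (d - i)) \<in> Units R"
    and vanish: "\<And>x. x \<in> carrier M \<Longrightarrow> (\<Oplus>\<^bsub>M\<^esub>i\<in>{..d}. c i \<odot>\<^bsub>M\<^esub> (F ^^ i) x) = \<zero>\<^bsub>M\<^esub>"
  shows "bij_betw (\<lambda>x\<in>carrier M. x \<ominus>\<^bsub>M\<^esub> \<tau> \<odot>\<^bsub>M\<^esub> F x) (carrier M) (carrier M)"
proof -
  let ?N = "\<lambda>x\<in>carrier M. x \<ominus>\<^bsub>M\<^esub> \<tau> \<odot>\<^bsub>M\<^esub> F x"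
  define tp where "tp i = \<tau> [^]\<^bsub>R\<^esub> i" for i :: nat
  define G where "G i x = tp i \<odot>\<^bsub>M\<^esub> (F ^^ i) x" for i x
  define u where "u = (\<Oplus>\<^bsub>R\<^esub>i\<in>{..d}. c i \<otimes>\<^bsub>R\<^esub> tp (d - i))"
  have \<tau>c: "\<tau> \<in> carrier R" and cc: "c i \<in> carrier R" for i using \<tau> c by (auto simp: ring_center_def)
  have tpc: "tp i \<in> ring_center R" "tp i \<in> carrier R" for i
    using \<tau>c center_pow[OF R.ring_axioms \<tau>, of i] by (auto simp: tp_def)
  have w: "c i \<otimes>\<^bsub>R\<^esub> tp j \<in> ring_center R" "c i \<otimes>\<^bsub>R\<^esub> tp j \<in> carrier R" for i j
    using R.center_mult[OF c tpc(1)] cc tpc(2) by auto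
  note Fc = linear_mapD(1)[OF F] and Fi = pow_closed[OF F]
  have Gc: "G i x \<in> carrier M" if "x \<in> carrier M" for i x using Fi[OF that] tpc by (simp add: G_def ract_closed)
  have G_Suc: "G (Suc i) x = \<tau> \<odot>\<^bsub>M\<^esub> F (G i x)" if x: "x \<in> carrier M" for i x
  proof -
    have "\<tau> \<odot>\<^bsub>M\<^esub> F (G i x) = \<tau> \<odot>\<^bsub>M\<^esub> (tp i \<odot>\<^bsub>M\<^esub> F ((F ^^ i) x))"
      unfolding G_def by (simp only: linear_mapD(4)[OF F tpc(2) Fi[OF x]])
    also have "\<dots> = (tp i \<otimes>\<^bsub>R\<^esub> \<tau>) \<odot>\<^bsub>M\<^esub> F ((F ^^ i) x)" by (rule ract_assoc[OF tpc(2) \<tau>c Fc[OF Fi[OF x]], symmetric])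
    also have "\<dots> = G (Suc i) x" by (simp add: G_def tp_def)
    finally show ?thesis ..
  qed
  have N: "?N x = x \<ominus>\<^bsub>M\<^esub> \<tau> \<odot>\<^bsub>M\<^esub> F x" if "x \<in> carrier M" for x using that by simp
  have Nlin: "linear_map R M M ?N"
    by (rule linear_one_minus[OF F \<tau>])
  \<comment> \<open>applied below to the zero submodule for injectivity and to the image of \<open>N\<close> for surjectivity\<close>
  have key: "u \<odot>\<^bsub>M\<^esub> x \<in> I"
    if I: "I \<subseteq> carrier M" "\<zero>\<^bsub>M\<^esub> \<in> I" "\<And>a b. a \<in> I \<Longrightarrow> b \<in> I \<Longrightarrow> a \<oplus>\<^bsub>M\<^esub> b \<in> I"
      "\<And>a x. a \<in> carrier R \<Longrightarrow> x \<in> I \<Longrightarrow> a \<odot>\<^bsub>M\<^esub> x \<in> I"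
    and x: "x \<in> carrier M" and NI: "\<And>i. ?N (G i x) \<in> I" for I x
  proof -
    have d: "x \<ominus>\<^bsub>M\<^esub> G i x \<in> I" for i
    proof (induction i)
      case 0
      have "G 0 x = x" using x by (simp add: G_def tp_def ract_one)
      then show ?case using I(2) x by (simp add: a_minus_def M.r_neg)
    next
      case (Suc i)
      have "x \<ominus>\<^bsub>M\<^esub> G (Suc i) x = (x \<ominus>\<^bsub>M\<^esub> G i x) \<oplus>\<^bsub>M\<^esub> (G i x \<ominus>\<^bsub>M\<^esub> G (Suc i) x)"
      proof -
        have "\<ominus>\<^bsub>M\<^esub> G i x \<oplus>\<^bsub>M\<^esub> (G i x \<oplus>\<^bsub>M\<^esub> \<ominus>\<^bsub>M\<^esub> G (Suc i) x) = \<ominus>\<^bsub>M\<^esub> G (Suc i) x"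
          using Gc[OF x] by (simp add: M.r_neg1)
        then show ?thesis using x Gc[OF x] by (simp add: a_minus_def M.a_assoc)
      qed
      also have "G i x \<ominus>\<^bsub>M\<^esub> G (Suc i) x = ?N (G i x)" using Gc[OF x] by (simp add: G_Suc[OF x])
      finally show ?case using I(3)[OF Suc NI] by simp
    qed
    let ?w = "\<lambda>i. c i \<otimes>\<^bsub>R\<^esub> tp (d - i)"
    have dc: "x \<ominus>\<^bsub>M\<^esub> G i x \<in> carrier M" for i using I(1) d by blast
    have split: "?w i \<odot>\<^bsub>M\<^esub> x = ?w i \<odot>\<^bsub>M\<^esub> (x \<ominus>\<^bsub>M\<^esub> G i x) \<oplus>\<^bsub>M\<^esub> ?w i \<odot>\<^bsub>M\<^esub> G i x" for i
    proof -
      have "x = (x \<ominus>\<^bsub>M\<^esub> G i x) \<oplus>\<^bsub>M\<^esub> G i x" using x Gc[OF x] by (simp add: a_minus_def M.a_assoc M.l_neg)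
      then have "?w i \<odot>\<^bsub>M\<^esub> x = ?w i \<odot>\<^bsub>M\<^esub> ((x \<ominus>\<^bsub>M\<^esub> G i x) \<oplus>\<^bsub>M\<^esub> G i x)" by simp
      also have "\<dots> = ?w i \<odot>\<^bsub>M\<^esub> (x \<ominus>\<^bsub>M\<^esub> G i x) \<oplus>\<^bsub>M\<^esub> ?w i \<odot>\<^bsub>M\<^esub> G i x" by (rule ract_r_distr[OF w(2) dc Gc[OF x]])
      finally show ?thesis .
    qed
    have shift: "?w i \<odot>\<^bsub>M\<^esub> G i x = tp d \<odot>\<^bsub>M\<^esub> (c i \<odot>\<^bsub>M\<^esub> (F ^^ i) x)" if "i \<le> d" for i
    proof -
      have "?w i \<odot>\<^bsub>M\<^esub> G i x = tp i \<odot>\<^bsub>M\<^esub> (?w i \<odot>\<^bsub>M\<^esub> (F ^^ i) x)"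
        unfolding G_def by (rule ract_central[OF w(1) tpc(2) Fi[OF x]])
      also have "?w i \<odot>\<^bsub>M\<^esub> (F ^^ i) x = tp (d - i) \<odot>\<^bsub>M\<^esub> (c i \<odot>\<^bsub>M\<^esub> (F ^^ i) x)" by (rule ract_assoc[OF cc tpc(2) Fi[OF x]])
      also have "tp i \<odot>\<^bsub>M\<^esub> \<dots> = (tp (d - i) \<otimes>\<^bsub>R\<^esub> tp i) \<odot>\<^bsub>M\<^esub> (c i \<odot>\<^bsub>M\<^esub> (F ^^ i) x)"
        by (rule ract_assoc[OF tpc(2) tpc(2) ract_closed[OF cc Fi[OF x]], symmetric])
      also have "tp (d - i) \<otimes>\<^bsub>R\<^esub> tp i = tp d" using that \<tau>c by (simp add: tp_def R.nat_pow_mult)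
      finally show ?thesis .
    qed
    have cFc: "c i \<odot>\<^bsub>M\<^esub> (F ^^ i) x \<in> carrier M" for i by (rule ract_closed[OF cc Fi[OF x]])
    have "u \<odot>\<^bsub>M\<^esub> x = (\<Oplus>\<^bsub>M\<^esub>i\<in>{..d}. ?w i \<odot>\<^bsub>M\<^esub> x)"
      unfolding u_def by (rule finsum_ract_l) (use w x in auto)
    also have "\<dots> = (\<Oplus>\<^bsub>M\<^esub>i\<in>{..d}. ?w i \<odot>\<^bsub>M\<^esub> (x \<ominus>\<^bsub>M\<^esub> G i x) \<oplus>\<^bsub>M\<^esub> ?w i \<odot>\<^bsub>M\<^esub> G i x)"
      using ract_closed[OF w(2) x] by (intro M.finsum_cong' refl) (simp_all add: split[symmetric])
    also have "\<dots> = (\<Oplus>\<^bsub>M\<^esub>i\<in>{..d}. ?w i \<odot>\<^bsub>M\<^esub> (x \<ominus>\<^bsub>M\<^esub> G i x)) \<oplus>\<^bsub>M\<^esub> (\<Oplus>\<^bsub>M\<^esub>i\<in>{..d}. ?w i \<odot>\<^bsub>M\<^esub> G i x)"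
      by (intro M.finsum_addf) (simp_all add: ract_closed[OF w(2) dc] ract_closed[OF w(2) Gc[OF x]])
    also have "(\<Oplus>\<^bsub>M\<^esub>i\<in>{..d}. ?w i \<odot>\<^bsub>M\<^esub> G i x) = (\<Oplus>\<^bsub>M\<^esub>i\<in>{..d}. tp d \<odot>\<^bsub>M\<^esub> (c i \<odot>\<^bsub>M\<^esub> (F ^^ i) x))"
      by (intro M.finsum_cong' refl) (simp_all add: shift ract_closed[OF tpc(2) cFc])
    also have "\<dots> = tp d \<odot>\<^bsub>M\<^esub> (\<Oplus>\<^bsub>M\<^esub>i\<in>{..d}. c i \<odot>\<^bsub>M\<^esub> (F ^^ i) x)"
      by (intro finsum_ract[symmetric]) (simp_all add: tpc cFc)
    also have "\<dots> = \<zero>\<^bsub>M\<^esub>" unfolding vanish[OF x] by (rule ract_zero[OF tpc(2)])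
    finally have ux: "u \<odot>\<^bsub>M\<^esub> x = (\<Oplus>\<^bsub>M\<^esub>i\<in>{..d}. ?w i \<odot>\<^bsub>M\<^esub> (x \<ominus>\<^bsub>M\<^esub> G i x)) \<oplus>\<^bsub>M\<^esub> \<zero>\<^bsub>M\<^esub>" .
    have "(\<Oplus>\<^bsub>M\<^esub>i\<in>{..d}. ?w i \<odot>\<^bsub>M\<^esub> (x \<ominus>\<^bsub>M\<^esub> G i x)) \<in> I"
      using finsum_additive[OF M.abelian_group_axioms M.abelian_group_axioms, of "{..d}" I "\<lambda>x. x" "\<lambda>i. ?w i \<odot>\<^bsub>M\<^esub> (x \<ominus>\<^bsub>M\<^esub> G i x)"]
        I(1-3) I(4)[OF w(2) d] by (simp add: Pi_iff subset_iff)
    then show ?thesis unfolding ux by (rule I(3)[OF _ I(2)])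
  qed
  have uU: "u \<in> Units R" using unit by (simp add: u_def tp_def)
  have uc: "u \<in> carrier R" "inv\<^bsub>R\<^esub> u \<in> carrier R" using uU by (rule R.Units_closed, rule R.Units_inv_closed)
  have uinv: "x = inv\<^bsub>R\<^esub> u \<odot>\<^bsub>M\<^esub> (u \<odot>\<^bsub>M\<^esub> x)" if "x \<in> carrier M" for x
  proof -
    have "inv\<^bsub>R\<^esub> u \<odot>\<^bsub>M\<^esub> (u \<odot>\<^bsub>M\<^esub> x) = (u \<otimes>\<^bsub>R\<^esub> inv\<^bsub>R\<^esub> u) \<odot>\<^bsub>M\<^esub> x"
      by (rule ract_assoc[OF uc that, symmetric])
    also have "\<dots> = x" unfolding R.Units_r_inv[OF uU] by (rule ract_one[OF that])
    finally show ?thesis ..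
  qed
  have N0: "x = \<zero>\<^bsub>M\<^esub>" if x: "x \<in> carrier M" "?N x = \<zero>\<^bsub>M\<^esub>" for x
  proof -
    have "x \<ominus>\<^bsub>M\<^esub> \<tau> \<odot>\<^bsub>M\<^esub> F x = \<zero>\<^bsub>M\<^esub>" using x(2) unfolding N[OF x(1)] .
    then have tx: "\<tau> \<odot>\<^bsub>M\<^esub> F x = x"
      by (rule right_module_minus_eq_zero[OF right_module_axioms x(1) ract_closed[OF \<tau>c Fc[OF x(1)]], symmetric])
    have Gx: "G i x = x" for i
    proof (induction i)
      case 0
      show ?case using x(1) by (simp add: G_def tp_def ract_one)
    next
      case (Suc i)
      show ?case unfolding G_Suc[OF x(1)] Suc by (rule tx)
    qed
    have NG: "?N (G i x) \<in> {\<zero>\<^bsub>M\<^esub>}" for i unfolding Gx x(2) by (rule singletonI)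
    have "u \<odot>\<^bsub>M\<^esub> x \<in> {\<zero>\<^bsub>M\<^esub>}"
      by (rule key[OF _ _ _ _ x(1) NG]) (simp_all add: ract_zero)
    then have "inv\<^bsub>R\<^esub> u \<odot>\<^bsub>M\<^esub> (u \<odot>\<^bsub>M\<^esub> x) = \<zero>\<^bsub>M\<^esub>" using ract_zero[OF uc(2)] by simp
    then show ?thesis unfolding uinv[OF x(1), symmetric] .
  qed
  have minus_self: "y \<ominus>\<^bsub>M\<^esub> y = \<zero>\<^bsub>M\<^esub>" if "y \<in> carrier M" for y
    using that by (simp add: a_minus_def M.r_neg)
  have inj: "inj_on ?N (carrier M)"
  proof (rule inj_onI)
    fix a b assume ab: "a \<in> carrier M" "b \<in> carrier M" "?N a = ?N b"
    have "?N (a \<ominus>\<^bsub>M\<^esub> b) = ?N a \<ominus>\<^bsub>M\<^esub> ?N b"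
      by (rule linear_map_minus[OF right_module_axioms right_module_axioms Nlin ab(1,2)])
    also have "\<dots> = \<zero>\<^bsub>M\<^esub>" unfolding ab(3) by (rule minus_self[OF linear_mapD(1)[OF Nlin ab(2)]])
    finally have "a \<ominus>\<^bsub>M\<^esub> b = \<zero>\<^bsub>M\<^esub>" by (rule N0[OF M.minus_closed[OF ab(1,2)]])
    then show "a = b" by (rule right_module_minus_eq_zero[OF right_module_axioms ab(1,2)])
  qed
  have surj: "x \<in> ?N ` carrier M" if x: "x \<in> carrier M" for x
  proof -
    let ?I = "?N ` carrier M"
    have Iact: "a \<odot>\<^bsub>M\<^esub> y \<in> ?I" if a: "a \<in> carrier R" and y: "y \<in> ?I" for a y
    proof -
      obtain z where z: "z \<in> carrier M" "y = ?N z" using y by blast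
      show ?thesis unfolding z(2) linear_mapD(4)[OF Nlin a z(1), symmetric] by (rule imageI[OF ract_closed[OF a z(1)]])
    qed
    have "u \<odot>\<^bsub>M\<^esub> x \<in> ?I"
    proof (rule key[OF _ _ _ Iact x])
      show "?I \<subseteq> carrier M" using linear_mapD(1)[OF Nlin] by blast
      show "\<zero>\<^bsub>M\<^esub> \<in> ?I"
        using imageI[OF M.zero_closed, of ?N] unfolding linear_map_zero[OF right_module_axioms right_module_axioms Nlin] .
      fix a b assume "a \<in> ?I" "b \<in> ?I"
      then obtain a' b' where ab: "a' \<in> carrier M" "a = ?N a'" "b' \<in> carrier M" "b = ?N b'" by blast
      show "a \<oplus>\<^bsub>M\<^esub> b \<in> ?I"
        unfolding ab(2,4) linear_mapD(3)[OF Nlin ab(1,3), symmetric] by (rule imageI[OF M.a_closed[OF ab(1,3)]])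
    qed (assumption | rule imageI[OF Gc[OF x]])+
    from Iact[OF uc(2) this] show ?thesis unfolding uinv[OF x, symmetric] .
  qed
  have im: "?N ` carrier M = carrier M"
  proof (intro equalityI subsetI)
    fix y assume "y \<in> ?N ` carrier M"
    then obtain x where x: "x \<in> carrier M" "y = ?N x" by (rule imageE) 
    show "y \<in> carrier M" unfolding x(2) by (rule linear_mapD(1)[OF Nlin x(1)])
  qed (rule surj)
  have result: "bij_betw ?N (carrier M) (carrier M)" by (rule bij_betw_imageI[OF inj im])
  show ?thesis by (rule result)
qed

end

context ext_scalars
begin

lemma V_minus:
  assumes X: "X \<in> summands R" and ab: "a \<in> snd X" "b \<in> snd X"
  shows "V (fst X) (a \<ominus>\<^bsub>the_mod R X\<^esub> b) = V (fst X) a \<ominus>\<^bsub>the_mod R' (E X)\<^esub> V (fst X) b"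
proof -
  interpret X: right_module R "the_mod R X" by (rule right_module_the_mod[OF R X])
  interpret E: right_module R' "the_mod R' (E X)" by (rule right_module_the_mod[OF R' E_summand[OF X]])
  have c: "a \<in> carrier (the_mod R X)" "b \<in> carrier (the_mod R X)" using ab by simp_all
  have m: "a \<ominus>\<^bsub>the_mod R X\<^esub> b \<in> snd X" using X.M.minus_closed[OF c] by (simp only: the_mod_simps(1))
  have F: "x \<in> carrier (free_mod R (fst X))" if "x \<in> snd X" for x using summand_subset[OF X R] that by blast
  have Vc: "V (fst X) x \<in> carrier (the_mod R' (E X))" if "x \<in> snd X" for x using V_in_E[OF that] by simp
  have "(a \<ominus>\<^bsub>the_mod R X\<^esub> b) \<oplus>\<^bsub>the_mod R X\<^esub> b = a"
    unfolding a_minus_def using c by (simp only: X.M.a_assoc X.M.a_inv_closed X.M.l_neg X.M.r_zero)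
  then have "V (fst X) (a \<ominus>\<^bsub>the_mod R X\<^esub> b) \<oplus>\<^bsub>the_mod R' (E X)\<^esub> V (fst X) b = V (fst X) a"
    using V_add[OF F[OF m] F[OF ab(2)]] by (simp only: the_mod_simps fst_E)
  then have "V (fst X) a \<ominus>\<^bsub>the_mod R' (E X)\<^esub> V (fst X) b =
      (V (fst X) (a \<ominus>\<^bsub>the_mod R X\<^esub> b) \<oplus>\<^bsub>the_mod R' (E X)\<^esub> V (fst X) b) \<ominus>\<^bsub>the_mod R' (E X)\<^esub> V (fst X) b"
    by (simp only:)
  also have "\<dots> = V (fst X) (a \<ominus>\<^bsub>the_mod R X\<^esub> b)"
    unfolding a_minus_def[of "the_mod R' (E X)"] using Vc[OF m] Vc[OF ab(2)]
    by (simp only: E.M.a_assoc E.M.a_inv_closed E.M.r_neg E.M.r_zero)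
  finally show ?thesis ..
qed

lemma V_act_mod:
  assumes X: "X \<in> summands R" and a: "a \<in> carrier R" and x: "x \<in> snd X"
  shows "V (fst X) (a \<odot>\<^bsub>the_mod R X\<^esub> x) = \<phi> a \<odot>\<^bsub>the_mod R' (E X)\<^esub> V (fst X) x"
proof -
  have "x \<in> carrier (free_mod R (fst X))" using summand_subset[OF X R] x by blast
  then show ?thesis using V_act[OF a] by (simp only: the_mod_simps fst_E)
qed

lemma ext_map_natural:
  assumes X: "X \<in> summands R" and Y: "Y \<in> summands R" and f: "lin R X X f" and g: "lin R Y Y g" and h: "lin R X Y h"
    and comm: "\<And>x. x \<in> snd X \<Longrightarrow> g (h x) = h (f x)" and x: "x \<in> snd (E X)"
  shows "ext_map R' \<phi> Y Y g (ext_map R' \<phi> X Y h x) = ext_map R' \<phi> X Y h (ext_map R' \<phi> X X f x)"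
proof -
  have "compose (snd X) g h = compose (snd X) h f" using comm by (auto simp: compose_def fun_eq_iff)
  then have "compose (snd (E X)) (ext_map R' \<phi> Y Y g) (ext_map R' \<phi> X Y h) =
      compose (snd (E X)) (ext_map R' \<phi> X Y h) (ext_map R' \<phi> X X f)"
    by (simp only: ext_map_comp[OF X Y Y h g, symmetric] ext_map_comp[OF X X Y f h, symmetric])
  then show ?thesis unfolding compose_def using x by (rule restrict_eqD)
qed

end

context poly_at
begin

sublocale ext: ext_scalars A B const
  by (intro ext_scalars.intro R.ring_axioms B.ring_axioms const_hom)

text \<open>Both sides are linear on the extended module, because the coefficients of a centric
  polynomial are central, and on \<open>V(X)\<close> the sum is the image of
  \<open>p(f)\<close>.\<close>

lemma poly_vanish:
  assumes X: "X \<in> summands A" and f: "lin A X X f" and p: "p \<in> ring_center P"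
    and van: "\<And>x. x \<in> snd X \<Longrightarrow>
      (\<Oplus>\<^bsub>the_mod A X\<^esub>i\<in>{..deg A p}. coeff P p i \<odot>\<^bsub>the_mod A X\<^esub> (f ^^ i) x) = \<zero>\<^bsub>the_mod A X\<^esub>"
    and y: "y \<in> snd (ext.E X)"
  shows "(\<Oplus>\<^bsub>the_mod B (ext.E X)\<^esub>i\<in>{..deg A p}. const (coeff P p i) \<odot>\<^bsub>the_mod B (ext.E X)\<^esub>
    ((ext_map B const X X f) ^^ i) y) = \<zero>\<^bsub>the_mod B (ext.E X)\<^esub>"
proof -
  let ?M = "the_mod B (ext.E X)" and ?N = "the_mod A X" and ?F = "ext_map B const X X f" and ?V = "ext.V (fst X)"
  have Mm: "right_module B ?M" by (rule right_module_the_mod[OF B.ring_axioms ext.E_summand[OF X]])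
  interpret M: right_module B ?M by (rule Mm)
  interpret N: right_module A ?N by (rule right_module_the_mod[OF R.ring_axioms X])
  have c: "coeff P p i \<in> ring_center A" for i using p center_UP_iff by blast
  have cA: "coeff P p i \<in> carrier A" for i using c by (auto simp: ring_center_def)
  have F: "linear_map B ?M ?M ?F" by (rule ext.ext_map(1)[OF X X f])
  have pow: "(f ^^ i) x \<in> snd X \<and> (?F ^^ i) (?V x) = ?V ((f ^^ i) x)" if x: "x \<in> snd X" for i x
  proof (induction i)
    case (Suc i)
    then show ?case using linD(1)[OF f] ext.ext_map(2)[OF X X f] by simp
  qed (use x in simp)
  let ?g = "\<lambda>i. compose (carrier ?M) (\<lambda>x\<in>carrier ?M. const (coeff P p i) \<odot>\<^bsub>?M\<^esub> x) (\<lambda>x\<in>carrier ?M. (?F ^^ i) x)"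
  have g: "linear_map B ?M ?M (?g i)" for i
    by (rule linear_map_compose[OF Mm M.linear_pow[OF F] M.linear_scale[OF const_central[OF c]]])
  have g_eq: "?g i z = const (coeff P p i) \<odot>\<^bsub>?M\<^esub> (?F ^^ i) z" if z: "z \<in> carrier ?M" for i z
    using z M.pow_closed[OF F z] by (simp only: compose_def restrict_apply')
  have eq: "(\<lambda>x\<in>carrier ?M. \<Oplus>\<^bsub>?M\<^esub>i\<in>{..deg A p}. ?g i x) = (\<lambda>x\<in>carrier ?M. \<zero>\<^bsub>?M\<^esub>)"
  proof (rule ext.ext_unique[OF X Mm M.linear_sum[OF _ g] M.linear_zero])
    fix x assume x: "x \<in> snd X"
    have Vx: "?V x \<in> carrier ?M" using ext.V_in_E[OF x] by simp
    have closed: "coeff P p i \<odot>\<^bsub>?N\<^esub> (f ^^ i) x \<in> snd X" for i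
      using N.ract_closed[OF cA, of "(f ^^ i) x" i] pow[OF x, of i] by (simp only: the_mod_simps(1))
    have gi: "?g i (?V x) = ?V (coeff P p i \<odot>\<^bsub>?N\<^esub> (f ^^ i) x)" for i
      using pow[OF x, of i] by (simp only: g_eq[OF Vx] ext.V_act_mod[OF X cA])
    have XF: "z \<in> carrier (free_mod A (fst X))" if "z \<in> snd X" for z using summand_subset[OF X R.ring_axioms] that by blast
    have "(\<Oplus>\<^bsub>?N\<^esub>i\<in>{..deg A p}. coeff P p i \<odot>\<^bsub>?N\<^esub> (f ^^ i) x) \<in> snd X \<and>
        ?V (\<Oplus>\<^bsub>?N\<^esub>i\<in>{..deg A p}. coeff P p i \<odot>\<^bsub>?N\<^esub> (f ^^ i) x) =
        (\<Oplus>\<^bsub>?M\<^esub>i\<in>{..deg A p}. ?V (coeff P p i \<odot>\<^bsub>?N\<^esub> (f ^^ i) x))"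
    proof (rule finsum_additive)
      show "abelian_group ?N" "abelian_group ?M" by (rule N.M.abelian_group_axioms M.M.abelian_group_axioms)+
      show "snd X \<subseteq> carrier ?N" by simp
      show "\<zero>\<^bsub>?N\<^esub> \<in> snd X" using N.M.zero_closed by (simp only: the_mod_simps(1))
      show "a \<oplus>\<^bsub>?N\<^esub> b \<in> snd X \<and> ?V (a \<oplus>\<^bsub>?N\<^esub> b) = ?V a \<oplus>\<^bsub>?M\<^esub> ?V b" if "a \<in> snd X" "b \<in> snd X" for a b
        using summand_closed(2)[OF R.ring_axioms X that] ext.V_add[OF XF[OF that(1)] XF[OF that(2)]] by simp
      show "?V \<in> snd X \<rightarrow> carrier ?M" using ext.V_in_E by simp
      show "(\<lambda>i. coeff P p i \<odot>\<^bsub>?N\<^esub> (f ^^ i) x) \<in> {..deg A p} \<rightarrow> snd X" using closed by blast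
    qed simp
    moreover have "?V \<zero>\<^bsub>?N\<^esub> = \<zero>\<^bsub>?M\<^esub>" by (simp add: ext.V_zero)
    ultimately have "(\<Oplus>\<^bsub>?M\<^esub>i\<in>{..deg A p}. ?g i (?V x)) = \<zero>\<^bsub>?M\<^esub>"
      unfolding gi van[OF x] by (simp only:)
    then show "(\<lambda>x\<in>carrier ?M. \<Oplus>\<^bsub>?M\<^esub>i\<in>{..deg A p}. ?g i x) (?V x) = (\<lambda>x\<in>carrier ?M. \<zero>\<^bsub>?M\<^esub>) (?V x)"
      unfolding restrict_apply'[OF Vx] .
  qed simp
  have yM: "y \<in> carrier ?M" using y by simp
  have "(\<Oplus>\<^bsub>?M\<^esub>i\<in>{..deg A p}. ?g i y) = \<zero>\<^bsub>?M\<^esub>" by (rule restrict_eqD[OF eq yM])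
  then show ?thesis unfolding g_eq[OF yM] .
qed

end

text \<open>Of three maps in a commutative triangle of self-maps, bijectivity of two gives that of
  the third.  It is used to get the invertibility of \<open>t - f\<close> from that of
  \<open>t\<close> and of \<open>(1 - f/t)\<^sup>-\<^sup>1\<close>.\<close>

lemma bij_betw_factor:
  assumes f: "bij_betw f A A" and h: "bij_betw h A A" and gf: "\<And>x. x \<in> A \<Longrightarrow> g (f x) = h x"
  shows "bij_betw g A A"
proof -
  have "bij_betw (inv_into A f) A A" by (rule bij_betw_inv_into[OF f])
  from bij_betw_trans[OF this h] have "bij_betw (h \<circ> inv_into A f) A A" .
  moreover have "(h \<circ> inv_into A f) x = g x" if x: "x \<in> A" for x
  proof -
    have "inv_into A f x \<in> A" "f (inv_into A f x) = x"
      using f x by (auto simp: bij_betw_def inv_into_into f_inv_into_f)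
    then show ?thesis using gf[of "inv_into A f x"] by simp
  qed
  ultimately show ?thesis by (simp cong: bij_betw_cong)
qed

context poly_loc
begin

sublocale inv: ext_scalars T.B S.B "invert_indet A S"
  by (intro ext_scalars.intro T.B.ring_axioms S.B.ring_axioms invert_indet_hom)

lemma End_obD:
  assumes "X \<in> cat_ob (End_S A S)"
  shows "fst X \<in> summands A" and "lin A (fst X) (fst X) (snd X)"
    and "\<exists>p\<in>S. \<forall>x\<in>snd (fst X). (\<Oplus>\<^bsub>the_mod A (fst X)\<^esub>i\<in>{..deg A p}.
      coeff P p i \<odot>\<^bsub>the_mod A (fst X)\<^esub> (snd X ^^ i) x) = \<zero>\<^bsub>the_mod A (fst X)\<^esub>"
proof -
  show "fst X \<in> summands A" "lin A (fst X) (fst X) (snd X)" using assms by (auto simp: End_S_def)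
  have "X \<in> {(X, f). \<exists>p\<in>S. \<forall>x\<in>snd X. (\<Oplus>\<^bsub>the_mod A X\<^esub>i\<in>{..deg A p}.
      coeff (UP A) p i \<odot>\<^bsub>the_mod A X\<^esub> (f ^^ i) x) = \<zero>\<^bsub>the_mod A X\<^esub>}"
    using assms unfolding End_S_def full_sub_simps by blast
  then show "\<exists>p\<in>S. \<forall>x\<in>snd (fst X). (\<Oplus>\<^bsub>the_mod A (fst X)\<^esub>i\<in>{..deg A p}.
      coeff P p i \<odot>\<^bsub>the_mod A (fst X)\<^esub> (snd X ^^ i) x) = \<zero>\<^bsub>the_mod A (fst X)\<^esub>"
    by (simp only: mem_Collect_eq case_prod_unfold P_def)
qed

lemma End_homD:
  assumes "h \<in> cat_hom (End_S A S) X Y"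
  shows "lin A (fst X) (fst Y) h" and "x \<in> snd (fst X) \<Longrightarrow> snd Y (h x) = h (snd X x)"
  using assms end_cat_hom[of h A X Y] by (auto simp: End_S_def)

text \<open>If \<open>p\<close> annihilates an endomorphism, it annihilates the induced one on every
  quotient.\<close>

lemma mod_cat_End_S: "mod_cat A (End_S A S) fst snd"
  unfolding End_S_def
proof (rule mod_cat_end[OF R.ring_axioms])
  note z = zero_summand[OF R.ring_axioms]
  interpret Z: right_module A "the_mod A (0, carrier (free_mod A 0))" by (rule right_module_the_mod[OF R.ring_axioms z])
  have fix_pow: "((\<lambda>x\<in>carrier (free_mod A 0). x) ^^ i) x = x" if "x \<in> carrier (free_mod A 0)" for i x
    by (induction i) (use that in simp_all)
  have "(\<Oplus>\<^bsub>the_mod A (0, carrier (free_mod A 0))\<^esub>i\<in>{..deg A q}. coeff (UP A) q i \<odot>\<^bsub>the_mod A (0, carrier (free_mod A 0))\<^esub>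
      ((\<lambda>x\<in>carrier (free_mod A 0). x) ^^ i) x) = \<zero>\<^bsub>the_mod A (0, carrier (free_mod A 0))\<^esub>"
    if q: "q \<in> S" and x: "x \<in> carrier (free_mod A 0)" for q x
  proof -
    have "coeff (UP A) q i \<in> carrier A" for i
      using S_monic[OF q] coeff_closed[of q i] by (simp add: monic_def P_def)
    then have "coeff (UP A) q i \<odot>\<^bsub>the_mod A (0, carrier (free_mod A 0))\<^esub> x \<in> carrier (the_mod A (0, carrier (free_mod A 0)))" for i
      by (rule Z.ract_closed) (use x in simp)
    then have "(\<Oplus>\<^bsub>the_mod A (0, carrier (free_mod A 0))\<^esub>i\<in>{..deg A q}. coeff (UP A) q i \<odot>\<^bsub>the_mod A (0, carrier (free_mod A 0))\<^esub>
        ((\<lambda>x\<in>carrier (free_mod A 0). x) ^^ i) x) \<in> carrier (the_mod A (0, carrier (free_mod A 0)))"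
      unfolding fix_pow[OF x] by (intro Z.M.finsum_closed) blast
    then show ?thesis by (auto simp: free_mod_simps)
  qed
  then show "((0, carrier (free_mod A 0)), \<lambda>x\<in>carrier (free_mod A 0). x) \<in> {(X, f). \<exists>p\<in>S. \<forall>x\<in>snd X.
      (\<Oplus>\<^bsub>the_mod A X\<^esub>i\<in>{..deg A p}. coeff (UP A) p i \<odot>\<^bsub>the_mod A X\<^esub> (f ^^ i) x) = \<zero>\<^bsub>the_mod A X\<^esub>}"
    using indet_in_S by (simp only: mem_Collect_eq case_prod_conv snd_conv) blast
next
  fix X Y Q f g g' h q
  assume X: "X \<in> summands A" and Y: "Y \<in> summands A" and Q: "Q \<in> summands A"
    and f: "lin A X X f" and g: "lin A Y Y g" and g': "lin A Q Q g'" and h: "lin A X Y h" and q: "lin A Y Q q"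
    and XU: "(X, f) \<in> {(X, f). \<exists>p\<in>S. \<forall>x\<in>snd X.
      (\<Oplus>\<^bsub>the_mod A X\<^esub>i\<in>{..deg A p}. coeff (UP A) p i \<odot>\<^bsub>the_mod A X\<^esub> (f ^^ i) x) = \<zero>\<^bsub>the_mod A X\<^esub>}"
    and YU: "(Y, g) \<in> {(X, f). \<exists>p\<in>S. \<forall>x\<in>snd X.
      (\<Oplus>\<^bsub>the_mod A X\<^esub>i\<in>{..deg A p}. coeff (UP A) p i \<odot>\<^bsub>the_mod A X\<^esub> (f ^^ i) x) = \<zero>\<^bsub>the_mod A X\<^esub>}"
    and gh: "\<And>x. x \<in> snd X \<Longrightarrow> g (h x) = h (f x)" and g'q: "\<And>y. y \<in> snd Y \<Longrightarrow> g' (q y) = q (g y)"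
    and s: "ses A X Y Q h q"
  have Ym: "right_module A (the_mod A Y)" and Qm: "right_module A (the_mod A Q)" by (rule right_module_the_mod[OF R.ring_axioms] Y Q)+
  interpret Y: right_module A "the_mod A Y" by (rule Ym)
  interpret Q: right_module A "the_mod A Q" by (rule Qm)
  obtain p where p: "p \<in> S" and van: "\<And>y. y \<in> snd Y \<Longrightarrow>
      (\<Oplus>\<^bsub>the_mod A Y\<^esub>i\<in>{..deg A p}. coeff (UP A) p i \<odot>\<^bsub>the_mod A Y\<^esub> (g ^^ i) y) = \<zero>\<^bsub>the_mod A Y\<^esub>"
    using YU by auto
  have c: "coeff (UP A) p i \<in> carrier A" for i
    using S_monic[OF p] coeff_closed[of p i] by (simp add: monic_def P_def)
  have pow: "(g ^^ i) y \<in> snd Y \<and> (g' ^^ i) (q y) = q ((g ^^ i) y)" if y: "y \<in> snd Y" for y i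
  proof (induction i)
    case (Suc i)
    then show ?case using linD(1)[OF g] g'q by simp
  qed (use y in simp)
  have "(\<Oplus>\<^bsub>the_mod A Q\<^esub>i\<in>{..deg A p}. coeff (UP A) p i \<odot>\<^bsub>the_mod A Q\<^esub> (g' ^^ i) z) = \<zero>\<^bsub>the_mod A Q\<^esub>"
    if "z \<in> snd Q" for z
  proof -
    have "z \<in> q ` snd Y" using that s by (simp add: ses_def)
    then obtain y where y: "y \<in> snd Y" "z = q y" by blast
    have yc: "(g ^^ i) y \<in> carrier (the_mod A Y)" for i using pow[OF y(1), of i] by simp
    have "coeff (UP A) p i \<odot>\<^bsub>the_mod A Q\<^esub> (g' ^^ i) z = q (coeff (UP A) p i \<odot>\<^bsub>the_mod A Y\<^esub> (g ^^ i) y)" for i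
      using pow[OF y(1), of i] unfolding y(2) by (simp only: linear_mapD(4)[OF q c yc])
    then have "(\<Oplus>\<^bsub>the_mod A Q\<^esub>i\<in>{..deg A p}. coeff (UP A) p i \<odot>\<^bsub>the_mod A Q\<^esub> (g' ^^ i) z) =
        (\<Oplus>\<^bsub>the_mod A Q\<^esub>i\<in>{..deg A p}. q (coeff (UP A) p i \<odot>\<^bsub>the_mod A Y\<^esub> (g ^^ i) y))" by (simp only:)
    also have "\<dots> = q (\<Oplus>\<^bsub>the_mod A Y\<^esub>i\<in>{..deg A p}. coeff (UP A) p i \<odot>\<^bsub>the_mod A Y\<^esub> (g ^^ i) y)"
      by (rule linear_map_finsum[OF Ym Qm q, symmetric]) (use Y.ract_closed[OF c yc] in blast)+
    also have "\<dots> = \<zero>\<^bsub>the_mod A Q\<^esub>" unfolding van[OF y(1)] by (rule linear_map_zero[OF Ym Qm q])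
    finally show ?thesis .
  qed
  then show "(Q, g') \<in> {(X, f). \<exists>p\<in>S. \<forall>x\<in>snd X.
      (\<Oplus>\<^bsub>the_mod A X\<^esub>i\<in>{..deg A p}. coeff (UP A) p i \<odot>\<^bsub>the_mod A X\<^esub> (f ^^ i) x) = \<zero>\<^bsub>the_mod A X\<^esub>}"
    using p by (simp only: mem_Collect_eq case_prod_conv) blast
qed

end

context poly_at
begin

definition base :: "('a summand \<times> 'a vfun, 'a vfun, _, _) fctr" where
  "base = (\<lambda>X. ext.E (fst X), \<lambda>X Y. ext_map B const (fst X) (fst Y))"

lemma base_exact:
  assumes "mod_cat A C fst snd"
  shows "exact_functor C (fgproj B) base"
proof -
  interpret mod_cat A C fst snd by fact
  have "exact_functor C (fgproj A) forget_end" unfolding forget_end_def by (rule forget_exact)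
  from exact_family_precomp[OF this ext.ext_exact]
  show ?thesis by (simp add: base_def precomp_def forget_end_def ext_fctr_def comp_def)
qed

end

context poly_loc
begin

text \<open>The composite \<open>A \<rightarrow> A[t]\<^sub>T \<rightarrow> A[t]\<^sub>S\<close> is
  the structure map, and the model of extension of scalars is strictly functorial, so base change
  along \<open>t \<mapsto> 1/t\<close> takes \<open>P[t]\<^sub>T\<close> to
  \<open>P[t]\<^sub>S\<close> on the nose.\<close>

lemma inv_E: "X \<in> summands A \<Longrightarrow> inv.E (T.ext.E X) = S.ext.E X"
  by (rule ext_ob_trans(1)[OF T.ext.ext_scalars_axioms inv.ext_scalars_axioms S.ext.ext_scalars_axioms invert_indet_const])

lemma inv_ext_map: "X \<in> summands A \<Longrightarrow> Y \<in> summands A \<Longrightarrow> lin A X Y h \<Longrightarrow>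
    ext_map S.B (invert_indet A S) (T.ext.E X) (T.ext.E Y) (ext_map T.B T.const X Y h) = ext_map S.B S.const X Y h"
  by (rule ext_ob_trans(2)[OF T.ext.ext_scalars_axioms inv.ext_scalars_axioms S.ext.ext_scalars_axioms invert_indet_const])

abbreviation "F\<^sub>T X \<equiv> ext_map T.B T.const (fst X) (fst X) (snd X)"
abbreviation "F\<^sub>S X \<equiv> ext_map S.B S.const (fst X) (fst X) (snd X)"
abbreviation "M\<^sub>T X \<equiv> the_mod T.B (T.ext.E (fst X))"
abbreviation "M\<^sub>S X \<equiv> the_mod S.B (S.ext.E (fst X))"

definition one_minus where
  "one_minus X = (\<lambda>x\<in>carrier (M\<^sub>T X). x \<ominus>\<^bsub>M\<^sub>T X\<^esub> (T.t \<odot>\<^bsub>M\<^sub>T X\<^esub> F\<^sub>T X x))"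

definition zeta_aut where
  "zeta_aut X = (\<lambda>y\<in>snd (T.ext.E (fst X)). inv_into (snd (T.ext.E (fst X))) (\<lambda>x. x \<ominus>\<^bsub>M\<^sub>T X\<^esub> (T.t \<odot>\<^bsub>M\<^sub>T X\<^esub> F\<^sub>T X x)) y)"

definition zeta_inv_aut where
  "zeta_inv_aut X = ext_map S.B (invert_indet A S) (T.ext.E (fst X)) (T.ext.E (fst X)) (zeta_aut X)"

definition tau_aut where
  "tau_aut X = (\<lambda>x\<in>carrier (M\<^sub>S X). (S.t \<odot>\<^bsub>M\<^sub>S X\<^esub> x) \<ominus>\<^bsub>M\<^sub>S X\<^esub> F\<^sub>S X x)"

definition t_aut where
  "t_aut Y = (\<lambda>x\<in>carrier (the_mod S.B (S.ext.E Y)). S.t \<odot>\<^bsub>the_mod S.B (S.ext.E Y)\<^esub> x)"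

lemma zeta_fctr_eq: "zeta_fctr A T = (\<lambda>X. (fst T.base X, zeta_aut X), snd T.base)"
  by (simp add: zeta_fctr_def Let_def split_beta T.base_def zeta_aut_def fun_eq_iff)

lemma tau_fctr_eq: "tau_fctr A S = (\<lambda>X. (fst S.base X, tau_aut X), snd S.base)"
  by (simp add: tau_fctr_def Let_def split_beta S.base_def tau_aut_def fun_eq_iff)

lemma mult_t_fctr_eq: "mult_t_fctr A S =
    (\<lambda>X. (fst (ext_fctr S.B S.const) X, t_aut X), snd (ext_fctr S.B S.const))"
  by (simp add: mult_t_fctr_def Let_def ext_fctr_def t_aut_def fun_eq_iff)

lemma M\<^sub>T: "X \<in> cat_ob (End_S A S) \<Longrightarrow> right_module T.B (M\<^sub>T X)"
  by (rule right_module_the_mod[OF T.B.ring_axioms T.ext.E_summand[OF End_obD(1)]])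

lemma M\<^sub>S: "X \<in> cat_ob (End_S A S) \<Longrightarrow> right_module S.B (M\<^sub>S X)"
  by (rule right_module_the_mod[OF S.B.ring_axioms S.ext.E_summand[OF End_obD(1)]])

lemma F\<^sub>T: "X \<in> cat_ob (End_S A S) \<Longrightarrow> linear_map T.B (M\<^sub>T X) (M\<^sub>T X) (F\<^sub>T X)"
  by (rule T.ext.ext_map(1)) (erule End_obD)+

lemma F\<^sub>S: "X \<in> cat_ob (End_S A S) \<Longrightarrow> linear_map S.B (M\<^sub>S X) (M\<^sub>S X) (F\<^sub>S X)"
  by (rule S.ext.ext_map(1)) (erule End_obD)+

text \<open>If \<open>p(f) = 0\<close>, then \<open>1 - f t\<close> is invertible over \<open>A[t]\<^sub>T\<close>, since it divides the unit
  \<open>\<Sum>\<^sub>i p\<^sub>i t\<^sup>d\<^sup>-\<^sup>i\<close>, the reversed polynomial of \<open>p\<close>.\<close>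

lemma one_minus_linear: "X \<in> cat_ob (End_S A S) \<Longrightarrow> linear_map T.B (M\<^sub>T X) (M\<^sub>T X) (one_minus X)"
  unfolding one_minus_def by (rule right_module.linear_one_minus[OF M\<^sub>T F\<^sub>T T.t_central])

lemma one_minus_bij:
  assumes X: "X \<in> cat_ob (End_S A S)"
  shows "bij_betw (one_minus X) (carrier (M\<^sub>T X)) (carrier (M\<^sub>T X))"
proof -
  note o = End_obD[OF X]
  obtain p where p: "p \<in> S" and van: "\<And>x. x \<in> snd (fst X) \<Longrightarrow> (\<Oplus>\<^bsub>the_mod A (fst X)\<^esub>i\<in>{..deg A p}.
      coeff P p i \<odot>\<^bsub>the_mod A (fst X)\<^esub> (snd X ^^ i) x) = \<zero>\<^bsub>the_mod A (fst X)\<^esub>"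
    using o(3) by blast
  have pc: "p \<in> ring_center P" using p S_central by blast
  have cc: "T.const (coeff P p i) \<in> ring_center T.B" for i
    by (rule T.const_central) (use pc center_UP_iff in blast)
  show ?thesis
    unfolding one_minus_def
  proof (rule right_module.one_minus_bij[OF M\<^sub>T[OF X] F\<^sub>T[OF X] T.t_central cc reversed_sum_unit[OF p]])
    fix x assume "x \<in> carrier (M\<^sub>T X)"
    then have "x \<in> snd (T.ext.E (fst X))" by simp
    from T.poly_vanish[OF o(1,2) pc van this]
    show "(\<Oplus>\<^bsub>M\<^sub>T X\<^esub>i\<in>{..deg A p}. T.const (coeff P p i) \<odot>\<^bsub>M\<^sub>T X\<^esub> (F\<^sub>T X ^^ i) x) = \<zero>\<^bsub>M\<^sub>T X\<^esub>" .
  qed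
qed

lemma zeta_aut_eq: "zeta_aut X = (\<lambda>y\<in>snd (T.ext.E (fst X)). inv_into (snd (T.ext.E (fst X))) (one_minus X) y)"
proof -
  have eq: "inv_into B (restrict f B) = inv_into B f" for f :: "'b \<Rightarrow> 'c" and B
    by (auto simp: inv_into_def fun_eq_iff intro!: arg_cong[of _ _ Eps])
  show ?thesis unfolding zeta_aut_def one_minus_def the_mod_simps(1) eq ..
qed

lemma zeta_aut:
  assumes X: "X \<in> cat_ob (End_S A S)"
  shows "lin T.B (T.ext.E (fst X)) (T.ext.E (fst X)) (zeta_aut X)"
    and "x \<in> snd (T.ext.E (fst X)) \<Longrightarrow> one_minus X (zeta_aut X x) = x"
    and "x \<in> snd (T.ext.E (fst X)) \<Longrightarrow> zeta_aut X (one_minus X x) = x"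
    and "bij_betw (zeta_aut X) (snd (T.ext.E (fst X))) (snd (T.ext.E (fst X)))"
proof -
  let ?E = "T.ext.E (fst X)"
  note b = one_minus_bij[OF X, unfolded the_mod_simps(1)]
  note E = T.ext.E_summand[OF End_obD(1)[OF X]]
  show l: "lin T.B ?E ?E (zeta_aut X)"
    unfolding zeta_aut_eq by (rule lin_inverse[OF T.B.ring_axioms E E one_minus_linear[OF X] b])
  show 1: "one_minus X (zeta_aut X x) = x" if "x \<in> snd ?E" for x
    using b that by (simp add: zeta_aut_eq bij_betw_def f_inv_into_f)
  have N: "one_minus X x \<in> snd ?E" if "x \<in> snd ?E" for x by (rule linD(1)[OF one_minus_linear[OF X] that])
  show 2: "zeta_aut X (one_minus X x) = x" if "x \<in> snd ?E" for x
    using b that N[OF that] by (simp add: zeta_aut_eq bij_betw_def)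
  show "bij_betw (zeta_aut X) (snd ?E) (snd ?E)"
    by (rule bij_betwI[of _ _ _ "one_minus X"]) (use 1 2 N linD(1)[OF l] in auto)
qed

lemma one_minus_natural:
  assumes X: "X \<in> cat_ob (End_S A S)" and Y: "Y \<in> cat_ob (End_S A S)" and h: "h \<in> cat_hom (End_S A S) X Y"
    and x: "x \<in> snd (T.ext.E (fst X))"
  shows "one_minus Y (ext_map T.B T.const (fst X) (fst Y) h x) = ext_map T.B T.const (fst X) (fst Y) h (one_minus X x)"
proof -
  let ?h = "ext_map T.B T.const (fst X) (fst Y) h"
  note oX = End_obD[OF X] and oY = End_obD[OF Y]
  have l: "linear_map T.B (M\<^sub>T X) (M\<^sub>T Y) ?h" by (rule T.ext.ext_map(1)[OF oX(1) oY(1) End_homD(1)[OF h]])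
  have x': "x \<in> carrier (M\<^sub>T X)" using x by simp
  have t: "T.t \<in> carrier T.B" using T.t_central by (simp add: ring_center_def)
  note Fx = linear_mapD(1)[OF F\<^sub>T[OF X] x']
  have "?h (one_minus X x) = ?h x \<ominus>\<^bsub>M\<^sub>T Y\<^esub> ?h (T.t \<odot>\<^bsub>M\<^sub>T X\<^esub> F\<^sub>T X x)"
    unfolding one_minus_def restrict_apply'[OF x']
    by (rule linear_map_minus[OF M\<^sub>T[OF X] M\<^sub>T[OF Y] l x' right_module.ract_closed[OF M\<^sub>T[OF X] t Fx]])
  also have "?h (T.t \<odot>\<^bsub>M\<^sub>T X\<^esub> F\<^sub>T X x) = T.t \<odot>\<^bsub>M\<^sub>T Y\<^esub> ?h (F\<^sub>T X x)" by (rule linear_mapD(4)[OF l t Fx])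
  also have "?h (F\<^sub>T X x) = F\<^sub>T Y (?h x)"
    by (rule T.ext.ext_map_natural[OF oX(1) oY(1) oX(2) oY(2) End_homD[OF h] x, symmetric])
  also have "?h x \<ominus>\<^bsub>M\<^sub>T Y\<^esub> (T.t \<odot>\<^bsub>M\<^sub>T Y\<^esub> F\<^sub>T Y (?h x)) = one_minus Y (?h x)"
    unfolding one_minus_def restrict_apply'[OF linear_mapD(1)[OF l x']] ..
  finally show ?thesis ..
qed

lemma zeta_aut_natural:
  assumes X: "X \<in> cat_ob (End_S A S)" and Y: "Y \<in> cat_ob (End_S A S)" and h: "h \<in> cat_hom (End_S A S) X Y"
    and x: "x \<in> snd (T.ext.E (fst X))"
  shows "zeta_aut Y (ext_map T.B T.const (fst X) (fst Y) h x) = ext_map T.B T.const (fst X) (fst Y) h (zeta_aut X x)"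
proof -
  let ?h = "ext_map T.B T.const (fst X) (fst Y) h"
  have z: "zeta_aut X x \<in> snd (T.ext.E (fst X))" by (rule linD(1)[OF zeta_aut(1)[OF X] x])
  have hz: "?h (zeta_aut X x) \<in> snd (T.ext.E (fst Y))"
    by (rule linD(1)[OF T.ext.ext_map(1)[OF End_obD(1)[OF X] End_obD(1)[OF Y] End_homD(1)[OF h]] z])
  have "zeta_aut Y (one_minus Y (?h (zeta_aut X x))) = ?h (zeta_aut X x)" by (rule zeta_aut(3)[OF Y hz])
  then show ?thesis unfolding one_minus_natural[OF X Y h z] zeta_aut(2)[OF X x] .
qed

lemma zeta_inv_aut:
  assumes X: "X \<in> cat_ob (End_S A S)"
  shows "lin S.B (S.ext.E (fst X)) (S.ext.E (fst X)) (zeta_inv_aut X)"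
    and "bij_betw (zeta_inv_aut X) (snd (S.ext.E (fst X))) (snd (S.ext.E (fst X)))"
proof -
  note o = End_obD(1)[OF X] and E = T.ext.E_summand[OF End_obD(1)[OF X]]
  show "lin S.B (S.ext.E (fst X)) (S.ext.E (fst X)) (zeta_inv_aut X)"
    using inv.ext_map(1)[OF E E zeta_aut(1)[OF X]] unfolding inv_E[OF o] zeta_inv_aut_def .
  show "bij_betw (zeta_inv_aut X) (snd (S.ext.E (fst X))) (snd (S.ext.E (fst X)))"
    using inv.ext_bij[OF E E zeta_aut(1,4)[OF X]] unfolding inv_E[OF o] zeta_inv_aut_def .
qed

lemma zeta_inv_aut_natural:
  assumes X: "X \<in> cat_ob (End_S A S)" and Y: "Y \<in> cat_ob (End_S A S)" and h: "h \<in> cat_hom (End_S A S) X Y"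
    and x: "x \<in> snd (S.ext.E (fst X))"
  shows "zeta_inv_aut Y (ext_map S.B S.const (fst X) (fst Y) h x) = ext_map S.B S.const (fst X) (fst Y) h (zeta_inv_aut X x)"
proof -
  note oX = End_obD(1)[OF X] and oY = End_obD(1)[OF Y] and h' = End_homD(1)[OF h]
  show ?thesis
    using inv.ext_map_natural[OF T.ext.E_summand[OF oX] T.ext.E_summand[OF oY] zeta_aut(1)[OF X] zeta_aut(1)[OF Y]
        T.ext.ext_map(1)[OF oX oY h'] zeta_aut_natural[OF X Y h], of x] x
    unfolding inv_E[OF oX] inv_ext_map[OF oX oY h'] zeta_inv_aut_def[symmetric] by blast
qed

text \<open>The map is \<open>(1 - f/t)\<^sup>-\<^sup>1\<close>: by linearity this is checked on the
  image of \<open>P[t]\<^sub>T\<close>, where \<open>t\<close> acts through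
  \<open>1/t\<close>.\<close>

lemma zeta_inv_aut_inverse:
  assumes X: "X \<in> cat_ob (End_S A S)" and y: "y \<in> snd (S.ext.E (fst X))"
  shows "zeta_inv_aut X y \<ominus>\<^bsub>M\<^sub>S X\<^esub> (ti \<odot>\<^bsub>M\<^sub>S X\<^esub> F\<^sub>S X (zeta_inv_aut X y)) = y"
proof -
  let ?E = "T.ext.E (fst X)" and ?\<alpha> = "zeta_inv_aut X" and ?V = "inv.V (fst (fst X))"
  note o = End_obD[OF X] and E = T.ext.E_summand[OF End_obD(1)[OF X]] and a = zeta_inv_aut(1)[OF X]
  interpret MS: right_module S.B "M\<^sub>S X" by (rule M\<^sub>S[OF X])
  have aV: "?\<alpha> (?V x) = ?V (zeta_aut X x)" if "x \<in> snd ?E" for x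
    using inv.ext_map(2)[OF E E zeta_aut(1)[OF X] that] by (simp add: zeta_inv_aut_def)
  have FV: "F\<^sub>S X (?V x) = ?V (F\<^sub>T X x)" if "x \<in> snd ?E" for x
    using inv.ext_map(2)[OF E E F\<^sub>T[OF X] that] unfolding inv_ext_map[OF o(1,1,2)] by simp
  let ?tF = "compose (carrier (M\<^sub>S X)) (\<lambda>x\<in>carrier (M\<^sub>S X). ti \<odot>\<^bsub>M\<^sub>S X\<^esub> x) (compose (carrier (M\<^sub>S X)) (F\<^sub>S X) ?\<alpha>)"
  have tF: "linear_map S.B (M\<^sub>S X) (M\<^sub>S X) ?tF"
    by (rule linear_map_compose[OF M\<^sub>S[OF X] linear_map_compose[OF M\<^sub>S[OF X] a F\<^sub>S[OF X]] MS.linear_scale[OF ti_central]])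
  have tF_eq: "?tF z = ti \<odot>\<^bsub>M\<^sub>S X\<^esub> F\<^sub>S X (?\<alpha> z)" if z: "z \<in> carrier (M\<^sub>S X)" for z
    using linear_mapD(1)[OF F\<^sub>S[OF X] linear_mapD(1)[OF a z]] z by (simp only: compose_def restrict_apply')
  let ?L = "\<lambda>x\<in>carrier (M\<^sub>S X). ?\<alpha> x \<ominus>\<^bsub>M\<^sub>S X\<^esub> ?tF x"
  have "?L = (\<lambda>x\<in>snd (S.ext.E (fst X)). x)"
  proof (rule inv.ext_unique[OF E M\<^sub>S[OF X], unfolded inv_E[OF o(1)]])
    show "linear_map S.B (M\<^sub>S X) (M\<^sub>S X) ?L" by (rule MS.linear_diff[OF a tF])
    show "lin S.B (S.ext.E (fst X)) (S.ext.E (fst X)) (\<lambda>x\<in>snd (S.ext.E (fst X)). x)"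
      by (rule lin_id[OF S.B.ring_axioms S.ext.E_summand[OF o(1)]])
    fix x assume x: "x \<in> snd ?E"
    let ?z = "zeta_aut X x"
    have z: "?z \<in> snd ?E" by (rule linD(1)[OF zeta_aut(1)[OF X] x])
    have zc: "?z \<in> carrier (M\<^sub>T X)" using z by simp
    have Fz: "F\<^sub>T X ?z \<in> snd ?E" by (rule linD(1)[OF F\<^sub>T[OF X] z])
    have t: "T.t \<in> carrier T.B" using T.t_central by (simp add: ring_center_def)
    have tFz: "T.t \<odot>\<^bsub>M\<^sub>T X\<^esub> F\<^sub>T X ?z \<in> snd ?E"
      using right_module.ract_closed[OF M\<^sub>T[OF X] t, of "F\<^sub>T X ?z"] Fz by (simp only: the_mod_simps(1))
    have Vx: "?V x \<in> snd (S.ext.E (fst X))" using inv.V_in_E[OF x] inv_E[OF o(1)] by simp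
    have "?L (?V x) = ?V ?z \<ominus>\<^bsub>M\<^sub>S X\<^esub> (ti \<odot>\<^bsub>M\<^sub>S X\<^esub> ?V (F\<^sub>T X ?z))"
      using Vx tF_eq[of "?V x"] by (simp only: restrict_apply' the_mod_simps(1) aV[OF x] FV[OF z])
    also have "ti \<odot>\<^bsub>M\<^sub>S X\<^esub> ?V (F\<^sub>T X ?z) = ?V (T.t \<odot>\<^bsub>M\<^sub>T X\<^esub> F\<^sub>T X ?z)"
      using inv.V_act_mod[OF E t Fz] by (simp only: inv_E[OF o(1)] invert_indet_t T.ext.fst_E)
    also have "?V ?z \<ominus>\<^bsub>M\<^sub>S X\<^esub> ?V (T.t \<odot>\<^bsub>M\<^sub>T X\<^esub> F\<^sub>T X ?z) = ?V (?z \<ominus>\<^bsub>M\<^sub>T X\<^esub> (T.t \<odot>\<^bsub>M\<^sub>T X\<^esub> F\<^sub>T X ?z))"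
      using inv.V_minus[OF E z tFz] by (simp only: inv_E[OF o(1)] T.ext.fst_E)
    also have "?z \<ominus>\<^bsub>M\<^sub>T X\<^esub> (T.t \<odot>\<^bsub>M\<^sub>T X\<^esub> F\<^sub>T X ?z) = one_minus X ?z"
      unfolding one_minus_def restrict_apply'[OF zc] ..
    also have "\<dots> = x" by (rule zeta_aut(2)[OF X x])
    finally show "?L (inv.V (fst ?E) x) = (\<lambda>x\<in>snd (S.ext.E (fst X)). x) (inv.V (fst ?E) x)"
      unfolding T.ext.fst_E restrict_apply'[OF Vx] .
  qed
  from fun_cong[OF this, of y] show ?thesis
    using y tF_eq[of y] by (simp only: restrict_apply' the_mod_simps(1))
qed

lemma t_aut:
  assumes Y: "Y \<in> summands A"
  shows "lin S.B (S.ext.E Y) (S.ext.E Y) (t_aut Y)"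
    and "bij_betw (t_aut Y) (snd (S.ext.E Y)) (snd (S.ext.E Y))"
proof -
  let ?M = "the_mod S.B (S.ext.E Y)"
  interpret M: right_module S.B ?M by (rule right_module_the_mod[OF S.B.ring_axioms S.ext.E_summand[OF Y]])
  show "lin S.B (S.ext.E Y) (S.ext.E Y) (t_aut Y)" unfolding t_aut_def by (rule M.linear_scale[OF S.t_central])
  have "bij_betw (t_aut Y) (carrier ?M) (carrier ?M)"
  proof (rule bij_betwI[of _ _ _ "\<lambda>x. ti \<odot>\<^bsub>?M\<^esub> x"])
    show "t_aut Y \<in> carrier ?M \<rightarrow> carrier ?M" "(\<lambda>x. ti \<odot>\<^bsub>?M\<^esub> x) \<in> carrier ?M \<rightarrow> carrier ?M"
      unfolding t_aut_def by (intro funcsetI, simp only: restrict_apply' M.ract_closed[OF t_closed],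
          intro funcsetI, rule M.ract_closed[OF ti_closed])
    fix x assume x: "x \<in> carrier ?M"
    have "ti \<odot>\<^bsub>?M\<^esub> (S.t \<odot>\<^bsub>?M\<^esub> x) = x"
      unfolding M.ract_assoc[OF t_closed ti_closed x, symmetric] t_ti by (rule M.ract_one[OF x])
    then show "ti \<odot>\<^bsub>?M\<^esub> t_aut Y x = x" unfolding t_aut_def restrict_apply'[OF x] .
    have "S.t \<odot>\<^bsub>?M\<^esub> (ti \<odot>\<^bsub>?M\<^esub> x) = x"
      unfolding M.ract_assoc[OF ti_closed t_closed x, symmetric] t_ti by (rule M.ract_one[OF x])
    then show "t_aut Y (ti \<odot>\<^bsub>?M\<^esub> x) = x" unfolding t_aut_def restrict_apply'[OF M.ract_closed[OF ti_closed x]] .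
  qed
  then show "bij_betw (t_aut Y) (snd (S.ext.E Y)) (snd (S.ext.E Y))" unfolding the_mod_simps(1) .
qed

lemma t_aut_natural:
  assumes X: "X \<in> summands A" and Y: "Y \<in> summands A" and h: "lin A X Y h" and x: "x \<in> snd (S.ext.E X)"
  shows "t_aut Y (ext_map S.B S.const X Y h x) = ext_map S.B S.const X Y h (t_aut X x)"
proof -
  note l = S.ext.ext_map(1)[OF X Y h]
  have x': "x \<in> carrier (the_mod S.B (S.ext.E X))" using x by simp
  show ?thesis
    unfolding t_aut_def restrict_apply'[OF x'] restrict_apply'[OF linear_mapD(1)[OF l x']]
    by (rule linear_mapD(4)[OF l t_closed x', symmetric])
qed

text \<open>The factorisation behind the theorem: \<open>t = (t - f) (1 - f / t)\<^sup>-\<^sup>1\<close>.\<close>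

lemma tau_aut_zeta_inv_aut:
  assumes X: "X \<in> cat_ob (End_S A S)" and y: "y \<in> snd (S.ext.E (fst X))"
  shows "tau_aut X (zeta_inv_aut X y) = t_aut (fst X) y"
proof -
  interpret M: right_module S.B "M\<^sub>S X" by (rule M\<^sub>S[OF X])
  let ?z = "zeta_inv_aut X y"
  have y': "y \<in> carrier (M\<^sub>S X)" using y by simp
  have z: "?z \<in> carrier (M\<^sub>S X)" by (rule linear_mapD(1)[OF zeta_inv_aut(1)[OF X] y'])
  note Fz = linear_mapD(1)[OF F\<^sub>S[OF X] z]
  have "S.t \<odot>\<^bsub>M\<^sub>S X\<^esub> y = S.t \<odot>\<^bsub>M\<^sub>S X\<^esub> (?z \<ominus>\<^bsub>M\<^sub>S X\<^esub> (ti \<odot>\<^bsub>M\<^sub>S X\<^esub> F\<^sub>S X ?z))"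
    unfolding zeta_inv_aut_inverse[OF X y] ..
  also have "\<dots> = S.t \<odot>\<^bsub>M\<^sub>S X\<^esub> ?z \<ominus>\<^bsub>M\<^sub>S X\<^esub> S.t \<odot>\<^bsub>M\<^sub>S X\<^esub> (ti \<odot>\<^bsub>M\<^sub>S X\<^esub> F\<^sub>S X ?z)"
    by (rule M.ract_minus[OF t_closed z M.ract_closed[OF ti_closed Fz]])
  also have "S.t \<odot>\<^bsub>M\<^sub>S X\<^esub> (ti \<odot>\<^bsub>M\<^sub>S X\<^esub> F\<^sub>S X ?z) = F\<^sub>S X ?z"
    unfolding M.ract_assoc[OF ti_closed t_closed Fz, symmetric] t_ti by (rule M.ract_one[OF Fz])
  finally show ?thesis unfolding tau_aut_def t_aut_def restrict_apply'[OF y'] restrict_apply'[OF z] ..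
qed

lemma tau_aut:
  assumes X: "X \<in> cat_ob (End_S A S)"
  shows "lin S.B (S.ext.E (fst X)) (S.ext.E (fst X)) (tau_aut X)"
    and "bij_betw (tau_aut X) (snd (S.ext.E (fst X))) (snd (S.ext.E (fst X)))"
proof -
  interpret M: right_module S.B "M\<^sub>S X" by (rule M\<^sub>S[OF X])
  have "tau_aut X = (\<lambda>x\<in>carrier (M\<^sub>S X). (\<lambda>x\<in>carrier (M\<^sub>S X). S.t \<odot>\<^bsub>M\<^sub>S X\<^esub> x) x \<ominus>\<^bsub>M\<^sub>S X\<^esub> F\<^sub>S X x)"
    unfolding tau_aut_def by (rule restrict_ext) (simp only: restrict_apply')
  then show "lin S.B (S.ext.E (fst X)) (S.ext.E (fst X)) (tau_aut X)"
    using M.linear_diff[OF M.linear_scale[OF S.t_central] F\<^sub>S[OF X]] by (simp only:)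
  show "bij_betw (tau_aut X) (snd (S.ext.E (fst X))) (snd (S.ext.E (fst X)))"
    by (rule bij_betw_factor[OF zeta_inv_aut(2)[OF X] t_aut(2)[OF End_obD(1)[OF X]] tau_aut_zeta_inv_aut[OF X]])
qed

text \<open>Every element is in the image of \<open>(1 - f/t)\<^sup>-\<^sup>1\<close>, so naturality
  of \<open>t - f\<close> follows from that of the other two automorphisms in the
  factorisation.\<close>

lemma tau_aut_natural:
  assumes X: "X \<in> cat_ob (End_S A S)" and Y: "Y \<in> cat_ob (End_S A S)" and h: "h \<in> cat_hom (End_S A S) X Y"
    and x: "x \<in> snd (S.ext.E (fst X))"
  shows "tau_aut Y (ext_map S.B S.const (fst X) (fst Y) h x) = ext_map S.B S.const (fst X) (fst Y) h (tau_aut X x)"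
proof -
  let ?h = "ext_map S.B S.const (fst X) (fst Y) h"
  note oX = End_obD(1)[OF X] and oY = End_obD(1)[OF Y] and l = S.ext.ext_map(1)[OF End_obD(1)[OF X] End_obD(1)[OF Y] End_homD(1)[OF h]]
  obtain y where y: "y \<in> snd (S.ext.E (fst X))" "x = zeta_inv_aut X y"
    using x zeta_inv_aut(2)[OF X] unfolding bij_betw_def by blast
  have hy: "?h y \<in> snd (S.ext.E (fst Y))" by (rule linD(1)[OF l y(1)])
  have "tau_aut Y (?h x) = tau_aut Y (zeta_inv_aut Y (?h y))"
    unfolding y(2) zeta_inv_aut_natural[OF X Y h y(1)] ..
  also have "\<dots> = ?h (t_aut (fst X) y)"
    unfolding tau_aut_zeta_inv_aut[OF Y hy] by (rule t_aut_natural[OF oX oY End_homD(1)[OF h] y(1)])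
  also have "\<dots> = ?h (tau_aut X x)" unfolding y(2) tau_aut_zeta_inv_aut[OF X y(1)] ..
  finally show ?thesis .
qed

end

section \<open>Loops along the edges of the triangle\<close>

lemma K_space_D:
  assumes "\<omega> \<in> topspace (K_space C)" "r \<in> {0..1}"
  shows "\<omega> r \<in> topspace (realise (wS_space C))"
  using assms unfolding K_space_def based_loops_def by (auto simp: topspace_mapping_space continuous_map_def)

lemma vertex_0_in_simplex: "vertex 0 \<in> standard_simplex 0" by simp

lemma K_map_in_realise:
  assumes \<Phi>: "exact_functor C D \<Phi>" and y: "\<omega> r \<in> topspace (realise (wS_space C))" and r: "r \<in> {0..1}"
  shows "K_map D \<Phi> \<omega> r \<in> topspace (realise (wS_space D))"
  unfolding K_map_eq_K_family[of C D \<Phi> \<omega> r, OF \<Phi> y r]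
  by (rule exact_family.K_family_in_realise[OF \<Phi> vertex_0_in_simplex y])

lemma coassembly_K_map:
  assumes \<Phi>: "exact_functor C (aut_cat D) \<Phi>" and self: "exact_family 1 (aut_cat D) D fst (self_map D)"
    and y: "\<omega> r \<in> topspace (realise (wS_space C))" and r: "r \<in> {0..1}" and s: "s \<in> {0..1}"
  shows "coassembly D (K_map (aut_cat D) \<Phi> \<omega>) s r =
    K_family 1 D (fst \<circ> fst \<Phi>) (precomp \<Phi> (self_map D)) (edge s) (\<omega> r)"
  unfolding coassembly_eq_K_family[where D = D and \<omega> = "K_map (aut_cat D) \<Phi> \<omega>" and r = r and s = s, OF self K_map_in_realise[of C "aut_cat D" \<Phi> \<omega> r, OF \<Phi> y r] r s]
    K_map_eq_K_family[of C "aut_cat D" \<Phi> \<omega> r, OF \<Phi> y r]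
  by (rule K_family_precomp[OF \<Phi> self edge_in_simplex[OF s] y])

text \<open>A family over \<open>[p]\<close> that is the restriction of a triangle along
  \<open>f\<close> is \<open>\<Xi>\<close> along the affine map induced by \<open>f\<close>.\<close>

lemma K_family_along:
  assumes A: "exact_family 2 C D O\<^sub>A A" and B: "exact_family p C D O\<^sub>B B"
    and f: "mono_on {..p} f" "f ` {..p} \<subseteq> {..2}"
    and ob: "\<And>X. X \<in> cat_ob C \<Longrightarrow> O\<^sub>B X = O\<^sub>A X"
    and arr: "\<And>e e' X Y h. \<lbrakk>e \<le> e'; e' \<le> p; X \<in> cat_ob C; Y \<in> cat_ob C; h \<in> cat_hom C X Y\<rbrakk>
      \<Longrightarrow> B e e' X Y h = A (f e) (f e') X Y h"
    and v: "v \<in> standard_simplex p" and y: "y \<in> topspace (realise (wS_space C))"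
  shows "K_family p D O\<^sub>B B v y = K_family 2 D O\<^sub>A A (simplex_push p f v) y"
proof -
  have "K_family p D O\<^sub>B B v y = K_family p D O\<^sub>A (\<lambda>e e'. A (f e) (f e')) v y"
    by (rule exact_family.K_family_cong[OF B exact_family_reindex[OF A f] ob arr v y])
  also have "\<dots> = K_family 2 D O\<^sub>A A (simplex_push p f v) y"
    by (rule exact_family.K_family_reindex[OF A f v y])
  finally show ?thesis .
qed

context poly_loc
begin

abbreviation "D\<^sub>S \<equiv> fgproj S.B"

text \<open>The edges \<open>01\<close>, \<open>12\<close> and \<open>02\<close> of the triangle
  carry \<open>(1 - f/t)\<^sup>-\<^sup>1\<close>, \<open>t - f\<close> and \<open>t\<close>.\<close>

definition triangle_aut where
  "triangle_aut e e' X = (if e = 0 then (if e' = 1 then zeta_inv_aut X else t_aut (fst X)) else tau_aut X)" for e e' :: nat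

lemma S_base_exact: "exact_functor (End_S A S) D\<^sub>S S.base"
  by (rule S.base_exact[OF mod_cat_End_S])

lemma T_base_exact: "exact_functor (End_S A S) (fgproj T.B) T.base"
  by (rule T.base_exact[OF mod_cat_End_S])

lemma S_base_simps: "fst S.base X = S.ext.E (fst X)" "snd S.base X Y = ext_map S.B S.const (fst X) (fst Y)"
  and T_base_simps: "fst T.base X = T.ext.E (fst X)" "snd T.base X Y = ext_map T.B T.const (fst X) (fst Y)"
  by (simp_all add: S.base_def T.base_def)

text \<open>The cocycle condition for \<open>[2]\<close> is the factorisation of
  \<open>t\<close>.\<close>

lemma triangle_exact: "exact_family 2 (End_S A S) D\<^sub>S (fst S.base) (twisted S.base triangle_aut)"
proof (rule exact_family_twisted[OF S.B.ring_axioms S_base_exact], unfold S_base_simps)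
  fix e e' :: nat and X assume "e < e'" "e' \<le> 2" and X: "X \<in> cat_ob (End_S A S)"
  then have e: "e = 0 \<and> e' = 1 \<or> e = 0 \<and> e' = 2 \<or> e = 1 \<and> e' = 2" by auto
  note o = End_obD(1)[OF X]
  show "lin S.B (S.ext.E (fst X)) (S.ext.E (fst X)) (triangle_aut e e' X)"
    using e zeta_inv_aut(1)[OF X] t_aut(1)[OF o] tau_aut(1)[OF X] by (elim disjE) (simp_all add: triangle_aut_def)
  show "bij_betw (triangle_aut e e' X) (snd (S.ext.E (fst X))) (snd (S.ext.E (fst X)))"
    using e zeta_inv_aut(2)[OF X] t_aut(2)[OF o] tau_aut(2)[OF X] by (elim disjE) (simp_all add: triangle_aut_def)
  fix Y h x assume Y: "Y \<in> cat_ob (End_S A S)" and h: "h \<in> cat_hom (End_S A S) X Y" and x: "x \<in> snd (S.ext.E (fst X))"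
  show "triangle_aut e e' Y (ext_map S.B S.const (fst X) (fst Y) h x) =
      ext_map S.B S.const (fst X) (fst Y) h (triangle_aut e e' X x)"
    using e zeta_inv_aut_natural[OF X Y h x] t_aut_natural[OF o End_obD(1)[OF Y] End_homD(1)[OF h] x] tau_aut_natural[OF X Y h x]
    by (elim disjE) (simp_all add: triangle_aut_def)
next
  fix e e' e'' :: nat and X x
  assume "e < e'" "e' < e''" "e'' \<le> 2" and X: "X \<in> cat_ob (End_S A S)" and x: "x \<in> snd (S.ext.E (fst X))"
  then have "e = 0" "e' = 1" "e'' = 2" by auto
  then show "triangle_aut e e'' X x = triangle_aut e' e'' X (triangle_aut e e' X x)"
    using tau_aut_zeta_inv_aut[OF X x] by (simp add: triangle_aut_def)
qed

lemma zero_End: "fst (wzero (End_S A S)) = (0, carrier (free_mod A 0))"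
  by (rule mod_cat.zero(2)[OF mod_cat_End_S])

sublocale triangle: homotopy_family "End_S A S" D\<^sub>S "fst S.base" "twisted S.base triangle_aut"
proof (intro homotopy_family.intro homotopy_family_axioms.intro triangle_exact)
  show "const_diagram {..0::nat} (wS (End_S A S) 0) (zero_diagram (End_S A S)) \<in> diagrams {..0} (wS (End_S A S) 0)"
    by (rule mod_cat.zero_simplex[OF mod_cat_End_S])
  show "fst S.base (wzero (End_S A S)) = wzero D\<^sub>S"
    unfolding S_base_simps zero_End S.ext.ext_zero by simp
  interpret D: mod_cat S.B D\<^sub>S "\<lambda>X. X" "\<lambda>X. \<lambda>x\<in>snd X. x" by (rule mod_cat_fgproj[OF S.B.ring_axioms])
  show "h = cat_id D\<^sub>S (wzero D\<^sub>S)" if "h \<in> cat_hom D\<^sub>S (wzero D\<^sub>S) (wzero D\<^sub>S)" for h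
    by (rule D.from_zero_unique[OF D.zero(1) that])
      (use lin_id[OF S.B.ring_axioms zero_summand[OF S.B.ring_axioms]] in simp)
qed

lemma tau_exact: "exact_functor (End_S A S) (aut_cat D\<^sub>S) (tau_fctr A S)"
  unfolding tau_fctr_eq
proof (rule exact_functor_aut[OF S.B.ring_axioms S_base_exact], unfold S_base_simps)
  show "wzero (End_S A S) \<in> cat_ob (End_S A S)" by (rule mod_cat.zero(1)[OF mod_cat_End_S])
  show "S.ext.E (fst (wzero (End_S A S))) = (0, carrier (free_mod S.B 0))" unfolding zero_End by (rule S.ext.ext_zero)
qed (rule tau_aut tau_aut_natural, assumption+)+

lemma zeta_exact: "exact_functor (End_S A S) (aut_cat (fgproj T.B)) (zeta_fctr A T)"
  unfolding zeta_fctr_eq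
proof (rule exact_functor_aut[OF T.B.ring_axioms T_base_exact], unfold T_base_simps)
  show "wzero (End_S A S) \<in> cat_ob (End_S A S)" by (rule mod_cat.zero(1)[OF mod_cat_End_S])
  show "T.ext.E (fst (wzero (End_S A S))) = (0, carrier (free_mod T.B 0))" unfolding zero_End by (rule T.ext.ext_zero)
qed (rule zeta_aut zeta_aut_natural, assumption+)+

lemma mult_t_exact: "exact_functor (fgproj A) (aut_cat D\<^sub>S) (mult_t_fctr A S)"
  unfolding mult_t_fctr_eq
proof (rule exact_functor_aut[OF S.B.ring_axioms S.ext.ext_exact])
  show "wzero (fgproj A) \<in> cat_ob (fgproj A)" using zero_summand[OF R.ring_axioms] by simp
  show "fst (ext_fctr S.B S.const) (wzero (fgproj A)) = (0, carrier (free_mod S.B 0))"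
    by (simp add: ext_fctr_def S.ext.ext_zero)
qed (simp_all add: ext_fctr_def t_aut t_aut_natural)

lemma forget_End_exact: "exact_functor (End_S A S) (fgproj A) forget_end"
  unfolding forget_end_def by (rule mod_cat.forget_exact[OF mod_cat_End_S])

lemma self_S: "exact_family 1 (aut_cat D\<^sub>S) D\<^sub>S fst (self_map D\<^sub>S)"
  by (rule exact_family_self_map[OF S.B.ring_axioms])

lemma self_T: "exact_family 1 (aut_cat (fgproj T.B)) (fgproj T.B) fst (self_map (fgproj T.B))"
  by (rule exact_family_self_map[OF T.B.ring_axioms])

lemma edge_monos:
  "mono_on {..1::nat} Suc" "Suc ` {..1} \<subseteq> {..2}"
  "mono_on {..1::nat} (\<lambda>e. e)" "(\<lambda>e::nat. e) ` {..1} \<subseteq> {..2}"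
  "mono_on {..1::nat} (\<lambda>e. 2 * e)" "(\<lambda>e::nat. 2 * e) ` {..1} \<subseteq> {..2}"
  "mono_on {..0::nat} (\<lambda>_. 0::nat)" "(\<lambda>_. 0) ` {..0::nat} \<subseteq> {..2::nat}"
  by (auto simp: monotone_on_def)

lemma edge_cases:
  assumes "e \<le> e'" "e' \<le> (1::nat)"
  obtains "e = e'" | "e = 0" "e' = 1"
  using assms by linarith

lemma tau_eq_loops:
  assumes \<omega>: "\<omega> \<in> topspace (K_space (End_S A S))"
  shows "tau A S \<omega> = triangle.loops Suc \<omega>"
proof -
  have "tau A S \<omega> s r = K_family 2 D\<^sub>S (fst S.base) (twisted S.base triangle_aut) (simplex_push 1 Suc (edge s)) (\<omega> r)"
    if s: "s \<in> {0..1}" and r: "r \<in> {0..1}" for s r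
  proof -
    note y = K_space_D[OF \<omega> r]
    have "tau A S \<omega> s r = K_family 1 D\<^sub>S (fst \<circ> fst (tau_fctr A S)) (precomp (tau_fctr A S) (self_map D\<^sub>S)) (edge s) (\<omega> r)"
      unfolding tau_def Let_def by (rule coassembly_K_map[of "End_S A S" D\<^sub>S "tau_fctr A S" \<omega> r, OF tau_exact self_S y r s])
    also have "\<dots> = K_family 2 D\<^sub>S (fst S.base) (twisted S.base triangle_aut) (simplex_push 1 Suc (edge s)) (\<omega> r)"
    proof (rule K_family_along[OF triangle_exact exact_family_precomp[OF tau_exact self_S] edge_monos(1,2) _ _ edge_in_simplex[OF s] y])
      show "(fst \<circ> fst (tau_fctr A S)) X = fst S.base X" for X by (simp add: tau_fctr_eq)
      show "precomp (tau_fctr A S) (self_map D\<^sub>S) e e' X Y h = twisted S.base triangle_aut (Suc e) (Suc e') X Y h"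
        if "e \<le> e'" "e' \<le> 1" for e e' X Y h
        using that by (cases rule: edge_cases)
          (simp_all add: precomp_def self_map_def twisted_def tau_fctr_eq triangle_aut_def)
    qed
    finally show ?thesis .
  qed
  then show ?thesis
    unfolding triangle.loops_def by (auto simp: fun_eq_iff tau_def Let_def coassembly_def restrict_def)
qed

lemma K_map_comp:
  assumes \<Psi>: "exact_functor C C' \<Psi>" and \<Phi>: "exact_functor C' D \<Phi>"
    and y: "\<omega> r \<in> topspace (realise (wS_space C))" and r: "r \<in> {0..1}"
  shows "K_map D \<Phi> (K_map C' \<Psi> \<omega>) r = K_family 0 D (fst \<Phi> \<circ> fst \<Psi>) (precomp \<Psi> (\<lambda>_ _. snd \<Phi>)) (vertex 0) (\<omega> r)"
  unfolding K_map_eq_K_family[of C' D \<Phi> "K_map C' \<Psi> \<omega>" r, OF \<Phi> K_map_in_realise[of C C' \<Psi> \<omega> r, OF \<Psi> y r] r]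
    K_map_eq_K_family[of C C' \<Psi> \<omega> r, OF \<Psi> y r]
  by (rule K_family_precomp[OF \<Psi> \<Phi> vertex_0_in_simplex y])

lemma mult_t_eq_loops:
  assumes \<omega>: "\<omega> \<in> topspace (K_space (End_S A S))"
  shows "mult_t A S \<omega> = triangle.loops (\<lambda>e. 2 * e) \<omega>"
proof -
  let ?\<Phi> = "mult_t_fctr A S"
  have "mult_t A S \<omega> s r = K_family 2 D\<^sub>S (fst S.base) (twisted S.base triangle_aut) (simplex_push 1 (\<lambda>e. 2 * e) (edge s)) (\<omega> r)"
    if s: "s \<in> {0..1}" and r: "r \<in> {0..1}" for s r
  proof -
    note y = K_space_D[OF \<omega> r]
    note y' = K_map_in_realise[of "End_S A S" "fgproj A" forget_end \<omega> r, OF forget_End_exact y r]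
    have 1: "exact_family 1 (fgproj A) D\<^sub>S (fst \<circ> fst ?\<Phi>) (precomp ?\<Phi> (self_map D\<^sub>S))"
      by (rule exact_family_precomp[OF mult_t_exact self_S])
    have "mult_t A S \<omega> s r = K_family 1 D\<^sub>S (fst \<circ> fst ?\<Phi>) (precomp ?\<Phi> (self_map D\<^sub>S)) (edge s) (K_map (fgproj A) forget_end \<omega> r)"
      unfolding mult_t_def Let_def
      by (rule coassembly_K_map[of "fgproj A" D\<^sub>S ?\<Phi> "K_map (fgproj A) forget_end \<omega>" r, OF mult_t_exact self_S y' r s])
    also have "\<dots> = K_family 1 D\<^sub>S (fst \<circ> fst ?\<Phi> \<circ> fst forget_end) (precomp forget_end (precomp ?\<Phi> (self_map D\<^sub>S))) (edge s) (\<omega> r)"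
      unfolding K_map_eq_K_family[of "End_S A S" "fgproj A" forget_end \<omega> r, OF forget_End_exact y r]
      by (rule K_family_precomp[OF forget_End_exact 1 edge_in_simplex[OF s] y])
    also have "\<dots> = K_family 2 D\<^sub>S (fst S.base) (twisted S.base triangle_aut) (simplex_push 1 (\<lambda>e. 2 * e) (edge s)) (\<omega> r)"
    proof (rule K_family_along[OF triangle_exact exact_family_precomp[OF forget_End_exact 1] edge_monos(5,6) _ _ edge_in_simplex[OF s] y])
      show "(fst \<circ> fst ?\<Phi> \<circ> fst forget_end) X = fst S.base X" for X
        by (simp add: mult_t_fctr_eq ext_fctr_def S_base_simps forget_end_def)
      show "precomp forget_end (precomp ?\<Phi> (self_map D\<^sub>S)) e e' X Y h = twisted S.base triangle_aut (2 * e) (2 * e') X Y h"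
        if "e \<le> e'" "e' \<le> 1" for e e' X Y h
        using that by (cases rule: edge_cases)
          (simp_all add: precomp_def self_map_def twisted_def mult_t_fctr_eq triangle_aut_def ext_fctr_def forget_end_def S_base_simps)
    qed
    finally show ?thesis .
  qed
  then show ?thesis
    unfolding triangle.loops_def by (auto simp: fun_eq_iff mult_t_def Let_def coassembly_def restrict_def)
qed

text \<open>The base change along \<open>t \<mapsto> 1/t\<close> is applied after coassembly in
  \<open>\<zeta>(t\<^sup>-\<^sup>1)\<close>; postcomposition of families moves it into the family,
  where it turns \<open>(1 - f t)\<^sup>-\<^sup>1\<close> into \<open>(1 -
  f/t)\<^sup>-\<^sup>1\<close>.\<close>

lemma zeta_inv_eq_loops:
  assumes \<omega>: "\<omega> \<in> topspace (K_space (End_S A S))"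
  shows "zeta_inv A S \<omega> = triangle.loops (\<lambda>e. e) \<omega>"
proof -
  let ?\<Phi> = "zeta_fctr A T" and ?\<Psi> = "ext_fctr S.B (invert_indet A S)" and ?D = "fgproj T.B"
  have "zeta_inv A S \<omega> s r = K_family 2 D\<^sub>S (fst S.base) (twisted S.base triangle_aut) (simplex_push 1 (\<lambda>e. e) (edge s)) (\<omega> r)"
    if s: "s \<in> {0..1}" and r: "r \<in> {0..1}" for s r
  proof -
    note y = K_space_D[OF \<omega> r]
    have 1: "exact_family 1 (End_S A S) ?D (fst \<circ> fst ?\<Phi>) (precomp ?\<Phi> (self_map ?D))"
      by (rule exact_family_precomp[OF zeta_exact self_T])
    have z: "zeta A T \<omega> s r = K_family 1 ?D (fst \<circ> fst ?\<Phi>) (precomp ?\<Phi> (self_map ?D)) (edge s) (\<omega> r)"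
      unfolding zeta_def Let_def by (rule coassembly_K_map[of "End_S A S" ?D ?\<Phi> \<omega> r, OF zeta_exact self_T y r s])
    have zr: "zeta A T \<omega> s r \<in> topspace (realise (wS_space ?D))"
      unfolding z by (rule exact_family.K_family_in_realise[OF 1 edge_in_simplex[OF s] y])
    have "zeta_inv A S \<omega> s r = K_map D\<^sub>S ?\<Psi> (zeta A T \<omega> s) r"
      using s by (simp add: zeta_inv_def Let_def LK_map_def)
    also have "\<dots> = K_family 0 D\<^sub>S (fst ?\<Psi>) (\<lambda>_ _. snd ?\<Psi>) (vertex 0) (zeta A T \<omega> s r)"
      by (rule K_map_eq_K_family[of ?D D\<^sub>S ?\<Psi> "zeta A T \<omega> s" r, OF inv.ext_exact zr r])
    also have "\<dots> = K_family 1 D\<^sub>S (fst ?\<Psi> \<circ> (fst \<circ> fst ?\<Phi>)) (postcomp ?\<Psi> (fst \<circ> fst ?\<Phi>) (precomp ?\<Phi> (self_map ?D))) (edge s) (\<omega> r)"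
      unfolding z by (rule K_family_postcomp[OF 1 inv.ext_exact edge_in_simplex[OF s] y])
    also have "\<dots> = K_family 2 D\<^sub>S (fst S.base) (twisted S.base triangle_aut) (simplex_push 1 (\<lambda>e. e) (edge s)) (\<omega> r)"
    proof (rule K_family_along[OF triangle_exact exact_family_postcomp[OF 1 inv.ext_exact] edge_monos(3,4) _ _ edge_in_simplex[OF s] y])
      show "(fst ?\<Psi> \<circ> (fst \<circ> fst ?\<Phi>)) X = fst S.base X" if "X \<in> cat_ob (End_S A S)" for X
        using inv_E[OF End_obD(1)[OF that]] by (simp add: zeta_fctr_eq ext_fctr_def S_base_simps T_base_simps)
      fix e e' X Y h assume e: "e \<le> e'" "e' \<le> (1::nat)" and X: "X \<in> cat_ob (End_S A S)" and Y: "Y \<in> cat_ob (End_S A S)"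
        and h: "h \<in> cat_hom (End_S A S) X Y"
      note oX = End_obD[OF X] and oY = End_obD[OF Y] and h' = End_homD(1)[OF h]
      note EX = T.ext.E_summand[OF oX(1)] and EY = T.ext.E_summand[OF oY(1)]
      show "postcomp ?\<Psi> (fst \<circ> fst ?\<Phi>) (precomp ?\<Phi> (self_map ?D)) e e' X Y h = twisted S.base triangle_aut e e' X Y h"
        using e
      proof (cases rule: edge_cases)
        case 1
        then show ?thesis
          using inv_ext_map[OF oX(1) oY(1) h']
          by (simp add: postcomp_def precomp_def self_map_def twisted_def zeta_fctr_eq ext_fctr_def S_base_simps T_base_simps)
      next
        case 2
        then show ?thesis
          using inv.ext_map_comp[OF EX EX EY zeta_aut(1)[OF X] T.ext.ext_map(1)[OF oX(1) oY(1) h']]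
          unfolding inv_ext_map[OF oX(1) oY(1) h'] inv_E[OF oX(1)]
          by (simp add: postcomp_def precomp_def self_map_def twisted_def zeta_fctr_eq ext_fctr_def S_base_simps T_base_simps
              triangle_aut_def zeta_inv_aut_def)
      qed
    qed
    finally show ?thesis .
  qed
  then show ?thesis
    unfolding triangle.loops_def
    by (auto simp: fun_eq_iff zeta_inv_def Let_def LK_map_def K_map_def restrict_def)
qed

lemma base_map_eq:
  assumes \<omega>: "\<omega> \<in> topspace (K_space (End_S A S))"
  shows "base_map A S \<omega> = (\<lambda>r\<in>{0..1}. K_family 2 D\<^sub>S (fst S.base) (twisted S.base triangle_aut) (vertex 0) (\<omega> r))"
proof -
  let ?\<Phi> = "ext_fctr S.B S.const"
  have "base_map A S \<omega> r = K_family 2 D\<^sub>S (fst S.base) (twisted S.base triangle_aut) (vertex 0) (\<omega> r)"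
    if r: "r \<in> {0..1}" for r
  proof -
    note y = K_space_D[OF \<omega> r]
    have "base_map A S \<omega> r = K_family 0 D\<^sub>S (fst ?\<Phi> \<circ> fst forget_end) (precomp forget_end (\<lambda>_ _. snd ?\<Phi>)) (vertex 0) (\<omega> r)"
      unfolding base_map_def Let_def
      by (rule K_map_comp[of "End_S A S" "fgproj A" forget_end D\<^sub>S ?\<Phi> \<omega> r, OF forget_End_exact S.ext.ext_exact y r])
    also have "\<dots> = K_family 2 D\<^sub>S (fst S.base) (twisted S.base triangle_aut) (simplex_push 0 (\<lambda>_. 0) (vertex 0)) (\<omega> r)"
    proof (rule K_family_along[OF triangle_exact exact_family_precomp[OF forget_End_exact S.ext.ext_exact] edge_monos(7,8) _ _ vertex_0_in_simplex y])
      show "(fst ?\<Phi> \<circ> fst forget_end) X = fst S.base X" for X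
        by (simp add: ext_fctr_def S_base_simps forget_end_def)
      show "precomp forget_end (\<lambda>_ _. snd ?\<Phi>) e e' X Y h = twisted S.base triangle_aut 0 0 X Y h" for e e' X Y h
        by (simp add: precomp_def twisted_def ext_fctr_def forget_end_def S_base_simps)
    qed
    also have "simplex_push 0 (\<lambda>_. 0) (vertex 0) = vertex 0" by (auto simp: simplex_push_def fun_eq_iff)
    finally show ?thesis .
  qed
  then show ?thesis by (auto simp: fun_eq_iff base_map_def Let_def K_map_def restrict_def)
qed

end

text \<open>The maps in the theorem agree with the loops along the edges only on the points of the
  K-theory space.\<close>

lemma homotopic_with_cong:
  assumes "homotopic_with P X Y f g"
    and "\<And>x. x \<in> topspace X \<Longrightarrow> f x = f' x" "\<And>x. x \<in> topspace X \<Longrightarrow> g x = g' x"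
    and P: "\<And>h h'. (\<And>x. x \<in> topspace X \<Longrightarrow> h x = h' x) \<Longrightarrow> P h = Q h'"
  shows "homotopic_with Q X Y f' g'"
proof -
  have PQ: "P = Q" by (rule ext) (rule P, rule refl)
  have Qc: "Q h = Q h'" if "\<And>x. x \<in> topspace X \<Longrightarrow> h x = h' x" for h h' using P[OF that] unfolding PQ .
  have fg: "homotopic_with Q X Y f g" using assms(1) unfolding PQ .
  note c = homotopic_with_imp_continuous_maps[OF fg] and q = homotopic_with_imp_property[OF fg]
  have "homotopic_with Q X Y f' f"
    by (rule homotopic_with_symD, rule homotopic_with_equal) (use c q Qc[of f f'] assms(2) in auto)
  moreover have "homotopic_with Q X Y g g'"
    by (rule homotopic_with_equal) (use c q Qc[of g g'] assms(3) in auto)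
  ultimately show ?thesis using fg homotopic_with_trans by blast
qed

theorem theorem1:
  fixes A :: "('a, 'r) ring_scheme" and S :: "(nat \<Rightarrow> 'a) set"
  assumes "ring A"
    and "submonoid S (UP A)"
    and "\<And>p. p \<in> S \<Longrightarrow> monic A p"
    and "S \<subseteq> ring_center (UP A)"
    and "indet A \<in> S"
  shows "homotopic_with
    (\<lambda>h. \<forall>\<omega>\<in>topspace (K_space (End_S A S)). h \<omega> 0 = base_map A S \<omega>)
    (K_space (End_S A S)) (free_loops (K_space (fgproj (polys_at A S))))
    (\<lambda>\<omega>. loop_concat (zeta_inv A S \<omega>) (tau A S \<omega>))
    (mult_t A S)"
proof -
  interpret poly_loc A "UP A" S
    by (intro poly_loc.intro poly_loc_axioms.intro UP_ring.intro assms) (simp_all add: assms)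
  show ?thesis
    by (rule homotopic_with_cong[OF triangle.loops_homotopic])
      (simp_all add: tau_eq_loops mult_t_eq_loops zeta_inv_eq_loops base_map_eq)
qed

end
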